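(* Let $k$ be an algebraically closed field of characteristic $2$, let $n\ge 2$, and let $\mathcal{O}$ be a non-trivial unipotent conjugacy class of $Sp(2n)=Sp_{2n}(k)$. Then $\mathcal{O}$ is spherical if and only if it consists of involutions.
   Context: A conjugacy class $\mathcal{O}$ of an algebraic group $G$ is called spherical if a Borel subgroup of $G$, acting by conjugation, has a dense orbit on $\mathcal{O}$. An involution is an element of order exactly $2$. A unipotent conjugacy class is non-trivial if it is not $\{1\}$. *)

theory Defs
  imports
    "HOL-Algebra.Solvable_Groups"
    "HOL-Algebra.Group_Action"
    "HOL-Algebra.Multiplicative_Group"
    "HOL-Computational_Algebra.Polynomial"
    "HOL-Analysis.Abstract_Topology"
    "Jordan_Normal_Form.Matrix"
begin

section \<open>The Zariski topology on square matrices\<close>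

text \<open>Regular functions on affine space of dimension \<open>N\<^sup>2\<close>, i.e. the functions given by
  polynomials in the matrix entries.\<close>

inductive_set poly_funs :: "nat \<Rightarrow> ('k::comm_ring_1 mat \<Rightarrow> 'k) set" for N :: nat where
  const: "(\<lambda>_. c) \<in> poly_funs N"
| entry: "i < N \<Longrightarrow> j < N \<Longrightarrow> (\<lambda>A. A $$ (i, j)) \<in> poly_funs N"
| add: "p \<in> poly_funs N \<Longrightarrow> q \<in> poly_funs N \<Longrightarrow> (\<lambda>A. p A + q A) \<in> poly_funs N"
| mult: "p \<in> poly_funs N \<Longrightarrow> q \<in> poly_funs N \<Longrightarrow> (\<lambda>A. p A * q A) \<in> poly_funs N"

definition zero_locus :: "nat \<Rightarrow> ('k::comm_ring_1 mat \<Rightarrow> 'k) set \<Rightarrow> 'k mat set" where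
  "zero_locus N P = {A \<in> carrier_mat N N. \<forall>p\<in>P. p A = 0}"

definition zariski :: "nat \<Rightarrow> 'k::field mat topology" where
  "zariski N = topology (\<lambda>U. U \<subseteq> carrier_mat N N \<and>
     (\<exists>P\<subseteq>poly_funs N. carrier_mat N N - U = zero_locus N P))"

lemma istopology_zariski:
  "istopology (\<lambda>U. U \<subseteq> carrier_mat N N \<and>
     (\<exists>P\<subseteq>poly_funs N. carrier_mat N N - U = zero_locus N (P :: ('k::field mat \<Rightarrow> 'k) set)))"
  unfolding istopology_def
proof (intro conjI allI impI)
  let ?C = "carrier_mat N N :: 'k mat set"
  fix S T :: "'k mat set"
  assume S: "S \<subseteq> ?C \<and> (\<exists>P\<subseteq>poly_funs N. ?C - S = zero_locus N P)"
    and T: "T \<subseteq> ?C \<and> (\<exists>P\<subseteq>poly_funs N. ?C - T = zero_locus N P)"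
  then show "S \<inter> T \<subseteq> ?C" by blast
  from S T obtain P Q where P: "P \<subseteq> poly_funs N" "?C - S = zero_locus N P"
    and Q: "Q \<subseteq> poly_funs N" "?C - T = zero_locus N Q" by blast
  let ?R = "{\<lambda>A. p A * q A | p q. p \<in> P \<and> q \<in> Q}"
  have "?R \<subseteq> poly_funs N" using P(1) Q(1) by (auto intro: poly_funs.mult)
  moreover have "zero_locus N ?R = zero_locus N P \<union> zero_locus N Q"
    unfolding zero_locus_def by (force simp: mult_eq_0_iff)
  then have "?C - (S \<inter> T) = zero_locus N ?R" using P(2) Q(2) by blast
  ultimately show "\<exists>P\<subseteq>poly_funs N. ?C - (S \<inter> T) = zero_locus N P" by blast
next
  let ?C = "carrier_mat N N :: 'k mat set"
  fix K :: "'k mat set set"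
  assume K: "\<forall>U\<in>K. U \<subseteq> ?C \<and> (\<exists>P\<subseteq>poly_funs N. ?C - U = zero_locus N P)"
  then show "\<Union>K \<subseteq> ?C" by blast
  from K obtain F where F: "\<And>U. U \<in> K \<Longrightarrow> F U \<subseteq> poly_funs N"
    "\<And>U. U \<in> K \<Longrightarrow> ?C - U = zero_locus N (F U)" by metis
  have "zero_locus N (\<Union>(F ` K)) = ?C \<inter> (\<Inter>U\<in>K. zero_locus N (F U))"
    unfolding zero_locus_def by blast
  also have "\<dots> = ?C - \<Union>K" using F(2) by blast
  finally have "?C - \<Union>K = zero_locus N (\<Union>(F ` K))" by simp
  moreover have "\<Union>(F ` K) \<subseteq> poly_funs N" using F(1) by blast
  ultimately show "\<exists>P\<subseteq>poly_funs N. ?C - \<Union>K = zero_locus N P" by blast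
qed

lemma openin_zariski:
  "openin (zariski N) U \<longleftrightarrow> U \<subseteq> carrier_mat N N \<and>
     (\<exists>P\<subseteq>poly_funs N. carrier_mat N N - U = zero_locus N P)"
  unfolding zariski_def topology_inverse'[OF istopology_zariski] by simp

lemma topspace_zariski [simp]: "topspace (zariski N) = carrier_mat N N"
proof
  show "topspace (zariski N) \<subseteq> carrier_mat N N"
    unfolding topspace_def by (auto simp: openin_zariski)
  have "zero_locus N {\<lambda>_. 1} = {}" by (simp add: zero_locus_def)
  moreover have "{\<lambda>_. 1} \<subseteq> poly_funs N" by (simp add: poly_funs.const)
  ultimately have "openin (zariski N) (carrier_mat N N)"
    unfolding openin_zariski by (metis Diff_cancel order_refl)
  then show "carrier_mat N N \<subseteq> topspace (zariski N)" by (rule openin_subset)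
qed

lemma closedin_zariski: "closedin (zariski N) S \<longleftrightarrow> (\<exists>P\<subseteq>poly_funs N. S = zero_locus N P)"
proof -
  have "zero_locus N P \<subseteq> carrier_mat N N" for P :: "('a mat \<Rightarrow> 'a) set"
    by (auto simp: zero_locus_def)
  then show ?thesis
    unfolding closedin_def openin_zariski topspace_zariski
    by (metis Diff_subset double_diff order_refl)
qed

section \<open>Linear algebraic groups\<close>

definition GL :: "nat \<Rightarrow> 'k::field mat monoid" where
  "GL N = units_of (ring_mat TYPE('k) N ())"

text \<open>The inverse determinant is not needed as an extra coordinate: the Zariski topology of
  \<open>GL N\<close> as an affine variety is the one induced from the space of all matrices.\<close>

definition linear_algebraic_group :: "nat \<Rightarrow> 'k::field mat monoid \<Rightarrow> bool" where
  "linear_algebraic_group N G \<longleftrightarrow>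
     subgroup (carrier G) (GL N) \<and> G = (GL N)\<lparr>carrier := carrier G\<rparr> \<and>
     closedin (subtopology (zariski N) (carrier (GL N))) (carrier G)"

definition closed_connected_solvable :: "nat \<Rightarrow> 'k::field mat monoid \<Rightarrow> 'k mat set \<Rightarrow> bool" where
  "closed_connected_solvable N G H \<longleftrightarrow>
     subgroup H G \<and> closedin (subtopology (zariski N) (carrier G)) H \<and>
     connectedin (zariski N) H \<and> solvable (G\<lparr>carrier := H\<rparr>)"

definition borel_subgroup :: "nat \<Rightarrow> 'k::field mat monoid \<Rightarrow> 'k mat set \<Rightarrow> bool" where
  "borel_subgroup N G B \<longleftrightarrow> closed_connected_solvable N G B \<and>
     (\<forall>H. closed_connected_solvable N G H \<longrightarrow> B \<subseteq> H \<longrightarrow> H = B)"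

definition conjugation :: "('a, 'b) monoid_scheme \<Rightarrow> 'a \<Rightarrow> 'a \<Rightarrow> 'a" where
  "conjugation G g x = g \<otimes>\<^bsub>G\<^esub> x \<otimes>\<^bsub>G\<^esub> inv\<^bsub>G\<^esub> g"

definition conjugacy_classes :: "('a, 'b) monoid_scheme \<Rightarrow> 'a set set" where
  "conjugacy_classes G = orbits G (carrier G) (conjugation G)"

definition spherical :: "nat \<Rightarrow> 'k::field mat monoid \<Rightarrow> 'k mat set \<Rightarrow> bool" where
  "spherical N G C \<longleftrightarrow> (\<exists>B. borel_subgroup N G B \<and>
     (\<exists>x\<in>C. (subtopology (zariski N) C) closure_of
               (orbit (G\<lparr>carrier := B\<rparr>) (conjugation G) x) = C))"

definition unipotent :: "nat \<Rightarrow> 'k::field mat \<Rightarrow> bool" where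
  "unipotent N A \<longleftrightarrow> (\<exists>m. (A - 1\<^sub>m N) ^\<^sub>m m = 0\<^sub>m N N)"

section \<open>The symplectic group\<close>

definition symp_form :: "nat \<Rightarrow> 'k::field mat" where
  "symp_form n = four_block_mat (0\<^sub>m n n) (1\<^sub>m n) (- 1\<^sub>m n) (0\<^sub>m n n)"

text \<open>The bilinear form with Gram matrix \<open>symp_form n\<close> is alternating in every
  characteristic, including 2, since the diagonal of the matrix vanishes as well.\<close>

definition Sp :: "nat \<Rightarrow> 'k::field mat monoid" where
  "Sp n = (GL (2 * n))\<lparr>carrier :=
     {A \<in> carrier (GL (2 * n)). transpose_mat A * symp_form n * A = symp_form n}\<rparr>"

lemma group_GL: "group (GL N :: 'k::field mat monoid)"
proof -
  interpret ring "ring_mat TYPE('k) N ()" by (rule ring_mat)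
  show ?thesis unfolding GL_def by (rule units_group)
qed

lemma mult_GL: "x \<otimes>\<^bsub>GL N\<^esub> y = x * y"
  and one_GL: "\<one>\<^bsub>GL N\<^esub> = 1\<^sub>m N"
  by (simp_all add: GL_def units_of_def ring_mat_simps)

lemma carrier_GL: "carrier (GL N) \<subseteq> carrier_mat N N"
  by (auto simp: GL_def units_of_def Units_def ring_mat_simps)

lemma symp_form_carrier: "symp_form n \<in> carrier_mat (2 * n) (2 * n)"
  unfolding symp_form_def carrier_mat_def by (simp add: mult_2)

lemma subgroup_Sp: "subgroup (carrier (Sp n :: 'k::field mat monoid)) (GL (2 * n))"
proof -
  let ?G = "GL (2 * n) :: 'k mat monoid" and ?J = "symp_form n :: 'k mat"
  interpret group ?G by (rule group_GL)
  note J = symp_form_carrier[of n, where ?'a = 'k]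
  note c = subsetD[OF carrier_GL]
  have tr: "transpose_mat (x * y) * M * (x * y) = transpose_mat y * (transpose_mat x * M * x) * y"
    if "x \<in> carrier_mat N N" "y \<in> carrier_mat N N" "M \<in> carrier_mat N N" for x y M :: "'k mat" and N
  proof -
    have "transpose_mat (x * y) * M * (x * y) = transpose_mat y * transpose_mat x * M * (x * y)"
      using that by (simp add: transpose_mult)
    also have "\<dots> = transpose_mat y * (transpose_mat x * M * x) * y"
      using that by (simp add: assoc_mult_mat[where ?n\<^sub>1 = N and ?n\<^sub>2 = N and ?n\<^sub>3 = N and ?n\<^sub>4 = N])
    finally show ?thesis .
  qed
  show ?thesis
  proof (rule subgroupI)
    show "carrier (Sp n :: 'k mat monoid) \<subseteq> carrier ?G" by (auto simp: Sp_def)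
    have "\<one>\<^bsub>?G\<^esub> \<in> carrier (Sp n)" using J one_closed by (simp add: Sp_def one_GL)
    then show "carrier (Sp n :: 'k mat monoid) \<noteq> {}" by blast
    fix x :: "'k mat" assume x: "x \<in> carrier (Sp n)"
    then have xG: "x \<in> carrier ?G" and xJ: "transpose_mat x * ?J * x = ?J" by (auto simp: Sp_def)
    let ?y = "inv\<^bsub>?G\<^esub> x"
    have yG: "?y \<in> carrier ?G" using xG by simp
    have xy: "x * ?y = 1\<^sub>m (2 * n)" using r_inv[OF xG] by (simp add: mult_GL one_GL)
    have "transpose_mat ?y * ?J * ?y = ?J"
      using tr[OF c[OF xG] c[OF yG] J] J unfolding xJ xy by simp
    with yG show "?y \<in> carrier (Sp n)" by (simp add: Sp_def)
    fix z :: "'k mat" assume z: "z \<in> carrier (Sp n)"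
    then have zG: "z \<in> carrier ?G" and zJ: "transpose_mat z * ?J * z = ?J" by (auto simp: Sp_def)
    have "x * z \<in> carrier ?G" using m_closed[OF xG zG] by (simp add: mult_GL)
    then show "x \<otimes>\<^bsub>?G\<^esub> z \<in> carrier (Sp n)"
      using tr[OF c[OF xG] c[OF zG] J] by (simp add: Sp_def mult_GL xJ zJ)
  qed
qed

lemma group_Sp: "group (Sp n :: 'k::field mat monoid)"
  using subgroup.subgroup_is_group[OF subgroup_Sp group_GL] by (simp add: Sp_def)

lemma poly_funs_sum:
  "(\<And>i. i \<in> I \<Longrightarrow> f i \<in> poly_funs N) \<Longrightarrow> (\<lambda>A. \<Sum>i\<in>I. f i A) \<in> poly_funs N"
  by (induction I rule: infinite_finite_induct) (auto intro: poly_funs.intros)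

lemma linear_algebraic_group_Sp: "linear_algebraic_group (2 * n) (Sp n :: 'k::field mat monoid)"
proof -
  let ?N = "2 * n" and ?J = "symp_form n :: 'k mat"
  define f where "f i j = (\<lambda>A :: 'k mat. (\<Sum>l<?N. (\<Sum>k<?N. A $$ (k, i) * ?J $$ (k, l)) * A $$ (l, j))
    + - ?J $$ (i, j))" for i j
  let ?P = "{f i j | i j. i < ?N \<and> j < ?N}"
  have "f i j \<in> poly_funs ?N" if "i < ?N" "j < ?N" for i j
    unfolding f_def using that
    by (intro poly_funs.add poly_funs_sum poly_funs.mult poly_funs.entry poly_funs.const) simp_all
  then have P: "?P \<subseteq> poly_funs ?N" by blast
  have J: "dim_row ?J = ?N" "dim_col ?J = ?N" using symp_form_carrier[of n, where ?'a = 'k] by auto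
  have eq: "transpose_mat A * ?J * A = ?J \<longleftrightarrow> (\<forall>p\<in>?P. p A = 0)"
    if A: "A \<in> carrier_mat ?N ?N" for A
  proof -
    have "(transpose_mat A * ?J * A) $$ (i, j) + - ?J $$ (i, j) = f i j A"
      if ij: "i < ?N" "j < ?N" for i j
      using A J ij by (simp add: f_def scalar_prod_def lessThan_atLeast0)
    then have "f i j A = 0 \<longleftrightarrow> (transpose_mat A * ?J * A) $$ (i, j) = ?J $$ (i, j)"
      if "i < ?N" "j < ?N" for i j
      using that by (metis add.right_inverse add_right_cancel)
    moreover have "transpose_mat A * ?J * A = ?J \<longleftrightarrow>
      (\<forall>i<?N. \<forall>j<?N. (transpose_mat A * ?J * A) $$ (i, j) = ?J $$ (i, j))"
    proof -
      have "M = ?J \<longleftrightarrow> (\<forall>i<?N. \<forall>j<?N. M $$ (i, j) = ?J $$ (i, j))"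
        if "dim_row M = ?N" "dim_col M = ?N" for M
        using J that by (auto intro!: eq_matI)
      then show ?thesis using A by simp
    qed
    ultimately show ?thesis by blast
  qed
  have "carrier (Sp n) = zero_locus ?N ?P \<inter> carrier (GL ?N)"
    using eq carrier_GL[of ?N, where ?'a = 'k] by (auto simp: Sp_def zero_locus_def)
  then have "closedin (subtopology (zariski ?N) (carrier (GL ?N))) (carrier (Sp n :: 'k mat monoid))"
    unfolding closedin_subtopology closedin_zariski using P by blast
  with subgroup_Sp[of n] show ?thesis
    unfolding linear_algebraic_group_def by (simp add: Sp_def)
qed

end

theory Submission
  imports Defs "Jordan_Normal_Form.Char_Poly"
begin

text \<open>Let \<open>\<beta>\<close> be the symplectic form and \<open>x\<close> an element of a class with a dense Borel orbit. By the
  Lie-Kolchin theorem the Borel subgroup fixes a flag \<open>\<langle>p\<rangle> \<subset> \<langle>p, q\<rangle>\<close> of isotropic subspaces, and in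
  characteristic 2 the functions \<open>A y = (\<beta>(yp, q) + \<beta>(yq, p))\<^sup>2\<close> and
  \<open>D y = \<beta>(yp, p) \<beta>(yq, q) + \<beta>(yp, q) \<beta>(yq, p)\<close> are semi-invariants of the same weight. So they are
  proportional on the class, and since \<open>Sp\<close> is transitive on isotropic pairs, the same relation
  holds for all such pairs in place of \<open>p, q\<close>. For unipotent \<open>x\<close> this forces \<open>x\<^sup>2 = 1\<close>.

  Conversely, a class of involutions contains some \<open>low R\<close>, the lower unitriangular block matrix with
  a symmetric block \<open>R\<close>, and \<open>R\<close> can be replaced by a normal form \<open>E\<close> under congruence for which the
  lower triangular congruences already produce a nonempty open set of congruent matrices. Every
  element of the class lies on a polynomial curve whose generic points are in the orbit of \<open>low E\<close>
  under the standard Borel subgroup, so that this orbit is dense.\<close>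

section \<open>Polynomial maps and curves\<close>

text \<open>\<open>D y\<close> is the Gram determinant of the form \<open>bil (y v) w\<close> on the
  plane of \<open>p, q\<close>, and \<open>A y\<close> is the square of its alternating part; a
  change of basis multiplies both by the square of its determinant. The constant ratio leaves two
  cases. If \<open>A\<close> vanishes on all isotropic pairs, \<open>x v + x^-1 v\<close> is always
  a multiple of \<open>v\<close>, and a unipotent element with such a quadratic relation satisfies
  \<open>x\<^sup>2 v = v\<close>. Otherwise \<open>A = 0\<close> forces \<open>D = 0\<close>. But a
  vector \<open>v\<close> with \<open>bil (x v) v = 0\<close> that \<open>x\<^sup>2\<close> moves
  has a partner \<open>w\<close> with \<open>A = 0\<close> and \<open>D = 1\<close>. So
  \<open>x\<^sup>2\<close> fixes this quadric pointwise, and secant lines of the quadric extend this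
  to all vectors. Sphericity asks for some Borel subgroup. Conjugacy of Borel subgroups is bypassed:
  Lie-Kolchin is applied to an arbitrary one in the first direction, and proves the maximality of
  the standard one in the second. In characteristic 2 a nonzero symmetric matrix can be alternating,
  which is invariant under congruence; hence two kinds of normal form \<open>E\<close>.\<close>

lemma poly_funs_comp:
  assumes "f \<in> poly_funs M" "\<And>i j. i < M \<Longrightarrow> j < M \<Longrightarrow> (\<lambda>A. \<phi> A $$ (i, j)) \<in> poly_funs N"
  shows "(\<lambda>A. f (\<phi> A)) \<in> poly_funs N"
  using assms by (induction rule: poly_funs.induct) (auto intro: poly_funs.intros)

lemma poly_funs_mult_mat:
  assumes "\<And>A. \<phi> A \<in> carrier_mat l m" "\<And>A. \<psi> A \<in> carrier_mat m r"
    and "\<And>i j. i < l \<Longrightarrow> j < m \<Longrightarrow> (\<lambda>A. \<phi> A $$ (i, j)) \<in> poly_funs N"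
    and "\<And>i j. i < m \<Longrightarrow> j < r \<Longrightarrow> (\<lambda>A. \<psi> A $$ (i, j)) \<in> poly_funs N"
    and "i < l" "j < r"
  shows "(\<lambda>A. (\<phi> A * \<psi> A) $$ (i, j)) \<in> poly_funs N"
proof -
  have "(\<lambda>A. (\<phi> A * \<psi> A) $$ (i, j)) = (\<lambda>A. \<Sum>k<m. \<phi> A $$ (i, k) * \<psi> A $$ (k, j))"
  proof
    fix A
    show "(\<phi> A * \<psi> A) $$ (i, j) = (\<Sum>k<m. \<phi> A $$ (i, k) * \<psi> A $$ (k, j))"
      using assms(1)[of A] assms(2)[of A] assms(5,6)
      by (simp add: scalar_prod_def lessThan_atLeast0)
  qed
  then show ?thesis using assms(3-6) by (auto intro!: poly_funs_sum poly_funs.mult)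
qed

lemma continuous_map_zariski:
  fixes \<phi> :: "'k::field mat \<Rightarrow> 'k mat"
  assumes "\<And>A. A \<in> carrier_mat N N \<Longrightarrow> \<phi> A \<in> carrier_mat M M"
    and "\<And>i j. i < M \<Longrightarrow> j < M \<Longrightarrow> (\<lambda>A. \<phi> A $$ (i, j)) \<in> poly_funs N"
  shows "continuous_map (zariski N) (zariski M) \<phi>"
  unfolding continuous_map_closedin topspace_zariski
proof (intro conjI ballI allI impI)
  fix C :: "'k mat set" assume "closedin (zariski M) C"
  then obtain P where P: "P \<subseteq> poly_funs M" "C = zero_locus M P" unfolding closedin_zariski by blast
  have "{x \<in> carrier_mat N N. \<phi> x \<in> C} = zero_locus N ((\<lambda>p A. p (\<phi> A)) ` P)"
    using assms(1) by (auto simp: P(2) zero_locus_def)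
  moreover have "(\<lambda>p A. p (\<phi> A)) ` P \<subseteq> poly_funs N"
    using P(1) poly_funs_comp[OF _ assms(2)] by blast
  ultimately show "closedin (zariski N) {x \<in> carrier_mat N N. \<phi> x \<in> C}"
    unfolding closedin_zariski by blast
qed (use assms(1) in auto)

section \<open>Polynomial functions of one variable\<close>

definition polyf :: "('k::comm_ring_1 \<Rightarrow> 'k) set" where
  "polyf = range poly"

lemma polyf_const: "(\<lambda>_. c) \<in> polyf"
  unfolding polyf_def by (rule range_eqI[of _ _ "[:c:]"]) auto

lemma polyf_id: "(\<lambda>t. t) \<in> polyf"
  unfolding polyf_def by (rule range_eqI[of _ _ "[:0, 1:]"]) auto

lemma polyf_add: "f \<in> polyf \<Longrightarrow> g \<in> polyf \<Longrightarrow> (\<lambda>t. f t + g t) \<in> polyf"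
  unfolding polyf_def by (auto simp: image_iff fun_eq_iff) (metis poly_add)

lemma polyf_mult: "f \<in> polyf \<Longrightarrow> g \<in> polyf \<Longrightarrow> (\<lambda>t. f t * g t) \<in> polyf"
  unfolding polyf_def by (auto simp: image_iff fun_eq_iff) (metis poly_mult)

lemma polyf_sum: "(\<And>i. i \<in> I \<Longrightarrow> f i \<in> polyf) \<Longrightarrow> (\<lambda>t. \<Sum>i\<in>I. f i t) \<in> polyf"
  by (induction I rule: infinite_finite_induct) (auto intro: polyf_const polyf_add)

lemma polyf_prod: "(\<And>i. i \<in> I \<Longrightarrow> f i \<in> polyf) \<Longrightarrow> (\<lambda>t. \<Prod>i\<in>I. f i t) \<in> polyf"
  by (induction I rule: infinite_finite_induct) (auto intro: polyf_const polyf_mult)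

lemma polyf_power: "f \<in> polyf \<Longrightarrow> (\<lambda>t. f t ^ m) \<in> polyf"
  by (induction m) (auto intro: polyf_const polyf_mult)

text \<open>Euclid's argument: over a finite field the product of all \<open>X - a\<close> vanishes
  at every point, so adding 1 gives a nonconstant polynomial without roots.\<close>

lemma infinite_UNIV_alg_closed: "infinite (UNIV :: 'k::alg_closed_field set)"
proof
  assume fin: "finite (UNIV :: 'k set)"
  define p where "p = (\<Prod>a\<in>(UNIV :: 'k set). [:- a, 1:])"
  have "poly p x = 0" for x
    using fin by (auto simp: p_def poly_prod)
  moreover have "\<exists>x. poly (p + 1) x = 0"
  proof (rule alg_closed_imp_poly_has_root)
    have d: "degree p = card (UNIV :: 'k set)"
      unfolding p_def by (subst degree_prod_eq_sum_degree) auto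
    then have "degree p > 0" using fin by (simp add: finite_UNIV_card_ge_0)
    then show "degree (p + 1) > 0" by (simp add: degree_add_eq_left)
  qed
  ultimately show False by auto
qed

text \<open>One-variable polynomials over an infinite field form a domain. The conclusion also
  covers the zeros of \<open>g\<close>, which is how an identity known at generic parameters extends
  to all.\<close>

lemma polyf_mult_eq_0:
  fixes f g :: "'k::alg_closed_field \<Rightarrow> 'k"
  assumes "f \<in> polyf" "g \<in> polyf" "\<And>t. f t * g t = 0" "g t0 \<noteq> 0"
  shows "f t = 0"
proof -
  obtain p q where pq: "f = poly p" "g = poly q" using assms(1,2) by (auto simp: polyf_def)
  have "poly (p * q) t = 0" for t using assms(3) pq by simp
  then have "{t. poly (p * q) t = 0} = UNIV" by blast
  then have "p * q = 0" using poly_roots_finite[of "p * q"] infinite_UNIV_alg_closed by metis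
  moreover have "q \<noteq> 0" using assms(4) pq by auto
  ultimately show ?thesis using pq by simp
qed

text \<open>The denominator \<open>\<delta>\<close> is needed for curves in \<open>GL N\<close> that involve matrix inversion.\<close>

lemma poly_funs_curve:
  assumes f: "f \<in> poly_funs N" and \<delta>: "\<delta> \<in> polyf"
    and \<gamma>: "\<And>i j. i < N \<Longrightarrow> j < N \<Longrightarrow> \<exists>\<psi>\<in>polyf. \<forall>t. \<delta> t \<noteq> 0 \<longrightarrow> \<gamma> t $$ (i, j) * \<delta> t = \<psi> t"
  shows "\<exists>m. \<exists>\<psi>\<in>polyf. \<forall>t. \<delta> t \<noteq> 0 \<longrightarrow> f (\<gamma> t) * \<delta> t ^ m = \<psi> t"
  using f
proof (induction rule: poly_funs.induct)
  case (const c)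
  then show ?case by (intro exI[of _ 0] bexI[OF _ polyf_const[of c]]) auto
next
  case (entry i j)
  then show ?case using \<gamma>[of i j] by (metis power_one_right)
next
  case (add p q)
  then obtain m l \<psi> \<phi> where *: "\<psi> \<in> polyf" "\<phi> \<in> polyf" "\<And>t. \<delta> t \<noteq> 0 \<Longrightarrow> p (\<gamma> t) * \<delta> t ^ m = \<psi> t"
    "\<And>t. \<delta> t \<noteq> 0 \<Longrightarrow> q (\<gamma> t) * \<delta> t ^ l = \<phi> t" by metis
  have "(p (\<gamma> t) + q (\<gamma> t)) * \<delta> t ^ (m + l) = \<psi> t * \<delta> t ^ l + \<phi> t * \<delta> t ^ m" if "\<delta> t \<noteq> 0" for t
    unfolding *(3,4)[OF that, symmetric] by (simp add: algebra_simps power_add)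
  moreover have "(\<lambda>t. \<psi> t * \<delta> t ^ l + \<phi> t * \<delta> t ^ m) \<in> polyf"
    using * \<delta> by (intro polyf_add polyf_mult polyf_power)
  ultimately show ?case
    by (intro exI[of _ "m + l"] bexI[of _ "\<lambda>t. \<psi> t * \<delta> t ^ l + \<phi> t * \<delta> t ^ m"]) auto
next
  case (mult p q)
  then obtain m l \<psi> \<phi> where *: "\<psi> \<in> polyf" "\<phi> \<in> polyf" "\<And>t. \<delta> t \<noteq> 0 \<Longrightarrow> p (\<gamma> t) * \<delta> t ^ m = \<psi> t"
    "\<And>t. \<delta> t \<noteq> 0 \<Longrightarrow> q (\<gamma> t) * \<delta> t ^ l = \<phi> t" by metis
  have "(p (\<gamma> t) * q (\<gamma> t)) * \<delta> t ^ (m + l) = \<psi> t * \<phi> t" if "\<delta> t \<noteq> 0" for t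
    unfolding *(3,4)[OF that, symmetric] by (simp add: algebra_simps power_add)
  moreover have "(\<lambda>t. \<psi> t * \<phi> t) \<in> polyf" using * by (intro polyf_mult)
  ultimately show ?case
    by (intro exI[of _ "m + l"] bexI[of _ "\<lambda>t. \<psi> t * \<phi> t"]) auto
qed

lemma poly_funs_curve_polyf:
  assumes "f \<in> poly_funs N" "\<And>i j. i < N \<Longrightarrow> j < N \<Longrightarrow> (\<lambda>t. \<gamma> t $$ (i, j)) \<in> polyf"
  shows "(\<lambda>t. f (\<gamma> t)) \<in> polyf"
  using assms by (induction rule: poly_funs.induct) (auto intro: polyf_const polyf_add polyf_mult)

text \<open>The tool for density: the parameters with \<psi> nonzero are generic as soon as there is
  one of them, and vanishing along the curve passes from these to the special parameter of
  interest.\<close>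

lemma poly_funs_curve_eq_0:
  fixes \<gamma> :: "'k::alg_closed_field \<Rightarrow> 'k mat"
  assumes "f \<in> poly_funs N" "\<And>i j. i < N \<Longrightarrow> j < N \<Longrightarrow> (\<lambda>t. \<gamma> t $$ (i, j)) \<in> polyf"
    and "\<psi> \<in> polyf" "\<psi> t0 \<noteq> 0" "\<And>t. \<psi> t \<noteq> 0 \<Longrightarrow> f (\<gamma> t) = 0"
  shows "f (\<gamma> t) = 0"
  using polyf_mult_eq_0[OF poly_funs_curve_polyf[OF assms(1,2)] assms(3) _ assms(4)] assms(5)
  by (metis mult_eq_0_iff)

text \<open>A separation by closed sets gives two polynomials, each vanishing on one side and
  nonzero at a point of the other. With denominators cleared, their product vanishes at every
  parameter, although neither factor does.\<close>

lemma connectedin_curve: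
  fixes \<gamma> :: "'k::alg_closed_field \<Rightarrow> 'k mat"
  assumes \<delta>: "\<delta> \<in> polyf"
    and car: "\<And>t. \<delta> t \<noteq> 0 \<Longrightarrow> \<gamma> t \<in> carrier_mat N N"
    and \<gamma>: "\<And>i j. i < N \<Longrightarrow> j < N \<Longrightarrow> \<exists>\<psi>\<in>polyf. \<forall>t. \<delta> t \<noteq> 0 \<longrightarrow> \<gamma> t $$ (i, j) * \<delta> t = \<psi> t"
  shows "connectedin (zariski N) (\<gamma> ` {t. \<delta> t \<noteq> 0})" (is "connectedin _ ?S")
  unfolding connectedin_closedin
proof (intro conjI notI)
  show "?S \<subseteq> topspace (zariski N)" using car by auto
  assume "\<exists>E1 E2. closedin (zariski N) E1 \<and> closedin (zariski N) E2 \<and> ?S \<subseteq> E1 \<union> E2 \<and>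
    E1 \<inter> E2 \<inter> ?S = {} \<and> E1 \<inter> ?S \<noteq> {} \<and> E2 \<inter> ?S \<noteq> {}"
  then obtain E1 E2 where "closedin (zariski N) E1" "closedin (zariski N) E2" and
    S: "?S \<subseteq> E1 \<union> E2" "E1 \<inter> E2 \<inter> ?S = {}" "E1 \<inter> ?S \<noteq> {}" "E2 \<inter> ?S \<noteq> {}" by blast
  then obtain P1 P2 where P: "P1 \<subseteq> poly_funs N" "P2 \<subseteq> poly_funs N"
    and E: "E1 = zero_locus N P1" "E2 = zero_locus N P2" unfolding closedin_zariski by blast
  from S obtain t1 t2 where t: "\<delta> t1 \<noteq> 0" "\<gamma> t1 \<notin> E2" "\<delta> t2 \<noteq> 0" "\<gamma> t2 \<notin> E1" by blast
  with E car obtain p1 p2 where p: "p1 \<in> P1" "p2 \<in> P2" "p1 (\<gamma> t2) \<noteq> 0" "p2 (\<gamma> t1) \<noteq> 0"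
    unfolding zero_locus_def by blast
  obtain m1 \<psi>1 where 1: "\<psi>1 \<in> polyf" "\<And>t. \<delta> t \<noteq> 0 \<Longrightarrow> p1 (\<gamma> t) * \<delta> t ^ m1 = \<psi>1 t"
    using poly_funs_curve[OF _ \<delta> \<gamma>] p(1) P(1) by (meson subsetD)
  obtain m2 \<psi>2 where 2: "\<psi>2 \<in> polyf" "\<And>t. \<delta> t \<noteq> 0 \<Longrightarrow> p2 (\<gamma> t) * \<delta> t ^ m2 = \<psi>2 t"
    using poly_funs_curve[OF _ \<delta> \<gamma>] p(2) P(2) by (meson subsetD)
  \<comment> \<open>The factor \<open>\<delta> t\<close> makes the product vanish also at the zeros
    of \<delta>, where nothing is known about \<open>\<psi>1\<close> and
    \<open>\<psi>2\<close>.\<close>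
  have "\<psi>1 t * (\<psi>2 t * \<delta> t) = 0" for t
  proof (cases "\<delta> t = 0")
    case False
    then have "\<gamma> t \<in> E1 \<or> \<gamma> t \<in> E2" using S(1) by blast
    then have "p1 (\<gamma> t) = 0 \<or> p2 (\<gamma> t) = 0" using p E by (auto simp: zero_locus_def)
    then show ?thesis using 1(2)[OF False] 2(2)[OF False] by auto
  qed simp
  then have "\<psi>1 t2 = 0"
    using polyf_mult_eq_0[OF 1(1) polyf_mult[OF 2(1) \<delta>], of t1] 2(2)[OF t(1)] p(4) t(1)
    by (metis mult_eq_0_iff power_not_zero)
  then show False using 1(2)[OF t(3)] p(3) t(3) by (metis mult_eq_0_iff power_not_zero)
qed

section \<open>Matrices with polynomial entries\<close>

definition polymat :: "nat \<Rightarrow> nat \<Rightarrow> ('k::comm_ring_1 \<Rightarrow> 'k mat) \<Rightarrow> bool" where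
  "polymat m r \<gamma> \<longleftrightarrow> (\<forall>t. \<gamma> t \<in> carrier_mat m r) \<and>
     (\<forall>i<m. \<forall>j<r. (\<lambda>t. \<gamma> t $$ (i, j)) \<in> polyf)"

lemma polymat_const: "A \<in> carrier_mat m r \<Longrightarrow> polymat m r (\<lambda>_. A)"
  by (auto simp: polymat_def intro: polyf_const)

lemma polymat_carrier: "polymat m r \<gamma> \<Longrightarrow> \<gamma> t \<in> carrier_mat m r"
  by (auto simp: polymat_def)

lemma polymat_entry: "polymat m r \<gamma> \<Longrightarrow> i < m \<Longrightarrow> j < r \<Longrightarrow> (\<lambda>t. \<gamma> t $$ (i, j)) \<in> polyf"
  by (auto simp: polymat_def)

lemma polymat_cong_entry:
  assumes "\<And>t. \<gamma> t \<in> carrier_mat m r"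
    "\<And>i j t. i < m \<Longrightarrow> j < r \<Longrightarrow> \<gamma> t $$ (i, j) = f i j t"
    "\<And>i j. i < m \<Longrightarrow> j < r \<Longrightarrow> f i j \<in> polyf"
  shows "polymat m r \<gamma>"
  unfolding polymat_def
proof (intro conjI allI impI)
  fix i j assume "i < m" "j < r"
  then show "(\<lambda>t. \<gamma> t $$ (i, j)) \<in> polyf" using assms(2,3) by simp
qed (use assms in auto)

lemma polymat_add:
  assumes "polymat m r \<gamma>" "polymat m r \<eta>" shows "polymat m r (\<lambda>t. \<gamma> t + \<eta> t)"
  by (rule polymat_cong_entry[where f = "\<lambda>i j t. \<gamma> t $$ (i, j) + \<eta> t $$ (i, j)"])
    (use assms carrier_matD[OF polymat_carrier[OF assms(2)]] in
      \<open>auto simp: polymat_def intro: polyf_add\<close>)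

lemma polymat_smult:
  assumes "\<phi> \<in> polyf" "polymat m r \<gamma>" shows "polymat m r (\<lambda>t. \<phi> t \<cdot>\<^sub>m \<gamma> t)"
  by (rule polymat_cong_entry[where f = "\<lambda>i j t. \<phi> t * \<gamma> t $$ (i, j)"])
    (use assms carrier_matD[OF polymat_carrier[OF assms(2)]] in
      \<open>auto simp: polymat_def intro: polyf_mult\<close>)

lemma polymat_mult:
  assumes "polymat l m \<gamma>" "polymat m r \<eta>" shows "polymat l r (\<lambda>t. \<gamma> t * \<eta> t)"
proof (rule polymat_cong_entry[where f = "\<lambda>i j t. \<Sum>k<m. \<gamma> t $$ (i, k) * \<eta> t $$ (k, j)"])
  note car = polymat_carrier[OF assms(1)] polymat_carrier[OF assms(2)]
  show "\<gamma> t * \<eta> t \<in> carrier_mat l r" for t using car by (rule mult_carrier_mat)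
  fix i j t assume ij: "i < l" "j < r"
  then show "(\<gamma> t * \<eta> t) $$ (i, j) = (\<Sum>k<m. \<gamma> t $$ (i, k) * \<eta> t $$ (k, j))"
    using carrier_matD[OF car(1)[of t]] carrier_matD[OF car(2)[of t]]
    by (simp add: scalar_prod_def lessThan_atLeast0)
next
  fix i j assume "i < l" "j < r"
  then show "(\<lambda>t. \<Sum>k<m. \<gamma> t $$ (i, k) * \<eta> t $$ (k, j)) \<in> polyf"
    using assms by (intro polyf_sum polyf_mult) (auto simp: polymat_def)
qed

lemma polymat_transpose:
  assumes "polymat m r \<gamma>" shows "polymat r m (\<lambda>t. transpose_mat (\<gamma> t))"
  by (rule polymat_cong_entry[where f = "\<lambda>i j t. \<gamma> t $$ (j, i)"])
    (use assms carrier_matD[OF polymat_carrier[OF assms]] in \<open>auto simp: polymat_def\<close>)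

lemma polymat_four_block:
  assumes "polymat m r a" "polymat m s b" "polymat l r c" "polymat l s d"
  shows "polymat (m + l) (r + s) (\<lambda>t. four_block_mat (a t) (b t) (c t) (d t))"
proof (rule polymat_cong_entry[where f = "\<lambda>i j t. if i < m then if j < r then a t $$ (i, j)
      else b t $$ (i, j - r) else if j < r then c t $$ (i - m, j) else d t $$ (i - m, j - r)"])
  note car = assms[THEN polymat_carrier]
  show "four_block_mat (a t) (b t) (c t) (d t) \<in> carrier_mat (m + l) (r + s)" for t
    using car[of t] by auto
  show "four_block_mat (a t) (b t) (c t) (d t) $$ (i, j) =
      (if i < m then if j < r then a t $$ (i, j) else b t $$ (i, j - r)
       else if j < r then c t $$ (i - m, j) else d t $$ (i - m, j - r))"
    if "i < m + l" "j < r + s" for i j t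
    using car[of t] that by auto
  fix i j assume "i < m + l" "j < r + s"
  then show "(\<lambda>t. if i < m then if j < r then a t $$ (i, j)
      else b t $$ (i, j - r) else if j < r then c t $$ (i - m, j) else d t $$ (i - m,
        j - r)) \<in> polyf"
    using assms by (cases "i < m"; cases "j < r") (auto simp: polymat_def)
qed

lemma polyf_det:
  assumes "polymat m m \<gamma>" shows "(\<lambda>t. det (\<gamma> t)) \<in> polyf"
proof -
  have "(\<lambda>t. det (\<gamma> t)) = (\<lambda>t. \<Sum>p\<in>{p. p permutes {0..<m}}. signof p * (\<Prod>i=0..<m. \<gamma> t $$ (i, p i)))"
    using det_def'[OF polymat_carrier[OF assms]] by auto
  moreover have "(\<lambda>t. \<gamma> t $$ (i, p i)) \<in> polyf" if "p permutes {0..<m}" "i \<in> {0..<m}" for p i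
    using polymat_entry[OF assms] that permutes_in_image[OF that(1), of i] by auto
  ultimately show ?thesis by (auto intro!: polyf_sum polyf_mult polyf_prod polyf_const)
qed

text \<open>Entries of the adjugate are signed minors. It replaces the inverse on polynomial curves,
  at the price of the denominator \<open>det\<close>.\<close>

lemma polymat_adj_mat:
  assumes "polymat m m \<gamma>" shows "polymat m m (\<lambda>t. adj_mat (\<gamma> t))"
proof (rule polymat_cong_entry[where f = "\<lambda>i j t. (-1) ^ (j + i) * det (mat_delete (\<gamma> t) j i)"])
  note car = polymat_carrier[OF assms]
  show "adj_mat (\<gamma> t) \<in> carrier_mat m m" for t using adj_mat(1)[OF car] .
  fix i j assume ij: "i < m" "j < m"
  show "adj_mat (\<gamma> t) $$ (i, j) = (-1) ^ (j + i) * det (mat_delete (\<gamma> t) j i)" for t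
    using carrier_matD[OF car[of t]] ij by (simp add: adj_mat_def cofactor_def)
  have "polymat (m - 1) (m - 1) (\<lambda>t. mat_delete (\<gamma> t) j i)"
  proof (rule polymat_cong_entry[where f = "\<lambda>k l t. \<gamma> t $$ (insert_index j k, insert_index i l)"])
    show "mat_delete (\<gamma> t) j i \<in> carrier_mat (m - 1) (m - 1)" for t
      using carrier_matD[OF car[of t]] by (auto simp: mat_delete_def)
    fix k l assume kl: "k < m - 1" "l < m - 1"
    then have "insert_index j k < m" "insert_index i l < m"
      using ij by (auto simp: insert_index_def)
    then show "(\<lambda>t. \<gamma> t $$ (insert_index j k, insert_index i l)) \<in> polyf"
      using polymat_entry[OF assms] by blast
    show "mat_delete (\<gamma> t) j i $$ (k, l) = \<gamma> t $$ (insert_index j k, insert_index i l)" for t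
      using carrier_matD[OF car[of t]] kl by (simp add: mat_delete_def insert_index_def)
  qed
  then show "(\<lambda>t. (-1) ^ (j + i) * det (mat_delete (\<gamma> t) j i)) \<in> polyf"
    by (intro polyf_mult polyf_const polyf_det)
qed

section \<open>Subspaces and eigenvectors\<close>

definition subsp :: "nat \<Rightarrow> 'k::field vec set \<Rightarrow> bool" where
  "subsp m W \<longleftrightarrow> W \<subseteq> carrier_vec m \<and> 0\<^sub>v m \<in> W \<and>
     (\<forall>v\<in>W. \<forall>w\<in>W. v + w \<in> W) \<and> (\<forall>c. \<forall>v\<in>W. c \<cdot>\<^sub>v v \<in> W)"

lemma subspI:
  assumes "W \<subseteq> carrier_vec m" "0\<^sub>v m \<in> W" "\<And>v w. v \<in> W \<Longrightarrow> w \<in> W \<Longrightarrow> v + w \<in> W"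
    "\<And>c v. v \<in> W \<Longrightarrow> c \<cdot>\<^sub>v v \<in> W"
  shows "subsp m W"
  using assms by (auto simp: subsp_def)

lemma subspD:
  assumes "subsp m W"
  shows "W \<subseteq> carrier_vec m" "0\<^sub>v m \<in> W" "\<And>v w. v \<in> W \<Longrightarrow> w \<in> W \<Longrightarrow> v + w \<in> W"
    "\<And>c v. v \<in> W \<Longrightarrow> c \<cdot>\<^sub>v v \<in> W"
  using assms by (auto simp: subsp_def)

text \<open>The number of leading positions of the vectors of a subspace is its dimension; only strict
  monotonicity is needed.\<close>

definition leads :: "nat \<Rightarrow> 'k::field vec set \<Rightarrow> nat set" where
  "leads m W = {i. i < m \<and> (\<exists>w\<in>W. w $ i \<noteq> 0 \<and> (\<forall>j<i. w $ j = 0))}"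

lemma card_leads_le: "card (leads m W) \<le> m"
  using card_mono[of "{..<m}" "leads m W"] by (auto simp: leads_def)

text \<open>If the leading positions agreed, every \<open>w\<close> in \<open>W\<close> could be
  reduced by a multiple of a vector of \<open>V\<close> with the same leading position. Each
  reduction moves the leading position to the right, so \<open>w\<close> would lie in
  \<open>V\<close>.\<close>

lemma leads_psubset:
  assumes V: "subsp m V" and W: "subsp m W" and VW: "V \<subset> W"
  shows "card (leads m V) < card (leads m W)"
proof -
  have sub: "leads m V \<subseteq> leads m W" using VW by (auto simp: leads_def)
  have "leads m V \<noteq> leads m W"
  proof
    assume eq: "leads m V = leads m W"
    \<comment> \<open>Downward induction on the number of leading zeros; with \<open>m\<close> of
      them the vector is 0.\<close>
    have "w \<in> V" if "i \<le> m" "w \<in> W" "\<forall>j<i. w $ j = 0" for i w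
      using that
    proof (induction arbitrary: w rule: inc_induct)
      case base
      then have "w = 0\<^sub>v m" using subspD(1)[OF W] by (intro eq_vecI) auto
      then show ?case using subspD(2)[OF V] by simp
    next
      case (step i)
      show ?case
      proof (cases "w $ i = 0")
        case True
        then show ?thesis using step.IH[OF step.prems(1)] step.prems(2) less_Suc_eq by auto
      next
        case False
        then have "i \<in> leads m V" using step.prems step.hyps eq by (auto simp: leads_def)
        then obtain v where v: "v \<in> V" "v $ i \<noteq> 0" "\<forall>j<i. v $ j = 0" by (auto simp: leads_def)
        have car: "v \<in> carrier_vec m" "w \<in> carrier_vec m"
          using v(1) step.prems(1) subspD(1)[OF V] subspD(1)[OF W] by auto
        define c where "c = w $ i / v $ i"
        have "w + (- c) \<cdot>\<^sub>v v \<in> W"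
          using v(1) VW step.prems(1) subspD(3,4)[OF W] by blast
        moreover have "\<forall>j<Suc i. (w + (- c) \<cdot>\<^sub>v v) $ j = 0"
          using car v step.prems(2) step.hyps by (auto simp: c_def less_Suc_eq)
        ultimately have "w + (- c) \<cdot>\<^sub>v v \<in> V" by (rule step.IH)
        then have "(w + (- c) \<cdot>\<^sub>v v) + c \<cdot>\<^sub>v v \<in> V" using v(1) subspD(3,4)[OF V] by blast
        moreover have "(w + (- c) \<cdot>\<^sub>v v) + c \<cdot>\<^sub>v v = w" using car by (intro eq_vecI) auto
        ultimately show ?thesis by simp
      qed
    qed
    then have "W \<subseteq> V" using subspD(1)[OF W] by (metis not_less_zero le0 subsetI)
    then show False using VW by blast
  qed
  with sub have "leads m V \<subset> leads m W" by blast
  moreover have "finite (leads m W)" by (simp add: leads_def)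
  ultimately show ?thesis by (rule psubset_card_mono[rotated])
qed

lemma subsp_vec_kernel:
  assumes "M \<in> carrier_mat r m" shows "subsp m {v \<in> carrier_vec m. M *\<^sub>v v = 0\<^sub>v r}"
  using assms by (intro subspI) (auto simp: mult_add_distrib_mat_vec mult_mat_vec)

text \<open>The lead count drops strictly on proper subspaces, so a candidate of least lead count is
  minimal for inclusion. \<open>P\<close> is instantiated with invariance under a group.\<close>

lemma minimal_invariant_subsp:
  assumes "subsp m W" "W \<noteq> {0\<^sub>v m}" "P W"
  obtains U where "subsp m U" "U \<noteq> {0\<^sub>v m}" "P U" "U \<subseteq> W"
    "\<And>V. subsp m V \<Longrightarrow> V \<noteq> {0\<^sub>v m} \<Longrightarrow> P V \<Longrightarrow> V \<subseteq> U \<Longrightarrow> V = U"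
proof -
  define Q where "Q U \<longleftrightarrow> subsp m U \<and> U \<noteq> {0\<^sub>v m} \<and> P U \<and> U \<subseteq> W" for U
  have "Q W" using assms by (simp add: Q_def)
  then obtain U where U: "Q U" "\<And>V. Q V \<Longrightarrow> card (leads m U) \<le> card (leads m V)"
    using exists_least_iff[of "\<lambda>k. \<exists>U. Q U \<and> card (leads m U) = k"] by (metis not_le)
  show ?thesis
  proof (rule that[of U])
    fix V assume V: "subsp m V" "V \<noteq> {0\<^sub>v m}" "P V" "V \<subseteq> U"
    then have "Q V" using U(1) by (auto simp: Q_def)
    then have "card (leads m U) \<le> card (leads m V)" by (rule U(2))
    moreover have "subsp m U" using U(1) by (simp add: Q_def)
    ultimately show "V = U" using leads_psubset[OF V(1), of U] V(4) by fastforce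
  qed (use U(1) in \<open>auto simp: Q_def\<close>)
qed

text \<open>The vector \<open>p(h) w\<close>, evaluated by Horner's scheme, so that powers of the
  matrix \<open>h\<close> do not occur.\<close>

definition poly_apply :: "'k::field mat \<Rightarrow> 'k vec \<Rightarrow> 'k poly \<Rightarrow> 'k vec" where
  "poly_apply h w p = fold_coeffs (\<lambda>a v. a \<cdot>\<^sub>v w + h *\<^sub>v v) p (0\<^sub>v (dim_vec w))"

context
  fixes h :: "'k::field mat" and w :: "'k vec" and m :: nat
  assumes h: "h \<in> carrier_mat m m" and w: "w \<in> carrier_vec m"
begin

lemma poly_apply_0: "poly_apply h w 0 = 0\<^sub>v m"
  using w by (simp add: poly_apply_def)

lemma poly_apply_pCons: "poly_apply h w (pCons a p) = a \<cdot>\<^sub>v w + h *\<^sub>v poly_apply h w p"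
proof (cases "a = 0 \<and> p = 0")
  case True
  then show ?thesis using h w by (intro eq_vecI) (auto simp: poly_apply_0)
next
  case False
  then have "fold_coeffs (\<lambda>a v. a \<cdot>\<^sub>v w + h *\<^sub>v v) (pCons a p) =
    (\<lambda>v. a \<cdot>\<^sub>v w + h *\<^sub>v v) \<circ> fold_coeffs (\<lambda>a v. a \<cdot>\<^sub>v w + h *\<^sub>v v) p" by auto
  then show ?thesis by (simp add: poly_apply_def)
qed

lemma poly_apply_carrier: "poly_apply h w p \<in> carrier_vec m"
  by (induction p) (use h w in \<open>auto simp: poly_apply_0 poly_apply_pCons\<close>)

lemma poly_apply_add: "poly_apply h w (p + q) = poly_apply h w p + poly_apply h w q"
proof (induction p q rule: poly_induct2)
  case (pCons a p b q)
  let ?x = "poly_apply h w p" and ?y = "poly_apply h w q"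
  have "poly_apply h w (pCons a p + pCons b q) = (a + b) \<cdot>\<^sub>v w + (h *\<^sub>v ?x + h *\<^sub>v ?y)"
    using pCons h by (simp add: poly_apply_pCons mult_add_distrib_mat_vec[OF h] poly_apply_carrier)
  also have "\<dots> = (a \<cdot>\<^sub>v w + h *\<^sub>v ?x) + (b \<cdot>\<^sub>v w + h *\<^sub>v ?y)"
    using h w by (intro eq_vecI) (auto simp: algebra_simps)
  finally show ?case by (simp add: poly_apply_pCons)
qed (auto simp: poly_apply_0)

lemma poly_apply_smult: "poly_apply h w (smult c p) = c \<cdot>\<^sub>v poly_apply h w p"
proof (induction p)
  case 0
  then show ?case by (auto simp: poly_apply_0)
next
  case (pCons a p)
  have "poly_apply h w (smult c (pCons a p)) = (c * a) \<cdot>\<^sub>v w + c \<cdot>\<^sub>v (h *\<^sub>v poly_apply h w p)"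
    using pCons by (simp add: poly_apply_pCons mult_mat_vec[OF h poly_apply_carrier])
  also have "\<dots> = c \<cdot>\<^sub>v (a \<cdot>\<^sub>v w + h *\<^sub>v poly_apply h w p)"
    using h w by (intro eq_vecI) (auto simp: algebra_simps)
  finally show ?case by (simp add: poly_apply_pCons)
qed

lemma poly_apply_linear_factor:
  "poly_apply h w ([:- a, 1:] * q) = h *\<^sub>v poly_apply h w q - a \<cdot>\<^sub>v poly_apply h w q"
proof -
  have "poly_apply h w ([:- a, 1:] * q) = poly_apply h w (smult (- a) q + pCons 0 q)" by simp
  also have "\<dots> = (- a) \<cdot>\<^sub>v poly_apply h w q + (0 \<cdot>\<^sub>v w + h *\<^sub>v poly_apply h w q)"
    unfolding poly_apply_add poly_apply_smult poly_apply_pCons ..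
  also have "\<dots> = h *\<^sub>v poly_apply h w q - a \<cdot>\<^sub>v poly_apply h w q"
    using h w carrier_vecD[OF poly_apply_carrier[of q]] by (intro eq_vecI) auto
  finally show ?thesis .
qed

lemma poly_apply_in_subsp:
  assumes "subsp m W" "\<And>v. v \<in> W \<Longrightarrow> h *\<^sub>v v \<in> W" "w \<in> W"
  shows "poly_apply h w p \<in> W"
  using assms subspD[OF assms(1)]
  by (induction p) (auto simp: poly_apply_0 poly_apply_pCons)

text \<open>The spaces \<open>E i\<close> of vectors \<open>p(h) w\<close> with \<open>p\<close> of
  degree below \<open>i\<close> increase with \<open>i\<close>, and their lead counts are at most
  \<open>m\<close>. As soon as \<open>E i = E (Suc i)\<close>, the vector \<open>h^i w\<close> is a
  combination of lower powers.\<close>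

lemma annihilating_poly: "\<exists>p. p \<noteq> 0 \<and> poly_apply h w p = 0\<^sub>v m"
proof -
  define E where "E i = {poly_apply h w p | p. \<forall>j\<ge>i. coeff p j = 0}" for i
  have sub: "subsp m (E i)" for i
  proof (rule subspI)
    show "0\<^sub>v m \<in> E i" unfolding E_def by (rule CollectI, rule exI[of _ 0]) (simp add: poly_apply_0)
    show "E i \<subseteq> carrier_vec m" unfolding E_def using poly_apply_carrier by blast
    fix v c assume "v \<in> E i"
    then obtain p where p: "v = poly_apply h w p" "\<forall>j\<ge>i. coeff p j = 0" unfolding E_def by blast
    then show "c \<cdot>\<^sub>v v \<in> E i" unfolding E_def
      by (intro CollectI exI[of _ "smult c p"]) (auto simp: poly_apply_smult)
    fix u assume "u \<in> E i"
    then obtain q where q: "u = poly_apply h w q" "\<forall>j\<ge>i. coeff q j = 0" unfolding E_def by blast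
    show "v + u \<in> E i" unfolding E_def using p q
      by (intro CollectI exI[of _ "p + q"]) (auto simp: poly_apply_add)
  qed
  have mono: "E i \<subseteq> E (Suc i)" for i unfolding E_def by auto
  have "\<exists>i. E i = E (Suc i)"
  proof (rule ccontr)
    assume "\<not> ?thesis"
    then have lt: "card (leads m (E i)) < card (leads m (E (Suc i)))" for i
      using leads_psubset[OF sub sub] mono by blast
    have "i \<le> card (leads m (E i))" for i
      by (induction i) (use lt Suc_leI le_less_trans in blast)+
    from this[of "Suc m"] card_leads_le[of m "E (Suc m)"] show False by simp
  qed
  then obtain i where i: "E i = E (Suc i)" by blast
  have "poly_apply h w (monom 1 i) \<in> E (Suc i)" unfolding E_def by auto
  then obtain p where p: "poly_apply h w (monom 1 i) = poly_apply h w p" "\<forall>j\<ge>i. coeff p j = 0"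
    unfolding i[symmetric] unfolding E_def by blast
  have "poly_apply h w (monom 1 i + smult (-1) p) = 0\<^sub>v m"
    unfolding poly_apply_add poly_apply_smult p(1) using carrier_vecD[OF poly_apply_carrier[of p]]
    by (intro eq_vecI) auto
  moreover have "coeff (monom 1 i + smult (-1) p) i \<noteq> 0" using p(2) by simp
  then have "monom 1 i + smult (-1) p \<noteq> 0" by (metis coeff_0)
  ultimately show ?thesis by blast
qed

end

text \<open>Split linear factors off an annihilating polynomial of some \<open>w\<close> in
  \<open>W\<close>: the first quotient \<open>q\<close> with \<open>q(h) w\<close> nonzero yields an
  eigenvector. It lies in \<open>W\<close> because \<open>W\<close> is stable under
  \<open>h\<close>, which a root of the characteristic polynomial of \<open>h\<close> alone would
  not ensure.\<close>

lemma eigenvector_in_subsp: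
  fixes h :: "'k::alg_closed_field mat"
  assumes h: "h \<in> carrier_mat m m" and W: "subsp m W" "\<And>v. v \<in> W \<Longrightarrow> h *\<^sub>v v \<in> W" "W \<noteq> {0\<^sub>v m}"
  obtains v c where "v \<in> W" "v \<noteq> 0\<^sub>v m" "h *\<^sub>v v = c \<cdot>\<^sub>v v"
proof -
  obtain w where w: "w \<in> W" "w \<noteq> 0\<^sub>v m" using W(1,3) subspD(2) by blast
  then have wc: "w \<in> carrier_vec m" using subspD(1)[OF W(1)] by auto
  note [simp] = poly_apply_0[OF h wc] poly_apply_pCons[OF h wc]
  obtain p where "p \<noteq> 0" "poly_apply h w p = 0\<^sub>v m" using annihilating_poly[OF h wc] by blast
  then have "\<exists>v\<in>W. v \<noteq> 0\<^sub>v m \<and> (\<exists>c. h *\<^sub>v v = c \<cdot>\<^sub>v v)"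
  proof (induction "degree p" arbitrary: p)
    case 0
    then obtain a where "p = [:a:]" "a \<noteq> 0" by (metis degree_eq_zeroE pCons_0_0)
    moreover have "a \<cdot>\<^sub>v w + h *\<^sub>v 0\<^sub>v m = a \<cdot>\<^sub>v w" using h wc by (intro eq_vecI) auto
    ultimately have "a \<cdot>\<^sub>v w = 0\<^sub>v m" using 0 by simp
    then have "(a \<cdot>\<^sub>v w) $ i = 0" if "i < m" for i using that by simp
    then have "w = 0\<^sub>v m" using \<open>a \<noteq> 0\<close> wc by (intro eq_vecI) auto
    with w(2) show ?case by simp
  next
    case (Suc d)
    obtain a where "poly p a = 0" using alg_closed_imp_poly_has_root[of p] Suc by auto
    then obtain q where q: "p = [:- a, 1:] * q" by (metis dvdE poly_eq_0_iff_dvd)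
    with Suc.prems have "q \<noteq> 0" by auto
    let ?u = "poly_apply h w q"
    have u: "?u \<in> W" "?u \<in> carrier_vec m"
      using poly_apply_in_subsp[OF h wc W(1,2) w(1)] poly_apply_carrier[OF h wc] by auto
    show ?case
    proof (cases "?u = 0\<^sub>v m")
      case True
      have "degree p = Suc (degree q)" unfolding q using \<open>q \<noteq> 0\<close> by (subst degree_mult_eq) auto
      then show ?thesis using Suc(1)[of q] Suc(2) True \<open>q \<noteq> 0\<close> by auto
    next
      case False
      have 0: "h *\<^sub>v ?u - a \<cdot>\<^sub>v ?u = 0\<^sub>v m"
        using Suc.prems poly_apply_linear_factor[OF h wc] q by metis
      have "h *\<^sub>v ?u = a \<cdot>\<^sub>v ?u"
      proof (rule eq_vecI)
        fix i assume "i < dim_vec (a \<cdot>\<^sub>v ?u)"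
        then have "(h *\<^sub>v ?u - a \<cdot>\<^sub>v ?u) $ i = 0" using 0 u by simp
        then show "(h *\<^sub>v ?u) $ i = (a \<cdot>\<^sub>v ?u) $ i" using \<open>i < _\<close> by simp
      qed (use h u in auto)
      then show ?thesis using u False by blast
    qed
  qed
  then show thesis using that by blast
qed

lemma finite_eigenvalues:
  assumes "h \<in> carrier_mat m m"
  shows "finite {c. \<exists>v\<in>carrier_vec m. v \<noteq> 0\<^sub>v m \<and> h *\<^sub>v v = c \<cdot>\<^sub>v (v :: 'k::field vec)}"
proof -
  have "{c. \<exists>v\<in>carrier_vec m. v \<noteq> 0\<^sub>v m \<and> h *\<^sub>v v = c \<cdot>\<^sub>v v} = {c. poly (char_poly h) c = 0}"
    using eigenvalue_root_char_poly[OF assms] assms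
    by (auto simp: eigenvalue_def eigenvector_def)
  moreover have "char_poly h \<noteq> 0" using degree_monic_char_poly[OF assms] by auto
  ultimately show ?thesis by (simp add: poly_roots_finite)
qed

text \<open>The eigenvalue takes finitely many values on a connected set, each on a closed subset.\<close>

lemma connected_eigenvalue:
  fixes \<rho> :: "'k::field mat \<Rightarrow> 'k mat"
  assumes H: "connectedin (zariski N) H"
    and \<rho>: "\<And>A. \<rho> A \<in> carrier_mat m m" "\<And>i j. i < m \<Longrightarrow> j < m \<Longrightarrow> (\<lambda>A. \<rho> A $$ (i, j)) \<in> poly_funs N"
    and x: "x \<in> carrier_mat m m" and v: "v \<in> carrier_vec m"
    and ev: "\<And>h. h \<in> H \<Longrightarrow> \<rho> h *\<^sub>v v \<noteq> 0\<^sub>v m \<and> (\<exists>c. x *\<^sub>v (\<rho> h *\<^sub>v v) = c \<cdot>\<^sub>v (\<rho> h *\<^sub>v v))"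
    and g: "g \<in> H" "x *\<^sub>v (\<rho> g *\<^sub>v v) = c \<cdot>\<^sub>v (\<rho> g *\<^sub>v v)" and h: "h \<in> H"
  shows "x *\<^sub>v (\<rho> h *\<^sub>v v) = c \<cdot>\<^sub>v (\<rho> h *\<^sub>v v)"
proof (rule ccontr)
  assume neq: "\<not> ?thesis"
  define E where "E a = {A \<in> carrier_mat N N. x *\<^sub>v (\<rho> A *\<^sub>v v) = a \<cdot>\<^sub>v (\<rho> A *\<^sub>v v)}" for a
  define Ev where "Ev = {c. \<exists>v\<in>carrier_vec m. v \<noteq> 0\<^sub>v m \<and> x *\<^sub>v v = c \<cdot>\<^sub>v v}"
  have fin: "finite Ev" unfolding Ev_def by (rule finite_eigenvalues[OF x])
  have HN: "H \<subseteq> carrier_mat N N" using connectedin_subset_topspace[OF H] by simp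
  have cl: "closedin (zariski N) (E a)" for a
  proof -
    define f where "f i A = (\<Sum>j<m. x $$ (i, j) * (\<Sum>k<m. \<rho> A $$ (j, k) * v $ k)) +
      (- a) * (\<Sum>k<m. \<rho> A $$ (i, k) * v $ k)" for i A
    have "f i \<in> poly_funs N" if "i < m" for i
      unfolding f_def using \<rho>(2) that
      by (intro poly_funs.add poly_funs.mult poly_funs_sum poly_funs.const) auto
    moreover have "E a = zero_locus N (f ` {..<m})"
    proof -
      have "x *\<^sub>v (\<rho> A *\<^sub>v v) = a \<cdot>\<^sub>v (\<rho> A *\<^sub>v v) \<longleftrightarrow> (\<forall>i<m. f i A = 0)" for A
      proof -
        have r: "(\<rho> A *\<^sub>v v) $ j = (\<Sum>k<m. \<rho> A $$ (j, k) * v $ k)" if "j < m" for j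
          using \<rho>(1)[of A] v that by (auto simp: scalar_prod_def lessThan_atLeast0)
        have l: "(x *\<^sub>v (\<rho> A *\<^sub>v v)) $ i = (\<Sum>j<m. x $$ (i, j) * (\<Sum>k<m. \<rho> A $$ (j, k) * v $ k))"
          if "i < m" for i
        proof -
          have "(x *\<^sub>v (\<rho> A *\<^sub>v v)) $ i = (\<Sum>j<m. x $$ (i, j) * (\<rho> A *\<^sub>v v) $ j)"
            using \<rho>(1)[of A] v x that by (auto simp: scalar_prod_def lessThan_atLeast0)
          then show ?thesis using r by simp
        qed
        have "x *\<^sub>v (\<rho> A *\<^sub>v v) = a \<cdot>\<^sub>v (\<rho> A *\<^sub>v v) \<longleftrightarrow>
          (\<forall>i<m. (x *\<^sub>v (\<rho> A *\<^sub>v v)) $ i = (a \<cdot>\<^sub>v (\<rho> A *\<^sub>v v)) $ i)"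
          using \<rho>(1)[of A] x v by (auto simp del: index_mult_mat_vec)
        also have "\<dots> \<longleftrightarrow> (\<forall>i<m. f i A = 0)"
          using \<rho>(1)[of A] l r by (simp add: f_def del: index_mult_mat_vec)
        finally show ?thesis .
      qed
      then show ?thesis unfolding E_def zero_locus_def by auto
    qed
    ultimately show ?thesis unfolding closedin_zariski by (intro exI[of _ "f ` {..<m}"]) auto
  qed
  let ?F = "\<Union>a\<in>Ev - {c}. E a"
  have clF: "closedin (zariski N) ?F" using fin cl by (intro closedin_Union) auto
  have nz: "\<rho> A *\<^sub>v v \<in> carrier_vec m" for A using \<rho>(1) v by (rule mult_mat_vec_carrier)
  have cov: "A \<in> E c \<or> A \<in> ?F" if A: "A \<in> H" for A
  proof -
    obtain a where a: "x *\<^sub>v (\<rho> A *\<^sub>v v) = a \<cdot>\<^sub>v (\<rho> A *\<^sub>v v)" using ev[OF A] by blast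
    then have "A \<in> E a" "a \<in> Ev" using A HN ev[OF A] nz[of A] unfolding E_def Ev_def by blast+
    then show ?thesis by blast
  qed
  have disj: "A \<notin> ?F" if A: "A \<in> H" "A \<in> E c" for A
  proof
    assume "A \<in> ?F"
    then obtain a where a: "a \<noteq> c" "A \<in> E a" by blast
    then have "a \<cdot>\<^sub>v (\<rho> A *\<^sub>v v) = c \<cdot>\<^sub>v (\<rho> A *\<^sub>v v)" using A by (auto simp: E_def)
    then have "\<forall>i<m. (a \<cdot>\<^sub>v (\<rho> A *\<^sub>v v)) $ i = (c \<cdot>\<^sub>v (\<rho> A *\<^sub>v v)) $ i" by simp
    then have "\<forall>i<m. (\<rho> A *\<^sub>v v) $ i = 0"
      using a(1) carrier_vecD[OF nz[of A]] by (simp del: index_mult_mat_vec)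
    then have "\<rho> A *\<^sub>v v = 0\<^sub>v m" using carrier_vecD[OF nz[of A]]
      by (intro eq_vecI) (simp_all del: index_mult_mat_vec)
    then show False using ev[OF A(1)] by blast
  qed
  have "g \<in> E c" using g HN by (auto simp: E_def)
  moreover have "h \<notin> E c" using neq by (auto simp: E_def)
  ultimately show False
    using H cl[of c] clF cov disj g(1) h unfolding connectedin_closedin by blast
qed

section \<open>Block matrices in characteristic 2\<close>

notation transpose_mat (\<open>(_\<^sup>T)\<close> [1000] 1000)

text \<open>Truncation to size \<open>N\<close>, the identity on matrices of that size. Composed
  with it, a map such as left multiplication by \<open>g\<close> has values of the right format for
  every argument, as \<open>poly_funs_mult_mat\<close> asks.\<close>

definition cut_mat :: "nat \<Rightarrow> 'a mat \<Rightarrow> 'a mat" where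
  "cut_mat N A = mat N N (\<lambda>(i, j). A $$ (i, j))"

lemma cut_mat_carrier [simp]: "cut_mat N A \<in> carrier_mat N N"
  by (simp add: cut_mat_def)

lemma cut_mat_id: "A \<in> carrier_mat N N \<Longrightarrow> cut_mat N A = A"
  by (auto simp: cut_mat_def)

lemma poly_funs_cut_mat: "i < N \<Longrightarrow> j < N \<Longrightarrow> (\<lambda>A. cut_mat N A $$ (i, j)) \<in> poly_funs N"
  by (simp add: cut_mat_def poly_funs.entry)

lemma poly_funs_cut_mat_transpose:
  "i < N \<Longrightarrow> j < N \<Longrightarrow> (\<lambda>A. (cut_mat N A)\<^sup>T $$ (i, j)) \<in> poly_funs N"
  by (simp add: cut_mat_def poly_funs.entry)

lemma four_block_cases:
  assumes "A \<in> carrier_mat (2 * n) (2 * n)"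
  obtains a b c d where "a \<in> carrier_mat n n" "b \<in> carrier_mat n n" "c \<in> carrier_mat n n"
    "d \<in> carrier_mat n n" "A = four_block_mat a b c d"
proof (rule that)
  show "A = four_block_mat (mat n n (\<lambda>(i, j). A $$ (i, j))) (mat n n (\<lambda>(i, j). A $$ (i, j + n)))
     (mat n n (\<lambda>(i, j). A $$ (i + n, j))) (mat n n (\<lambda>(i, j). A $$ (i + n, j + n)))"
    using assms by (intro eq_matI) auto
qed auto

lemma four_block_mat_eq_iff:
  assumes "a \<in> carrier_mat n n" "b \<in> carrier_mat n n" "c \<in> carrier_mat n n" "d \<in> carrier_mat n n"
    "a' \<in> carrier_mat n n" "b' \<in> carrier_mat n n" "c' \<in> carrier_mat n n" "d' \<in> carrier_mat n n"
  shows "four_block_mat a b c d = four_block_mat a' b' c' d' \<longleftrightarrow> a = a' \<and> b = b' \<and> c = c' \<and> d = d'"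
proof
  assume eq: "four_block_mat a b c d = four_block_mat a' b' c' d'"
  have *: "four_block_mat a b c d $$ (i, j) = four_block_mat a' b' c' d' $$ (i, j)" for i j
    using eq by simp
  show "a = a' \<and> b = b' \<and> c = c' \<and> d = d'"
  proof (intro conjI eq_matI)
    fix i j
    show "i < dim_row a' \<Longrightarrow> j < dim_col a' \<Longrightarrow> a $$ (i, j) = a' $$ (i, j)"
      using *[of i j] assms by auto
    show "i < dim_row b' \<Longrightarrow> j < dim_col b' \<Longrightarrow> b $$ (i, j) = b' $$ (i, j)"
      using *[of i "j + n"] assms by auto
    show "i < dim_row c' \<Longrightarrow> j < dim_col c' \<Longrightarrow> c $$ (i, j) = c' $$ (i, j)"
      using *[of "i + n" j] assms by auto
    show "i < dim_row d' \<Longrightarrow> j < dim_col d' \<Longrightarrow> d $$ (i, j) = d' $$ (i, j)"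
      using *[of "i + n" "j + n"] assms by auto
  qed (use assms in auto)
qed simp

lemma mult_square_carrier: "A \<in> carrier_mat m m \<Longrightarrow> B \<in> carrier_mat m m \<Longrightarrow> A * B \<in> carrier_mat m m"
  by (rule mult_carrier_mat)

lemma assoc_mult_square:
  "A \<in> carrier_mat m m \<Longrightarrow> B \<in> carrier_mat m m \<Longrightarrow> C \<in> carrier_mat m m \<Longrightarrow> (A * B) * C = A * (B * C)"
  by (rule assoc_mult_mat)

lemmas square_simps = mult_square_carrier assoc_mult_square

locale symplectic_char2 =
  fixes n :: nat and ty :: "'k::alg_closed_field itself"
  assumes char2: "CHAR('k) = 2"
begin

lemmas block_mult = mult_four_block_mat[where ?nr1.0 = n and ?n1.0 = n and ?n2.0 = n and ?nr2.0 = n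
    and ?nc1.0 = n and ?nc2.0 = n]
lemmas block_transpose = transpose_four_block_mat[where ?nr1.0 = n and ?nc1.0 = n and ?nc2.0 = n
    and ?nr2.0 = n]
lemmas block_simps = square_simps[of _ n]
lemmas Sp_simps = square_simps[of _ "2 * n"]

lemma add_self: "x + x = (0 :: 'k)"
proof -
  have "(2 :: 'k) = 0" using of_nat_CHAR[where 'a = 'k] char2 by simp
  then show ?thesis by (metis mult_2 mult_zero_left)
qed

lemma uminus_self: "- x = (x :: 'k)"
  using add_self by (metis add_eq_0_iff)

lemma minus_is_plus: "x - y = x + (y :: 'k)"
  by (metis uminus_self diff_conv_add_uminus)

lemma add_eq_0_iff2: "x + y = (0 :: 'k) \<longleftrightarrow> x = y"
  by (metis add_eq_0_iff uminus_self)

lemma add_left_self: "x + (x + y) = (y :: 'k)"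
  by (metis add.assoc add_0 add_self)

lemma mat_add_self: "A \<in> carrier_mat m r \<Longrightarrow> A + A = (0\<^sub>m m r :: 'k mat)"
  by (intro eq_matI) (auto simp: add_self)

lemma mat_add_eq_0_iff:
  assumes "A \<in> carrier_mat m r" "B \<in> carrier_mat m r"
  shows "A + B = 0\<^sub>m m r \<longleftrightarrow> A = (B :: 'k mat)"
proof
  assume eq: "A + B = 0\<^sub>m m r"
  show "A = B"
  proof (rule eq_matI)
    fix i j assume "i < dim_row B" "j < dim_col B"
    then have "(A + B) $$ (i, j) = 0" using eq assms by simp
    then show "A $$ (i, j) = B $$ (i, j)"
      using assms \<open>i < _\<close> \<open>j < _\<close> by (simp add: add_eq_0_iff2)
  qed (use assms in auto)
qed (use assms mat_add_self in auto)

abbreviation J :: "'k mat" where "J \<equiv> symp_form n"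
abbreviation G :: "'k mat monoid" where "G \<equiv> Sp n"

sublocale G: group G
  by (rule group_Sp)

lemma J_eq: "J = four_block_mat (0\<^sub>m n n) (1\<^sub>m n) (1\<^sub>m n) (0\<^sub>m n n)"
proof -
  have "- (1\<^sub>m n :: 'k mat) = 1\<^sub>m n" by (intro eq_matI) (auto simp: uminus_self)
  then show ?thesis by (simp add: symp_form_def)
qed

lemma J_carrier [simp]: "J \<in> carrier_mat (2 * n) (2 * n)"
  by (rule symp_form_carrier)

lemma J_J: "J * J = 1\<^sub>m (2 * n)"
  unfolding J_eq by (subst block_mult) (simp_all add: mult_2)

lemma J_transpose: "J\<^sup>T = J"
  unfolding J_eq by (subst block_transpose) auto

lemma Sp_mult: "x \<otimes>\<^bsub>G\<^esub> y = x * y" and Sp_one: "\<one>\<^bsub>G\<^esub> = 1\<^sub>m (2 * n)"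
  by (simp_all add: Sp_def mult_GL one_GL)

text \<open>The equation \<open>A\<^sup>T * J * A = J\<close> exhibits
  \<open>J * A\<^sup>T * J\<close> as a left inverse of \<open>A\<close>, and a left inverse of a
  square matrix is two-sided; so \<open>A\<close> lies in \<open>GL\<close>.\<close>

lemma Sp_iff: "A \<in> carrier G \<longleftrightarrow> A \<in> carrier_mat (2 * n) (2 * n) \<and> A\<^sup>T * J * A = J"
proof
  assume "A \<in> carrier G"
  then show "A \<in> carrier_mat (2 * n) (2 * n) \<and> A\<^sup>T * J * A = J"
    using carrier_GL by (auto simp: Sp_def)
next
  assume A: "A \<in> carrier_mat (2 * n) (2 * n) \<and> A\<^sup>T * J * A = J"
  have "(J * A\<^sup>T * J) * A = J * (A\<^sup>T * J * A)"
    using A by (simp add: Sp_simps del: assoc_mult_mat)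
  then have 1: "(J * A\<^sup>T * J) * A = 1\<^sub>m (2 * n)" using A J_J by simp
  moreover have car: "J * A\<^sup>T * J \<in> carrier_mat (2 * n) (2 * n)"
    using A by (auto intro!: mult_carrier_mat)
  ultimately have "A * (J * A\<^sup>T * J) = 1\<^sub>m (2 * n)"
    using A mat_mult_left_right_inverse by blast
  then show "A \<in> carrier G" using A 1 car
    by (auto simp: Sp_def GL_def units_of_def Units_def ring_mat_simps)
qed

lemma Sp_carrier: "A \<in> carrier G \<Longrightarrow> A \<in> carrier_mat (2 * n) (2 * n)"
  by (simp add: Sp_iff)

text \<open>Inversion is thus polynomial on the group, which makes commutator maps continuous in the
  Zariski topology.\<close>

lemma Sp_inv:
  assumes "A \<in> carrier G" shows "inv\<^bsub>G\<^esub> A = J * A\<^sup>T * J"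
proof -
  note A = assms[unfolded Sp_iff]
  have B: "inv\<^bsub>G\<^esub> A \<in> carrier_mat (2 * n) (2 * n)" "A * inv\<^bsub>G\<^esub> A = 1\<^sub>m (2 * n)"
    using assms G.r_inv[OF assms] Sp_carrier by (auto simp: Sp_mult Sp_one)
  have 1: "(J * A\<^sup>T * J) * A = 1\<^sub>m (2 * n)"
  proof -
    have "(J * A\<^sup>T * J) * A = J * (A\<^sup>T * J * A)"
      using A by (simp add: Sp_simps del: assoc_mult_mat)
    then show ?thesis using A J_J by simp
  qed
  have car: "J * A\<^sup>T * J \<in> carrier_mat (2 * n) (2 * n)" using A by (auto intro!: mult_carrier_mat)
  have "J * A\<^sup>T * J = (J * A\<^sup>T * J) * (A * inv\<^bsub>G\<^esub> A)"
    unfolding B(2) using right_mult_one_mat[OF car] by simp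
  also have "\<dots> = ((J * A\<^sup>T * J) * A) * inv\<^bsub>G\<^esub> A"
    using assoc_mult_square[OF car _ B(1), of A] A by simp
  finally show ?thesis using 1 B(1) by simp
qed

lemma Sp_four_block_iff:
  assumes "a \<in> carrier_mat n n" "b \<in> carrier_mat n n" "c \<in> carrier_mat n n" "d \<in> carrier_mat n n"
  shows "four_block_mat a b c d \<in> carrier G \<longleftrightarrow>
    a\<^sup>T * c = c\<^sup>T * a \<and> b\<^sup>T * d = d\<^sup>T * b \<and> a\<^sup>T * d + c\<^sup>T * b = 1\<^sub>m n"
proof -
  have 1: "(four_block_mat a b c d)\<^sup>T = four_block_mat (a\<^sup>T) (c\<^sup>T) (b\<^sup>T) (d\<^sup>T)"
    using assms by (subst block_transpose) auto
  have 2: "four_block_mat (a\<^sup>T) (c\<^sup>T) (b\<^sup>T) (d\<^sup>T) * J = four_block_mat (c\<^sup>T) (a\<^sup>T) (d\<^sup>T) (b\<^sup>T)"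
    unfolding J_eq using assms by (subst block_mult) auto
  have 3: "four_block_mat (c\<^sup>T) (a\<^sup>T) (d\<^sup>T) (b\<^sup>T) * four_block_mat a b c d =
    four_block_mat (c\<^sup>T * a + a\<^sup>T * c) (c\<^sup>T * b + a\<^sup>T * d) (d\<^sup>T * a + b\<^sup>T * c) (d\<^sup>T * b + b\<^sup>T * d)"
    using assms by (subst block_mult) auto
  \<comment> \<open>The lower left block equation is the transpose of the upper right one, which
    leaves three conditions.\<close>
  have 4: "d\<^sup>T * a + b\<^sup>T * c = (a\<^sup>T * d + c\<^sup>T * b)\<^sup>T"
    using assms by (simp add: transpose_add[of _ n n] transpose_mult[of _ n n _ n])
  have 5: "c\<^sup>T * b + a\<^sup>T * d = a\<^sup>T * d + c\<^sup>T * b" using assms by (intro comm_add_mat[of _ n n]) auto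
  show ?thesis
    unfolding Sp_iff 1 2 3 unfolding J_eq
    using assms by (subst four_block_mat_eq_iff)
      (auto simp: mat_add_eq_0_iff[of _ n n] 4 5 mult_2 intro!: four_block_carrier_mat)
qed

lemma Sp_four_block_inv:
  assumes "a \<in> carrier_mat n n" "b \<in> carrier_mat n n" "c \<in> carrier_mat n n" "d \<in> carrier_mat n n"
    and "four_block_mat a b c d \<in> carrier G"
  shows "inv\<^bsub>G\<^esub> (four_block_mat a b c d) = four_block_mat (d\<^sup>T) (b\<^sup>T) (c\<^sup>T) (a\<^sup>T)"
proof -
  have 1: "(four_block_mat a b c d)\<^sup>T = four_block_mat (a\<^sup>T) (c\<^sup>T) (b\<^sup>T) (d\<^sup>T)"
    using assms by (subst block_transpose) auto
  have 2: "J * four_block_mat (a\<^sup>T) (c\<^sup>T) (b\<^sup>T) (d\<^sup>T) = four_block_mat (b\<^sup>T) (d\<^sup>T) (a\<^sup>T) (c\<^sup>T)"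
    unfolding J_eq using assms by (subst block_mult) auto
  have 3: "four_block_mat (b\<^sup>T) (d\<^sup>T) (a\<^sup>T) (c\<^sup>T) * J = four_block_mat (d\<^sup>T) (b\<^sup>T) (c\<^sup>T) (a\<^sup>T)"
    unfolding J_eq using assms by (subst block_mult) auto
  show ?thesis unfolding Sp_inv[OF assms(5)] 1 2 3 ..
qed

section \<open>The Lie-Kolchin theorem\<close>

text \<open>For fixed \<open>g\<close> in \<open>H\<close>, the commutators of \<open>g\<close> with
  elements of \<open>H\<close> form a continuous image of \<open>H\<close> that contains the
  identity. Inverses and products of elements joined to the identity by a connected subset of the
  derived group are again joined to it, and the union of all these subsets is connected.\<close>

lemma connectedin_derived:
  assumes H: "subgroup H G" and con: "connectedin (zariski (2 * n)) H"
  shows "connectedin (zariski (2 * n)) (derived G H)"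
proof -
  let ?N = "2 * n" and ?D = "derived_set G H"
  \<comment> \<open>The polynomial map that agrees with inversion on the group.\<close>
  define \<iota> where "\<iota> A = J * (cut_mat ?N A)\<^sup>T * J" for A
  have \<iota>c: "\<iota> A \<in> carrier_mat ?N ?N" for A unfolding \<iota>_def by (intro mult_square_carrier) auto
  have \<iota>p: "(\<lambda>A. \<iota> A $$ (i, j)) \<in> poly_funs ?N" if "i < ?N" "j < ?N" for i j
  proof -
    have 1: "(\<lambda>A. (J * (cut_mat ?N A)\<^sup>T) $$ (i, j)) \<in> poly_funs ?N" if "i < ?N" "j < ?N" for i j
      by (rule poly_funs_mult_mat[of _ ?N ?N _ ?N])
        (use that in \<open>auto intro: poly_funs.const poly_funs_cut_mat_transpose\<close>)
    show ?thesis unfolding \<iota>_def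
      by (rule poly_funs_mult_mat[of _ ?N ?N _ ?N])
        (use that 1 in \<open>auto intro: poly_funs.const intro!: mult_square_carrier\<close>)
  qed
  have \<iota>: "\<iota> A = inv\<^bsub>G\<^esub> A" if "A \<in> carrier G" for A
    using that Sp_carrier[OF that] by (simp add: \<iota>_def cut_mat_id Sp_inv)
  have HG: "H \<subseteq> carrier G" using H by (rule subgroup.subset)
  have DG: "?D \<subseteq> carrier G" using G.derived_set_in_carrier[OF HG] .
  have comm: "\<exists>K. connectedin (zariski ?N) K \<and> \<one>\<^bsub>G\<^esub> \<in> K \<and> x \<in> K \<and> K \<subseteq> ?D" if x: "x \<in> ?D" for x
  proof -
    obtain g h where gh: "g \<in> H" "h \<in> H"
      "x = g \<otimes>\<^bsub>G\<^esub> h \<otimes>\<^bsub>G\<^esub> inv\<^bsub>G\<^esub> g \<otimes>\<^bsub>G\<^esub> inv\<^bsub>G\<^esub> h" using x by blast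
    have g: "g \<in> carrier G" using gh(1) HG by blast
    then have gi: "inv\<^bsub>G\<^esub> g \<in> carrier G" by simp
    let ?f = "\<lambda>A. ((g * cut_mat ?N A) * inv\<^bsub>G\<^esub> g) * \<iota> A"
    have c: "g * cut_mat ?N A \<in> carrier_mat ?N ?N" "(g * cut_mat ?N A) * inv\<^bsub>G\<^esub> g \<in> carrier_mat ?N ?N"
      "?f A \<in> carrier_mat ?N ?N" for A
      using Sp_carrier[OF g] Sp_carrier[OF gi] \<iota>c[of A]
      by (meson mult_carrier_mat cut_mat_carrier)+
    have "connectedin (zariski ?N) (?f ` H)"
    proof (rule connectedin_continuous_map_image[OF continuous_map_zariski con])
      fix i j assume ij: "i < ?N" "j < ?N"
      have 1: "(\<lambda>A. (g * cut_mat ?N A) $$ (i, j)) \<in> poly_funs ?N" if "i < ?N" "j < ?N" for i j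
        by (rule poly_funs_mult_mat[of _ ?N ?N _ ?N])
          (use that Sp_carrier[OF g] in \<open>auto intro: poly_funs.const poly_funs_cut_mat\<close>)
      have 2: "(\<lambda>A. ((g * cut_mat ?N A) * inv\<^bsub>G\<^esub> g) $$ (i, j)) \<in> poly_funs ?N"
        if "i < ?N" "j < ?N" for i j
        by (rule poly_funs_mult_mat[of _ ?N ?N _ ?N])
          (use that Sp_carrier[OF gi] c 1 in \<open>auto intro: poly_funs.const\<close>)
      show "(\<lambda>A. ?f A $$ (i, j)) \<in> poly_funs ?N"
        by (rule poly_funs_mult_mat[of _ ?N ?N _ ?N]) (use ij c 2 \<iota>c \<iota>p in auto)
    qed (rule c)
    moreover have "?f A = g \<otimes>\<^bsub>G\<^esub> A \<otimes>\<^bsub>G\<^esub> inv\<^bsub>G\<^esub> g \<otimes>\<^bsub>G\<^esub> inv\<^bsub>G\<^esub> A" if "A \<in> H" for A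
      using that HG \<iota>[of A] Sp_carrier[of A] by (auto simp: Sp_mult cut_mat_id)
    then have "?f ` H = (\<lambda>A. g \<otimes>\<^bsub>G\<^esub> A \<otimes>\<^bsub>G\<^esub> inv\<^bsub>G\<^esub> g \<otimes>\<^bsub>G\<^esub> inv\<^bsub>G\<^esub> A) ` H" (is "_ = ?h ` H")
      by (intro image_cong) auto
    ultimately have "connectedin (zariski ?N) (?h ` H)" by simp
    moreover have "\<one>\<^bsub>G\<^esub> = ?h \<one>\<^bsub>G\<^esub>" using g by simp
    then have "\<one>\<^bsub>G\<^esub> \<in> ?h ` H" using subgroup.one_closed[OF H] by (rule image_eqI)
    moreover have "x \<in> ?h ` H" using gh by blast
    moreover have "?h ` H \<subseteq> ?D" using gh(1) by blast
    ultimately show ?thesis by blast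
  qed
  have "\<exists>K. connectedin (zariski ?N) K \<and> \<one>\<^bsub>G\<^esub> \<in> K \<and> x \<in> K \<and> K \<subseteq> generate G ?D"
    if "x \<in> generate G ?D" for x
    using that
  proof (induction rule: generate.induct)
    case one
    show ?case by (rule exI[of _ "{\<one>\<^bsub>G\<^esub>}"]) (auto intro: generate.one simp: Sp_carrier)
  next
    case (incl x)
    obtain K where K: "connectedin (zariski ?N) K" "\<one>\<^bsub>G\<^esub> \<in> K" "x \<in> K" "K \<subseteq> ?D"
      using comm[OF incl] by (elim exE conjE)
    have "K \<subseteq> generate G ?D" using K(4) by (rule subset_trans) (rule subsetI, rule generate.incl)
    with K show ?case by (intro exI[of _ K] conjI)
  next
    case (inv x)
    obtain K where K: "connectedin (zariski ?N) K" "\<one>\<^bsub>G\<^esub> \<in> K" "x \<in> K" "K \<subseteq> ?D"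
      using comm[OF inv] by (elim exE conjE)
    have "connectedin (zariski ?N) (\<iota> ` K)"
      by (rule connectedin_continuous_map_image[OF continuous_map_zariski K(1)])
        (use \<iota>c \<iota>p in auto)
    moreover have "\<iota> ` K \<subseteq> generate G ?D"
    proof
      fix y assume "y \<in> \<iota> ` K"
      then obtain z where z: "z \<in> K" "y = \<iota> z" by (elim imageE)
      have "z \<in> ?D" using K(4) z(1) by (rule subsetD)
      then show "y \<in> generate G ?D"
        using \<iota>[OF subsetD[OF DG]] z(2) generate.inv[of z ?D] by (simp del: UN_iff)
    qed
    moreover have "\<iota> \<one>\<^bsub>G\<^esub> = \<one>\<^bsub>G\<^esub>" "\<iota> x = inv\<^bsub>G\<^esub> x"
      using \<iota>[of "\<one>\<^bsub>G\<^esub>"] \<iota>[OF subsetD[OF DG inv]] by auto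
    ultimately show ?case
      using K(2,3) by (intro exI[of _ "\<iota> ` K"] conjI) (auto intro: rev_image_eqI simp del: UN_iff)
  next
    case (eng x y)
    then obtain K L where K: "connectedin (zariski ?N) K" "\<one>\<^bsub>G\<^esub> \<in> K" "x \<in> K" "K \<subseteq> generate G ?D"
      and L: "connectedin (zariski ?N) L" "\<one>\<^bsub>G\<^esub> \<in> L" "y \<in> L" "L \<subseteq> generate G ?D" by blast
    have x: "x \<in> carrier G" using eng(1) G.generate_in_carrier[OF DG] by blast
    have xc: "x \<in> carrier_mat ?N ?N" by (rule Sp_carrier[OF x])
    let ?f = "\<lambda>A. x * cut_mat ?N A"
    have "connectedin (zariski ?N) (?f ` L)"
      by (rule connectedin_continuous_map_image[OF continuous_map_zariski L(1)])
        (use xc in \<open>auto intro!: poly_funs_mult_mat[of _ ?N ?N _ ?N] poly_funs_cut_mat poly_funs.const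
          simp: mult_carrier_mat[OF xc]\<close>)
    moreover have fL: "?f ` L = (\<lambda>A. x \<otimes>\<^bsub>G\<^esub> A) ` L"
      using G.generate_in_carrier[OF DG] L(4)
        by (intro image_cong) (auto simp: Sp_mult cut_mat_id Sp_carrier)
    \<comment> \<open>The translate of \<open>L\<close> passes through \<open>x\<close>, because
      \<open>L\<close> contains the identity; this is where it meets \<open>K\<close>.\<close>
    moreover have "x \<in> (\<lambda>A. x \<otimes>\<^bsub>G\<^esub> A) ` L" using L(2) x by (metis G.r_one image_eqI)
    ultimately have "connectedin (zariski ?N) (K \<union> (\<lambda>A. x \<otimes>\<^bsub>G\<^esub> A) ` L)"
      using connectedin_Un[OF K(1)] K(3) by auto
    moreover have "(\<lambda>A. x \<otimes>\<^bsub>G\<^esub> A) ` L \<subseteq> generate G ?D"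
      using eng(1) L(4) by (auto intro: generate.eng)
    ultimately show ?case using K L by (intro exI[of _ "K \<union> (\<lambda>A. x \<otimes>\<^bsub>G\<^esub> A) ` L"]) auto
  qed
  note cover = this
  let ?C = "{K. connectedin (zariski ?N) K \<and> \<one>\<^bsub>G\<^esub> \<in> K \<and> K \<subseteq> generate G ?D}"
  have "connectedin (zariski ?N) (\<Union>?C)"
    by (rule connectedin_Union) blast+
  moreover have "\<Union>?C = generate G ?D"
  proof
    show "generate G ?D \<subseteq> \<Union>?C"
    proof
      fix x assume "x \<in> generate G ?D"
      from cover[OF this] obtain K where K: "connectedin (zariski ?N) K \<and> \<one>\<^bsub>G\<^esub> \<in> K \<and> x \<in> K \<and>
        K \<subseteq> generate G ?D" by (rule exE)
      then have "K \<in> ?C" by simp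
      moreover have "x \<in> K" using K by simp
      ultimately show "x \<in> \<Union>?C" by (rule UnionI)
    qed
  qed (rule Union_least, elim CollectE conjE)
  ultimately show ?thesis by (simp add: derived_def)
qed

lemma mult_swap_derived:
  assumes H: "subgroup H G" and "a \<in> H" "b \<in> H"
  obtains c where "c \<in> derived G H" "a * b = b * a * c"
proof (rule that)
  have c: "a \<in> carrier G" "b \<in> carrier G" using assms subgroup.mem_carrier by fastforce+
  \<comment> \<open>The commutator of the inverses of \<open>a\<close> and \<open>b\<close>, with
    the double inverses that match the shape of \<open>derived_set\<close>.\<close>
  let ?c = "inv\<^bsub>G\<^esub> a \<otimes>\<^bsub>G\<^esub> inv\<^bsub>G\<^esub> b \<otimes>\<^bsub>G\<^esub> inv\<^bsub>G\<^esub> (inv\<^bsub>G\<^esub> a) \<otimes>\<^bsub>G\<^esub> inv\<^bsub>G\<^esub> (inv\<^bsub>G\<^esub> b)"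
  show "?c \<in> derived G H"
    unfolding derived_def using assms subgroup.m_inv_closed[OF H]
    by (intro generate.incl) blast
  have "b \<otimes>\<^bsub>G\<^esub> a \<otimes>\<^bsub>G\<^esub> ?c = a \<otimes>\<^bsub>G\<^esub> b"
    using c G.r_inv[of a] G.r_inv[of b]
    by (simp add: G.m_assoc) (simp add: G.m_assoc[symmetric])
  then show "a * b = b * a * ?c" by (simp add: Sp_mult)
qed

text \<open>Induction on the derived length. The derived group has a common eigenvector; the weight
  space \<open>W\<close> of its character is stable under \<open>H\<close>, and on a minimal stable
  subspace \<open>U\<close> of \<open>W\<close> every element of \<open>H\<close> turns out to be
  scalar. Both claims rest on connectedness: an eigenvalue that could a priori vary over
  \<open>H\<close> is constant. A polynomial \<rho> in place of the natural representation makes the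
  result available for subquotients.\<close>

theorem lie_kolchin:
  fixes \<rho> :: "'k mat \<Rightarrow> 'k mat"
  assumes H: "subgroup H G" and con: "connectedin (zariski (2 * n)) H"
    and sol: "(derived G ^^ d) H = {\<one>\<^bsub>G\<^esub>}" and m: "m > 0"
    and \<rho>: "\<And>A. \<rho> A \<in> carrier_mat m m"
      "\<And>i j. i < m \<Longrightarrow> j < m \<Longrightarrow> (\<lambda>A. \<rho> A $$ (i, j)) \<in> poly_funs (2 * n)"
    and hom: "\<And>g h. g \<in> H \<Longrightarrow> h \<in> H \<Longrightarrow> \<rho> (g * h) = \<rho> g * \<rho> h" "\<rho> (1\<^sub>m (2 * n)) = 1\<^sub>m m"
  shows "\<exists>v\<in>carrier_vec m. v \<noteq> 0\<^sub>v m \<and> (\<forall>h\<in>H. \<exists>c. \<rho> h *\<^sub>v v = c \<cdot>\<^sub>v v)"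
  using H con sol hom(1)
proof (induction d arbitrary: H)
  case 0
  then have "H = {1\<^sub>m (2 * n)}" by (simp add: Sp_one)
  moreover have "1\<^sub>m m *\<^sub>v unit_vec m 0 = 1 \<cdot>\<^sub>v (unit_vec m 0 :: 'k vec)" by simp
  moreover have "unit_vec m 0 \<noteq> (0\<^sub>v m :: 'k vec)" using m by simp
  ultimately show ?case using hom(2) by (metis singletonD unit_vec_carrier)
next
  case (Suc d)
  let ?K = "derived G H"
  have HG: "H \<subseteq> carrier G" using Suc.prems(1) by (rule subgroup.subset)
  have KH: "?K \<subseteq> H" by (rule G.derived_incl[OF order_refl Suc.prems(1)])
  have K: "subgroup ?K G" by (rule G.derived_is_subgroup[OF HG])
  have one: "1\<^sub>m (2 * n) \<in> H" using subgroup.one_closed[OF Suc.prems(1)] by (simp add: Sp_one)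
  have mulH: "g * h \<in> H" if "g \<in> H" "h \<in> H" for g h
    using subgroup.m_closed[OF Suc.prems(1) that] by (simp add: Sp_mult)
  have mulK: "g * h \<in> ?K" if "g \<in> ?K" "h \<in> ?K" for g h
    using subgroup.m_closed[OF K that] by (simp add: Sp_mult)
  have app: "\<rho> (g * h) *\<^sub>v v = \<rho> g *\<^sub>v (\<rho> h *\<^sub>v v)" if "g \<in> H" "h \<in> H" "v \<in> carrier_vec m" for g h v
    using Suc.prems(4)[OF that(1,2)] that(3) \<rho>(1) by (simp add: assoc_mult_mat_vec[of _ m m _ m])
  have inj: "\<rho> h *\<^sub>v v \<noteq> 0\<^sub>v m" if h: "h \<in> H" and v: "v \<in> carrier_vec m" "v \<noteq> 0\<^sub>v m" for h v
  proof
    assume 0: "\<rho> h *\<^sub>v v = 0\<^sub>v m"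
    have hi: "inv\<^bsub>G\<^esub> h \<in> H" "inv\<^bsub>G\<^esub> h * h = 1\<^sub>m (2 * n)"
      using subgroup.m_inv_closed[OF Suc.prems(1) h] G.l_inv[of h] h HG
        by (auto simp: Sp_mult Sp_one)
    have "v = \<rho> (inv\<^bsub>G\<^esub> h * h) *\<^sub>v v" using v hi(2) hom(2) by simp
    also have "\<dots> = \<rho> (inv\<^bsub>G\<^esub> h) *\<^sub>v 0\<^sub>v m" using app[OF hi(1) h v(1)] 0 by simp
    also have "\<dots> = 0\<^sub>v m" using \<rho>(1)[of "inv\<^bsub>G\<^esub> h"] by (intro eq_vecI) auto
    finally show False using v by simp
  qed
  have smul: "\<rho> h *\<^sub>v (c \<cdot>\<^sub>v v) = c \<cdot>\<^sub>v (\<rho> h *\<^sub>v v)" if "v \<in> carrier_vec m" for h c v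
    using mult_mat_vec[OF \<rho>(1) that] .
  have car: "\<rho> h *\<^sub>v v \<in> carrier_vec m" if "v \<in> carrier_vec m" for h v
    using \<rho>(1) that by (rule mult_mat_vec_carrier)
  have "\<exists>v\<in>carrier_vec m. v \<noteq> 0\<^sub>v m \<and> (\<forall>h\<in>?K. \<exists>c. \<rho> h *\<^sub>v v = c \<cdot>\<^sub>v v)"
    using Suc.prems KH by (intro Suc.IH[OF K connectedin_derived]) (auto simp: funpow_swap1)
  then obtain v0 \<chi> where v0: "v0 \<in> carrier_vec m" "v0 \<noteq> 0\<^sub>v m" "\<And>k. k \<in> ?K \<Longrightarrow> \<rho> k *\<^sub>v v0 = \<chi> k \<cdot>\<^sub>v v0"
    by metis
  define W where "W = {w \<in> carrier_vec m. \<forall>k\<in>?K. \<rho> k *\<^sub>v w = \<chi> k \<cdot>\<^sub>v w}"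
  have WD: "w \<in> carrier_vec m" "k \<in> ?K \<Longrightarrow> \<rho> k *\<^sub>v w = \<chi> k \<cdot>\<^sub>v w" if "w \<in> W" for w k
    using that by (auto simp: W_def)
  have zero: "\<rho> h *\<^sub>v 0\<^sub>v m = 0\<^sub>v m" for h using \<rho>(1)[of h] by (intro eq_vecI) auto
  have add: "\<rho> h *\<^sub>v (v + w) = \<rho> h *\<^sub>v v + \<rho> h *\<^sub>v w" if "v \<in> carrier_vec m" "w \<in> carrier_vec m"
    for h v w
    using mult_add_distrib_mat_vec[OF \<rho>(1) that] .
  have W: "subsp m W"
    unfolding W_def
    by (intro subspI)
      (auto simp: zero add smul smult_add_distrib_vec[of _ m] smult_smult_assoc mult.commute)
  have WH: "\<rho> h *\<^sub>v w \<in> W" if h: "h \<in> H" and w: "w \<in> W" for h w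
  proof (cases "w = 0\<^sub>v m")
    case True
    then show ?thesis using zero subspD(2)[OF W] by simp
  next
    case False
    note wc = WD(1)[OF w]
    have "\<rho> k *\<^sub>v (\<rho> h *\<^sub>v w) = \<chi> k \<cdot>\<^sub>v (\<rho> h *\<^sub>v w)" if k: "k \<in> ?K" for k
    proof (rule connected_eigenvalue[OF Suc.prems(2) \<rho> \<rho>(1) wc _ one _ h])
      show "\<rho> k *\<^sub>v (\<rho> (1\<^sub>m (2 * n)) *\<^sub>v w) = \<chi> k \<cdot>\<^sub>v (\<rho> (1\<^sub>m (2 * n)) *\<^sub>v w)"
        using WD(2)[OF w k] wc hom(2) by simp
      fix g assume g: "g \<in> H"
      \<comment> \<open>Moving \<open>k\<close> past \<open>g\<close> produces an element of the
        derived group, which acts on \<open>w\<close> by a scalar. So the image of \<open>w\<close>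
        under \<open>g\<close> is still an eigenvector of \<open>k\<close>, with eigenvalue
        \<open>\<chi> (k * c)\<close>; \<open>connected_eigenvalue\<close> identifies this with
        \<open>\<chi> k\<close>.\<close>
      obtain c where c: "c \<in> ?K" "k * g = g * k * c"
        using mult_swap_derived[OF Suc.prems(1)] k KH g by blast
      have "k * g = g * (k * c)"
        using c(2) g k c(1) KH HG Sp_carrier assoc_mult_mat by (metis subsetD)
      then have "\<rho> k *\<^sub>v (\<rho> g *\<^sub>v w) = \<rho> g *\<^sub>v (\<rho> (k * c) *\<^sub>v w)"
        using app[OF subsetD[OF KH k] g wc] app[OF g subsetD[OF KH mulK[OF k c(1)]] wc] by simp
      also have "\<dots> = \<chi> (k * c) \<cdot>\<^sub>v (\<rho> g *\<^sub>v w)"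
        using WD(2)[OF w mulK[OF k c(1)]] smul[OF wc] by simp
      finally show "\<rho> g *\<^sub>v w \<noteq> 0\<^sub>v m \<and> (\<exists>c. \<rho> k *\<^sub>v (\<rho> g *\<^sub>v w) = c \<cdot>\<^sub>v (\<rho> g *\<^sub>v w))"
        using inj[OF g wc False] by blast
    qed auto
    then show ?thesis using car[OF wc] by (simp add: W_def)
  qed
  have "v0 \<in> W" using v0 by (simp add: W_def)
  then have "W \<noteq> {0\<^sub>v m}" using v0(2) by blast
  then obtain U where U: "subsp m U" "U \<noteq> {0\<^sub>v m}" "\<forall>h\<in>H. \<forall>u\<in>U. \<rho> h *\<^sub>v u \<in> U" "U \<subseteq> W"
    and min: "\<And>V. subsp m V \<Longrightarrow> V \<noteq> {0\<^sub>v m} \<Longrightarrow> \<forall>h\<in>H. \<forall>u\<in>V. \<rho> h *\<^sub>v u \<in> V \<Longrightarrow> V \<subseteq> U \<Longrightarrow> V = U"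
    using minimal_invariant_subsp[OF W, of "\<lambda>U. \<forall>h\<in>H. \<forall>u\<in>U. \<rho> h *\<^sub>v u \<in> U"] WH by blast
  note Uc = subsetD[OF subspD(1)[OF U(1)]]
  have scal: "\<exists>c. \<forall>u\<in>U. \<rho> h *\<^sub>v u = c \<cdot>\<^sub>v u" if h: "h \<in> H" for h
  proof -
    obtain u a where u: "u \<in> U" "u \<noteq> 0\<^sub>v m" "\<rho> h *\<^sub>v u = a \<cdot>\<^sub>v u"
      using eigenvector_in_subsp[OF \<rho>(1) U(1) _ U(2), of h] U(3) h by blast
    note uc = Uc[OF u(1)]
    \<comment> \<open>Asking for the whole \<open>H\<close>-orbit of \<open>w\<close> makes
      \<open>E\<close> stable under \<open>H\<close> by construction, so minimality of
      \<open>U\<close> applies once \<open>E\<close> contains \<open>u\<close>.\<close>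
    define E where "E = {w \<in> U. \<forall>g\<in>H. \<rho> h *\<^sub>v (\<rho> g *\<^sub>v w) = a \<cdot>\<^sub>v (\<rho> g *\<^sub>v w)}"
    have "\<rho> h *\<^sub>v (\<rho> g *\<^sub>v u) = a \<cdot>\<^sub>v (\<rho> g *\<^sub>v u)" if g: "g \<in> H" for g
    proof (rule connected_eigenvalue[OF Suc.prems(2) \<rho> \<rho>(1) uc _ one _ g])
      show "\<rho> h *\<^sub>v (\<rho> (1\<^sub>m (2 * n)) *\<^sub>v u) = a \<cdot>\<^sub>v (\<rho> (1\<^sub>m (2 * n)) *\<^sub>v u)"
        using u(3) uc hom(2) by simp
      fix g assume g: "g \<in> H"
      \<comment> \<open>The same exchange as before: \<open>c\<close> acts on \<open>u\<close> by a
        scalar because \<open>U\<close> lies in \<open>W\<close>.\<close>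
      obtain c where c: "c \<in> ?K" "h * g = g * h * c"
        using mult_swap_derived[OF Suc.prems(1) h g] by blast
      have cH: "c \<in> H" using c KH by blast
      have "\<rho> h *\<^sub>v (\<rho> g *\<^sub>v u) = \<rho> g *\<^sub>v (\<rho> h *\<^sub>v (\<rho> c *\<^sub>v u))"
        using app[OF h g uc] app[OF mulH[OF g h] cH uc] app[OF g h car[OF uc]] c(2) by simp
      also have "\<dots> = (\<chi> c * a) \<cdot>\<^sub>v (\<rho> g *\<^sub>v u)"
        using WD(2)[of u, OF _ c(1)] U(4) u uc smul smult_smult_assoc by (simp add: subset_iff)
      finally show "\<rho> g *\<^sub>v u \<noteq> 0\<^sub>v m \<and> (\<exists>c. \<rho> h *\<^sub>v (\<rho> g *\<^sub>v u) = c \<cdot>\<^sub>v (\<rho> g *\<^sub>v u))"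
        using inj[OF g uc u(2)] by blast
    qed auto
    then have uE: "u \<in> E" using u by (simp add: E_def)
    have "E = U"
    proof (rule min)
      have "\<rho> h *\<^sub>v (\<rho> g *\<^sub>v (v + w)) = a \<cdot>\<^sub>v (\<rho> g *\<^sub>v (v + w))"
        if "v \<in> E" "w \<in> E" "g \<in> H" for v w g
        using that by (auto simp: E_def add Uc car smult_add_distrib_vec[OF car car])
      moreover have "\<rho> h *\<^sub>v (\<rho> g *\<^sub>v (c \<cdot>\<^sub>v v)) = a \<cdot>\<^sub>v (\<rho> g *\<^sub>v (c \<cdot>\<^sub>v v))"
        if "v \<in> E" "g \<in> H" for c v g
        using that by (auto simp: E_def smul Uc car smult_smult_assoc mult.commute)
      ultimately show "subsp m E"
        using subspD[OF U(1)] by (intro subspI) (auto simp: E_def zero)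
      show "E \<noteq> {0\<^sub>v m}" using uE u(2) by blast
      show "E \<subseteq> U" by (auto simp: E_def)
      show "\<forall>g\<in>H. \<forall>u\<in>E. \<rho> g *\<^sub>v u \<in> E"
      proof (intro ballI)
        fix g w assume g: "g \<in> H" and w: "w \<in> E"
        have "\<rho> h *\<^sub>v (\<rho> k *\<^sub>v (\<rho> g *\<^sub>v w)) = a \<cdot>\<^sub>v (\<rho> k *\<^sub>v (\<rho> g *\<^sub>v w))" if k: "k \<in> H" for k
          using w mulH[OF k g] app[OF k g, of w] Uc by (auto simp: E_def)
        then show "\<rho> g *\<^sub>v w \<in> E" using w g U(3) by (auto simp: E_def)
      qed
    qed
    have "\<rho> h *\<^sub>v w = a \<cdot>\<^sub>v w" if "w \<in> U" for w
    proof -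
      have "\<rho> h *\<^sub>v (\<rho> (1\<^sub>m (2 * n)) *\<^sub>v w) = a \<cdot>\<^sub>v (\<rho> (1\<^sub>m (2 * n)) *\<^sub>v w)"
        using that[folded \<open>E = U\<close>] one unfolding E_def by blast
      then show ?thesis using Uc[OF that] hom(2) by simp
    qed
    then show ?thesis by blast
  qed
  obtain u where "u \<in> U" "u \<noteq> 0\<^sub>v m" using U(1,2) subspD(2) by blast
  then show ?case using scal Uc by blast
qed

end

section \<open>Symplectic linear algebra\<close>

context symplectic_char2
begin

abbreviation V :: "'k vec set" where "V \<equiv> carrier_vec (2 * n)"

definition bil :: "'k vec \<Rightarrow> 'k vec \<Rightarrow> 'k" where
  "bil v w = v \<bullet> (J *\<^sub>v w)"

lemma J_mult_vec:
  assumes "v \<in> V"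
  shows "J *\<^sub>v v = vec (2 * n) (\<lambda>i. if i < n then v $ (i + n) else v $ (i - n))"
proof (rule eq_vecI)
  fix i assume "i < dim_vec (vec (2 * n) (\<lambda>i. if i < n then v $ (i + n) else v $ (i - n)))"
  then have i: "i < 2 * n" by simp
  have "row J i = unit_vec (2 * n) (if i < n then i + n else i - n)"
    using i by (intro eq_vecI) (auto simp: J_eq unit_vec_def)
  then have "(J *\<^sub>v v) $ i = unit_vec (2 * n) (if i < n then i + n else i - n) \<bullet> v"
    using i carrier_matD[OF J_carrier] by simp
  also have "\<dots> = v $ (if i < n then i + n else i - n)"
    using assms i by (intro scalar_prod_left_unit) auto
  finally show "(J *\<^sub>v v) $ i = vec (2 * n) (\<lambda>i. if i < n then v $ (i + n) else v $ (i - n)) $ i"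
    using i by simp
qed (use carrier_matD[OF J_carrier] in simp)

lemma J_vec_carrier [simp]: "J *\<^sub>v v \<in> V" 
  using carrier_matD[OF J_carrier] by (intro carrier_vecI) simp

lemma bil_add_left: "u \<in> V \<Longrightarrow> v \<in> V \<Longrightarrow> bil (u + v) w = bil u w + bil v w"
  unfolding bil_def by (rule add_scalar_prod_distrib[of _ "2 * n"]) auto

lemma bil_smult_left: "v \<in> V \<Longrightarrow> bil (c \<cdot>\<^sub>v v) w = c * bil v w"
  unfolding bil_def by (rule smult_scalar_prod_distrib[of _ "2 * n"]) auto

lemma bil_sym:
  assumes "v \<in> V" "w \<in> V" shows "bil v w = bil w v"
proof -
  have "bil v w = (J *\<^sub>v v) \<bullet> w"
    using transpose_vec_mult_scalar[OF J_carrier assms(2,1)] by (simp add: bil_def J_transpose)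
  also have "\<dots> = bil w v" unfolding bil_def
    using assms by (intro comm_scalar_prod[of _ "2 * n"]) auto
  finally show ?thesis .
qed

lemma bil_add_right: "u \<in> V \<Longrightarrow> v \<in> V \<Longrightarrow> w \<in> V \<Longrightarrow> bil w (u + v) = bil w u + bil w v"
  by (metis bil_sym bil_add_left add_carrier_vec)

lemma bil_smult_right: "v \<in> V \<Longrightarrow> w \<in> V \<Longrightarrow> bil w (c \<cdot>\<^sub>v v) = c * bil w v"
  by (metis bil_sym bil_smult_left smult_carrier_vec)

lemma bil_zero [simp]: "v \<in> V \<Longrightarrow> bil (0\<^sub>v (2 * n)) v = 0" "v \<in> V \<Longrightarrow> bil v (0\<^sub>v (2 * n)) = 0"
  by (auto simp: bil_def J_mult_vec scalar_prod_def intro!: sum.neutral)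

lemmas bil_simps = bil_add_left bil_smult_left bil_add_right bil_smult_right

text \<open>In characteristic 2 this does not follow from symmetry; the coordinates \<open>i\<close>
  and \<open>i + n\<close> contribute equal terms, which cancel.\<close>

lemma bil_self: 
  assumes "v \<in> V" shows "bil v v = 0"
proof -
  have "bil v v = (\<Sum>i\<in>{0..<2 * n}. v $ i * (if i < n then v $ (i + n) else v $ (i - n)))"
    using assms by (simp add: bil_def J_mult_vec scalar_prod_def)
  also have "\<dots> = (\<Sum>i\<in>{0..<n} \<union> {n..<2 * n}. v $ i * (if i < n then v $ (i + n) else v $ (i - n)))"
    by (intro sum.cong) auto
  also have "\<dots> = (\<Sum>i\<in>{0..<n}. v $ i * v $ (i + n)) + (\<Sum>i\<in>{n..<2 * n}. v $ i * v $ (i - n))"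
    by (subst sum.union_disjoint) (auto intro!: arg_cong2[where f = "(+)"] sum.cong)
  also have "(\<Sum>i\<in>{n..<2 * n}. v $ i * v $ (i - n)) = (\<Sum>i\<in>{0..<n}. v $ i * v $ (i + n))"
    by (rule sum.reindex_bij_witness[of _ "\<lambda>i. i + n" "\<lambda>i. i - n"]) auto
  finally show ?thesis by (simp add: add_self)
qed

lemma bil_nondegenerate:
  assumes "v \<in> V" "\<And>z. z \<in> V \<Longrightarrow> bil v z = 0" shows "v = 0\<^sub>v (2 * n)"
proof (rule eq_vecI)
  fix i assume "i < dim_vec (0\<^sub>v (2 * n))"
  then have i: "i < 2 * n" by simp
  have "bil v (J *\<^sub>v unit_vec (2 * n) i) = v \<bullet> ((J * J) *\<^sub>v unit_vec (2 * n) i)"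
    unfolding bil_def by (subst assoc_mult_mat_vec[OF J_carrier J_carrier]) auto
  then show "v $ i = 0\<^sub>v (2 * n) $ i" using assms(2)[of "J *\<^sub>v unit_vec (2 * n) i"] i assms(1)
    by (simp add: J_J)
qed (use assms in auto)

lemma bil_eqI:
  assumes "v \<in> V" "w \<in> V" "\<And>z. z \<in> V \<Longrightarrow> bil v z = bil w z" shows "v = w"
proof -
  have "v + w = 0\<^sub>v (2 * n)"
    using assms by (intro bil_nondegenerate) (auto simp: bil_simps add_self)
  then have "(v + w) $ i = 0" if "i < 2 * n" for i using that by simp
  then show ?thesis using assms by (intro eq_vecI) (auto simp: add_eq_0_iff2)
qed

lemma Sp_vec [simp]: "x \<in> carrier G \<Longrightarrow> v \<in> V \<Longrightarrow> x *\<^sub>v v \<in> V"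
  using Sp_carrier by (metis mult_mat_vec_carrier)

lemma bil_Sp:
  assumes x: "x \<in> carrier G" and v: "v \<in> V" "w \<in> V"
  shows "bil (x *\<^sub>v v) (x *\<^sub>v w) = bil v w"
proof -
  note X = Sp_carrier[OF x]
  have "bil v w = v \<bullet> ((x\<^sup>T * J * x) *\<^sub>v w)" using x by (simp add: bil_def Sp_iff)
  also have "(x\<^sup>T * J * x) *\<^sub>v w = x\<^sup>T *\<^sub>v (J *\<^sub>v (x *\<^sub>v w))"
    using X v(2) by (subst assoc_mult_mat_vec[of _ "2 * n" "2 * n" _ "2 * n"],
      auto intro!: mult_square_carrier assoc_mult_mat_vec[of _ "2 * n" "2 * n" _ "2 * n"])
  also have "v \<bullet> (x\<^sup>T *\<^sub>v (J *\<^sub>v (x *\<^sub>v w))) = bil (x *\<^sub>v v) (x *\<^sub>v w)"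
    using transpose_vec_mult_scalar[of "x\<^sup>T" "2 * n" "2 * n" "J *\<^sub>v (x *\<^sub>v w)" v] X v
    by (simp add: bil_def)
  finally show ?thesis by simp
qed

lemma Sp_app:
  "x \<in> carrier G \<Longrightarrow> y \<in> carrier G \<Longrightarrow> v \<in> V \<Longrightarrow> (x * y) *\<^sub>v v = x *\<^sub>v (y *\<^sub>v v)"
  using Sp_carrier by (intro assoc_mult_mat_vec[of _ "2 * n" "2 * n" _ "2 * n"])

lemma Sp_inv_app [simp]:
  assumes "x \<in> carrier G" "v \<in> V"
  shows "inv\<^bsub>G\<^esub> x *\<^sub>v (x *\<^sub>v v) = v" "x *\<^sub>v (inv\<^bsub>G\<^esub> x *\<^sub>v v) = v"
  using Sp_app[of x "inv\<^bsub>G\<^esub> x" v] Sp_app[of "inv\<^bsub>G\<^esub> x" x v] G.l_inv[of x] G.r_inv[of x] assms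
  by (auto simp: Sp_mult Sp_one)

lemma bil_Sp_adjoint:
  assumes "x \<in> carrier G" "v \<in> V" "w \<in> V"
  shows "bil (x *\<^sub>v v) w = bil v (inv\<^bsub>G\<^esub> x *\<^sub>v w)"
  using bil_Sp[OF assms(1,2), of "inv\<^bsub>G\<^esub> x *\<^sub>v w"] assms by simp

lemma Sp_app_add: "x \<in> carrier G \<Longrightarrow> v \<in> V \<Longrightarrow> w \<in> V \<Longrightarrow> x *\<^sub>v (v + w) = x *\<^sub>v v + x *\<^sub>v w"
  by (rule mult_add_distrib_mat_vec[OF Sp_carrier])

lemma Sp_app_smult: "x \<in> carrier G \<Longrightarrow> v \<in> V \<Longrightarrow> x *\<^sub>v (c \<cdot>\<^sub>v v) = c \<cdot>\<^sub>v (x *\<^sub>v v)"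
  by (rule mult_mat_vec[OF Sp_carrier])

lemma SpI_bil:
  assumes A: "A \<in> carrier_mat (2 * n) (2 * n)"
    and "\<And>v w. v \<in> V \<Longrightarrow> w \<in> V \<Longrightarrow> bil (A *\<^sub>v v) (A *\<^sub>v w) = bil v w"
  shows "A \<in> carrier G"
  unfolding Sp_iff
proof (intro conjI eq_matI)
  fix i j assume "i < dim_row J" "j < dim_col J"
  then have i: "i < 2 * n" and j: "j < 2 * n" using carrier_matD[OF J_carrier] by auto
  let ?e = "unit_vec (2 * n) :: nat \<Rightarrow> 'k vec"
  have entry: "M $$ (i, j) = ?e i \<bullet> (M *\<^sub>v ?e j)" if "M \<in> carrier_mat (2 * n) (2 * n)" for M
    using that i j by simp
  have "(A\<^sup>T * J * A) $$ (i, j) = ?e i \<bullet> ((A\<^sup>T * J * A) *\<^sub>v ?e j)"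
    using A by (intro entry mult_square_carrier) auto
  also have "(A\<^sup>T * J * A) *\<^sub>v ?e j = A\<^sup>T *\<^sub>v (J *\<^sub>v (A *\<^sub>v ?e j))"
    using A by (subst assoc_mult_mat_vec[of _ "2 * n" "2 * n" _ "2 * n"],
      auto intro!: mult_square_carrier assoc_mult_mat_vec[of _ "2 * n" "2 * n" _ "2 * n"])
  also have "?e i \<bullet> (A\<^sup>T *\<^sub>v (J *\<^sub>v (A *\<^sub>v ?e j))) = bil (A *\<^sub>v ?e i) (A *\<^sub>v ?e j)"
    using transpose_vec_mult_scalar[of "A\<^sup>T" "2 * n" "2 * n" "J *\<^sub>v (A *\<^sub>v ?e j)" "?e i"] A
    by (simp add: bil_def)
  also have "\<dots> = ?e i \<bullet> (J *\<^sub>v ?e j)" using assms(2)[of "?e i" "?e j"] by (simp add: bil_def)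
  also have "\<dots> = J $$ (i, j)" by (rule entry[symmetric]) simp
  finally show "(A\<^sup>T * J * A) $$ (i, j) = J $$ (i, j)" .
qed (use A carrier_matD[OF J_carrier] in auto)

text \<open>Any \<open>y\<close> becomes orthogonal to \<open>p\<close> after adding a multiple of a
  fixed \<open>z\<close> with \<open>bil p z\<close> nonzero, and this determines
  \<open>bil w y\<close>. So a line is its own double orthogonal, without any dimension
  count.\<close>

lemma in_span1:
  assumes p: "p \<in> V" and w: "w \<in> V" and *: "\<And>z. z \<in> V \<Longrightarrow> bil p z = 0 \<Longrightarrow> bil w z = 0"
  obtains c where "w = c \<cdot>\<^sub>v p"
proof (cases "p = 0\<^sub>v (2 * n)")
  case True
  then have "w = 0\<^sub>v (2 * n)" using * w by (intro bil_nondegenerate) auto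
  moreover have "0\<^sub>v (2 * n) = 0 \<cdot>\<^sub>v (0\<^sub>v (2 * n) :: 'k vec)" by auto
  ultimately show thesis using that[of 0] True by simp
next
  case False
  then obtain z where z: "z \<in> V" "bil p z \<noteq> 0" using bil_nondegenerate[OF p] by blast
  have "w = (bil w z / bil p z) \<cdot>\<^sub>v p"
  proof (rule bil_eqI)
    fix y assume y: "y \<in> V"
    have "bil p (y + (bil p y / bil p z) \<cdot>\<^sub>v z) = 0"
      using p y z by (simp add: bil_simps add_self)
    then have "bil w (y + (bil p y / bil p z) \<cdot>\<^sub>v z) = 0" using y z by (intro *) auto
    then have "bil w y = (bil p y / bil p z) * bil w z"
      using w y z by (simp add: bil_simps add_eq_0_iff2)
    then show "bil w y = bil ((bil w z / bil p z) \<cdot>\<^sub>v p) y" using p y by (simp add: bil_simps)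
  qed (use p w in auto)
  then show thesis by (rule that)
qed

text \<open>If some \<open>z\<close> is orthogonal to \<open>p\<close> but not to \<open>q\<close>,
  adding a multiple of \<open>q\<close> makes \<open>w\<close> orthogonal to \<open>z\<close>, and
  the sum then satisfies the hypothesis of \<open>in_span1\<close>. If there is no such
  \<open>z\<close>, orthogonality to \<open>p\<close> implies orthogonality to
  \<open>q\<close>.\<close>

lemma in_span2:
  assumes p: "p \<in> V" and q: "q \<in> V" and w: "w \<in> V"
    and *: "\<And>z. z \<in> V \<Longrightarrow> bil p z = 0 \<Longrightarrow> bil q z = 0 \<Longrightarrow> bil w z = 0"
  obtains c d where "w = c \<cdot>\<^sub>v p + d \<cdot>\<^sub>v q"
proof (cases "\<exists>z\<in>V. bil p z = 0 \<and> bil q z \<noteq> 0")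
  case True
  then obtain z where z: "z \<in> V" "bil p z = 0" "bil q z \<noteq> 0" by blast
  let ?d = "bil w z / bil q z"
  have "bil (w + ?d \<cdot>\<^sub>v q) y = 0" if y: "y \<in> V" "bil p y = 0" for y
  proof -
    let ?y = "y + (bil q y / bil q z) \<cdot>\<^sub>v z"
    have "bil w ?y = 0"
      using p q y z by (intro *) (auto simp: bil_simps add_self)
    then show ?thesis using w y z q by (simp add: bil_simps mult.commute)
  qed
  then obtain c where c: "w + ?d \<cdot>\<^sub>v q = c \<cdot>\<^sub>v p"
    using in_span1[OF p, of "w + ?d \<cdot>\<^sub>v q"] w q by auto
  have "w = w + (?d + ?d) \<cdot>\<^sub>v q" using w q by (intro eq_vecI) (auto simp: add_self)
  also have "\<dots> = (w + ?d \<cdot>\<^sub>v q) + ?d \<cdot>\<^sub>v q" using w q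
    by (intro eq_vecI) (auto simp: algebra_simps)
  finally show thesis using that c by metis
next
  case False
  then obtain c where "w = c \<cdot>\<^sub>v p" using in_span1[OF p w] * by metis
  then have "w = c \<cdot>\<^sub>v p + 0 \<cdot>\<^sub>v q" using p q by (intro eq_vecI) auto
  then show thesis by (rule that)
qed

section \<open>Transvections and transitivity\<close>

lemma transvection:
  assumes u: "u \<in> V"
  obtains t where "t \<in> carrier G" "\<And>v. v \<in> V \<Longrightarrow> t *\<^sub>v v = v + (c * bil u v) \<cdot>\<^sub>v u"
proof -
  define t where "t = 1\<^sub>m (2 * n) + mat (2 * n) (2 * n) (\<lambda>(i, j). c * u $ i * (J *\<^sub>v u) $ j)"
  have t: "t \<in> carrier_mat (2 * n) (2 * n)" by (simp add: t_def)
  have app: "t *\<^sub>v v = v + (c * bil u v) \<cdot>\<^sub>v u" if v: "v \<in> V" for v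
  proof (rule eq_vecI)
    fix i assume "i < dim_vec (v + (c * bil u v) \<cdot>\<^sub>v u)"
    then have i: "i < 2 * n" using u by simp
    have "row t i = unit_vec (2 * n) i + (c * u $ i) \<cdot>\<^sub>v (J *\<^sub>v u)"
      using i carrier_matD[OF J_carrier]
      by (intro eq_vecI) (auto simp: t_def unit_vec_def simp del: index_mult_mat_vec)
    then have "(t *\<^sub>v v) $ i = (unit_vec (2 * n) i + (c * u $ i) \<cdot>\<^sub>v (J *\<^sub>v u)) \<bullet> v"
      using i t by simp
    also have "\<dots> = unit_vec (2 * n) i \<bullet> v + ((c * u $ i) \<cdot>\<^sub>v (J *\<^sub>v u)) \<bullet> v"
      using v by (intro add_scalar_prod_distrib[of _ "2 * n"]) auto
    also have "\<dots> = v $ i + c * u $ i * ((J *\<^sub>v u) \<bullet> v)"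
      using v i by (simp add: scalar_prod_left_unit smult_scalar_prod_distrib[of _ "2 * n"])
    also have "(J *\<^sub>v u) \<bullet> v = bil u v"
      using comm_scalar_prod[of "J *\<^sub>v u" "2 * n" v] u v bil_sym[OF u v] by (simp add: bil_def)
    finally show "(t *\<^sub>v v) $ i = (v + (c * bil u v) \<cdot>\<^sub>v u) $ i" using i u v by simp
  qed (use t u in auto)
  have "t \<in> carrier G"
  proof (rule SpI_bil[OF t])
    fix v w assume v: "v \<in> V" and w: "w \<in> V"
    \<comment> \<open>The two cross terms are equal and cancel in characteristic 2; the term
      quadratic in \<open>c\<close> contains \<open>bil u u = 0\<close>.\<close>
    have "bil (t *\<^sub>v v) (t *\<^sub>v w) = bil v w + (c * (bil u w * bil u v) + c * (bil u w * bil u v))"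
      unfolding app[OF v] app[OF w] using u v w
      by (simp add: bil_simps bil_self bil_sym[of v u] algebra_simps)
    then show "bil (t *\<^sub>v v) (t *\<^sub>v w) = bil v w" by (simp add: add_self)
  qed
  then show thesis using that app by blast
qed

text \<open>If \<open>bil w w'\<close> is nonzero, a transvection along \<open>w + w'\<close> takes
  \<open>w\<close> to \<open>w'\<close> and fixes \<open>p\<close>, which is orthogonal to
  \<open>w + w'\<close>. The general case goes through an intermediate \<open>z\<close>.\<close>

lemma Sp_transitive_perp:
  assumes p: "p \<in> V" and w: "w \<in> V" "bil p w = 0" "\<And>c. w \<noteq> c \<cdot>\<^sub>v p"
    and w': "w' \<in> V" "bil p w' = 0" "\<And>c. w' \<noteq> c \<cdot>\<^sub>v p"
  obtains g where "g \<in> carrier G" "g *\<^sub>v p = p" "g *\<^sub>v w = w'"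
proof -
  have one: "\<exists>g\<in>carrier G. g *\<^sub>v p = p \<and> g *\<^sub>v w = w'"
    if w: "w \<in> V" "bil p w = 0" and w': "w' \<in> V" "bil p w' = 0" and nz: "bil w w' \<noteq> 0" for w w'
  proof -
    have u: "w + w' \<in> V" using w w' by simp
    \<comment> \<open>The constant makes \<open>t\<close> add exactly \<open>w + w'\<close> to
      \<open>w\<close>, because \<open>bil (w + w') w = bil w w'\<close>.\<close>
    obtain t where t: "t \<in> carrier G"
      "\<And>v. v \<in> V \<Longrightarrow> t *\<^sub>v v = v + (1 / bil w w' * bil (w + w') v) \<cdot>\<^sub>v (w + w')"
      using transvection[OF u] by blast
    have "t *\<^sub>v p = p" using p w w' by (simp add: t(2) bil_simps bil_sym[of _ p] ) auto
    moreover have "t *\<^sub>v w = w + 1 \<cdot>\<^sub>v (w + w')"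
      using w w' nz by (simp add: t(2) bil_simps bil_self bil_sym[of w' w])
    moreover have "w + 1 \<cdot>\<^sub>v (w + w') = w'"
      using w w' by (intro eq_vecI) (auto simp: add_left_self)
    ultimately show ?thesis using t(1) by metis
  qed
  obtain z1 where z1: "z1 \<in> V" "bil p z1 = 0" "bil w z1 \<noteq> 0"
    using in_span1[OF p w(1)] w(3) by metis
  obtain z2 where z2: "z2 \<in> V" "bil p z2 = 0" "bil w' z2 \<noteq> 0"
    using in_span1[OF p w'(1)] w'(3) by metis
  \<comment> \<open>A space is not the union of two proper subspaces: one of \<open>z1\<close>,
    \<open>z2\<close> and \<open>z1 + z2\<close> works.\<close>
  have "\<exists>z\<in>V. bil p z = 0 \<and> bil w z \<noteq> 0 \<and> bil z w' \<noteq> 0"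
  proof (cases "bil w' z1 = 0 \<and> bil w z2 = 0")
    case True
    then show ?thesis using z1 z2 p w(1) w'(1)
      by (intro bexI[of _ "z1 + z2"]) (auto simp: bil_simps bil_sym[of _ w'])
  next
    case False
    then show ?thesis using z1 z2 bil_sym[OF _ w'(1)] by metis
  qed
  then obtain z where z: "z \<in> V" "bil p z = 0" "bil w z \<noteq> 0" "bil z w' \<noteq> 0" by blast
  obtain g h where g: "g \<in> carrier G" "g *\<^sub>v p = p" "g *\<^sub>v w = z"
    and h: "h \<in> carrier G" "h *\<^sub>v p = p" "h *\<^sub>v z = w'"
    using one[OF w(1,2) z(1,2,3)] one[OF z(1,2) w'(1,2) z(4)] by blast
  show thesis
    by (rule that[of "h * g"])
      (use g h p w G.m_closed[OF h(1) g(1)] in \<open>auto simp: Sp_app Sp_mult\<close>)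
qed

text \<open>\<open>Sp_transitive_perp\<close> with the zero vector as fixed vector: not being a
  multiple of 0 means being nonzero.\<close>

lemma Sp_transitive_nonzero:
  assumes "v \<in> V" "v \<noteq> 0\<^sub>v (2 * n)" "p \<in> V" "p \<noteq> 0\<^sub>v (2 * n)"
  obtains g where "g \<in> carrier G" "g *\<^sub>v v = p"
proof -
  have "c \<cdot>\<^sub>v 0\<^sub>v (2 * n) = 0\<^sub>v (2 * n)" for c :: 'k by auto
  then show thesis
    using Sp_transitive_perp[of "0\<^sub>v (2 * n)" v p] assms that by (metis bil_zero(1) zero_carrier_vec)
qed

text \<open>An ordered basis of a totally isotropic plane; \<open>bil_self\<close> provides the
  remaining two relations.\<close>

definition isotropic_pair :: "'k vec \<Rightarrow> 'k vec \<Rightarrow> bool" where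
  "isotropic_pair v w \<longleftrightarrow> v \<in> V \<and> w \<in> V \<and> v \<noteq> 0\<^sub>v (2 * n) \<and> bil v w = 0 \<and> (\<forall>c. w \<noteq> c \<cdot>\<^sub>v v)"

lemma Sp_transitive_isotropic_pair:
  assumes "isotropic_pair v w" "isotropic_pair p q"
  obtains g where "g \<in> carrier G" "g *\<^sub>v v = p" "g *\<^sub>v w = q"
proof -
  note vw = assms(1)[unfolded isotropic_pair_def] and pq = assms(2)[unfolded isotropic_pair_def]
  obtain g where g: "g \<in> carrier G" "g *\<^sub>v v = p" using Sp_transitive_nonzero vw pq by metis
  have "bil p (g *\<^sub>v w) = 0" using bil_Sp[OF g(1), of v w] g vw by simp
  moreover have "g *\<^sub>v w \<noteq> c \<cdot>\<^sub>v p" for c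
  proof
    assume "g *\<^sub>v w = c \<cdot>\<^sub>v p"
    then have "w = inv\<^bsub>G\<^esub> g *\<^sub>v (c \<cdot>\<^sub>v (g *\<^sub>v v))" using g vw by (metis Sp_inv_app(1))
    then have "w = c \<cdot>\<^sub>v v" using g(1) vw by (simp add: Sp_app_smult)
    then show False using vw by blast
  qed
  ultimately obtain h where h: "h \<in> carrier G" "h *\<^sub>v p = p" "h *\<^sub>v (g *\<^sub>v w) = q"
    using Sp_transitive_perp[of p "g *\<^sub>v w" q] g vw pq by (metis Sp_vec)
  show thesis
    by (rule that[of "h * g"])
      (use g h vw G.m_closed[OF h(1) g(1)] in \<open>auto simp: Sp_app Sp_mult\<close>)
qed

text \<open>In terms of \<open>N = x - 1\<close> the relation says that
  \<open>a N\<^sup>2 + \<mu> N + \<gamma>\<close> kills \<open>v\<close>. If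
  \<open>N\<^sup>2 v\<close> were nonzero, applying powers of the nilpotent \<open>N\<close> would
  give \<gamma> = 0, then \<mu> = 0, then \<open>a = 0\<close> and hence \<open>b = 0\<close>. And
  \<open>N\<^sup>2 = x\<^sup>2 - 1\<close> in characteristic 2.\<close>

lemma unipotent_quadratic:
  assumes x: "x \<in> carrier G" and u: "unipotent (2 * n) x" and v: "v \<in> V"
    and rel: "a \<cdot>\<^sub>v (x *\<^sub>v v) + b \<cdot>\<^sub>v (inv\<^bsub>G\<^esub> x *\<^sub>v v) = \<mu> \<cdot>\<^sub>v v" and ab: "a \<noteq> 0 \<or> b \<noteq> 0"
  shows "x *\<^sub>v (x *\<^sub>v v) = v"
proof -
  let ?N = "x - 1\<^sub>m (2 * n)"
  note X = Sp_carrier[OF x]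
  define f where "f k = ((\<lambda>v. ?N *\<^sub>v v) ^^ k) v" for k
  have fc: "f k \<in> V" for k
    by (induction k) (use v X in \<open>auto simp: f_def minus_carrier_mat intro!: mult_mat_vec_carrier\<close>)
  have N: "?N *\<^sub>v w = x *\<^sub>v w + w" if "w \<in> V" for w
    using X that by (subst minus_mult_distrib_mat_vec[OF X]) (auto simp: minus_is_plus)
  have fS: "f (Suc k) = x *\<^sub>v f k + f k" for k using N[OF fc] by (simp add: f_def)
  obtain m where m: "?N ^\<^sub>m m = 0\<^sub>m (2 * n) (2 * n)" using u by (auto simp: unipotent_def)
  have Nc: "?N \<in> carrier_mat (2 * n) (2 * n)" using X by (simp add: minus_carrier_mat)
  have "?N ^\<^sub>m k *\<^sub>v w = ((\<lambda>v. ?N *\<^sub>v v) ^^ k) w" if "w \<in> V" for k w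
    using that
  proof (induction k arbitrary: w)
    case (Suc k)
    have "?N *\<^sub>v w \<in> V" using mult_mat_vec_carrier[OF Nc Suc.prems] .
    moreover have "?N ^\<^sub>m Suc k *\<^sub>v w = ?N ^\<^sub>m k *\<^sub>v (?N *\<^sub>v w)"
      using Nc Suc.prems by (simp add: assoc_mult_mat_vec[of _ "2 * n" "2 * n" _ "2 * n"])
    ultimately show ?case using Suc.IH by (simp add: funpow_swap1)
  qed (use Nc in auto)
  then have "f m = 0\<^sub>m (2 * n) (2 * n) *\<^sub>v v" using v m unfolding f_def by metis
  then have fm: "f m = 0\<^sub>v (2 * n)" using v by (auto simp: scalar_prod_def)
  \<comment> \<open>The constant term after applying \<open>x\<close> to \<open>rel\<close> and
    substituting \<open>x = N + 1\<close>.\<close>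
  define \<gamma> where "\<gamma> = a + b + \<mu>"
  have r0: "a \<cdot>\<^sub>v f 2 + \<mu> \<cdot>\<^sub>v f 1 + \<gamma> \<cdot>\<^sub>v f 0 = 0\<^sub>v (2 * n)"
  proof -
    have "x *\<^sub>v (a \<cdot>\<^sub>v (x *\<^sub>v v) + b \<cdot>\<^sub>v (inv\<^bsub>G\<^esub> x *\<^sub>v v)) = x *\<^sub>v (\<mu> \<cdot>\<^sub>v v)" using rel by simp
    then have r: "a \<cdot>\<^sub>v (x *\<^sub>v (x *\<^sub>v v)) + b \<cdot>\<^sub>v v = \<mu> \<cdot>\<^sub>v (x *\<^sub>v v)"
      using x v by (simp add: Sp_app_add Sp_app_smult)
    have f2: "f 2 = x *\<^sub>v (x *\<^sub>v v + v) + (x *\<^sub>v v + v)"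
      using fS[of 1] fS[of 0] by (simp add: f_def numeral_2_eq_2)
    have f1: "f 1 = x *\<^sub>v v + v" using fS[of 0] by (simp add: f_def)
    define X1 where "X1 = x *\<^sub>v v"
    define X2 where "X2 = x *\<^sub>v X1"
    have c: "X1 \<in> V" "X2 \<in> V" using x v by (auto simp: X1_def X2_def)
    have F2: "f 2 = (X2 + X1) + (X1 + v)"
      unfolding f2 using x v c by (simp add: Sp_app_add X1_def X2_def)
    show ?thesis
    proof (rule eq_vecI)
      fix i assume "i < dim_vec (0\<^sub>v (2 * n))"
      then have i: "i < 2 * n" by simp
      have "(a \<cdot>\<^sub>v X2 + b \<cdot>\<^sub>v v) $ i = (\<mu> \<cdot>\<^sub>v X1) $ i" using r by (simp add: X1_def X2_def)
      then have r': "a * X2 $ i + b * v $ i = \<mu> * X1 $ i" using i c v by simp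
      have "(a \<cdot>\<^sub>v f 2 + \<mu> \<cdot>\<^sub>v f 1 + \<gamma> \<cdot>\<^sub>v f 0) $ i =
        a * (X2 $ i + X1 $ i + (X1 $ i + v $ i)) + \<mu> * (X1 $ i + v $ i) + (a + b + \<mu>) * v $ i"
        using i c v F2 f1 by (simp add: f_def \<gamma>_def X1_def[symmetric])
      also have "\<dots> = (a * X2 $ i + b * v $ i) + \<mu> * X1 $ i + a * (X1 $ i + X1 $ i) +
        (a * v $ i + a * v $ i) + (\<mu> * v $ i + \<mu> * v $ i)" by (simp add: algebra_simps)
      also have "\<dots> = 0" unfolding r' by (simp add: add_self)
      finally show "(a \<cdot>\<^sub>v f 2 + \<mu> \<cdot>\<^sub>v f 1 + \<gamma> \<cdot>\<^sub>v f 0) $ i = 0\<^sub>v (2 * n) $ i" using i by simp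
    qed (use fc in auto)
  qed
  have fadd: "f (Suc k) = ?N *\<^sub>v f k" for k by (simp add: f_def)
  have r: "a \<cdot>\<^sub>v f (k + 2) + \<mu> \<cdot>\<^sub>v f (k + 1) + \<gamma> \<cdot>\<^sub>v f k = 0\<^sub>v (2 * n)" for k
  proof (induction k)
    case 0
    show ?case using r0 by (simp add: numeral_2_eq_2)
  next
    case (Suc k)
    have "?N *\<^sub>v (a \<cdot>\<^sub>v f (k + 2) + \<mu> \<cdot>\<^sub>v f (k + 1) + \<gamma> \<cdot>\<^sub>v f k) =
      a \<cdot>\<^sub>v f (Suc k + 2) + \<mu> \<cdot>\<^sub>v f (Suc k + 1) + \<gamma> \<cdot>\<^sub>v f (Suc k)"
      using fc by (simp add: mult_add_distrib_mat_vec[OF Nc] mult_mat_vec[OF Nc] fadd[symmetric]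
        del: funpow.simps)
    moreover have "?N *\<^sub>v 0\<^sub>v (2 * n) = 0\<^sub>v (2 * n)" using Nc by (intro eq_vecI) auto
    ultimately show ?case using Suc by simp
  qed
  have f2: "f 2 = 0\<^sub>v (2 * n)"
  proof (rule ccontr)
    assume nz: "f 2 \<noteq> 0\<^sub>v (2 * n)"
    have mono: "f k = 0\<^sub>v (2 * n) \<Longrightarrow> f (k + l) = 0\<^sub>v (2 * n)" for k l
      by (induction l) (use Nc in \<open>auto simp: fadd scalar_prod_def\<close>)
    define l where "l = (LEAST k. f k = 0\<^sub>v (2 * n))"
    have l: "f l = 0\<^sub>v (2 * n)" unfolding l_def using fm by (rule LeastI)
    have lt: "f k \<noteq> 0\<^sub>v (2 * n)" if "k < l" for k using not_less_Least that unfolding l_def by blast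
    have "2 < l" using nz l mono[of l "2 - l"] by (metis le_add_diff_inverse not_le)
    \<comment> \<open>Then \<open>f (k + 2)\<close> is the last nonzero iterate, and reading the
      relation at \<open>k + 2\<close>, \<open>k + 1\<close> and \<open>k\<close> isolates one
      coefficient each time.\<close>
    then obtain k where k: "l = k + 3"
      by (metis add.commute less_iff_Suc_add add_Suc_right numeral_3_eq_3 numeral_2_eq_2)
    have z: "f (k + 3) = 0\<^sub>v (2 * n)" "f (k + 4) = 0\<^sub>v (2 * n)"
      using l mono[of l 1] k by (auto simp: add.commute)
    have "f (k + 2) \<noteq> 0\<^sub>v (2 * n)" using lt k by simp
    then obtain i where i: "i < 2 * n" "f (k + 2) $ i \<noteq> 0"
      using fc[of "k + 2"] by (metis carrier_vecD eq_vecI index_zero_vec)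
    have rr: "a * f (k + 2) $ i + \<mu> * f (k + 1) $ i + \<gamma> * f k $ i = 0" for k
    proof -
      have "(a \<cdot>\<^sub>v f (k + 2) + \<mu> \<cdot>\<^sub>v f (k + 1) + \<gamma> \<cdot>\<^sub>v f k) $ i = 0" using r[of k] i(1) by simp
      then show ?thesis using fc[of "k + 2"] fc[of "k + 1"] fc[of k] i(1) by simp
    qed
    have "\<gamma> = 0" using rr[of "k + 2"] z i by (simp add: add.commute numeral_eq_Suc)
    moreover have "\<mu> = 0" using rr[of "k + 1"] z i \<open>\<gamma> = 0\<close> by (simp add: add.commute numeral_eq_Suc)
    moreover have "a = 0" using rr[of k] i \<open>\<gamma> = 0\<close> \<open>\<mu> = 0\<close> by (simp add: add.commute numeral_eq_Suc)
    ultimately show False using ab by (simp add: \<gamma>_def)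
  qed
  show ?thesis
  proof (rule eq_vecI)
    fix i assume "i < dim_vec v"
    then have i: "i < 2 * n" using v by simp
    have c: "x *\<^sub>v v \<in> V" "x *\<^sub>v (x *\<^sub>v v) \<in> V" using x v by auto
    have "f 2 = (x *\<^sub>v (x *\<^sub>v v) + x *\<^sub>v v) + (x *\<^sub>v v + v)"
      using fS[of 1] fS[of 0] Sp_app_add[OF x c(1) v] by (simp add: f_def numeral_2_eq_2)
    moreover have "f 2 $ i = 0" using f2 i by simp
    ultimately have "((x *\<^sub>v (x *\<^sub>v v) + x *\<^sub>v v) + (x *\<^sub>v v + v)) $ i = 0" by metis
    then have "(x *\<^sub>v (x *\<^sub>v v)) $ i + (x *\<^sub>v v) $ i + ((x *\<^sub>v v) $ i + v $ i) = 0"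
      using i v carrier_vecD[OF c(1)] carrier_vecD[OF c(2)] by (simp del: index_mult_mat_vec)
    then show "(x *\<^sub>v (x *\<^sub>v v)) $ i = v $ i"
      by (metis add.assoc add_left_self add_eq_0_iff2)
  qed (use X v in auto)
qed

end

no_notation Congruence.eq_closure_of (\<open>closure'_of\<index>\<close>)

text \<open>Turns density into a condition on polynomials. A given dense orbit is exploited from
  left to right; the density of a constructed orbit is obtained from right to left.\<close>

lemma closure_of_eq_iff:
  assumes "S \<subseteq> C" "C \<subseteq> carrier_mat N N"
  shows "(subtopology (zariski N) C) closure_of S = C \<longleftrightarrow>
    (\<forall>f\<in>poly_funs N. (\<forall>y\<in>S. f y = 0) \<longrightarrow> (\<forall>y\<in>C. f y = 0))" (is "?cl = C \<longleftrightarrow> _")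
proof
  assume cl: "?cl = C"
  show "\<forall>f\<in>poly_funs N. (\<forall>y\<in>S. f y = 0) \<longrightarrow> (\<forall>y\<in>C. f y = 0)"
  proof (intro ballI impI)
    fix f y assume f: "f \<in> poly_funs N" "\<forall>y\<in>S. f y = 0" and y: "y \<in> C"
    have "closedin (zariski N) (zero_locus N {f})"
      using f(1) unfolding closedin_zariski by blast
    then have "closedin (subtopology (zariski N) C) (zero_locus N {f} \<inter> C)"
      unfolding closedin_subtopology by blast
    moreover have "S \<subseteq> zero_locus N {f} \<inter> C" using f(2) assms by (auto simp: zero_locus_def)
    ultimately have "?cl \<subseteq> zero_locus N {f} \<inter> C" by (rule closure_of_minimal[rotated])
    then show "f y = 0" using y cl by (auto simp: zero_locus_def)
  qed
next
  assume *: "\<forall>f\<in>poly_funs N. (\<forall>y\<in>S. f y = 0) \<longrightarrow> (\<forall>y\<in>C. f y = 0)"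
  have top: "topspace (subtopology (zariski N) C) = C" using assms(2) by auto
  have sub: "S \<subseteq> ?cl" using assms(1) top by (intro closure_of_subset) simp
  have "closedin (subtopology (zariski N) C) ?cl" by (rule closedin_closure_of)
  then obtain P where P: "P \<subseteq> poly_funs N" "?cl = zero_locus N P \<inter> C"
    unfolding closedin_subtopology closedin_zariski by blast
  have "f y = 0" if "f \<in> P" "y \<in> C" for f y
  proof -
    have "\<forall>y\<in>S. f y = 0" using sub P(2) that(1) by (auto simp: zero_locus_def)
    then show ?thesis using * P(1) that by blast
  qed
  then have "C \<subseteq> ?cl" unfolding P(2) using assms(2) by (auto simp: zero_locus_def)
  moreover have "?cl \<subseteq> C" using P(2) by blast
  ultimately show "?cl = C" by blast
qed

text \<open>Representations on subquotients of the natural module appear as submatrices. Assumption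
  \<open>z\<close> expresses that the discarded indices contribute nothing to the product, which
  stability of the subspaces guarantees.\<close>

lemma submatrix_mult:
  assumes A: "A \<in> carrier_mat N N" and B: "B \<in> carrier_mat N N"
    and idx: "inj_on idx {..<m}" "idx ` {..<m} \<subseteq> {..<N}"
    and z: "\<And>a b l. a < m \<Longrightarrow> b < m \<Longrightarrow> l < N \<Longrightarrow> l \<notin> idx ` {..<m} \<Longrightarrow>
      A $$ (idx a, l) * B $$ (l, idx b) = (0 :: 'k::comm_ring_1)"
  shows "mat m m (\<lambda>(a, b). (A * B) $$ (idx a, idx b)) =
    mat m m (\<lambda>(a, b). A $$ (idx a, idx b)) * mat m m (\<lambda>(a, b). B $$ (idx a, idx b))"
proof (rule eq_matI)
  fix a b
  assume "a < dim_row (mat m m (\<lambda>(a, b). A $$ (idx a, idx b)) * mat m m (\<lambda>(a, b). B $$ (idx a,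
    idx b)))"
    "b < dim_col (mat m m (\<lambda>(a, b). A $$ (idx a, idx b)) * mat m m (\<lambda>(a, b). B $$ (idx a, idx b)))"
  then have ab: "a < m" "b < m" by auto
  then have "idx a < N" "idx b < N" using idx(2) by auto
  then have "(A * B) $$ (idx a, idx b) = (\<Sum>l<N. A $$ (idx a, l) * B $$ (l, idx b))"
    using A B by (simp add: scalar_prod_def lessThan_atLeast0)
  also have "\<dots> = (\<Sum>l\<in>idx ` {..<m}. A $$ (idx a, l) * B $$ (l, idx b))"
    using idx(2) z[OF ab] by (intro sum.mono_neutral_right) auto
  also have "\<dots> = (\<Sum>l<m. A $$ (idx a, idx l) * B $$ (idx l, idx b))"
    using idx(1) by (simp add: sum.reindex)
  finally show "mat m m (\<lambda>(a, b). (A * B) $$ (idx a, idx b)) $$ (a, b) =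
    (mat m m (\<lambda>(a, b). A $$ (idx a, idx b)) * mat m m (\<lambda>(a, b). B $$ (idx a, idx b))) $$ (a, b)"
    using ab by (simp add: scalar_prod_def lessThan_atLeast0)
qed auto

context symplectic_char2
begin

section \<open>Spherical classes consist of involutions\<close>

lemma conjugacy_class_eq:
  assumes "C \<in> conjugacy_classes G" "x \<in> C"
  shows "x \<in> carrier G" "C = (\<lambda>g. g * x * inv\<^bsub>G\<^esub> g) ` carrier G"
proof -
  obtain y where y: "y \<in> carrier G" "C = (\<lambda>g. g * y * inv\<^bsub>G\<^esub> g) ` carrier G"
    using assms(1) by (auto simp: conjugacy_classes_def orbits_def orbit_def conjugation_def
      Sp_mult)
  obtain h where h: "h \<in> carrier G" "x = h * y * inv\<^bsub>G\<^esub> h" using assms(2) y(2) by blast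
  show x: "x \<in> carrier G"
    using G.m_closed[OF G.m_closed[OF h(1) y(1)] G.inv_closed[OF h(1)]] h(2) by (simp add: Sp_mult)
  have c: "(g \<otimes>\<^bsub>G\<^esub> h) \<otimes>\<^bsub>G\<^esub> y \<otimes>\<^bsub>G\<^esub> inv\<^bsub>G\<^esub> (g \<otimes>\<^bsub>G\<^esub> h) = g \<otimes>\<^bsub>G\<^esub> x \<otimes>\<^bsub>G\<^esub> inv\<^bsub>G\<^esub> g"
    if "g \<in> carrier G" for g
    using that h(1) y(1) unfolding h(2) by (simp add: Sp_mult[symmetric] G.m_assoc G.inv_mult_group)
  have "(\<lambda>g. g * x * inv\<^bsub>G\<^esub> g) ` carrier G = (\<lambda>g. g * y * inv\<^bsub>G\<^esub> g) ` ((\<lambda>g. g * h) ` carrier G)"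
    unfolding image_image using c by (intro image_cong) (auto simp: Sp_mult)
  also have "(\<lambda>g. g * h) ` carrier G = carrier G"
  proof
    show "(\<lambda>g. g * h) ` carrier G \<subseteq> carrier G" using h(1) G.m_closed by (auto simp: Sp_mult)
    show "carrier G \<subseteq> (\<lambda>g. g * h) ` carrier G"
    proof
      fix g assume g: "g \<in> carrier G"
      have "g = (g \<otimes>\<^bsub>G\<^esub> inv\<^bsub>G\<^esub> h) * h" using g h(1) by (simp add: Sp_mult[symmetric] G.m_assoc)
      then show "g \<in> (\<lambda>g. g * h) ` carrier G" using g h(1) by blast
    qed
  qed
  finally show "C = (\<lambda>g. g * x * inv\<^bsub>G\<^esub> g) ` carrier G" using y(2) by simp
qed

lemma orbit_conjugation: "orbit (G\<lparr>carrier := B\<rparr>) (conjugation G) x = (\<lambda>b. b * x * inv\<^bsub>G\<^esub> b) ` B"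
  by (auto simp: orbit_def conjugation_def Sp_mult)

text \<open>Suppose \<open>x\<^sup>2\<close> moves \<open>u\<close>. A line in direction
  \<open>u\<close> through a suitable \<open>w\<close> meets the quadric
  \<open>bil (x v) v = 0\<close> in two distinct points, both fixed by hypothesis, and
  \<open>u\<close> is a multiple of their difference. If there is no suitable \<open>w\<close>, then
  \<open>x u\<close> and \<open>x^-1 u\<close> coincide and \<open>u\<close> is fixed after
  all.\<close>

lemma fixed_quadric:
  assumes x: "x \<in> carrier G"
    and *: "\<And>v. v \<in> V \<Longrightarrow> bil (x *\<^sub>v v) v = 0 \<Longrightarrow> x *\<^sub>v (x *\<^sub>v v) = v"
    and u: "u \<in> V"
  shows "x *\<^sub>v (x *\<^sub>v u) = u"
proof (rule ccontr)
  assume nf: "x *\<^sub>v (x *\<^sub>v u) \<noteq> u"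
  define a where "a = bil (x *\<^sub>v u) u"
  have a: "a \<noteq> 0" using * u nf by (auto simp: a_def)
  let ?z = "x *\<^sub>v u + inv\<^bsub>G\<^esub> x *\<^sub>v u"
  have xi: "inv\<^bsub>G\<^esub> x \<in> carrier G" using x by simp
  have z: "?z \<in> V" using x xi u by simp
  have "bil ?z w = 0" if w: "w \<in> V" for w
  proof (rule ccontr)
    assume b: "bil ?z w \<noteq> 0"
    define b where "b = bil ?z w"
    have Q: "bil (x *\<^sub>v (w + t \<cdot>\<^sub>v u)) (w + t \<cdot>\<^sub>v u) = bil (x *\<^sub>v w) w + t * b + t * t * a" for t
    proof -
      have "bil (x *\<^sub>v w) u = bil (inv\<^bsub>G\<^esub> x *\<^sub>v u) w"
        using bil_Sp_adjoint[OF x w u] bil_sym[OF w, of "inv\<^bsub>G\<^esub> x *\<^sub>v u"] x u by simp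
      then show ?thesis using x u w xi
        by (simp add: Sp_app_add Sp_app_smult bil_simps a_def b_def) (simp add: algebra_simps)
    qed
    have "degree [:bil (x *\<^sub>v w) w, b, a:] > 0" using a by simp
    then obtain t where "poly [:bil (x *\<^sub>v w) w, b, a:] t = 0"
      using alg_closed_imp_poly_has_root by blast
    then have t: "bil (x *\<^sub>v w) w + t * b + t * t * a = 0" by (simp add: algebra_simps)
    \<comment> \<open>The second root of the quadratic polynomial: in characteristic 2 its roots add
      up to \<open>b / a\<close>.\<close>
    define s where "s = t + b / a"
    have ds: "s * s = t * t + (b / a) * (b / a)" unfolding s_def
      by (simp add: algebra_simps add_left_self)
    have "bil (x *\<^sub>v w) w + s * b + s * s * a =
      (bil (x *\<^sub>v w) w + t * b + t * t * a) + ((b / a) * b + (b / a) * (b / a) * a)"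
      unfolding ds by (simp add: s_def algebra_simps)
    also have "(b / a) * b + (b / a) * (b / a) * a = 0"
      using a by (simp add: add_self)
    finally have s: "bil (x *\<^sub>v w) w + s * b + s * s * a = 0" using t by simp
    have fix1: "x *\<^sub>v (x *\<^sub>v (w + t \<cdot>\<^sub>v u)) = w + t \<cdot>\<^sub>v u" 
      using Q[of t] t u w by (intro *) auto
    have fix2: "x *\<^sub>v (x *\<^sub>v (w + s \<cdot>\<^sub>v u)) = w + s \<cdot>\<^sub>v u" 
      using Q[of s] s u w by (intro *) auto
    have ba: "b / a \<noteq> 0" using a b by (simp add: b_def)
    have ueq: "u = (a / b) \<cdot>\<^sub>v ((w + t \<cdot>\<^sub>v u) + (w + s \<cdot>\<^sub>v u))"
    proof (rule eq_vecI)
      fix i assume "i < dim_vec ((a / b) \<cdot>\<^sub>v ((w + t \<cdot>\<^sub>v u) + (w + s \<cdot>\<^sub>v u)))"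
      then have i: "i < 2 * n" using w u by simp
      have "w $ i + t * u $ i + (w $ i + s * u $ i) = (b / a) * u $ i"
        by (simp add: s_def algebra_simps add_left_self)
      then show "u $ i = ((a / b) \<cdot>\<^sub>v ((w + t \<cdot>\<^sub>v u) + (w + s \<cdot>\<^sub>v u))) $ i"
        using i u w ba a by simp
    qed (use u w in auto)
    have "x *\<^sub>v (x *\<^sub>v u) = (a / b) \<cdot>\<^sub>v (x *\<^sub>v (x *\<^sub>v (w + t \<cdot>\<^sub>v u)) + x *\<^sub>v (x *\<^sub>v (w + s \<cdot>\<^sub>v u)))"
      using x u w by (subst ueq) (simp add: Sp_app_add[OF x, symmetric] Sp_app_smult[OF x,
        symmetric])
    then show False using fix1 fix2 ueq nf by simp
  qed
  then have "?z = 0\<^sub>v (2 * n)" using bil_nondegenerate[OF z] by blast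
  then have 0: "(x *\<^sub>v u + inv\<^bsub>G\<^esub> x *\<^sub>v u) $ i = 0" if "i < 2 * n" for i using that by simp
  have cc: "x *\<^sub>v u \<in> V" "inv\<^bsub>G\<^esub> x *\<^sub>v u \<in> V" using x xi u by auto
  have "X = Y" if "X \<in> V" "Y \<in> V" "\<And>i. i < 2 * n \<Longrightarrow> (X + Y) $ i = 0" for X Y
    using that by (intro eq_vecI) (auto simp: add_eq_0_iff2)
  from this[OF cc 0] have "x *\<^sub>v (x *\<^sub>v u) = u" using x u by simp
  then show False using nf by simp
qed

lemma Sp_involutionI:
  assumes x: "x \<in> carrier G" and "\<And>v. v \<in> V \<Longrightarrow> x *\<^sub>v (x *\<^sub>v v) = v"
  shows "x * x = 1\<^sub>m (2 * n)"
proof (rule eq_matI)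
  have xx: "x * x \<in> carrier_mat (2 * n) (2 * n)" using Sp_carrier[OF x] by auto
  fix i j assume "i < dim_row (1\<^sub>m (2 * n) :: 'k mat)" "j < dim_col (1\<^sub>m (2 * n) :: 'k mat)"
  then have ij: "i < 2 * n" "j < 2 * n" by auto
  have "M $$ (i, j) = (M *\<^sub>v unit_vec (2 * n) j) $ i" if "M \<in> carrier_mat (2 * n) (2 * n)"
    for M :: "'k mat"
    using that ij by simp
  then have "(x * x) $$ (i, j) = ((x * x) *\<^sub>v unit_vec (2 * n) j) $ i" using xx .
  also have "(x * x) *\<^sub>v unit_vec (2 * n) j = unit_vec (2 * n) j"
    using assms(2)[of "unit_vec (2 * n) j"] x by (simp add: Sp_app)
  finally show "(x * x) $$ (i, j) = 1\<^sub>m (2 * n) $$ (i, j)" using ij by (simp add: unit_vec_def)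
qed (use Sp_carrier[OF x] in auto)

lemma poly_funs_bil:
  assumes "v \<in> V" "w \<in> V" shows "\<exists>f\<in>poly_funs (2 * n). \<forall>y\<in>carrier G. f y = bil (y *\<^sub>v v) w"
proof -
  define f where "f y = (\<Sum>i<2 * n. (\<Sum>j<2 * n. y $$ (i, j) * v $ j) * (J *\<^sub>v w) $ i)" for y
  have "f \<in> poly_funs (2 * n)" unfolding f_def
    by (intro poly_funs_sum poly_funs.mult poly_funs.entry poly_funs.const) auto
  moreover have "f y = bil (y *\<^sub>v v) w" if "y \<in> carrier G" for y
  proof -
    have "bil (y *\<^sub>v v) w = (\<Sum>i<2 * n. (y *\<^sub>v v) $ i * (J *\<^sub>v w) $ i)"
      using carrier_vecD[OF J_vec_carrier[of w]]
        by (simp add: bil_def scalar_prod_def lessThan_atLeast0)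
    moreover have "(y *\<^sub>v v) $ i = (\<Sum>j<2 * n. y $$ (i, j) * v $ j)" if "i < 2 * n" for i
      using Sp_carrier[OF \<open>y \<in> _\<close>] assms that by (simp add: scalar_prod_def lessThan_atLeast0)
    ultimately show ?thesis by (simp add: f_def)
  qed
  ultimately show ?thesis by blast
qed

lemma dense_orbit_imp_involution:
  assumes x: "x \<in> carrier G" and uni: "unipotent (2 * n) x" and BG: "B \<subseteq> carrier G"
    and inv: "\<And>b. b \<in> B \<Longrightarrow> inv\<^bsub>G\<^esub> b \<in> B"
    and pq: "isotropic_pair p q"
    and flag: "\<And>b. b \<in> B \<Longrightarrow> \<exists>a. b *\<^sub>v p = a \<cdot>\<^sub>v p"
      "\<And>b. b \<in> B \<Longrightarrow> \<exists>d e. b *\<^sub>v q = d \<cdot>\<^sub>v q + e \<cdot>\<^sub>v p"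
    and dense: "\<And>f. f \<in> poly_funs (2 * n) \<Longrightarrow> (\<And>b. b \<in> B \<Longrightarrow> f (b * x * inv\<^bsub>G\<^esub> b) = 0) \<Longrightarrow>
      (\<And>g. g \<in> carrier G \<Longrightarrow> f (g * x * inv\<^bsub>G\<^esub> g) = 0)"
  shows "x * x = 1\<^sub>m (2 * n)"
proof -
  define F where "F y v w = bil (y *\<^sub>v v) w" for y v w
  define A where "A y v w = (F y v w + F y w v) * (F y v w + F y w v)" for y v w
  define D where "D y v w = F y v v * F y w w + F y v w * F y w v" for y v w
  note pqV = pq[unfolded isotropic_pair_def]
  have pV: "p \<in> V" and qV: "q \<in> V" using pqV by auto
  have Fconj: "F (g * x * inv\<^bsub>G\<^esub> g) v w = F x (inv\<^bsub>G\<^esub> g *\<^sub>v v) (inv\<^bsub>G\<^esub> g *\<^sub>v w)"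
    if "g \<in> carrier G" "v \<in> V" "w \<in> V" for g v w
  proof -
    have gi: "inv\<^bsub>G\<^esub> g \<in> carrier G" "g * x \<in> carrier G"
      using that x G.m_closed[of g x] by (auto simp: Sp_mult)
    have "(g * x * inv\<^bsub>G\<^esub> g) *\<^sub>v v = g *\<^sub>v (x *\<^sub>v (inv\<^bsub>G\<^esub> g *\<^sub>v v))"
      using Sp_app[OF gi(2,1) that(2)] Sp_app[OF that(1) x, of "inv\<^bsub>G\<^esub> g *\<^sub>v v"] gi that by simp
    then show ?thesis unfolding F_def
      using bil_Sp_adjoint[OF that(1), of "x *\<^sub>v (inv\<^bsub>G\<^esub> g *\<^sub>v v)" w] that gi x by simp
  qed
  have semi: "\<exists>c. A (b * x * inv\<^bsub>G\<^esub> b) p q = c * A x p q \<and> D (b * x * inv\<^bsub>G\<^esub> b) p q = c * D x p q"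
    if b: "b \<in> B" for b
  proof -
    obtain a where a: "inv\<^bsub>G\<^esub> b *\<^sub>v p = a \<cdot>\<^sub>v p" using flag(1)[OF inv[OF b]] by blast
    obtain d e where de: "inv\<^bsub>G\<^esub> b *\<^sub>v q = d \<cdot>\<^sub>v q + e \<cdot>\<^sub>v p" using flag(2)[OF inv[OF b]] by blast
    have bG: "b \<in> carrier G" using b BG by blast
    let ?y = "b * x * inv\<^bsub>G\<^esub> b"
    have pp: "F ?y p p = a * a * F x p p"
      unfolding Fconj[OF bG pV pV] unfolding a F_def
        using x pV by (simp add: Sp_app_smult bil_simps)
    have pq': "F ?y p q = a * d * F x p q + a * e * F x p p"
      unfolding Fconj[OF bG pV qV] unfolding a de F_def using x pV qV
      by (simp add: Sp_app_smult Sp_app_add bil_simps, (simp add: algebra_simps)?)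
    have qp: "F ?y q p = a * d * F x q p + a * e * F x p p"
      unfolding Fconj[OF bG qV pV] unfolding a de F_def using x pV qV
      by (simp add: Sp_app_smult Sp_app_add bil_simps, (simp add: algebra_simps)?)
    have qq: "F ?y q q = d * d * F x q q + d * e * (F x p q + F x q p) + e * e * F x p p"
      unfolding Fconj[OF bG qV qV] unfolding de F_def using x pV qV
      by (simp add: Sp_app_smult Sp_app_add bil_simps, (simp add: algebra_simps)?)
    have s: "F ?y p q + F ?y q p = a * d * (F x p q + F x q p)"
      unfolding pq' qp by (simp add: algebra_simps add_self add_left_self)
    have A: "A ?y p q = (a * d) * (a * d) * A x p q"
      unfolding A_def s by (simp add: algebra_simps)?
    \<comment> \<open>Arranged so that each of the two brackets is a sum of two equal terms.\<close>
    have "D ?y p q = (a * d) * (a * d) * D x p q +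
      (a * a * F x p p * (d * e * (F x p q + F x q p)) + a * d * (a * e) * F x p p * (F x p q +
        F x q p)) +
      (a * a * F x p p * (e * e * F x p p) + a * e * F x p p * (a * e * F x p p))"
      unfolding D_def pp pq' qp qq by (simp add: algebra_simps)
    also have "\<dots> = (a * d) * (a * d) * D x p q"
      by (simp add: algebra_simps add_self add_left_self)
    finally show ?thesis using A by blast
  qed
  obtain fpp where fpp: "fpp \<in> poly_funs (2 * n)" "\<forall>y\<in>carrier G. fpp y = F y p p"
    unfolding F_def using poly_funs_bil[OF pV pV] by blast
  obtain fpq where fpq: "fpq \<in> poly_funs (2 * n)" "\<forall>y\<in>carrier G. fpq y = F y p q"
    unfolding F_def using poly_funs_bil[OF pV qV] by blast
  obtain fqp where fqp: "fqp \<in> poly_funs (2 * n)" "\<forall>y\<in>carrier G. fqp y = F y q p"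
    unfolding F_def using poly_funs_bil[OF qV pV] by blast
  obtain fqq where fqq: "fqq \<in> poly_funs (2 * n)" "\<forall>y\<in>carrier G. fqq y = F y q q"
    unfolding F_def using poly_funs_bil[OF qV qV] by blast
  note poly = fpp(1) fpq(1) fqp(1) fqq(1)
  note eval = fpp(2)[rule_format] fpq(2)[rule_format] fqp(2)[rule_format] fqq(2)[rule_format]
  have conjG: "g * x * inv\<^bsub>G\<^esub> g \<in> carrier G" if "g \<in> carrier G" for g
    using G.m_closed[OF G.m_closed[OF that x] G.inv_closed[OF that]] by (simp add: Sp_mult)
  \<comment> \<open>A linear relation between \<open>A\<close> and \<open>D\<close> at
    \<open>x\<close> persists along the \<open>B\<close>-orbit by \<open>semi\<close>, and on the
    class by density. Replacing \<open>p, q\<close> by another isotropic pair amounts to conjugating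
    \<open>x\<close>.\<close>
  have transfer: "\<alpha> * A x v w + \<beta> * D x v w = 0"
    if vw: "isotropic_pair v w" and 0: "\<alpha> * A x p q + \<beta> * D x p q = 0" for v w \<alpha> \<beta>
  proof -
    define f where "f y = \<alpha> * ((fpq y + fqp y) * (fpq y + fqp y)) +
      \<beta> * (fpp y * fqq y + fpq y * fqp y)" for y
    have fp: "f \<in> poly_funs (2 * n)" unfolding f_def
      by (intro poly_funs.add poly_funs.mult poly_funs.const poly)
    have fe: "f y = \<alpha> * A y p q + \<beta> * D y p q" if "y \<in> carrier G" for y
      using eval[OF that] by (simp add: f_def A_def D_def)
    have vanish: "f (b * x * inv\<^bsub>G\<^esub> b) = 0" if b: "b \<in> B" for b
    proof -
      obtain c where "A (b * x * inv\<^bsub>G\<^esub> b) p q = c * A x p q" "D (b * x * inv\<^bsub>G\<^esub> b) p q = c * D x p q"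
        using semi[OF b] by blast
      then have "f (b * x * inv\<^bsub>G\<^esub> b) = c * (\<alpha> * A x p q + \<beta> * D x p q)"
        using fe[OF conjG] b BG by (simp add: subset_iff algebra_simps)
      then show ?thesis using 0 by simp
    qed
    have all: "f (g * x * inv\<^bsub>G\<^esub> g) = 0" if "g \<in> carrier G" for g
      using fp vanish that by (rule dense)
    obtain g where g: "g \<in> carrier G" "g *\<^sub>v v = p" "g *\<^sub>v w = q"
      using Sp_transitive_isotropic_pair[OF vw pq] by blast
    have "inv\<^bsub>G\<^esub> g *\<^sub>v p = v" "inv\<^bsub>G\<^esub> g *\<^sub>v q = w"
      using g vw unfolding isotropic_pair_def by auto
    then have "A (g * x * inv\<^bsub>G\<^esub> g) p q = A x v w" "D (g * x * inv\<^bsub>G\<^esub> g) p q = D x v w"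
      using pqV by (simp_all add: A_def D_def Fconj[OF g(1)])
    then show ?thesis using all[OF g(1)] fe[OF conjG[OF g(1)]] by simp
  qed
  have xi: "inv\<^bsub>G\<^esub> x \<in> carrier G" using x by simp
  have F_swap: "F x w v = bil (inv\<^bsub>G\<^esub> x *\<^sub>v v) w" if "v \<in> V" "w \<in> V" for v w
    unfolding F_def using bil_Sp_adjoint[OF x that(2,1)] bil_sym that x by simp
  show ?thesis
  proof (cases "\<exists>v w. isotropic_pair v w \<and> A x v w \<noteq> 0")
    case False
    \<comment> \<open>Vanishing of \<open>A\<close> puts \<open>x v + x^-1 v\<close> into the double
      orthogonal of \<open>v\<close>.\<close>
    have "x *\<^sub>v (x *\<^sub>v v) = v" if v: "v \<in> V" for v
    proof (cases "v = 0\<^sub>v (2 * n)")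
      case True
      then show ?thesis using Sp_carrier[OF x] by (auto simp: scalar_prod_def)
    next
      case nz: False
      let ?z = "x *\<^sub>v v + inv\<^bsub>G\<^esub> x *\<^sub>v v"
      have z: "?z \<in> V" using x v by simp
      have Fz: "bil ?z w = F x v w + F x w v" if "w \<in> V" for w
        using F_swap[OF v that] that v x by (simp add: F_def bil_simps)
      have "bil ?z w = 0" if w: "w \<in> V" "bil v w = 0" for w
      proof (cases "\<exists>c. w = c \<cdot>\<^sub>v v")
        case True
        then obtain c where c: "w = c \<cdot>\<^sub>v v" by blast
        show ?thesis using Fz[OF v] v z unfolding c by (simp add: bil_simps add_self)
      next
        case nc: False
        then have "isotropic_pair v w" using nz v w by (simp add: isotropic_pair_def)
        then have "A x v w = 0" using False by blast
        then show ?thesis using Fz[OF w(1)] by (simp add: A_def)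
      qed
      then obtain \<mu> where "?z = \<mu> \<cdot>\<^sub>v v" using in_span1[OF v z] by blast
      then show ?thesis using unipotent_quadratic[OF x uni v, of 1 1 \<mu>] by simp
    qed
    then show ?thesis by (rule Sp_involutionI[OF x])
  next
    case True
    then obtain v0 w0 where vw0: "isotropic_pair v0 w0" "A x v0 w0 \<noteq> 0" by blast
    have Apq: "A x p q \<noteq> 0" using transfer[OF vw0(1), of 1 0] vw0(2) by auto
    have AD: "D x v w = 0" if "isotropic_pair v w" "A x v w = 0" for v w
    proof -
      \<comment> \<open>Coefficients for which the relation holds trivially at \<open>p, q\<close>,
        where both terms are the same product.\<close>
      have "D x p q * A x v w + A x p q * D x v w = 0"
        by (rule transfer[OF that(1)]) (simp add: mult.commute add_self)
      then show ?thesis using that(2) Apq by simp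
    qed
    have quadric: "x *\<^sub>v (x *\<^sub>v v) = v" if v: "v \<in> V" and Q: "bil (x *\<^sub>v v) v = 0" for v
    proof (rule ccontr)
      assume nf: "x *\<^sub>v (x *\<^sub>v v) \<noteq> v"
      have "0\<^sub>v (2 * n) = x *\<^sub>v (x *\<^sub>v 0\<^sub>v (2 * n))"
        using Sp_carrier[OF x] by (auto simp: scalar_prod_def)
      then have nz: "v \<noteq> 0\<^sub>v (2 * n)" using nf by metis
      define X Y where "X = x *\<^sub>v v" and "Y = inv\<^bsub>G\<^esub> x *\<^sub>v v"
      have c: "X \<in> V" "Y \<in> V" "X + Y \<in> V" using x v by (auto simp: X_def Y_def)
      \<comment> \<open>Otherwise \<open>X\<close> would be a combination of \<open>v\<close> and
        \<open>X + Y\<close>. This is a relation between \<open>X\<close>, \<open>Y\<close> and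
        \<open>v\<close> with coefficients \<open>1 + \<beta>\<close> and \<open>\<beta>\<close> at
        \<open>X\<close> and \<open>Y\<close>, which cannot both vanish, so
        \<open>unipotent_quadratic\<close> would contradict \<open>nf\<close>.\<close>
      have "\<exists>z\<in>V. bil v z = 0 \<and> bil (X + Y) z = 0 \<and> bil X z \<noteq> 0"
      proof (rule ccontr)
        assume no: "\<not> ?thesis"
        obtain \<alpha> \<beta> where X: "X = \<alpha> \<cdot>\<^sub>v v + \<beta> \<cdot>\<^sub>v (X + Y)"
          using in_span2[OF v c(3) c(1)] no by blast
        have "(1 + \<beta>) \<cdot>\<^sub>v X + \<beta> \<cdot>\<^sub>v Y = \<alpha> \<cdot>\<^sub>v v"
        proof (rule eq_vecI)
          fix i assume "i < dim_vec (\<alpha> \<cdot>\<^sub>v v)"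
          then have i: "i < 2 * n" using v by simp
          then have "X $ i = \<alpha> * v $ i + \<beta> * (X $ i + Y $ i)"
            using arg_cong[OF X, of "\<lambda>u. u $ i"] c v by simp
          then have "X $ i + \<beta> * (X $ i + Y $ i) = \<alpha> * v $ i"
            by (metis add.assoc add_self add_0_right)
          then show "((1 + \<beta>) \<cdot>\<^sub>v X + \<beta> \<cdot>\<^sub>v Y) $ i = (\<alpha> \<cdot>\<^sub>v v) $ i"
            using i c v by (simp add: algebra_simps)
        qed (use c v in auto)
        moreover have "1 + \<beta> \<noteq> 0 \<or> \<beta> \<noteq> 0" by auto
        ultimately show False
          using unipotent_quadratic[OF x uni v] nf unfolding X_def Y_def by blast
      qed
      then obtain z where z: "z \<in> V" "bil v z = 0" "bil (X + Y) z = 0" "bil X z \<noteq> 0" by blast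
      then have XY: "bil X z = bil Y z" using c by (simp add: bil_simps add_eq_0_iff2)
      \<comment> \<open>Normalised so that \<open>F x v w = F x w v = 1\<close>; together with
        \<open>F x v v = 0\<close> this gives \<open>A = 0\<close> but \<open>D = 1\<close>.\<close>
      define w where "w = (1 / bil X z) \<cdot>\<^sub>v z"
      have w: "w \<in> V" "bil v w = 0" "bil X w = 1" "bil Y w = 1"
        using z c v XY by (auto simp: w_def bil_simps)
      have "w \<noteq> c \<cdot>\<^sub>v v" for c
      proof
        assume "w = c \<cdot>\<^sub>v v"
        then show False using w(3) Q v c by (simp add: bil_simps X_def[symmetric])
      qed
      then have ip: "isotropic_pair v w" using v w nz by (simp add: isotropic_pair_def)
      have F: "F x v w = 1" "F x w v = 1" "F x v v = 0"
        using w F_swap[OF v w(1)] Q by (auto simp: F_def X_def Y_def)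
      have "A x v w = 0" by (simp add: A_def F add_self)
      then have "D x v w = 0" by (rule AD[OF ip])
      then show False by (simp add: D_def F)
    qed
    show ?thesis by (rule Sp_involutionI[OF x fixed_quadric[OF x quadric]])
  qed
qed

section \<open>Borel subgroups\<close>

text \<open>The derived series formed inside \<open>H\<close> agrees term by term with the one
  formed in \<open>G\<close>, which gives solvability the form that \<open>lie_kolchin\<close>
  expects.\<close>

lemma closed_connected_solvableD:
  assumes "closed_connected_solvable (2 * n) G H"
  shows "subgroup H G" "connectedin (zariski (2 * n)) H" "\<exists>d. (derived G ^^ d) H = {\<one>\<^bsub>G\<^esub>}"
proof -
  show H: "subgroup H G" and "connectedin (zariski (2 * n)) H"
    using assms by (auto simp: closed_connected_solvable_def)
  let ?H = "G\<lparr>carrier := H\<rparr>"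
  interpret H: group ?H by (rule subgroup.subgroup_is_group[OF H G.group_axioms])
  have "(derived ?H ^^ k) H = (derived G ^^ k) H \<and> (derived G ^^ k) H \<subseteq> H" for k
  proof (induction k)
    case (Suc k)
    then show ?case
      using G.derived_consistent[OF _ H, of "(derived G ^^ k) H"] G.derived_incl[OF _ H, of
        "(derived G ^^ k) H"]
      by simp
  qed simp
  moreover have "\<exists>d. (derived ?H ^^ d) H = {\<one>\<^bsub>G\<^esub>}"
    using assms H.solvable_iff_trivial_derived_seq by (simp add: closed_connected_solvable_def)
  ultimately show "\<exists>d. (derived G ^^ d) H = {\<one>\<^bsub>G\<^esub>}" by metis
qed

lemma bil_unit_0:
  assumes "n > 0" "v \<in> V" shows "bil (unit_vec (2 * n) 0) v = v $ n"
  using assms by (simp add: bil_def J_mult_vec scalar_prod_left_unit)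

text \<open>Lie-Kolchin is applied twice: to the natural module, giving \<open>p\<close>, and to the
  orthogonal of \<open>p\<close> modulo \<open>p\<close>, whose dimension \<open>2 * n - 2\<close>
  is positive.\<close>

lemma borel_flag:
  assumes B: "closed_connected_solvable (2 * n) G B" and n: "n \<ge> 2"
  obtains p q where "isotropic_pair p q" "\<And>b. b \<in> B \<Longrightarrow> \<exists>a. b *\<^sub>v p = a \<cdot>\<^sub>v p"
    "\<And>b. b \<in> B \<Longrightarrow> \<exists>d e. b *\<^sub>v q = d \<cdot>\<^sub>v q + e \<cdot>\<^sub>v p"
proof -
  let ?N = "2 * n"
  note BD = closed_connected_solvableD[OF B]
  obtain d where d: "(derived G ^^ d) B = {\<one>\<^bsub>G\<^esub>}" using BD(3) by blast
  have BG: "b \<in> carrier G" if "b \<in> B" for b using BD(1) subgroup.mem_carrier that by fast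
  have Bm: "g * h \<in> B" if "g \<in> B" "h \<in> B" for g h
    using subgroup.m_closed[OF BD(1) that] by (simp add: Sp_mult)
  have cut: "cut_mat ?N b = b" if "b \<in> B" for b by (rule cut_mat_id[OF Sp_carrier[OF BG[OF that]]])
  have "\<exists>p\<in>V. p \<noteq> 0\<^sub>v ?N \<and> (\<forall>h\<in>B. \<exists>c. cut_mat ?N h *\<^sub>v p = c \<cdot>\<^sub>v p)"
    by (rule lie_kolchin[OF BD(1,2) d])
      (use n cut Bm in \<open>auto simp: poly_funs_cut_mat cut_mat_id\<close>)
  then obtain p where p: "p \<in> V" "p \<noteq> 0\<^sub>v ?N" "\<And>h. h \<in> B \<Longrightarrow> \<exists>c. h *\<^sub>v p = c \<cdot>\<^sub>v p"
    using cut by metis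
  let ?e = "unit_vec ?N 0 :: 'k vec"
  have e: "?e \<in> V" "?e \<noteq> 0\<^sub>v ?N" using n by auto
  \<comment> \<open>Once \<open>p\<close> is moved to the first basis vector \<open>?e\<close>, its
    orthogonal consists of the vectors with coordinate \<open>n\<close> equal to 0, and the
    subquotient is a submatrix of the conjugate \<open>\<kappa> h\<close>.\<close>
  obtain g where g: "g \<in> carrier G" "g *\<^sub>v p = ?e" using Sp_transitive_nonzero[OF p(1,2) e] by blast
  let ?gi = "inv\<^bsub>G\<^esub> g"
  have gi: "?gi \<in> carrier G" "?gi *\<^sub>v ?e = p"
    using g(1) Sp_inv_app(1)[OF g(1) p(1)] unfolding g(2) by auto
  define \<kappa> where "\<kappa> h = (g * cut_mat ?N h) * ?gi" for h
  have \<kappa>c: "\<kappa> h \<in> carrier_mat ?N ?N" for h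
    unfolding \<kappa>_def using Sp_carrier[OF g(1)] Sp_carrier[OF gi(1)]
      by (intro mult_square_carrier) auto
  have \<kappa>p: "(\<lambda>A. \<kappa> A $$ (i, j)) \<in> poly_funs ?N" if "i < ?N" "j < ?N" for i j
  proof -
    have 1: "(\<lambda>A. (g * cut_mat ?N A) $$ (i, j)) \<in> poly_funs ?N" if "i < ?N" "j < ?N" for i j
      by (rule poly_funs_mult_mat[of _ ?N ?N _ ?N])
        (use that Sp_carrier[OF g(1)] in \<open>auto intro: poly_funs.const poly_funs_cut_mat\<close>)
    show ?thesis unfolding \<kappa>_def
      by (rule poly_funs_mult_mat[of _ ?N ?N _ ?N])
        (use that 1 Sp_carrier[OF g(1)] Sp_carrier[OF gi(1)] in
          \<open>auto intro: poly_funs.const intro!: mult_square_carrier\<close>)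
  qed
  have \<kappa>eq: "\<kappa> h = g \<otimes>\<^bsub>G\<^esub> h \<otimes>\<^bsub>G\<^esub> ?gi" if "h \<in> B" for h using cut[OF that] by (simp add: \<kappa>_def Sp_mult)
  have \<kappa>G: "\<kappa> h \<in> carrier G" if "h \<in> B" for h
    unfolding \<kappa>eq[OF that] using g(1) BG[OF that] by simp
  have \<kappa>m: "\<kappa> (h * k) = \<kappa> h * \<kappa> k" if "h \<in> B" "k \<in> B" for h k
  proof -
    have "g \<otimes>\<^bsub>G\<^esub> (h \<otimes>\<^bsub>G\<^esub> k) \<otimes>\<^bsub>G\<^esub> ?gi = (g \<otimes>\<^bsub>G\<^esub> h \<otimes>\<^bsub>G\<^esub> ?gi) \<otimes>\<^bsub>G\<^esub> (g \<otimes>\<^bsub>G\<^esub> k \<otimes>\<^bsub>G\<^esub> ?gi)"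
      using g(1) BG that by (simp add: G.m_assoc) (simp add: G.m_assoc[symmetric])
    then show ?thesis
      using \<kappa>eq[OF that(1)] \<kappa>eq[OF that(2)] \<kappa>eq[OF Bm[OF that]] by (simp add: Sp_mult)
  qed
  have \<kappa>app: "\<kappa> h *\<^sub>v v = g *\<^sub>v (h *\<^sub>v (?gi *\<^sub>v v))" if "h \<in> B" "v \<in> V" for h v
    unfolding \<kappa>eq[OF that(1)] Sp_mult
    using Sp_app[OF G.m_closed[OF g(1) BG[OF that(1)]] gi(1) that(2)]
      Sp_app[OF g(1) BG[OF that(1)], of "?gi *\<^sub>v v"] gi(1) that(2) by (simp add: Sp_mult)
  have \<kappa>e: "\<exists>c. \<kappa> h *\<^sub>v ?e = c \<cdot>\<^sub>v ?e" if h: "h \<in> B" for h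
  proof -
    obtain c where "h *\<^sub>v p = c \<cdot>\<^sub>v p" using p(3)[OF h] by blast
    then have "\<kappa> h *\<^sub>v ?e = c \<cdot>\<^sub>v ?e" using \<kappa>app[OF h e(1)] gi(2) g p by (simp add: Sp_app_smult)
    then show ?thesis by blast
  qed
  have col0: "\<kappa> h $$ (i, 0) = 0" if h: "h \<in> B" and i: "i < ?N" "i \<noteq> 0" for h i
  proof -
    obtain c where c: "\<kappa> h *\<^sub>v ?e = c \<cdot>\<^sub>v ?e" using \<kappa>e[OF h] by blast
    have "\<kappa> h $$ (i, 0) = (\<kappa> h *\<^sub>v ?e) $ i" using \<kappa>c[of h] i n by simp
    then show ?thesis unfolding c using i by (simp add: unit_vec_def)
  qed
  \<comment> \<open>Stability of the orthogonal of \<open>?e\<close>, by duality from the stability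
    of the line through \<open>?e\<close> under the inverse.\<close>
  have rown: "\<kappa> h $$ (n, j) = 0" if h: "h \<in> B" and j: "j < ?N" "j \<noteq> n" for h j
  proof -
    have hi: "inv\<^bsub>G\<^esub> h \<in> B" using subgroup.m_inv_closed[OF BD(1) h] .
    obtain c where c: "\<kappa> (inv\<^bsub>G\<^esub> h) *\<^sub>v ?e = c \<cdot>\<^sub>v ?e" using \<kappa>e[OF hi] by blast
    have "inv\<^bsub>G\<^esub> (\<kappa> h) = \<kappa> (inv\<^bsub>G\<^esub> h)"
      unfolding \<kappa>eq[OF h] \<kappa>eq[OF hi] using g(1) BG[OF h] by (simp add: G.inv_mult_group G.m_assoc)
    then have ci: "inv\<^bsub>G\<^esub> (\<kappa> h) *\<^sub>v ?e = c \<cdot>\<^sub>v ?e" using c by simp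
    have uj: "unit_vec ?N j \<in> V" by simp
    have "\<kappa> h $$ (n, j) = (\<kappa> h *\<^sub>v unit_vec ?N j) $ n" using \<kappa>c[of h] j n by simp
    also have "\<dots> = bil ?e (\<kappa> h *\<^sub>v unit_vec ?N j)"
      using bil_unit_0[of "\<kappa> h *\<^sub>v unit_vec ?N j"] n Sp_vec[OF \<kappa>G[OF h] uj] by simp
    also have "\<dots> = bil (c \<cdot>\<^sub>v ?e) (unit_vec ?N j)"
      using bil_Sp_adjoint[OF \<kappa>G[OF h] uj e(1)] bil_sym[OF e(1) Sp_vec[OF \<kappa>G[OF h] uj]]
        bil_sym[OF uj, of "inv\<^bsub>G\<^esub> (\<kappa> h) *\<^sub>v ?e"] ci e by simp
    also have "\<dots> = 0" using bil_unit_0[OF _ uj] n j by (simp add: bil_smult_left unit_vec_def)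
    finally show ?thesis .
  qed
  define m where "m = ?N - 2"
  \<comment> \<open>Enumerates the indices other than \<open>0\<close> and \<open>n\<close>.\<close>
  define idx where "idx j = (if j < n - 1 then j + 1 else j + 2)" for j :: nat
  have idx: "inj_on idx {..<m}" "idx ` {..<m} \<subseteq> {..<?N}"
    using n by (auto simp: idx_def m_def inj_on_def split: if_splits)
  have idx_surj: "l \<in> idx ` {..<m}" if "l < ?N" "l \<noteq> 0" "l \<noteq> n" for l
  proof (cases "l < n")
    case True
    then show ?thesis using that n by (intro image_eqI[of _ _ "l - 1"]) (auto simp: idx_def m_def)
  next
    case False
    then show ?thesis using that n by (intro image_eqI[of _ _ "l - 2"]) (auto simp: idx_def m_def)
  qed
  have idx0: "idx a \<noteq> 0" "idx a \<noteq> n" for a using n by (auto simp: idx_def split: if_splits)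
  have idxN: "a < m \<Longrightarrow> idx a < ?N" for a using idx(2) by auto
  define \<rho> where "\<rho> h = mat m m (\<lambda>(a, b). \<kappa> h $$ (idx a, idx b))" for h
  have hom: "\<rho> (h * k) = \<rho> h * \<rho> k" if "h \<in> B" "k \<in> B" for h k
    unfolding \<rho>_def \<kappa>m[OF that]
  proof (rule submatrix_mult[OF \<kappa>c \<kappa>c idx])
    fix a b l assume ab: "a < m" "b < m" "l < ?N" "l \<notin> idx ` {..<m}"
    then have "l = 0 \<or> l = n" using idx_surj by blast
    then show "\<kappa> h $$ (idx a, l) * \<kappa> k $$ (l, idx b) = 0"
      using col0[OF that(1) idxN[OF ab(1)]] rown[OF that(2) idxN[OF ab(2)]] idx0 by auto
  qed
  have "\<exists>u\<in>carrier_vec m. u \<noteq> 0\<^sub>v m \<and> (\<forall>h\<in>B. \<exists>c. \<rho> h *\<^sub>v u = c \<cdot>\<^sub>v u)"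
  proof (rule lie_kolchin[OF BD(1,2) d])
    show "m > 0" using n by (simp add: m_def)
    show "\<rho> (1\<^sub>m ?N) = 1\<^sub>m m"
    proof -
      have "1\<^sub>m ?N \<in> B" using subgroup.one_closed[OF BD(1)] by (simp add: Sp_one)
      then have "\<kappa> (1\<^sub>m ?N) = 1\<^sub>m ?N" using \<kappa>eq[of "1\<^sub>m ?N"] g(1) G.r_inv[OF g(1)] G.r_one[OF g(1)]
        by (simp add: Sp_one)
      then show ?thesis using idxN inj_onD[OF idx(1)] by (intro eq_matI) (auto simp: \<rho>_def)
    qed
  qed (use hom \<kappa>p idxN in \<open>auto simp: \<rho>_def\<close>)
  then obtain u where u: "u \<in> carrier_vec m" "u \<noteq> 0\<^sub>v m" "\<And>h. h \<in> B \<Longrightarrow> \<exists>c. \<rho> h *\<^sub>v u = c \<cdot>\<^sub>v u" by blast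
  \<comment> \<open>A lift of \<open>u\<close>: coordinate \<open>n\<close> is 0 for orthogonality
    to \<open>?e\<close>, and coordinate \<open>0\<close> is a choice of representative modulo
    \<open>?e\<close>.\<close>
  define q' where "q' = vec ?N (\<lambda>i. if i = 0 \<or>
    i = n then 0 else u $ (if i < n then i - 1 else i - 2))"
  have q'V: "q' \<in> V" by (simp add: q'_def)
  have q'0: "q' $ 0 = 0" "q' $ n = 0" using n by (auto simp: q'_def)
  have q'idx: "q' $ idx a = u $ a" if "a < m" for a
    using idxN[OF that] idx0[of a] n by (auto simp: q'_def idx_def)
  have stable: "\<exists>c e. \<kappa> h *\<^sub>v q' = c \<cdot>\<^sub>v q' + e \<cdot>\<^sub>v ?e" if h: "h \<in> B" for h
  proof -
    obtain c where c: "\<rho> h *\<^sub>v u = c \<cdot>\<^sub>v u" using u(3)[OF h] by blast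
    have sum: "(\<kappa> h *\<^sub>v q') $ i = (\<Sum>b<m. \<kappa> h $$ (i, idx b) * u $ b)" if i: "i < ?N" for i
    proof -
      have "(\<kappa> h *\<^sub>v q') $ i = (\<Sum>l<?N. \<kappa> h $$ (i, l) * q' $ l)"
        using carrier_matD[OF \<kappa>c[of h]] carrier_vecD[OF q'V] i
          by (simp add: scalar_prod_def lessThan_atLeast0)
      also have "\<dots> = (\<Sum>l\<in>idx ` {..<m}. \<kappa> h $$ (i, l) * q' $ l)"
        using idx(2) idx_surj q'0 by (intro sum.mono_neutral_right) auto
      also have "\<dots> = (\<Sum>b<m. \<kappa> h $$ (i, idx b) * u $ b)"
        using idx(1) q'idx by (simp add: sum.reindex)
      finally show ?thesis .
    qed
    have "\<kappa> h *\<^sub>v q' = c \<cdot>\<^sub>v q' + ((\<kappa> h *\<^sub>v q') $ 0) \<cdot>\<^sub>v ?e"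
    proof (rule eq_vecI)
      fix i assume "i < dim_vec (c \<cdot>\<^sub>v q' + ((\<kappa> h *\<^sub>v q') $ 0) \<cdot>\<^sub>v ?e)"
      then have i: "i < ?N" by simp
      have rhs: "(c \<cdot>\<^sub>v q' + ((\<kappa> h *\<^sub>v q') $ 0) \<cdot>\<^sub>v ?e) $ i = c * q' $ i + (if i =
        0 then (\<kappa> h *\<^sub>v q') $ 0 else 0)"
        using i carrier_vecD[OF q'V] by (simp add: unit_vec_def del: index_mult_mat_vec)
      consider "i = 0" | "i = n" "i \<noteq> 0" | a where "a < m" "i = idx a"
        using idx_surj[OF i] by blast
      then show "(\<kappa> h *\<^sub>v q') $ i = (c \<cdot>\<^sub>v q' + ((\<kappa> h *\<^sub>v q') $ 0) \<cdot>\<^sub>v ?e) $ i"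
      proof cases
        case 1
        then show ?thesis unfolding rhs using q'0 by simp
      next
        case 2
        then show ?thesis unfolding rhs sum[OF i] using q'0 rown[OF h idxN] idx0 by simp
      next
        case (3 a)
        have "(\<rho> h *\<^sub>v u) $ a = (\<Sum>b<m. \<kappa> h $$ (i, idx b) * u $ b)"
          using 3 u(1) by (simp add: \<rho>_def scalar_prod_def lessThan_atLeast0)
        then show ?thesis unfolding rhs sum[OF i] using c 3 u(1) q'idx[OF 3(1)] idx0[of a] by simp
      qed
    qed (use \<kappa>c[of h] in auto)
    then show ?thesis by blast
  qed
  define q where "q = ?gi *\<^sub>v q'"
  have qV: "q \<in> V" using gi q'V by (simp add: q_def)
  have gq: "g *\<^sub>v q = q'" using g q'V by (simp add: q_def)
  show thesis
  proof (rule that[of p q])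
    have "bil p q = bil ?e q'" using bil_Sp[OF g(1) p(1) qV] g gq by simp
    also have "\<dots> = 0" using bil_unit_0[OF _ q'V] n q'0 by simp
    finally have "bil p q = 0" .
    moreover have "q \<noteq> c \<cdot>\<^sub>v p" for c
    proof
      assume "q = c \<cdot>\<^sub>v p"
      then have q': "q' = c \<cdot>\<^sub>v ?e" using gq g p by (simp add: Sp_app_smult)
      have "u $ a = 0" if "a < m" for a
        using q'idx[OF that] idx0[of a] idxN[OF that] unfolding q' by (simp add: unit_vec_def)
      then have "u = 0\<^sub>v m" using u(1) by (intro eq_vecI) auto
      then show False using u(2) by simp
    qed
    ultimately show "isotropic_pair p q" using p qV by (simp add: isotropic_pair_def)
    fix b assume b: "b \<in> B"
    show "\<exists>a. b *\<^sub>v p = a \<cdot>\<^sub>v p" by (rule p(3)[OF b])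
    obtain c e' where "\<kappa> b *\<^sub>v q' = c \<cdot>\<^sub>v q' + e' \<cdot>\<^sub>v ?e" using stable[OF b] by blast
    then have "g *\<^sub>v (b *\<^sub>v q) = c \<cdot>\<^sub>v q' + e' \<cdot>\<^sub>v ?e" using \<kappa>app[OF b q'V] by (simp add: q_def)
    then have "b *\<^sub>v q = ?gi *\<^sub>v (c \<cdot>\<^sub>v q' + e' \<cdot>\<^sub>v ?e)"
      using g(1) BG[OF b] qV by (metis Sp_inv_app(1) Sp_vec)
    also have "\<dots> = c \<cdot>\<^sub>v q + e' \<cdot>\<^sub>v p"
      using gi q'V e by (simp add: Sp_app_add Sp_app_smult q_def)
    finally show "\<exists>d e. b *\<^sub>v q = d \<cdot>\<^sub>v q + e \<cdot>\<^sub>v p" by blast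
  qed
qed

theorem spherical_imp_involution:
  assumes n: "n \<ge> 2" and C: "C \<in> conjugacy_classes G" and uni: "\<forall>x\<in>C. unipotent (2 * n) x"
    and sph: "spherical (2 * n) G C" and y: "y \<in> C"
  shows "y * y = 1\<^sub>m (2 * n)"
proof -
  obtain B x where B: "borel_subgroup (2 * n) G B" and x: "x \<in> C"
    and cl: "(subtopology (zariski (2 * n)) C) closure_of ((\<lambda>b. b * x * inv\<^bsub>G\<^esub> b) ` B) = C"
    using sph unfolding spherical_def orbit_conjugation by blast
  have ccs: "closed_connected_solvable (2 * n) G B" using B by (simp add: borel_subgroup_def)
  note BD = closed_connected_solvableD[OF ccs]
  have BG: "B \<subseteq> carrier G" using BD(1) by (rule subgroup.subset)
  note Cx = conjugacy_class_eq[OF C x]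
  have CN: "C \<subseteq> carrier_mat (2 * n) (2 * n)" using conjugacy_class_eq(1)[OF C] Sp_carrier by blast
  have "(\<lambda>b. b * x * inv\<^bsub>G\<^esub> b) ` B \<subseteq> C" using BG by (subst Cx(2)) blast
  note dense = closure_of_eq_iff[OF this CN, THEN iffD1, OF cl]
  obtain p q where pq: "isotropic_pair p q" and flag: "\<And>b. b \<in> B \<Longrightarrow> \<exists>a. b *\<^sub>v p = a \<cdot>\<^sub>v p"
    "\<And>b. b \<in> B \<Longrightarrow> \<exists>d e. b *\<^sub>v q = d \<cdot>\<^sub>v q + e \<cdot>\<^sub>v p"
    using borel_flag[OF ccs n] by blast
  have xx: "x * x = 1\<^sub>m (2 * n)"
  proof (rule dense_orbit_imp_involution[OF Cx(1) _ BG subgroup.m_inv_closed[OF BD(1)] pq flag])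
    show "unipotent (2 * n) x" using uni x by blast
    fix f g assume "f \<in> poly_funs (2 * n)" "\<And>b. b \<in> B \<Longrightarrow> f (b * x * inv\<^bsub>G\<^esub> b) = 0" "g \<in> carrier G"
    moreover have "g * x * inv\<^bsub>G\<^esub> g \<in> C" using \<open>g \<in> carrier G\<close> by (subst Cx(2)) blast
    ultimately show "f (g * x * inv\<^bsub>G\<^esub> g) = 0" using dense by blast
  qed
  obtain g where g: "g \<in> carrier G" "y = g \<otimes>\<^bsub>G\<^esub> x \<otimes>\<^bsub>G\<^esub> inv\<^bsub>G\<^esub> g"
    using y Cx(2) by (auto simp: Sp_mult)
  have "y \<otimes>\<^bsub>G\<^esub> y = g \<otimes>\<^bsub>G\<^esub> (x \<otimes>\<^bsub>G\<^esub> x) \<otimes>\<^bsub>G\<^esub> inv\<^bsub>G\<^esub> g"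
    unfolding g(2) using g(1) Cx(1) by (simp add: G.m_assoc) (simp add: G.m_assoc[symmetric])
  also have "x \<otimes>\<^bsub>G\<^esub> x = \<one>\<^bsub>G\<^esub>" using xx by (simp add: Sp_mult Sp_one)
  also have "g \<otimes>\<^bsub>G\<^esub> \<one>\<^bsub>G\<^esub> \<otimes>\<^bsub>G\<^esub> inv\<^bsub>G\<^esub> g = \<one>\<^bsub>G\<^esub>" using g(1) by simp
  finally show ?thesis by (simp only: Sp_mult Sp_one)
qed

end

text \<open>Row \<open>i\<close> of \<open>a\<^sup>T * d\<close> involves only the rows of
  \<open>d\<close> up to \<open>i\<close>, and by induction the earlier ones vanish in the columns
  from \<open>i\<close> on. What remains is \<open>a $$ (i, i) * d $$ (i, j)\<close>; column
  \<open>j = i\<close> shows that the first factor is nonzero.\<close>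

lemma lower_triangular_of_upper:
  fixes a d :: "'k::field mat"
  assumes a: "a \<in> carrier_mat m m" and d: "d \<in> carrier_mat m m"
    and up: "\<And>i j. j < i \<Longrightarrow> i < m \<Longrightarrow> a $$ (i, j) = 0" and ad: "a\<^sup>T * d = 1\<^sub>m m"
    and ij: "i < j" "j < m"
  shows "d $$ (i, j) = 0"
proof -
  have row: "(\<Sum>k\<le>i. a $$ (k, i) * d $$ (k, j)) = (if i = j then 1 else 0)" if "i < m" "j < m"
    for i j
  proof -
    have "(if i = j then 1 else 0) = (a\<^sup>T * d) $$ (i, j)" using that by (simp add: ad)
    also have "\<dots> = (\<Sum>k<m. a $$ (k, i) * d $$ (k, j))"
      using a d that by (simp add: scalar_prod_def lessThan_atLeast0)
    also have "\<dots> = (\<Sum>k\<le>i. a $$ (k, i) * d $$ (k, j))"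
      using that up by (intro sum.mono_neutral_right) auto
    finally show ?thesis by simp
  qed
  have "\<forall>j<m. i < j \<longrightarrow> d $$ (i, j) = 0" if "i < m" for i
    using that
  proof (induction i rule: less_induct)
    case (less i)
    have split: "(\<Sum>k\<le>i. a $$ (k, i) * d $$ (k, j)) = a $$ (i, i) * d $$ (i, j)" if j: "i \<le> j"
      "j < m" for j
    proof -
      have "d $$ (k, j) = 0" if "k < i" for k using less that j by auto
      then have "(\<Sum>k\<in>{..i} - {i}. a $$ (k, i) * d $$ (k, j)) = 0" by (intro sum.neutral) auto
      then show ?thesis by (simp add: sum.remove[of "{..i}" i])
    qed
    have "a $$ (i, i) * d $$ (i, i) = 1" using row[of i i] split[of i] less.prems by simp
    then have "a $$ (i, i) \<noteq> 0" by auto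
    moreover have "a $$ (i, i) * d $$ (i, j) = 0" if "i < j" "j < m" for j
      using row[of i j] split[of j] less.prems that by simp
    ultimately show ?case by auto
  qed
  then show ?thesis using ij by auto
qed

section \<open>The standard Borel subgroup\<close>

context symplectic_char2
begin

text \<open>Position of a basis vector in the ordering \<open>e\<^sub>1, \<dots>, e\<^sub>n, f\<^sub>n, \<dots>, f\<^sub>1\<close>, for which the
  elements of the standard Borel subgroup are upper triangular.\<close>

definition rk :: "nat \<Rightarrow> nat" where
  "rk i = (if i < n then i else 3 * n - 1 - i)"

text \<open>The index of the dual basis vector with respect to \<open>J\<close>. Passing to it
  reverses \<open>rk\<close>, which is why inversion in the symplectic group preserves
  triangularity.\<close>

definition flip :: "nat \<Rightarrow> nat" where
  "flip i = (if i < n then i + n else i - n)"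

lemma flip_simps: "i < 2 * n \<Longrightarrow> flip i < 2 * n" "i < 2 * n \<Longrightarrow> flip (flip i) = i"
  by (auto simp: flip_def)

lemma rk_flip: "i < 2 * n \<Longrightarrow> rk (flip i) = 2 * n - 1 - rk i"
  by (auto simp: flip_def rk_def)

lemma rk_less: "i < 2 * n \<Longrightarrow> rk i < 2 * n"
  by (auto simp: rk_def)

lemma rk_inj: "i < 2 * n \<Longrightarrow> j < 2 * n \<Longrightarrow> rk i = rk j \<Longrightarrow> i = j"
  by (auto simp: rk_def split: if_splits)

lemma J_entry: "i < 2 * n \<Longrightarrow> j < 2 * n \<Longrightarrow> J $$ (i, j) = (if j = flip i then 1 else 0)"
  by (auto simp: J_eq flip_def)

lemma inv_entry:
  assumes A: "A \<in> carrier G" and i: "i < 2 * n" and j: "j < 2 * n"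
  shows "(inv\<^bsub>G\<^esub> A) $$ (i, j) = A $$ (flip j, flip i)"
proof -
  note Ac = Sp_carrier[OF A]
  have 1: "(J * A\<^sup>T) $$ (i, l) = A $$ (l, flip i)" if l: "l < 2 * n" for l
  proof -
    have "(J * A\<^sup>T) $$ (i, l) = (\<Sum>k<2 * n. J $$ (i, k) * A $$ (l, k))"
      using Ac i l carrier_matD[OF J_carrier] by (simp add: scalar_prod_def lessThan_atLeast0)
    also have "\<dots> = (\<Sum>k<2 * n. if k = flip i then A $$ (l, k) else 0)"
      using i by (intro sum.cong) (auto simp: J_entry)
    finally show ?thesis using flip_simps(1)[OF i] by simp
  qed
  have JA: "J * A\<^sup>T \<in> carrier_mat (2 * n) (2 * n)" using Ac by (intro mult_square_carrier) auto
  have "(J * A\<^sup>T * J) $$ (i, j) = (\<Sum>k<2 * n. (J * A\<^sup>T) $$ (i, k) * J $$ (k, j))"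
    using carrier_matD[OF JA] i j carrier_matD[OF J_carrier]
    by (simp add: scalar_prod_def lessThan_atLeast0 del: index_mult_mat(1)) (simp add:
      scalar_prod_def)
  also have "\<dots> = (\<Sum>k<2 * n. if k = flip j then A $$ (k, flip i) else 0)"
    using j 1 flip_simps by (intro sum.cong) (auto simp: J_entry)
  finally show ?thesis using flip_simps(1)[OF j] Sp_inv[OF A] by simp
qed

definition std_borel :: "'k mat set" where
  "std_borel = {A \<in> carrier G. \<forall>i<2 * n. \<forall>j<2 * n. rk j < rk i \<longrightarrow> A $$ (i, j) = 0}"

text \<open>With \<open>c = 0\<close> the symplectic relations give
  \<open>a\<^sup>T * d = 1\<close>, so the block \<open>d\<close> inherits its triangular shape from
  \<open>a\<close>.\<close>

lemma std_borel_block_iff: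
  assumes c: "a \<in> carrier_mat n n" "b \<in> carrier_mat n n" "c \<in> carrier_mat n n" "d \<in> carrier_mat n n"
    and A: "four_block_mat a b c d \<in> carrier G"
  shows "four_block_mat a b c d \<in> std_borel \<longleftrightarrow>
    c = 0\<^sub>m n n \<and> (\<forall>i<n. \<forall>j<i. a $$ (i, j) = 0)" (is "_ \<in> _ \<longleftrightarrow> ?R")
proof
  let ?A = "four_block_mat a b c d"
  assume B: "?A \<in> std_borel"
  then have z: "?A $$ (i, j) = 0" if "i < 2 * n" "j < 2 * n" "rk j < rk i" for i j
    using that by (auto simp: std_borel_def)
  have "c $$ (i, j) = 0" if "i < n" "j < n" for i j
    using z[of "i + n" j] c that by (auto simp: rk_def)
  moreover have "a $$ (i, j) = 0" if "i < n" "j < i" for i j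
    using z[of i j] c that by (auto simp: rk_def)
  ultimately show ?R using c by auto
next
  let ?A = "four_block_mat a b c d"
  assume R: ?R
  have "c\<^sup>T * b = 0\<^sub>m n n" using R c by auto
  then have "a\<^sup>T * d = 1\<^sub>m n"
    using A Sp_four_block_iff[OF c] c by (auto simp: right_add_zero_mat[of _ n n])
  then have "d $$ (i, j) = 0" if "i < j" "j < n" for i j
    using lower_triangular_of_upper[OF c(1,4) _ _ that] R by auto
  then have "?A $$ (i, j) = 0" if "i < 2 * n" "j < 2 * n" "rk j < rk i" for i j
    using that c R by (auto simp: rk_def split: if_splits)
  then show "?A \<in> std_borel" using A by (auto simp: std_borel_def)
qed

text \<open>In the order \<open>rk\<close>, the matrices supported on or above the
  \<open>l\<close>-th superdiagonal: a filtration whose levels add up under multiplication.\<close>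

definition raises :: "nat \<Rightarrow> 'k mat \<Rightarrow> bool" where
  "raises l M \<longleftrightarrow> (\<forall>i<2 * n. \<forall>j<2 * n. rk j < rk i + l \<longrightarrow> M $$ (i, j) = 0)"

lemma raises_add:
  "A \<in> carrier_mat (2 * n) (2 * n) \<Longrightarrow> B \<in> carrier_mat (2 * n) (2 * n) \<Longrightarrow> raises l A \<Longrightarrow> raises l B \<Longrightarrow>
    raises l (A + B)"
  by (auto simp: raises_def)

lemma raises_mono: "raises l A \<Longrightarrow> k \<le> l \<Longrightarrow> raises k A"
  by (auto simp: raises_def)

lemma raises_mult:
  assumes c: "A \<in> carrier_mat (2 * n) (2 * n)" "B \<in> carrier_mat (2 * n) (2 * n)"
    and "raises l A" "raises k B"
  shows "raises (l + k) (A * B)"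
  unfolding raises_def
proof (intro allI impI)
  fix i j assume ij: "i < 2 * n" "j < 2 * n" "rk j < rk i + (l + k)"
  have "A $$ (i, s) * B $$ (s, j) = 0" if s: "s < 2 * n" for s
  proof (cases "rk s < rk i + l")
    case True
    then show ?thesis using assms(3) ij s by (simp add: raises_def)
  next
    case False
    then have "rk j < rk s + k" using ij(3) by simp
    then show ?thesis using assms(4) ij s by (simp add: raises_def)
  qed
  moreover have "(A * B) $$ (i, j) = (\<Sum>s<2 * n. A $$ (i, s) * B $$ (s, j))"
    using c ij by (simp add: scalar_prod_def lessThan_atLeast0)
  ultimately show "(A * B) $$ (i, j) = 0" by (auto intro!: sum.neutral)
qed

lemma two_eq_0: "2 = (0 :: 'k)"
  using add_self[of 1] by (simp add: one_add_one)

text \<open>\<open>A + 1\<close> is \<open>A - 1\<close> in characteristic 2. These subgroups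
  descend from \<open>std_borel\<close> at \<open>l = 0\<close> to the trivial group at
  \<open>l = 2 * n\<close> and bound the derived series.\<close>

definition unip :: "nat \<Rightarrow> 'k mat set" where
  "unip l = {A \<in> carrier G. raises l (A + 1\<^sub>m (2 * n))}"

lemma raises_0_add_one:
  assumes "A \<in> carrier_mat (2 * n) (2 * n)"
  shows "raises 0 (A + 1\<^sub>m (2 * n)) \<longleftrightarrow> raises 0 A"
proof -
  have "(A + 1\<^sub>m (2 * n)) $$ (i, j) = A $$ (i, j)" if "i < 2 * n" "j < 2 * n" "rk j < rk i" for i j
    using that assms by (cases "i = j") auto
  then show ?thesis unfolding raises_def by auto
qed

lemma unip_0: "unip 0 = std_borel"
proof -
  have "raises 0 (A + 1\<^sub>m (2 * n)) \<longleftrightarrow> (\<forall>i<2 * n. \<forall>j<2 * n. rk j < rk i \<longrightarrow> A $$ (i, j) = 0)"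
    if "A \<in> carrier G" for A
    using raises_0_add_one[OF Sp_carrier[OF that]] by (simp add: raises_def)
  then show ?thesis by (auto simp: unip_def std_borel_def)
qed

lemma mat_char2_expand:
  fixes A B :: "'k mat"
  assumes "A \<in> carrier_mat m m" "B \<in> carrier_mat m m"
  shows "A * B = (A + 1\<^sub>m m) * (B + 1\<^sub>m m) + (A + 1\<^sub>m m) + (B + 1\<^sub>m m) + 1\<^sub>m m"
proof -
  have "(A + 1\<^sub>m m) * (B + 1\<^sub>m m) = (A * B + A) + (B + 1\<^sub>m m)"
    using assms by (subst add_mult_distrib_mat[of _ m m _ _ m], simp_all)
      (subst mult_add_distrib_mat[of _ m m _ m], simp_all)
  then show ?thesis using assms by (intro eq_matI) (auto simp: algebra_simps add_self add_left_self)
qed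

lemma subgroup_unip: "subgroup (unip l) G"
proof (rule G.subgroupI)
  let ?I = "1\<^sub>m (2 * n) :: 'k mat"
  show "unip l \<subseteq> carrier G" by (auto simp: unip_def)
  have "?I \<in> unip l" using G.one_closed by (auto simp: unip_def Sp_one raises_def add_self)
  then show "unip l \<noteq> {}" by blast
  fix A assume A: "A \<in> unip l"
  then have AG: "A \<in> carrier G" and Ar: "raises l (A + ?I)" by (auto simp: unip_def)
  note Ac = Sp_carrier[OF AG]
  have ic: "inv\<^bsub>G\<^esub> A \<in> carrier_mat (2 * n) (2 * n)" using AG Sp_carrier by simp
  \<comment> \<open>An entry of the inverse is the entry of \<open>A\<close> at the flipped and
    swapped position, where the difference of ranks is the same.\<close>
  have "raises l (inv\<^bsub>G\<^esub> A + ?I)"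
    unfolding raises_def
  proof (intro allI impI)
    fix i j assume ij: "i < 2 * n" "j < 2 * n" "rk j < rk i + l"
    have f: "flip i < 2 * n" "flip j < 2 * n" using ij flip_simps by auto
    have "rk (flip i) < rk (flip j) + l" using ij rk_flip rk_less[of i] rk_less[of j] by auto
    then have "(A + ?I) $$ (flip j, flip i) = 0" using Ar f by (simp add: raises_def)
    moreover have "flip j = flip i \<longleftrightarrow> i = j" using ij flip_simps(2) by metis
    ultimately show "(inv\<^bsub>G\<^esub> A + ?I) $$ (i, j) = 0"
      using f ij Ac inv_entry[OF AG ij(1,2)] by auto
  qed
  then show "inv\<^bsub>G\<^esub> A \<in> unip l" using AG by (simp add: unip_def)
  fix B assume B: "B \<in> unip l"
  then have BG: "B \<in> carrier G" and Br: "raises l (B + ?I)" by (auto simp: unip_def)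
  note Bc = Sp_carrier[OF BG]
  have c: "A + ?I \<in> carrier_mat (2 * n) (2 * n)" "B + ?I \<in> carrier_mat (2 * n) (2 * n)"
    using Ac Bc by auto
  have "A * B + ?I = (A + ?I) * (B + ?I) + (A + ?I) + (B + ?I)"
    using Ac Bc mult_square_carrier[OF c]
    by (subst mat_char2_expand[OF Ac Bc]) (intro eq_matI, auto simp: add.assoc two_eq_0)
  moreover have "raises l ((A + ?I) * (B + ?I) + (A + ?I) + (B + ?I))"
    using raises_add[OF _ c(2) raises_add[OF mult_square_carrier[OF c] c(1)
      raises_mono[OF raises_mult[OF c Ar Br], of l] Ar] Br] c mult_square_carrier[OF c] by simp
  ultimately show "A \<otimes>\<^bsub>G\<^esub> B \<in> unip l"
    using G.m_closed[OF AG BG] by (simp add: unip_def Sp_mult)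
qed

text \<open>With \<open>g = 1 + a\<close> and \<open>h = 1 + b\<close> one has
  \<open>g h - h g = a b - b a\<close>, and the commutator minus 1 is this matrix times
  \<open>(h g)^-1\<close>. Products lie in level \<open>2 * l\<close>, which suffices for
  \<open>l > 0\<close>. For \<open>l = 0\<close> the diagonal of \<open>a b - b a\<close> vanishes,
  because triangular matrices multiply entrywise on the diagonal.\<close>

lemma derived_unip: "derived G (unip l) \<subseteq> unip (Suc l)"
  unfolding derived_def
proof (rule G.generate_subgroup_incl[OF _ subgroup_unip])
  let ?I = "1\<^sub>m (2 * n) :: 'k mat"
  show "derived_set G (unip l) \<subseteq> unip (Suc l)"
  proof (intro UN_least)
    fix g h assume g: "g \<in> unip l" and h: "h \<in> unip l"
    have gG: "g \<in> carrier G" and hG: "h \<in> carrier G" using g h by (auto simp: unip_def)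
    note gc = Sp_carrier[OF gG] and hc = Sp_carrier[OF hG]
    let ?a = "g + ?I" and ?b = "h + ?I"
    have ab: "?a \<in> carrier_mat (2 * n) (2 * n)" "?b \<in> carrier_mat (2 * n) (2 * n)"
      using gc hc by auto
    have r: "raises l ?a" "raises l ?b" using g h by (auto simp: unip_def)
    have abc: "?a * ?b \<in> carrier_mat (2 * n) (2 * n)" "?b * ?a \<in> carrier_mat (2 * n) (2 * n)"
      using ab by (auto intro: mult_square_carrier)
    have com: "g * h + h * g = ?a * ?b + ?b * ?a"
      using mat_char2_expand[OF gc hc] mat_char2_expand[OF hc gc] abc gc hc
      by (simp only:) (intro eq_matI, auto simp: algebra_simps add_self add_left_self)
    have rc: "raises (Suc l) (?a * ?b + ?b * ?a)"
      unfolding raises_def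
    proof (intro allI impI)
      fix i j assume ij: "i < 2 * n" "j < 2 * n" "rk j < rk i + Suc l"
      have sum: "(?a * ?b + ?b * ?a) $$ (i, j) = (?a * ?b) $$ (i, j) + (?b * ?a) $$ (i, j)"
        using ij abc by simp
      show "(?a * ?b + ?b * ?a) $$ (i, j) = 0"
      proof (cases "rk j < rk i + (l + l)")
        case True
        then show ?thesis unfolding sum
          using raises_mult[OF ab r] raises_mult[OF ab(2,1) r(2,1)] ij by (simp add: raises_def)
      next
        case False
        then have l: "l = 0" "rk i = rk j" using ij(3) by auto
        then have eq: "i = j" using rk_inj ij by blast
        have diag: "(M * N) $$ (i, i) = M $$ (i, i) * N $$ (i, i)"
          if M: "M \<in> carrier_mat (2 * n) (2 * n)" "raises 0 M"
            and N: "N \<in> carrier_mat (2 * n) (2 * n)" "raises 0 N"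
          for M N
        proof -
          have "(M * N) $$ (i, i) = (\<Sum>s<2 * n. M $$ (i, s) * N $$ (s, i))"
            using M N ij by (simp add: scalar_prod_def lessThan_atLeast0)
          also have "\<dots> = (\<Sum>s<2 * n. if s = i then M $$ (i, i) * N $$ (i, i) else 0)"
          proof (intro sum.cong refl)
            fix s assume "s \<in> {..<2 * n}"
            then have s: "s < 2 * n" by simp
            then have "s = i \<or> rk s < rk i \<or> rk i < rk s" using rk_inj[OF s ij(1)] by force
            then show "M $$ (i, s) * N $$ (s, i) = (if s = i then M $$ (i, i) * N $$ (i, i) else 0)"
              using M(2) N(2) s ij(1) by (auto simp: raises_def)
          qed
          finally show ?thesis using ij by simp
        qed
        show ?thesis unfolding sum unfolding eq[symmetric]
          using diag[OF ab(1) _ ab(2)] diag[OF ab(2) _ ab(1)] r l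
            by (simp add: mult.commute add_self)
      qed
    qed
    let ?gi = "inv\<^bsub>G\<^esub> g" and ?hi = "inv\<^bsub>G\<^esub> h"
    let ?c = "g \<otimes>\<^bsub>G\<^esub> h \<otimes>\<^bsub>G\<^esub> ?gi \<otimes>\<^bsub>G\<^esub> ?hi"
    have "?gi \<otimes>\<^bsub>G\<^esub> ?hi \<in> unip l"
      using subgroup.m_closed[OF subgroup_unip] subgroup.m_inv_closed[OF subgroup_unip] g h by blast
    then have ki: "raises 0 (?gi * ?hi + ?I)" and kG: "?gi * ?hi \<in> carrier G"
      using raises_mono by (auto simp: unip_def Sp_mult)
    note kc = Sp_carrier[OF kG]
    have k0: "raises 0 (?gi * ?hi)" using ki raises_0_add_one[OF kc] by simp
    have cG: "?c \<in> carrier G" using gG hG by simp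
    have hg: "h * g * (?gi * ?hi) = ?I"
    proof -
      have "h \<otimes>\<^bsub>G\<^esub> g \<otimes>\<^bsub>G\<^esub> (?gi \<otimes>\<^bsub>G\<^esub> ?hi) = \<one>\<^bsub>G\<^esub>"
        using gG hG by (simp add: G.m_assoc) (simp add: G.m_assoc[symmetric])
      then show ?thesis by (simp add: Sp_mult Sp_one)
    qed
    have "?c = g * h * (?gi * ?hi)" using gG hG by (simp add: G.m_assoc Sp_mult[symmetric])
    then have "?c + ?I = (g * h + h * g) * (?gi * ?hi)"
      using add_mult_distrib_mat[OF mult_square_carrier[OF gc hc] mult_square_carrier[OF hc gc]
        kc] hg by simp
    then have "raises (Suc l) (?c + ?I)"
      using raises_mult[OF _ kc rc k0] abc com by simp
    then show "{?c} \<subseteq> unip (Suc l)" using cG by (simp add: unip_def)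
  qed
qed

lemma subgroup_std_borel: "subgroup std_borel G"
  using subgroup_unip[of 0] by (simp add: unip_0)

lemma solvable_std_borel: "solvable (G\<lparr>carrier := std_borel\<rparr>)"
proof -
  let ?H = "G\<lparr>carrier := std_borel\<rparr>"
  interpret H: group ?H by (rule subgroup.subgroup_is_group[OF subgroup_std_borel G.group_axioms])
  have *: "(derived ?H ^^ k) std_borel \<subseteq> unip k \<and> (derived ?H ^^ k) std_borel \<subseteq> std_borel" for k
  proof (induction k)
    case 0
    show ?case by (simp add: unip_0)
  next
    case (Suc k)
    have "derived ?H ((derived ?H ^^ k) std_borel) = derived G ((derived ?H ^^ k) std_borel)"
      using G.derived_consistent[OF _ subgroup_std_borel] Suc by blast
    moreover have "\<dots> \<subseteq> derived G (unip k)" using Suc by (intro G.mono_derived) blast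
    moreover have "derived G ((derived ?H ^^ k) std_borel) \<subseteq> std_borel"
      using Suc by (intro G.derived_incl[OF _ subgroup_std_borel]) blast
    ultimately show ?case using derived_unip[of k] by auto
  qed
  have "unip (2 * n) \<subseteq> {\<one>\<^bsub>G\<^esub>}"
  proof
    fix A assume "A \<in> unip (2 * n)"
    then have A: "A \<in> carrier_mat (2 * n) (2 * n)" "raises (2 * n) (A + 1\<^sub>m (2 * n))"
      using Sp_carrier by (auto simp: unip_def)
    have "(A + 1\<^sub>m (2 * n)) $$ (i, j) = 0" if "i < 2 * n" "j < 2 * n" for i j
      using A(2) that rk_less[OF that(2)] by (simp add: raises_def)
    then have "A + 1\<^sub>m (2 * n) = 0\<^sub>m (2 * n) (2 * n)" using A(1) by (intro eq_matI) auto
    then show "A \<in> {\<one>\<^bsub>G\<^esub>}" using mat_add_eq_0_iff[OF A(1), of "1\<^sub>m (2 * n)"] by (simp add: Sp_one)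
  qed
  moreover have "subgroup ((derived ?H ^^ (2 * n)) std_borel) ?H"
    using H.exp_of_derived_is_subgroup[OF H.subgroup_self, of "2 * n"] by simp
  then have "\<one>\<^bsub>G\<^esub> \<in> (derived ?H ^^ (2 * n)) std_borel" using subgroup.one_closed by fastforce
  ultimately have "(derived ?H ^^ (2 * n)) std_borel = {\<one>\<^bsub>G\<^esub>}" using * by blast
  then show ?thesis unfolding H.solvable_iff_trivial_derived_seq by auto
qed

lemma closedin_std_borel: "closedin (subtopology (zariski (2 * n)) (carrier G)) std_borel"
proof -
  let ?P = "{(\<lambda>A. A $$ (i, j)) | i j. i < 2 * n \<and> j < 2 * n \<and> rk j < rk i} :: ('k mat \<Rightarrow> 'k) set"
  have "?P \<subseteq> poly_funs (2 * n)" by (auto intro: poly_funs.entry)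
  then have "closedin (zariski (2 * n)) (zero_locus (2 * n) ?P)" unfolding closedin_zariski by blast
  moreover have "std_borel = zero_locus (2 * n) ?P \<inter> carrier G"
    using Sp_carrier by (auto simp: std_borel_def zero_locus_def)
  ultimately show ?thesis unfolding closedin_subtopology by blast
qed

lemma upper_unipotent_in_Sp:
  assumes Y: "Y \<in> carrier_mat n n" "Y\<^sup>T = Y"
  shows "four_block_mat (1\<^sub>m n) Y (0\<^sub>m n n) (1\<^sub>m n) \<in> carrier G"
  using Y by (subst Sp_four_block_iff) (auto simp: right_add_zero_mat[of _ n n])

text \<open>Every element lies together with the identity on a rational curve inside the subgroup:
  its diagonal block \<open>a\<close> is deformed linearly to the identity, and its unipotent part
  is scaled down to the identity.\<close>

lemma connectedin_std_borel: "connectedin (zariski (2 * n)) std_borel"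
proof -
  let ?I = "1\<^sub>m n :: 'k mat" and ?O = "0\<^sub>m n n :: 'k mat"
  let ?\<C> = "{K. connectedin (zariski (2 * n)) K \<and> 1\<^sub>m (2 * n) \<in> K \<and> K \<subseteq> std_borel}"
  have "\<exists>K\<in>?\<C>. A \<in> K" if A: "A \<in> std_borel" for A
  proof -
    have AG: "A \<in> carrier G" using A by (simp add: std_borel_def)
    obtain a b c d where c: "a \<in> carrier_mat n n" "b \<in> carrier_mat n n" "c \<in> carrier_mat n n"
      "d \<in> carrier_mat n n" and Ab: "A = four_block_mat a b c d"
      using four_block_cases[OF Sp_carrier[OF AG]] by blast
    have c0: "c = ?O" and up: "\<And>i j. i < n \<Longrightarrow> j < i \<Longrightarrow> a $$ (i, j) = 0"
      using A std_borel_block_iff[OF c] AG unfolding Ab by auto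
    have rel: "b\<^sup>T * d = d\<^sup>T * b" "a\<^sup>T * d = ?I"
      using AG c Sp_four_block_iff[OF c] unfolding Ab c0
        by (auto simp: right_add_zero_mat[of _ n n])
    have da: "d\<^sup>T * a = ?I"
      using arg_cong[OF rel(2), of transpose_mat] c by (simp add: transpose_mult[of _ n n _ n])
    have ad: "a * d\<^sup>T = ?I" using mat_mult_left_right_inverse[OF _ c(1) da] c by simp
    \<comment> \<open>Since \<open>d\<^sup>T\<close> inverts \<open>a\<close>, this means
      \<open>b = a * Y\<close>. The symplectic relation says that \<open>Y\<close> is symmetric, a
      condition that scaling respects.\<close>
    define Y where "Y = d\<^sup>T * b"
    have Y: "Y \<in> carrier_mat n n" "Y\<^sup>T = Y"
      using c rel(1) by (auto simp: Y_def transpose_mult[of _ n n _ n])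
    define \<alpha> where "\<alpha> t = ?I + t \<cdot>\<^sub>m (a + ?I)" for t
    define \<delta> where "\<delta> t = det (\<alpha> t)" for t
    \<comment> \<open>The product of the block-diagonal element given by \<open>\<alpha> t\<close>
      and the upper unitriangular one with block \<open>t Y\<close>. Writing the inverse transpose
      with the adjugate leaves \<delta> as the only denominator.\<close>
    define \<gamma> where "\<gamma> t =
      four_block_mat (\<alpha> t) (\<alpha> t * (t \<cdot>\<^sub>m Y)) ?O (inverse (\<delta> t) \<cdot>\<^sub>m (adj_mat (\<alpha> t))\<^sup>T)" for t
    have \<alpha>p: "polymat n n \<alpha>" unfolding \<alpha>_def using c
      by (intro polymat_add polymat_const polymat_smult polyf_id) auto
    note \<alpha>c = polymat_carrier[OF \<alpha>p]
    note adjc = adj_mat(1)[OF \<alpha>c]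
    have \<delta>p: "\<delta> \<in> polyf" using polyf_det[OF \<alpha>p] by (simp add: \<delta>_def[abs_def])
    have \<alpha>Yp: "polymat n n (\<lambda>t. \<alpha> t * (t \<cdot>\<^sub>m Y))"
      using Y(1) by (intro polymat_mult[OF \<alpha>p] polymat_smult polyf_id polymat_const)
    have dc: "inverse (\<delta> t) \<cdot>\<^sub>m (adj_mat (\<alpha> t))\<^sup>T \<in> carrier_mat n n" for t using adjc by simp
    have \<gamma>c: "\<gamma> t \<in> carrier_mat (2 * n) (2 * n)" for t
      unfolding \<gamma>_def mult_2 using \<alpha>c dc by (intro four_block_carrier_mat)
    have ent: "\<exists>\<psi>\<in>polyf. \<forall>t. \<delta> t \<noteq> 0 \<longrightarrow> \<gamma> t $$ (i, j) * \<delta> t = \<psi> t" if ij: "i < 2 * n" "j < 2 * n"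
      for i j
    proof -
      define M where "M t =
        four_block_mat (\<delta> t \<cdot>\<^sub>m \<alpha> t) (\<delta> t \<cdot>\<^sub>m (\<alpha> t * (t \<cdot>\<^sub>m Y))) ?O ((adj_mat (\<alpha> t))\<^sup>T)" for t
      have "polymat (n + n) (n + n) M" unfolding M_def
        by (intro polymat_four_block polymat_smult \<delta>p \<alpha>p \<alpha>Yp polymat_const polymat_transpose
          polymat_adj_mat) simp
      then have "(\<lambda>t. M t $$ (i, j)) \<in> polyf" using polymat_entry ij by (metis mult_2)
      moreover have "\<gamma> t $$ (i, j) * \<delta> t = M t $$ (i, j)" if "\<delta> t \<noteq> 0" for t
        using ij that carrier_matD[OF \<alpha>c[of t]] carrier_matD[OF adjc[of t]] carrier_matD[OF Y(1)]
        by (auto simp: \<gamma>_def M_def simp del: index_mult_mat(1))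
      ultimately show ?thesis by (intro bexI[of _ "\<lambda>t. M t $$ (i, j)"]) auto
    qed
    let ?K = "\<gamma> ` {t. \<delta> t \<noteq> 0}"
    have con: "connectedin (zariski (2 * n)) ?K" by (rule connectedin_curve[OF \<delta>p \<gamma>c ent])
    have inB: "\<gamma> t \<in> std_borel" if t: "\<delta> t \<noteq> 0" for t
    proof -
      let ?d = "inverse (\<delta> t) \<cdot>\<^sub>m (adj_mat (\<alpha> t))\<^sup>T"
      have "(\<alpha> t)\<^sup>T * ?d = inverse (\<delta> t) \<cdot>\<^sub>m ((\<alpha> t)\<^sup>T * (adj_mat (\<alpha> t))\<^sup>T)"
        using \<alpha>c[of t] adjc[of t] by (simp add: mult_smult_distrib[of _ n n _ n])
      also have "(\<alpha> t)\<^sup>T * (adj_mat (\<alpha> t))\<^sup>T = (adj_mat (\<alpha> t) * \<alpha> t)\<^sup>T"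
        using \<alpha>c[of t] adjc[of t] by (simp add: transpose_mult[of _ n n _ n])
      also have "\<dots> = (\<delta> t \<cdot>\<^sub>m ?I)\<^sup>T" using adj_mat(3)[OF \<alpha>c[of t]] by (simp add: \<delta>_def)
      finally have ad: "(\<alpha> t)\<^sup>T * ?d = ?I" using t by (auto intro!: eq_matI)
      have tY: "t \<cdot>\<^sub>m Y \<in> carrier_mat n n" "(t \<cdot>\<^sub>m Y)\<^sup>T = t \<cdot>\<^sub>m Y"
        using Y by (auto simp: mat_eq_iff)
      have sym: "(\<alpha> t * (t \<cdot>\<^sub>m Y))\<^sup>T * ?d = t \<cdot>\<^sub>m Y"
        using \<alpha>c[of t] tY dc[of t] ad right_mult_one_mat[OF tY(1)]
        by (simp add: transpose_mult[of _ n n _ n] assoc_mult_square[of _ n])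
      have "?d\<^sup>T * (\<alpha> t * (t \<cdot>\<^sub>m Y)) = ((\<alpha> t * (t \<cdot>\<^sub>m Y))\<^sup>T * ?d)\<^sup>T"
        using \<alpha>c[of t] tY dc[of t] by (simp add: transpose_mult[of _ n n _ n] mult_square_carrier)
      then have "\<gamma> t \<in> carrier G" unfolding \<gamma>_def
        using \<alpha>c[of t] tY dc[of t] ad sym mult_square_carrier[OF \<alpha>c tY(1)]
        by (subst Sp_four_block_iff) (auto simp: right_add_zero_mat[of _ n n])
      moreover have "\<alpha> t $$ (i, j) = 0" if "i < n" "j < i" for i j
        using that c up by (simp add: \<alpha>_def)
      ultimately show ?thesis unfolding \<gamma>_def
        using std_borel_block_iff[OF \<alpha>c mult_square_carrier[OF \<alpha>c tY(1)] _ dc] by simp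
    qed
    have \<alpha>0: "\<alpha> 0 = ?I" and \<alpha>1: "\<alpha> 1 = a"
      using c by (auto simp: \<alpha>_def mat_eq_iff add_left_self add.commute two_eq_0)
    have "adj_mat ?I = ?I" using adj_mat(2)[of ?I n] adj_mat(1)[of ?I n] by (auto simp: mat_eq_iff)
    moreover have "?I * (0 \<cdot>\<^sub>m Y) = ?O" using Y by (auto simp: mat_eq_iff)
    moreover have "1 \<cdot>\<^sub>m ?I = ?I" by (auto simp: mat_eq_iff)
    ultimately have \<gamma>0: "\<gamma> 0 = 1\<^sub>m (2 * n)" using \<alpha>0 by (simp add: \<gamma>_def \<delta>_def mult_2)
    have \<delta>1: "\<delta> 1 \<noteq> 0" using det_mult[of "d\<^sup>T" n a] c da by (auto simp: \<delta>_def \<alpha>1)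
    have "adj_mat a = (d\<^sup>T * a) * adj_mat a" using da adj_mat(1)[OF c(1)] by simp
    also have "\<dots> = d\<^sup>T * (\<delta> 1 \<cdot>\<^sub>m ?I)"
      using c adj_mat(1,2)[OF c(1)] by (simp add: assoc_mult_square[of _ n] \<delta>_def \<alpha>1)
    also have "\<dots> = \<delta> 1 \<cdot>\<^sub>m d\<^sup>T" using c by (simp add: mult_smult_distrib[of _ n n _ n])
    finally have "inverse (\<delta> 1) \<cdot>\<^sub>m (adj_mat a)\<^sup>T = d" using \<delta>1 c by (auto simp: mat_eq_iff)
    moreover have "a * Y = b" unfolding Y_def
      using c ad by (simp add: assoc_mult_square[of _ n, symmetric] del: assoc_mult_mat)
    moreover have "1 \<cdot>\<^sub>m Y = Y" by (auto simp: mat_eq_iff)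
    ultimately have \<gamma>1: "\<gamma> 1 = A" using \<alpha>1 by (simp add: \<gamma>_def Ab c0)
    have "\<delta> 0 \<noteq> 0" by (simp add: \<delta>_def \<alpha>0)
    then have "1\<^sub>m (2 * n) \<in> ?K" using \<gamma>0 by (intro image_eqI[of _ _ 0]) auto
    moreover have "A \<in> ?K" using \<gamma>1 \<delta>1 by (intro image_eqI[of _ _ 1]) auto
    moreover have "?K \<subseteq> std_borel" using inB by auto
    ultimately show ?thesis using con by (intro bexI[of _ ?K]) auto
  qed
  then have "\<Union>?\<C> = std_borel" by blast
  moreover have "connectedin (zariski (2 * n)) (\<Union>?\<C>)" by (rule connectedin_Union) blast+
  ultimately show ?thesis by simp
qed

text \<open>Column by column: once the first \<open>k\<close> columns of all \<open>h\<close> in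
  \<open>H\<close> are triangular, the remaining coordinates carry a representation of
  \<open>H\<close>, and Lie-Kolchin supplies a common eigenvector. Being an eigenvector for the
  elements of \<open>std_borel\<close> forces it to be a multiple of the next basis vector, so
  column \<open>k\<close> is triangular too. After \<open>n\<close> columns
  \<open>std_borel_block_iff\<close> applies.\<close>

lemma std_borel_maximal:
  assumes H: "closed_connected_solvable (2 * n) G H" and BH: "std_borel \<subseteq> H"
  shows "H = std_borel"
proof -
  let ?N = "2 * n"
  note HD = closed_connected_solvableD[OF H]
  obtain d where d: "(derived G ^^ d) H = {\<one>\<^bsub>G\<^esub>}" using HD(3) by blast
  have HG: "h \<in> carrier G" if "h \<in> H" for h using HD(1) subgroup.mem_carrier that by fast
  have Hm: "g * h \<in> H" if "g \<in> H" "h \<in> H" for g h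
    using subgroup.m_closed[OF HD(1) that] by (simp add: Sp_mult)
  have cut: "cut_mat ?N h = h" if "h \<in> H" for h by (rule cut_mat_id[OF Sp_carrier[OF HG[OF that]]])
  have "\<forall>h\<in>H. \<forall>l<k. \<forall>i<?N. l < i \<longrightarrow> h $$ (i, l) = 0" if "k \<le> n" for k
    using that
  proof (induction k)
    case (Suc k)
    then have IH: "h $$ (i, l) = 0" if "h \<in> H" "l < k" "i < ?N" "l < i" for h i l using that by simp
    have kn: "k < n" using Suc.prems by simp
    define m where "m = ?N - k"
    define \<rho> :: "'k mat \<Rightarrow> 'k mat"
      where "\<rho> h = mat m m (\<lambda>(a, b). cut_mat ?N h $$ (k + a, k + b))" for h
    have inj: "inj_on (\<lambda>a. k + a) {..<m}" by (auto simp: inj_on_def)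
    have img: "(\<lambda>a. k + a) ` {..<m} = {k..<?N}"
      using kn image_add_atLeastLessThan[of k 0 m] by (simp add: lessThan_atLeast0 m_def)
    have hom: "\<rho> (g * h) = \<rho> g * \<rho> h" if gh: "g \<in> H" "h \<in> H" for g h
      unfolding \<rho>_def cut[OF gh(1)] cut[OF gh(2)] cut[OF Hm[OF gh]]
    proof (rule submatrix_mult[OF Sp_carrier[OF HG[OF gh(1)]] Sp_carrier[OF HG[OF gh(2)]] inj])
      show "(\<lambda>a. k + a) ` {..<m} \<subseteq> {..<?N}" unfolding img by auto
      fix a b l assume "a < m" "b < m" "l < ?N" "l \<notin> (\<lambda>a. k + a) ` {..<m}"
      then show "g $$ (k + a, l) * h $$ (l, k + b) = 0"
        unfolding img using IH[OF gh(1), of l "k + a"] by (auto simp: m_def)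
    qed
    have "\<exists>u\<in>carrier_vec m. u \<noteq> 0\<^sub>v m \<and> (\<forall>h\<in>H. \<exists>c. \<rho> h *\<^sub>v u = c \<cdot>\<^sub>v u)"
    proof (rule lie_kolchin[OF HD(1,2) d _ _ _ hom])
      show "m > 0" using kn by (simp add: m_def)
      show "\<rho> (1\<^sub>m ?N) = 1\<^sub>m m" by (auto simp: \<rho>_def cut_mat_id m_def)
      fix i j assume "i < m" "j < m"
      then show "(\<lambda>A. \<rho> A $$ (i, j)) \<in> poly_funs ?N"
        by (auto simp: \<rho>_def m_def intro: poly_funs_cut_mat)
    qed (auto simp: \<rho>_def)
    then obtain u where u: "u \<in> carrier_vec m" "u \<noteq> 0\<^sub>v m" "\<And>h. h \<in> H \<Longrightarrow> \<exists>c. \<rho> h *\<^sub>v u = c \<cdot>\<^sub>v u"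
      by blast
    \<comment> \<open>A lift of \<open>u\<close>, which is an eigenvector only in the coordinates
      from \<open>k\<close> on.\<close>
    define U where "U = vec ?N (\<lambda>s. if s < k then 0 else u $ (s - k))"
    have UV: "U \<in> V" by (simp add: U_def)
    have Us: "U $ s = u $ (s - k)" if "k \<le> s" "s < ?N" for s using that by (simp add: U_def)
    have eig: "\<exists>c. \<forall>r. k \<le> r \<longrightarrow> r < ?N \<longrightarrow> (h *\<^sub>v U) $ r = c * U $ r" if h: "h \<in> H" for h
    proof -
      obtain c where c: "\<rho> h *\<^sub>v u = c \<cdot>\<^sub>v u" using u(3)[OF h] by blast
      have "(h *\<^sub>v U) $ r = c * U $ r" if r: "k \<le> r" "r < ?N" for r
      proof -
        have "(h *\<^sub>v U) $ r = (\<Sum>s<?N. h $$ (r, s) * U $ s)"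
          using Sp_carrier[OF HG[OF h]] UV r by (simp add: scalar_prod_def lessThan_atLeast0)
        also have "\<dots> = (\<Sum>s\<in>{k..<?N}. h $$ (r, s) * U $ s)"
          by (intro sum.mono_neutral_right) (auto simp: U_def)
        also have "\<dots> = (\<Sum>b<m. h $$ (r, k + b) * u $ b)"
          unfolding img[symmetric] using inj by (simp add: sum.reindex U_def m_def)
        also have "\<dots> = (\<rho> h *\<^sub>v u) $ (r - k)"
          using r u(1) cut[OF h] by (simp add: \<rho>_def m_def scalar_prod_def lessThan_atLeast0)
        finally show ?thesis using c u(1) r Us[OF r] by (simp add: m_def)
      qed
      then show ?thesis by blast
    qed
    define x y where "x = vec n (\<lambda>i. U $ i)" and "y = vec n (\<lambda>i. U $ (i + n))"
    have Uxy: "U = x @\<^sub>v y" by (rule eq_vecI) (auto simp: x_def y_def U_def)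
    have xy: "x \<in> carrier_vec n" "y \<in> carrier_vec n" by (auto simp: x_def y_def)
    have block: "four_block_mat a b c d *\<^sub>v U = (a *\<^sub>v x + b *\<^sub>v y) @\<^sub>v (c *\<^sub>v x + d *\<^sub>v y)"
      if "a \<in> carrier_mat n n" "b \<in> carrier_mat n n" "c \<in> carrier_mat n n" "d \<in> carrier_mat n n"
        for a b c d
      unfolding Uxy using that xy by (intro four_block_mat_mult_vec) auto
    have y0: "y $ l = 0" if l: "l < n" for l
    proof (rule ccontr)
      assume nz: "y $ l \<noteq> 0"
      \<comment> \<open>The corresponding upper unitriangular element leaves coordinate
        \<open>l + n\<close> alone, so the eigenvalue is 1; but it adds \<open>y $ l\<close> to
        coordinate \<open>k\<close>.\<close>
      define Y where "Y = mat n n (\<lambda>(i, j). if i = k \<and> j = l \<or> i = l \<and> j = k then 1 else (0 :: 'k))"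
      have Y: "Y \<in> carrier_mat n n" "Y\<^sup>T = Y" by (auto simp: Y_def mat_eq_iff)
      let ?b = "four_block_mat (1\<^sub>m n) Y (0\<^sub>m n n) (1\<^sub>m n)"
      have "?b \<in> H" using BH std_borel_block_iff[OF _ Y(1) _ _ upper_unipotent_in_Sp[OF Y]] by auto
      then obtain c where c: "\<And>r. k \<le> r \<Longrightarrow> r < ?N \<Longrightarrow> (?b *\<^sub>v U) $ r = c * U $ r" using eig by blast
      have "0\<^sub>m n n *\<^sub>v x = 0\<^sub>v n" using xy by (intro eq_vecI) (auto simp: scalar_prod_def)
      then have bU: "?b *\<^sub>v U = (x + Y *\<^sub>v y) @\<^sub>v y"
        using block[of "1\<^sub>m n" Y "0\<^sub>m n n" "1\<^sub>m n"] Y(1) xy by simp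
      have "c = 1" using c[of "l + n"] nz l kn xy Y(1) unfolding bU by (simp add: Uxy)
      then have "(x + Y *\<^sub>v y) $ k = x $ k" using c[of k] kn xy Y(1) unfolding bU by (simp add: Uxy)
      then have "(Y *\<^sub>v y) $ k = 0" using kn xy Y(1) by simp
      moreover have "row Y k = unit_vec n l"
        using kn l by (intro eq_vecI) (auto simp: Y_def unit_vec_def)
      then have "(Y *\<^sub>v y) $ k = y $ l" using kn Y(1) xy l by simp
      ultimately show False using nz by simp
    qed
    have x0: "x $ l = 0" if l: "l < n" "k < l" for l
    proof (rule ccontr)
      assume nz: "x $ l \<noteq> 0"
      \<comment> \<open>The analogous test: the element with diagonal blocks \<open>E k l\<close>
        and \<open>E l k\<close> leaves coordinate \<open>l\<close> alone and adds
        \<open>x $ l\<close> to coordinate \<open>k\<close>. Elementary matrices are involutions in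
        characteristic 2, so \<open>E l k\<close> is the inverse transpose of
        \<open>E k l\<close>.\<close>
      define E where "E p q = mat n n (\<lambda>(i, j). (if i = j then 1 else 0) + (if i = p \<and>
        j = q then 1 else (0 :: 'k)))" for p q
      have E: "E p q \<in> carrier_mat n n" for p q by (simp add: E_def)
      have "(E k l)\<^sup>T = E l k" by (auto simp: E_def mat_eq_iff)
      have "E l k * E l k = 1\<^sub>m n"
      proof (rule eq_matI)
        fix i j assume "i < dim_row (1\<^sub>m n)" "j < dim_col (1\<^sub>m n)"
        then have ij: "i < n" "j < n" by auto
        have "(E l k * E l k) $$ (i, j) = (\<Sum>s<n. E l k $$ (i, s) * E l k $$ (s, j))"
          using ij by (simp add: E_def scalar_prod_def lessThan_atLeast0)
        also have "\<dots> = (\<Sum>s<n. (if s = i then E l k $$ (i, j) else 0) + (if s = k then (if i =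
          l then E l k $$ (k, j) else 0) else 0))"
          using ij l by (intro sum.cong) (auto simp: E_def)
        also have "\<dots> = E l k $$ (i, j) + (if i = l then E l k $$ (k, j) else 0)"
          using ij kn by (simp add: sum.distrib)
        also have "\<dots> = 1\<^sub>m n $$ (i, j)" using ij l kn by (auto simp: E_def add_self)
        finally show "(E l k * E l k) $$ (i, j) = 1\<^sub>m n $$ (i, j)" .
      qed (auto simp: E_def)
      let ?b = "four_block_mat (E k l) (0\<^sub>m n n) (0\<^sub>m n n) (E l k)"
      have bG: "?b \<in> carrier G"
        using E \<open>(E k l)\<^sup>T = E l k\<close> \<open>E l k * E l k = 1\<^sub>m n\<close> carrier_matD[OF E]
        by (subst Sp_four_block_iff) (auto simp: right_add_zero_mat[of _ n n])
      have "?b \<in> H" using BH std_borel_block_iff[OF E _ _ E bG] l by (auto simp: E_def)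
      then obtain c where c: "\<And>r. k \<le> r \<Longrightarrow> r < ?N \<Longrightarrow> (?b *\<^sub>v U) $ r = c * U $ r" using eig by blast
      have bU: "(?b *\<^sub>v U) $ r = (E k l *\<^sub>v x) $ r" if "r < n" for r
        using block[OF E _ _ E, of "0\<^sub>m n n" "0\<^sub>m n n" k l l k] E xy that y0
        by (simp add: scalar_prod_def) 
      have Ex: "(E k l *\<^sub>v x) $ r = x $ r + (if r = k then x $ l else 0)" if "r < n" for r
      proof -
        have "row (E k l) r = unit_vec n r + (if r = k then 1 else 0) \<cdot>\<^sub>v unit_vec n l"
          using that by (intro eq_vecI) (auto simp: E_def unit_vec_def)
        moreover have "(E k l *\<^sub>v x) $ r = row (E k l) r \<bullet> x"
          using that carrier_matD(1)[OF E] by simp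
        ultimately have "(E k l *\<^sub>v x) $ r = (unit_vec n r + (if r =
          k then 1 else 0) \<cdot>\<^sub>v unit_vec n l) \<bullet> x"
          by simp
        also have "\<dots> = x $ r + (if r = k then 1 else 0) * x $ l"
          using that l xy by (subst add_scalar_prod_distrib[of _ n]) auto
        finally show ?thesis by simp
      qed
      have "c = 1" using c[of l] bU[of l] Ex[of l] nz l xy by (simp add: Uxy)
      then have "x $ k + x $ l = x $ k" using c[of k] bU[of k] Ex[of k] kn xy by (simp add: Uxy)
      then show False using nz by simp
    qed
    have Uk: "U = U $ k \<cdot>\<^sub>v unit_vec ?N k"
    proof (rule eq_vecI)
      fix i assume "i < dim_vec (U $ k \<cdot>\<^sub>v unit_vec ?N k)"
      then have i: "i < ?N" by simp
      consider "i < k" | "i = k" | "k < i" "i < n" | "n \<le> i" using kn by linarith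
      then show "U $ i = (U $ k \<cdot>\<^sub>v unit_vec ?N k) $ i"
      proof cases
        case 3
        then show ?thesis using x0[of i] i by (simp add: x_def unit_vec_def)
      next
        case 4
        then show ?thesis using y0[of "i - n"] i kn by (simp add: y_def unit_vec_def)
      qed (use i kn in \<open>auto simp: U_def unit_vec_def\<close>)
    qed (simp add: U_def)
    have Uk0: "U $ k \<noteq> 0"
    proof
      assume "U $ k = 0"
      then have "U $ s = 0" if "s < ?N" for s
        using Uk that by (metis index_smult_vec(1) index_unit_vec(3) mult_zero_left)
      then have "u $ a = 0" if "a < m" for a using Us[of "k + a"] that by (simp add: m_def)
      then have "u = 0\<^sub>v m" using u(1) by (intro eq_vecI) auto
      then show False using u(2) by simp
    qed
    have new: "h $$ (i, k) = 0" if h: "h \<in> H" and i: "i < ?N" "k < i" for h i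
    proof -
      obtain c where c: "\<And>r. k \<le> r \<Longrightarrow> r < ?N \<Longrightarrow> (h *\<^sub>v U) $ r = c * U $ r" using eig[OF h] by blast
      have hc: "h \<in> carrier_mat ?N ?N" by (rule Sp_carrier[OF HG[OF h]])
      have ui: "U $ i = 0" using arg_cong[OF Uk, of "\<lambda>v. v $ i"] i kn by (simp add: unit_vec_def)
      have "(h *\<^sub>v U) $ i = (h *\<^sub>v (U $ k \<cdot>\<^sub>v unit_vec ?N k)) $ i" using Uk by simp
      also have "\<dots> = U $ k * h $$ (i, k)" using hc i kn by (simp add: mult_mat_vec[OF hc])
      finally show ?thesis using c[of i] i ui Uk0 by simp
    qed
    show ?case using IH new by (auto simp: less_Suc_eq)
  qed simp
  then have tri: "h $$ (i, l) = 0" if "h \<in> H" "l < n" "i < ?N" "l < i" for h i l using that by blast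
  have "h \<in> std_borel" if h: "h \<in> H" for h
  proof -
    obtain a b c d where c: "a \<in> carrier_mat n n" "b \<in> carrier_mat n n" "c \<in> carrier_mat n n"
      "d \<in> carrier_mat n n" and hb: "h = four_block_mat a b c d"
      using four_block_cases[OF Sp_carrier[OF HG[OF h]]] by blast
    have "c $$ (i, j) = 0" if "i < n" "j < n" for i j
      using tri[OF h, of j "i + n"] that c unfolding hb by simp
    moreover have "a $$ (i, j) = 0" if "i < n" "j < i" for i j
      using tri[OF h, of j i] that c unfolding hb by simp
    ultimately show ?thesis using std_borel_block_iff[OF c] HG[OF h] c unfolding hb by auto
  qed
  then show ?thesis using BH by blast
qed

theorem borel_subgroup_std_borel: "borel_subgroup (2 * n) G std_borel"
  unfolding borel_subgroup_def
  using std_borel_maximal subgroup_std_borel closedin_std_borel connectedin_std_borel solvable_std_borel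
  by (auto simp: closed_connected_solvable_def)

end

section \<open>Congruence of symmetric matrices in characteristic 2\<close>

lemma polyf_if:
  "(c \<Longrightarrow> f \<in> polyf) \<Longrightarrow> (\<not> c \<Longrightarrow> g \<in> polyf) \<Longrightarrow> (\<lambda>t. if c then f t else g t) \<in> polyf"
  by (cases c) auto

definition congruent_mat :: "nat \<Rightarrow> 'k::field mat \<Rightarrow> 'k mat \<Rightarrow> bool" where
  "congruent_mat m A B \<longleftrightarrow> A \<in> carrier_mat m m \<and>
     (\<exists>L\<in>carrier_mat m m. det L \<noteq> 0 \<and> B = L * A * L\<^sup>T)"

text \<open>A block-diagonal element of the standard Borel subgroup has a lower triangular block
  \<open>d\<close>, and conjugation by it changes \<open>low R\<close> into
  \<open>low (d * R * d\<^sup>T)\<close>.\<close>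

definition tri_congruent :: "nat \<Rightarrow> 'k::field mat \<Rightarrow> 'k mat \<Rightarrow> bool" where
  "tri_congruent m A B \<longleftrightarrow> A \<in> carrier_mat m m \<and>
     (\<exists>L\<in>carrier_mat m m. det L \<noteq> 0 \<and> (\<forall>i<m. \<forall>j<m. i < j \<longrightarrow> L $$ (i, j) = 0) \<and> B = L * A * L\<^sup>T)"

lemma tri_congruent_imp: "tri_congruent m A B \<Longrightarrow> congruent_mat m A B"
  by (auto simp: tri_congruent_def congruent_mat_def)

lemma congruent_carrier: "congruent_mat m A B \<Longrightarrow> A \<in> carrier_mat m m \<and> B \<in> carrier_mat m m"
  by (auto simp: congruent_mat_def intro!: mult_square_carrier)

lemma congruence_comp:
  fixes A :: "'k::field mat"
  assumes "A \<in> carrier_mat m m" "L \<in> carrier_mat m m" "K \<in> carrier_mat m m"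
  shows "K * (L * A * L\<^sup>T) * K\<^sup>T = (K * L) * A * (K * L)\<^sup>T"
  using assms by (simp add: transpose_mult[of _ m m _ m] square_simps[of _ m])

lemma congruent_refl: "A \<in> carrier_mat m m \<Longrightarrow> congruent_mat m A A"
  unfolding congruent_mat_def by (intro conjI bexI[of _ "1\<^sub>m m"]) auto

lemma tri_congruent_refl: "A \<in> carrier_mat m m \<Longrightarrow> tri_congruent m A A"
  unfolding tri_congruent_def by (intro conjI bexI[of _ "1\<^sub>m m"]) auto

lemma congruent_trans:
  assumes "congruent_mat m A B" "congruent_mat m B C" shows "congruent_mat m A C"
proof -
  obtain L K where L: "L \<in> carrier_mat m m" "det L \<noteq> 0" "B = L * A * L\<^sup>T"
    and K: "K \<in> carrier_mat m m" "det K \<noteq> 0" "C = K * B * K\<^sup>T" and A: "A \<in> carrier_mat m m"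
    using assms by (auto simp: congruent_mat_def)
  show ?thesis unfolding congruent_mat_def
    using L K A congruence_comp[OF A L(1) K(1)]
    by (intro conjI bexI[of _ "K * L"]) (auto simp: det_mult[of _ m])
qed

lemma tri_congruent_trans:
  assumes "tri_congruent m A B" "tri_congruent m B C" shows "tri_congruent m A C"
proof -
  obtain L K where L: "L \<in> carrier_mat m m" "det L \<noteq> 0" "B = L * A * L\<^sup>T"
    and K: "K \<in> carrier_mat m m" "det K \<noteq> 0" "C = K * B * K\<^sup>T" and A: "A \<in> carrier_mat m m"
    and tri: "\<And>i j. i < m \<Longrightarrow> j < m \<Longrightarrow> i < j \<Longrightarrow> L $$ (i, j) = 0"
      "\<And>i j. i < m \<Longrightarrow> j < m \<Longrightarrow> i < j \<Longrightarrow> K $$ (i, j) = 0"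
    using assms unfolding tri_congruent_def by metis
  have "(K * L) $$ (i, j) = 0" if ij: "i < m" "j < m" "i < j" for i j
  proof -
    have "(K * L) $$ (i, j) = (\<Sum>s<m. K $$ (i, s) * L $$ (s, j))"
      using K L ij by (simp add: scalar_prod_def lessThan_atLeast0)
    also have "\<dots> = 0"
    proof (intro sum.neutral ballI)
      fix s assume "s \<in> {..<m}"
      then show "K $$ (i, s) * L $$ (s, j) = 0"
        using tri(1)[of s j] tri(2)[of i s] ij by (cases "i < s") auto
    qed
    finally show ?thesis .
  qed
  then show ?thesis unfolding tri_congruent_def
    using L K A congruence_comp[OF A L(1) K(1)]
    by (intro conjI bexI[of _ "K * L"]) (auto simp: det_mult[of _ m])
qed

lemma det_nonzero_inverse:
  fixes L :: "'k::field mat"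
  assumes L: "L \<in> carrier_mat m m" and "det L \<noteq> 0"
  obtains K where "K \<in> carrier_mat m m" "K * L = 1\<^sub>m m" "L * K = 1\<^sub>m m"
proof -
  let ?K = "inverse (det L) \<cdot>\<^sub>m adj_mat L"
  have "?K * L = inverse (det L) \<cdot>\<^sub>m (det L \<cdot>\<^sub>m 1\<^sub>m m)"
    using adj_mat[OF L] L by (simp add: mult_smult_assoc_mat[of _ m m _ m])
  then have 1: "?K * L = 1\<^sub>m m" using assms(2) by (auto simp: mat_eq_iff)
  have K: "?K \<in> carrier_mat m m" using adj_mat[OF L] by simp
  show thesis using that[OF K 1] mat_mult_left_right_inverse[OF K L 1] by blast
qed

lemma congruent_sym:
  assumes "congruent_mat m A B" shows "congruent_mat m B A"
proof -
  obtain L where L: "L \<in> carrier_mat m m" "det L \<noteq> 0" "B = L * A * L\<^sup>T" and A: "A \<in> carrier_mat m m"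
    using assms by (auto simp: congruent_mat_def)
  obtain K where K: "K \<in> carrier_mat m m" "K * L = 1\<^sub>m m"
    using det_nonzero_inverse[OF L(1,2)] by blast
  have "K * B * K\<^sup>T = A" unfolding L(3) congruence_comp[OF A L(1) K(1)] K(2) using A by simp
  moreover have "det K \<noteq> 0" using det_mult[OF K(1) L(1)] K(2) by auto
  moreover have "B \<in> carrier_mat m m" using congruent_carrier[OF assms] by blast
  ultimately show ?thesis unfolding congruent_mat_def using K(1) by (intro conjI bexI[of _ K]) auto
qed

lemma mult_mat_entry:
  "A \<in> carrier_mat l m \<Longrightarrow> B \<in> carrier_mat m r \<Longrightarrow> i < l \<Longrightarrow> j < r \<Longrightarrow>
    (A * B) $$ (i, j) = (\<Sum>k<m. A $$ (i, k) * B $$ (k, j))"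
  by (simp add: scalar_prod_def lessThan_atLeast0)

lemma congruence_entry:
  fixes A :: "'k::field mat"
  assumes "A \<in> carrier_mat m m" "L \<in> carrier_mat m m" "i < m" "j < m"
  shows "(L * A * L\<^sup>T) $$ (i, j) = (\<Sum>l<m. L $$ (i, l) * (\<Sum>p<m. L $$ (j, p) * A $$ (l, p)))"
proof -
  have "(L * (A * L\<^sup>T)) $$ (i, j) = (\<Sum>l<m. L $$ (i, l) * (A * L\<^sup>T) $$ (l, j))"
    using assms by (simp add: scalar_prod_def lessThan_atLeast0)
  also have "\<dots> = (\<Sum>l<m. L $$ (i, l) * (\<Sum>p<m. L $$ (j, p) * A $$ (l, p)))"
    using assms by (intro sum.cong refl arg_cong2[where f = "(*)"])
      (simp_all add: scalar_prod_def lessThan_atLeast0 mult.commute)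
  finally show ?thesis using assms by (simp add: assoc_mult_square[of _ m])
qed

lemma congruent_add_row:
  fixes A :: "'k::field mat"
  assumes A: "A \<in> carrier_mat m m" and k: "k < m" and l: "l < m" and kl: "k \<noteq> l"
  shows "congruent_mat m A (mat m m (\<lambda>(i, j). A $$ (i, j) + (if i = k then A $$ (l, j) else 0) +
    (if j = k then A $$ (i, l) else 0) + (if i = k \<and> j = k then A $$ (l, l) else 0)))" (is
      "congruent_mat m A ?B")
proof -
  let ?L = "addrow_mat m (1 :: 'k) k l"
  have L: "?L \<in> carrier_mat m m" by simp
  have row: "(\<Sum>s<m. ?L $$ (i, s) * f s) = f i + (if i = k then f l else 0)" if i: "i < m" for i f
  proof -
    have "(\<Sum>s<m. ?L $$ (i, s) * f s) = (\<Sum>s<m. (if s = i then f i else 0) + (if s = l then (if i =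
      k then f l else 0) else 0))"
      using i kl by (intro sum.cong) auto
    also have "\<dots> = f i + (if i = k then f l else 0)" using i l by (simp add: sum.distrib)
    finally show ?thesis .
  qed
  have "?B = ?L * A * ?L\<^sup>T"
  proof (rule eq_matI)
    fix i j assume "i < dim_row (?L * A * ?L\<^sup>T)" "j < dim_col (?L * A * ?L\<^sup>T)"
    then have ij: "i < m" "j < m" by auto
    show "?B $$ (i, j) = (?L * A * ?L\<^sup>T) $$ (i, j)"
      unfolding congruence_entry[OF A L ij] row[OF ij(2)] row[OF ij(1)] using ij by auto
  qed auto
  moreover have "det ?L = 1" by (rule det_addrow_mat[OF kl])
  then have "det ?L \<noteq> 0" by simp
  ultimately show ?thesis unfolding congruent_mat_def using A L by (intro conjI bexI[of _ ?L])
qed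

lemma det_lower_nonzero:
  fixes L :: "'k::field mat"
  assumes "L \<in> carrier_mat m m" "\<And>i j. i < m \<Longrightarrow> j < m \<Longrightarrow> i < j \<Longrightarrow> L $$ (i, j) = 0"
    "\<And>i. i < m \<Longrightarrow> L $$ (i, i) \<noteq> 0"
  shows "det L \<noteq> 0"
proof -
  have "det L = prod_list (diag_mat L)" using assms(1,2) by (intro det_lower_triangular) auto
  also have "\<dots> = (\<Prod>i = 0..<dim_row L. L $$ (i, i))" by (rule prod_list_diag_prod)
  finally show ?thesis using assms(1,3) by simp
qed

lemma congruent_transpose:
  assumes "congruent_mat m A B" "A\<^sup>T = A" shows "B\<^sup>T = B"
proof -
  obtain L where L: "L \<in> carrier_mat m m" "B = L * A * L\<^sup>T" and A: "A \<in> carrier_mat m m"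
    using assms by (auto simp: congruent_mat_def)
  have "(L * A * L\<^sup>T)\<^sup>T = L * (A\<^sup>T * L\<^sup>T)"
    using L(1) A by (simp add: transpose_mult[of _ m m _ m] mult_square_carrier)
  then show ?thesis using L(1) A assms(2) unfolding L(2) by (simp add: assoc_mult_square[of _ m])
qed

lemma sym_entry:
  assumes "A \<in> carrier_mat m m" "A\<^sup>T = A" "i < m" "j < m" shows "A $$ (i, j) = A $$ (j, i)"
  using assms by (metis carrier_matD index_transpose_mat(1))

text \<open>A Gauss-type elimination: \<open>clean k M\<close> says that \<open>k\<close> steps are done. Maximality of \<open>k\<close> in the
  congruence class forces the normal form \<open>E k\<close>, and nonvanishing of the pivots is the open condition
  under which a triangular congruence to the normal form exists.\<close>

lemma elimination:
  fixes R :: "'k::alg_closed_field mat" and Adm :: "'k mat \<Rightarrow> bool"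
  assumes R: "R \<in> carrier_mat m m" "Adm R"
    and adm: "\<And>A B. Adm A \<Longrightarrow> congruent_mat m A B \<Longrightarrow> Adm B"
    and clean0: "\<And>M. clean 0 M" and bound: "\<And>k M. clean k M \<Longrightarrow> k \<le> m"
    and step: "\<And>k M. M \<in> carrier_mat m m \<Longrightarrow> Adm M \<Longrightarrow> clean k M \<Longrightarrow> piv k M \<noteq> 0 \<Longrightarrow>
      clean (Suc k) (step k M) \<and> tri_congruent m (step k M) M"
    and stuck: "\<And>k M. M \<in> carrier_mat m m \<Longrightarrow> Adm M \<Longrightarrow> clean k M \<Longrightarrow> M \<noteq> E k \<Longrightarrow>
      \<exists>M'. congruent_mat m M M' \<and> clean k M' \<and> piv k M' \<noteq> (0 :: 'k)"
    and fixE: "\<And>i k. clean k (E k) \<Longrightarrow> i < k \<Longrightarrow> step i (E k) = E k \<and> piv i (E k) \<noteq> 0"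
    and polys: "\<And>k \<gamma>. polymat m m \<gamma> \<Longrightarrow> polymat m m (\<lambda>t. step k (\<gamma> t))"
      "\<And>k \<gamma>. polymat m m \<gamma> \<Longrightarrow> (\<lambda>t. piv k (\<gamma> t)) \<in> polyf"
  shows "\<exists>k \<Phi>. congruent_mat m R (E k) \<and> (\<forall>\<gamma>. polymat m m \<gamma> \<longrightarrow> (\<lambda>t. \<Phi> (\<gamma> t)) \<in> polyf) \<and>
    \<Phi> (E k) \<noteq> (0 :: 'k) \<and>
    (\<forall>M. congruent_mat m (E k) M \<longrightarrow> \<Phi> M \<noteq> 0 \<longrightarrow> tri_congruent m (E k) M)"
proof -
  define P where "P k \<longleftrightarrow> (\<exists>M. congruent_mat m R M \<and> clean k M)" for k
  have "P 0" unfolding P_def using congruent_refl[OF R(1)] clean0 by blast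
  moreover have "\<forall>k. P k \<longrightarrow> k \<le> m" using bound by (auto simp: P_def)
  ultimately obtain k where k: "P k" "\<And>j. P j \<Longrightarrow> j \<le> k"
    using Greatest_le_nat[of P _ m] GreatestI_nat[of P 0 m] by blast
  have normal: "M = E k" if M: "congruent_mat m R M" "clean k M" for M
  proof (rule ccontr)
    have Mc: "M \<in> carrier_mat m m" using congruent_carrier[OF M(1)] by blast
    assume "M \<noteq> E k"
    then obtain M' where M': "congruent_mat m M M'" "clean k M'" "piv k M' \<noteq> 0"
      using stuck[OF Mc adm[OF R(2) M(1)] M(2)] by blast
    have RM': "congruent_mat m R M'" using congruent_trans[OF M(1) M'(1)] .
    have Mc': "M' \<in> carrier_mat m m" using congruent_carrier[OF RM'] by blast
    have s: "clean (Suc k) (step k M')" "tri_congruent m (step k M') M'"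
      using step[OF Mc' adm[OF R(2) RM'] M'(2,3)] by auto
    have "congruent_mat m R (step k M')"
      using congruent_trans[OF RM' congruent_sym[OF tri_congruent_imp[OF s(2)]]] .
    then have "P (Suc k)" using s(1) by (auto simp: P_def)
    then show False using k(2) by fastforce
  qed
  then have RE: "congruent_mat m R (E k)" and Ek: "clean k (E k)" using k(1) by (auto simp: P_def)
  have Ec: "E k \<in> carrier_mat m m" using congruent_carrier[OF RE] by blast
  \<comment> \<open>Steps \<open>0, ..., i - 1\<close> in a row, carried out whether or not the
    pivots vanish, so that \<open>\<Phi>\<close> is a polynomial in the entries of
    \<open>M\<close>.\<close>
  define chain where "chain = rec_nat (\<lambda>M. M) (\<lambda>i f M. step i (f M))"
  have chain: "chain 0 M = M" "chain (Suc i) M = step i (chain i M)" for i M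
    by (simp_all add: chain_def)
  define \<Phi> where "\<Phi> M = (\<Prod>i<k. piv i (chain i M))" for M
  have chain_poly: "polymat m m (\<lambda>t. chain i (\<gamma> t))" if "polymat m m \<gamma>" for i \<gamma>
    using that by (induction i) (auto simp: chain intro: polys)
  have "(\<lambda>t. \<Phi> (\<gamma> t)) \<in> polyf" if "polymat m m \<gamma>" for \<gamma>
    unfolding \<Phi>_def using polys(2)[OF chain_poly[OF that]] by (intro polyf_prod) auto
  moreover have "\<Phi> (E k) \<noteq> 0"
  proof -
    have "chain i (E k) = E k" if "i \<le> k" for i
      using that by (induction i) (use fixE[OF Ek] in \<open>auto simp: chain\<close>)
    then show ?thesis unfolding \<Phi>_def using fixE[OF Ek] by auto
  qed
  moreover have "tri_congruent m (E k) M" if M: "congruent_mat m (E k) M" "\<Phi> M \<noteq> 0" for M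
  proof -
    have RM: "congruent_mat m R M" using congruent_trans[OF RE M(1)] .
    have Mc: "M \<in> carrier_mat m m" using congruent_carrier[OF RM] by blast
    have "clean i (chain i M) \<and> tri_congruent m (chain i M) M" if "i \<le> k" for i
      using that
    proof (induction i)
      case 0
      then show ?case using clean0 tri_congruent_refl[OF Mc] by (simp add: chain)
    next
      case (Suc i)
      then have IH: "clean i (chain i M)" "tri_congruent m (chain i M) M" by auto
      have Rc: "congruent_mat m R (chain i M)"
        using congruent_trans[OF RM congruent_sym[OF tri_congruent_imp[OF IH(2)]]] .
      have cc: "chain i M \<in> carrier_mat m m" using congruent_carrier[OF Rc] by blast
      have "piv i (chain i M) \<noteq> 0" using M(2) Suc.prems by (auto simp: \<Phi>_def)
      then show ?case using step[OF cc adm[OF R(2) Rc] IH(1)] tri_congruent_trans[OF _ IH(2)]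
        by (simp add: chain)
    qed
    from this[of k] have c: "clean k (chain k M)" "tri_congruent m (chain k M) M" by auto
    have "congruent_mat m R (chain k M)"
      using congruent_trans[OF RM congruent_sym[OF tri_congruent_imp[OF c(2)]]] .
    \<comment> \<open>The elimination of \<open>M\<close> ends in a matrix congruent to
      \<open>R\<close> with \<open>k\<close> steps done, and by maximality of \<open>k\<close> there
      is only one such matrix.\<close>
    then have "chain k M = E k" using normal c(1) by blast
    then show ?thesis using c(2) by simp
  qed
  ultimately show ?thesis using RE by blast
qed

section \<open>Elimination for non-alternating symmetric matrices\<close>

context symplectic_char2
begin

definition clean1 :: "nat \<Rightarrow> nat \<Rightarrow> 'k mat \<Rightarrow> bool" where
  "clean1 m k M \<longleftrightarrow> k \<le> m \<and>
     (\<forall>i<m. \<forall>j<m. i < k \<or> j < k \<longrightarrow> M $$ (i, j) = (if i = j then 1 else 0))"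

text \<open>The Schur complement, scaled by the pivot to keep it polynomial.\<close>

definition step1 :: "nat \<Rightarrow> nat \<Rightarrow> 'k mat \<Rightarrow> 'k mat" where
  "step1 m k M = mat m m (\<lambda>(i, j). if i \<le> k \<or> j \<le> k then (if i = j then 1 else 0)
     else if k < m then M $$ (k, k) * M $$ (i, j) + M $$ (i, k) * M $$ (k, j) else 0)"

definition piv1 :: "nat \<Rightarrow> nat \<Rightarrow> 'k mat \<Rightarrow> 'k" where
  "piv1 m k M = (if k < m then M $$ (k, k) else 0)"

definition stdform1 :: "nat \<Rightarrow> nat \<Rightarrow> 'k mat" where
  "stdform1 m k = mat m m (\<lambda>(i, j). if i = j \<and> i < k then 1 else 0)"

lemma stdform1_carrier [simp]: "stdform1 m k \<in> carrier_mat m m" "dim_row (stdform1 m k) = m"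
  "dim_col (stdform1 m k) = m"
  by (simp_all add: stdform1_def)

lemma sqrt_exists: obtains s where "s * s = (a :: 'k)"
  using nth_root_exists[of 2 a] by (metis power2_eq_square zero_less_numeral)

lemma step1_congruent:
  assumes M: "M \<in> carrier_mat m m" "M\<^sup>T = M" and cl: "clean1 m k M" and p: "piv1 m k M \<noteq> 0"
  shows "clean1 m (Suc k) (step1 m k M) \<and> tri_congruent m (step1 m k M) M"
proof
  have k: "k < m" and a: "M $$ (k, k) \<noteq> 0" using p by (auto simp: piv1_def split: if_splits)
  show "clean1 m (Suc k) (step1 m k M)" using k by (auto simp: clean1_def step1_def)
  obtain s where s: "s * s = M $$ (k, k)" using sqrt_exists by blast
  then have s0: "s \<noteq> 0" using a by auto
  \<comment> \<open>\<open>L\<close> reverses the step: \<open>e\<close> restores column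
    \<open>k\<close>, and \<open>1 / s\<close> undoes the scaling of the Schur complement by the
    pivot. The square root is taken because a factor acts on rows and columns alike.\<close>
  define c where "c j = (if j < k then 1 else if j = k then s else 1 / s)" for j
  define e where "e j = (if k < j then M $$ (j, k) / s else 0)" for j
  define L where "L = mat m m (\<lambda>(j, l). (if l = j then c j else 0) + (if l = k then e j else 0))"
  have L: "L \<in> carrier_mat m m" by (simp add: L_def)
  let ?T = "step1 m k M"
  have T: "?T \<in> carrier_mat m m" by (simp add: step1_def)
  have row: "(\<Sum>l<m. L $$ (j, l) * f l) = c j * f j + e j * f k" if j: "j < m" for j f
  proof -
    have "(\<Sum>l<m. L $$ (j, l) * f l) = (\<Sum>l<m. (if l = j then c j * f j else 0) + (if l =
      k then e j * f k else 0))"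
      using j by (intro sum.cong) (auto simp: L_def algebra_simps)
    then show ?thesis using j k by (simp add: sum.distrib)
  qed
  have "M = L * ?T * L\<^sup>T"
  proof (rule eq_matI)
    fix i j assume "i < dim_row (L * ?T * L\<^sup>T)" "j < dim_col (L * ?T * L\<^sup>T)"
    then have ij: "i < m" "j < m" by (auto simp: L_def)
    have clean: "M $$ (i, j) = (if i = j then 1 else 0)" if "i < m" "j < m" "i < k \<or> j < k" for i j
      using cl that by (auto simp: clean1_def)
    have ss: "1 / (s * s) * (M $$ (k, k)) = 1" using s a by simp
    show "M $$ (i, j) = (L * ?T * L\<^sup>T) $$ (i, j)"
    proof (cases "k < i \<and> k < j")
      case True
      have "(L * ?T * L\<^sup>T) $$ (i, j) = 1 / s * (1 / s * (M $$ (k, k) * M $$ (i, j) + M $$ (i,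
        k) * M $$ (k, j))) +
          M $$ (i, k) / s * (M $$ (j, k) / s)"
        unfolding congruence_entry[OF T L ij] row[OF ij(2)] row[OF ij(1)]
        using True ij k by (simp add: c_def e_def step1_def)
      also have "\<dots> = (M $$ (k, k) * M $$ (i, j) + (M $$ (i, k) * M $$ (k, j) + M $$ (i,
        k) * M $$ (k, j))) / (s * s)"
        using s0 sym_entry[OF M ij(2) k] by (simp add: field_simps)
      also have "\<dots> = M $$ (i, j)" using a by (simp add: add_self s)
      finally show ?thesis by simp
    next
      case False
      note expand = congruence_entry[OF T L ij] row[OF ij(2)] row[OF ij(1)]
      have Te: "?T $$ (i, j) = (if i = j then 1 else 0)" if "i < m" "j < m" "i \<le> k \<or> j \<le> k" for i j
        using that by (simp add: step1_def)
      consider "i < k" | "j < k" "k \<le> i" | "i = k" "j = k" | "i = k" "k < j" | "k < i" "j = k"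
        using False by linarith
      then show ?thesis
      proof cases
        case 1
        then show ?thesis unfolding expand using ij k clean[OF ij] Te[OF ij] Te[OF ij(1) k]
          by (simp add: c_def e_def)
      next
        case 2
        then show ?thesis unfolding expand using ij k clean[OF ij] Te[OF ij] Te[OF k ij(2)]
          by (simp add: c_def e_def)
      next
        case 3
        then show ?thesis unfolding expand using k Te[OF k k] s by (simp add: c_def e_def)
      next
        case 4
        then show ?thesis unfolding expand
          using k Te[OF k k] Te[OF k ij(2)] s0 sym_entry[OF M ij(2) k]
          by (simp add: c_def e_def)
      next
        case 5
        then show ?thesis unfolding expand using k Te[OF k k] Te[OF ij(1) k] s0
          by (simp add: c_def e_def)
      qed
    qed
  qed (use M L in auto)
  moreover have "L $$ (i, j) = 0" if "i < m" "j < m" "i < j" for i j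
    using that by (auto simp: L_def e_def)
  moreover have "L $$ (i, i) \<noteq> 0" if "i < m" for i
    using that s0 by (auto simp: L_def c_def e_def)
  ultimately show "tri_congruent m ?T M"
    unfolding tri_congruent_def using L T det_lower_nonzero[OF L]
    by (intro conjI bexI[of _ L]) auto
qed

text \<open>A diagonal entry of \<open>B\<close> is a quadratic form in a row of \<open>L\<close>,
  whose mixed terms come in equal pairs and cancel. So the alternating and the non-alternating case
  never mix.\<close>

lemma congruent_alternating:
  assumes "congruent_mat m A B" "A\<^sup>T = A" "\<And>i. i < m \<Longrightarrow> A $$ (i, i) = 0" and i: "i < m"
  shows "B $$ (i, i) = (0 :: 'k)"
proof -
  obtain L where L: "L \<in> carrier_mat m m" "B = L * A * L\<^sup>T" and A: "A \<in> carrier_mat m m"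
    using assms by (auto simp: congruent_mat_def)
  define f where "f l p = L $$ (i, l) * (L $$ (i, p) * A $$ (l, p))" for l p
  have sym: "f l p = f p l" if "l < m" "p < m" for l p
    using sym_entry[OF A assms(2) that] by (simp add: f_def algebra_simps)
  have diag: "f l l = 0" if "l < m" for l using assms(3)[OF that] by (simp add: f_def)
  have "(\<Sum>l<r. \<Sum>p<r. f l p) = 0" if "r \<le> m" for r
    using that
  proof (induction r)
    case (Suc r)
    have "(\<Sum>l<Suc r. \<Sum>p<Suc r. f l p) = (\<Sum>l<r. \<Sum>p<r. f l p) + ((\<Sum>l<r. f l r) + (\<Sum>p<r. f r p)) +
      f r r"
      by (simp add: sum.distrib algebra_simps)
    moreover have "(\<Sum>l<r. f l r) = (\<Sum>p<r. f r p)" using sym Suc.prems by (intro sum.cong) auto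
    ultimately show ?case using Suc diag[of r] by (simp add: add_self)
  qed simp
  then show ?thesis unfolding L(2) congruence_entry[OF A L(1) i i]
    by (simp add: sum_distrib_left f_def)
qed

text \<open>A nonzero diagonal entry of the remaining block can be moved to position
  \<open>k\<close>. If that block is alternating and nonzero, the last completed row is sacrificed:
  a hyperbolic plane together with a vector of norm 1 is diagonalisable, so redoing step
  \<open>k - 1\<close> after mixing in a row of the remaining block produces a nonzero diagonal
  entry.\<close>

lemma stuck1:
  assumes M: "M \<in> carrier_mat m m" "M\<^sup>T = M" and cl: "clean1 m k M"
    and nalt: "\<exists>i<m. M $$ (i, i) \<noteq> 0" and ne: "M \<noteq> stdform1 m k"
  shows "\<exists>M'. congruent_mat m M M' \<and> clean1 m k M' \<and> piv1 m k M' \<noteq> 0"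
proof -
  have diag: "\<exists>M'. congruent_mat m M M' \<and> clean1 m k M' \<and> piv1 m k M' \<noteq> 0"
    if M: "M \<in> carrier_mat m m" "M\<^sup>T = M" and cl: "clean1 m k M" and j: "j < m" "k \<le> j"
      "M $$ (j, j) \<noteq> 0" for M j
  proof (cases "M $$ (k, k) = 0")
    case False
    then show ?thesis using congruent_refl[OF M(1)] cl j by (auto simp: piv1_def)
  next
    case True
    then have kj: "k \<noteq> j" "k < m" using j by auto
    \<comment> \<open>Adding row and column \<open>j\<close> to row and column \<open>k\<close>
      turns the diagonal entry into \<open>M $$ (k, k) + M $$ (j, j)\<close>, since the mixed terms
      cancel.\<close>
    let ?M = "mat m m (\<lambda>(i, l). M $$ (i, l) + (if i = k then M $$ (j, l) else 0) +
      (if l = k then M $$ (i, j) else 0) + (if i = k \<and> l = k then M $$ (j, j) else 0))"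
    have "clean1 m k ?M" using cl j kj by (auto simp: clean1_def)
    moreover have "congruent_mat m M ?M" by (rule congruent_add_row[OF M(1) kj(2) j(1) kj(1)])
    moreover have "piv1 m k ?M = M $$ (k, k) + (M $$ (j, k) + M $$ (k, j)) + M $$ (j, j)"
      using kj by (simp add: piv1_def)
    then have "piv1 m k ?M \<noteq> 0" using sym_entry[OF M j(1) kj(2)] True j(3) by (simp add: add_self)
    ultimately show ?thesis by blast
  qed
  show ?thesis
  proof (cases "\<exists>j<m. k \<le> j \<and> M $$ (j, j) \<noteq> 0")
    case True
    then show ?thesis using diag[OF M cl] by blast
  next
    case False
    have km: "k \<le> m" using cl by (simp add: clean1_def)
    \<comment> \<open>The matrix as a whole is not alternating, so its nonzero diagonal entry sits
      among the completed rows.\<close>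
    have k0: "k > 0" using nalt False by (metis gr0I le0)
    then obtain h where h: "k = Suc h" by (metis gr0_implies_Suc)
    have clean: "M $$ (i, j) = (if i = j then 1 else 0)" if "i < m" "j < m" "i < k \<or> j < k" for i j
      using cl that by (auto simp: clean1_def)
    have "\<exists>p<m. \<exists>q<m. M $$ (p, q) \<noteq> stdform1 m k $$ (p, q)"
    proof (rule ccontr)
      assume no: "\<not> ?thesis"
      have "M = stdform1 m k"
        by (rule eq_matI) (use no M(1) in auto)
      then show False using ne by simp
    qed
    then obtain p q where pq: "p < m" "q < m" "M $$ (p, q) \<noteq> stdform1 m k $$ (p, q)" by blast
    have "k \<le> p \<and> k \<le> q"
    proof (rule ccontr)
      assume "\<not> ?thesis"
      then have "p < k \<or> q < k" by auto
      then have "stdform1 m k $$ (p, q) = (if p = q then 1 else 0)"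
        using pq by (auto simp: stdform1_def)
      then show False using pq clean[OF pq(1,2) \<open>p < k \<or> q < k\<close>] by simp
    qed
    then have kp: "k \<le> p" and kq: "k \<le> q" by auto
    then have Mpq: "M $$ (p, q) \<noteq> 0" using pq by (auto simp: stdform1_def)
    \<comment> \<open>Mixing row \<open>p\<close> into the completed row \<open>h\<close> keeps its
      pivot 1 and puts \<open>M $$ (p, q)\<close> at position \<open>(h, q)\<close>. After step
      \<open>h\<close> the entry at \<open>(q, q)\<close> is the square of
      \<open>M $$ (p, q)\<close>.\<close>
    let ?M = "mat m m (\<lambda>(i, l). M $$ (i, l) + (if i = h then M $$ (p, l) else 0) +
      (if l = h then M $$ (i, p) else 0) + (if i = h \<and> l = h then M $$ (p, p) else 0))"
    have hm: "h < m" "h \<noteq> p" "h < k" using km h kp by auto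
    have c1: "congruent_mat m M ?M" by (rule congruent_add_row[OF M(1) hm(1) pq(1) hm(2)])
    have M1: "?M \<in> carrier_mat m m" "?M\<^sup>T = ?M" using congruent_transpose[OF c1 M(2)] by simp_all
    have cl1: "clean1 m h ?M" using h hm pq clean kp by (auto simp: clean1_def)
    have one: "?M $$ (h, h) = 1"
      using hm pq clean[of h h] clean[of p h] clean[of h p] False kp by auto
    have p1: "piv1 m h ?M \<noteq> 0" using one hm by (simp add: piv1_def)
    let ?T = "step1 m h ?M"
    have T: "clean1 m k ?T" "tri_congruent m ?T ?M" using step1_congruent[OF M1 cl1 p1] h by auto
    have cT: "congruent_mat m M ?T"
      by (rule congruent_trans[OF c1 congruent_sym[OF tri_congruent_imp[OF T(2)]]])
    have "?T $$ (q, q) = ?M $$ (h, h) * ?M $$ (q, q) + ?M $$ (q, h) * ?M $$ (h, q)"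
      using pq kq h hm by (simp add: step1_def)
    moreover have "?M $$ (q, q) = 0" using pq kq h False by auto
    moreover have "?M $$ (q, h) = M $$ (q, p)" "?M $$ (h, q) = M $$ (p, q)"
      using pq kq h hm clean[of q h] clean[of h q] by auto
    ultimately have "?T $$ (q, q) \<noteq> 0" using Mpq sym_entry[OF M pq(1,2)] by simp
    moreover have "?T \<in> carrier_mat m m" "?T\<^sup>T = ?T"
      using congruent_carrier[OF cT] congruent_transpose[OF cT M(2)] by auto
    ultimately obtain M' where "congruent_mat m ?T M'" "clean1 m k M'" "piv1 m k M' \<noteq> 0"
      using diag[OF _ _ T(1) pq(2) kq] by blast
    then show ?thesis using congruent_trans[OF cT] by blast
  qed
qed

section \<open>Elimination for alternating matrices\<close>

definition ptn :: "nat \<Rightarrow> nat" where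
  "ptn i = (if even i then i + 1 else i - 1)"

lemma ptn_ptn [simp]: "ptn (ptn i) = i"
  by (auto simp: ptn_def)

lemma ptn_less: "ptn i < 2 * k \<longleftrightarrow> i < 2 * k"
proof
  show "i < 2 * k \<Longrightarrow> ptn i < 2 * k" for i by (auto simp: ptn_def elim!: evenE)
  from this[of "ptn i"] show "ptn i < 2 * k \<Longrightarrow> i < 2 * k" by simp
qed

lemma ptn_eq_iff: "j = ptn i \<longleftrightarrow> i = ptn j"
  by (metis ptn_ptn)

text \<open>Each step splits off a hyperbolic plane on a pair of consecutive indices, which
  \<open>ptn\<close> exchanges.\<close>

definition clean2 :: "nat \<Rightarrow> nat \<Rightarrow> 'k mat \<Rightarrow> bool" where
  "clean2 m k M \<longleftrightarrow> 2 * k \<le> m \<and>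
     (\<forall>i<m. \<forall>j<m. i < 2 * k \<or> j < 2 * k \<longrightarrow> M $$ (i, j) = (if j = ptn i then 1 else 0))"

definition step2 :: "nat \<Rightarrow> nat \<Rightarrow> 'k mat \<Rightarrow> 'k mat" where
  "step2 m k M = mat m m (\<lambda>(i, j). if i < 2 * Suc k \<or>
    j < 2 * Suc k then (if j = ptn i then 1 else 0)
     else if Suc (2 * k) < m then M $$ (2 * k, Suc (2 * k)) * M $$ (i, j) +
       (M $$ (i, 2 * k) * M $$ (Suc (2 * k), j) + M $$ (i, Suc (2 * k)) * M $$ (2 * k, j)) else 0)"

definition piv2 :: "nat \<Rightarrow> nat \<Rightarrow> 'k mat \<Rightarrow> 'k" where
  "piv2 m k M = (if Suc (2 * k) < m then M $$ (2 * k, Suc (2 * k)) else 0)"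

definition stdform2 :: "nat \<Rightarrow> nat \<Rightarrow> 'k mat" where
  "stdform2 m k = mat m m (\<lambda>(i, j). if i < 2 * k \<and> j = ptn i then 1 else 0)"

lemma stdform2_carrier [simp]: "stdform2 m k \<in> carrier_mat m m" "dim_row (stdform2 m k) = m"
  "dim_col (stdform2 m k) = m"
  by (simp_all add: stdform2_def)

lemma step2_congruent:
  assumes M: "M \<in> carrier_mat m m" "M\<^sup>T = M" and alt: "\<And>i. i < m \<Longrightarrow> M $$ (i, i) = 0"
    and cl: "clean2 m k M" and p: "piv2 m k M \<noteq> 0"
  shows "clean2 m (Suc k) (step2 m k M) \<and> tri_congruent m (step2 m k M) M"
proof
  define a b where "a = 2 * k" and "b = Suc (2 * k)"
  define p where "p = M $$ (a, b)"
  have b: "b < m" and a: "a < m" and p0: "p \<noteq> 0"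
    using p by (auto simp: piv2_def a_def b_def p_def split: if_splits)
  have ab: "ptn a = b" "ptn b = a" by (auto simp: ptn_def a_def b_def)
  have lt: "ptn i < a \<longleftrightarrow> i < a" for i unfolding a_def by (rule ptn_less)
  have le: "ptn i \<le> b \<longleftrightarrow> i \<le> b" for i
    using ptn_less[of i "Suc k"] by (auto simp: b_def less_Suc_eq_le)
  show "clean2 m (Suc k) (step2 m k M)" using b by (auto simp: clean2_def step2_def b_def)
  obtain s where s: "s * s = p" using sqrt_exists by blast
  then have s0: "s \<noteq> 0" using p0 by auto
  \<comment> \<open>After the step, the plane of \<open>a\<close> and \<open>b\<close> has
    off-diagonal entries 1: \<open>c b = p\<close> restores the pivot, \<open>f\<close> restores
    column \<open>a\<close> and \<open>e\<close> column \<open>b\<close>. The factor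
    \<open>1 / s\<close> undoes the scaling of the complement by \<open>p\<close>.\<close>
  define c where "c j = (if j \<le> a then 1 else if j = b then p else 1 / s)" for j
  define e where "e j = (if b < j then M $$ (b, j) / p else 0)" for j
  define f where "f j = (if b < j then M $$ (a, j) else 0)" for j
  define L where "L = mat m m (\<lambda>(j, l). (if l = j then c j else 0) + (if l = a then e j else 0) +
    (if l = b then f j else 0))"
  have L: "L \<in> carrier_mat m m" by (simp add: L_def)
  let ?T = "step2 m k M"
  have T: "?T \<in> carrier_mat m m" by (simp add: step2_def)
  have row: "(\<Sum>l<m. L $$ (j, l) * g l) = c j * g j + e j * g a + f j * g b" if j: "j < m" for j g
  proof -
    have "(\<Sum>l<m. L $$ (j, l) * g l) = (\<Sum>l<m. (if l = j then c j * g j else 0) +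
        (if l = a then e j * g a else 0) + (if l = b then f j * g b else 0))"
      using j by (intro sum.cong) (auto simp: L_def algebra_simps)
    then show ?thesis using j a b by (simp add: sum.distrib)
  qed
  have Te: "?T $$ (i, j) = (if i \<le> b \<or> j \<le> b then (if j = ptn i then 1 else 0)
      else p * M $$ (i, j) + (M $$ (i, a) * M $$ (b, j) + M $$ (i, b) * M $$ (a, j)))" if "i < m"
        "j < m" for i j
    using that b by (auto simp: step2_def a_def b_def p_def)
  have "M = L * ?T * L\<^sup>T"
  proof (rule eq_matI)
    fix i j assume "i < dim_row (L * ?T * L\<^sup>T)" "j < dim_col (L * ?T * L\<^sup>T)"
    then have ij: "i < m" "j < m" by (auto simp: L_def)
    have clean: "M $$ (i, j) = (if j = ptn i then 1 else 0)" if "i < a \<or> j < a"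
      using cl that ij by (auto simp: clean2_def a_def)
    have sy: "M $$ (i, a) = M $$ (a, i)" "M $$ (i, b) = M $$ (b, i)"
      using sym_entry[OF M] ij a b by auto
    have corner: "M $$ (a, a) = 0" "M $$ (b, b) = 0" "M $$ (a, b) = p" "M $$ (b, a) = p"
      using sym_entry[OF M a b] alt a b by (auto simp: p_def)
    have Tc: "?T $$ (a, a) = 0" "?T $$ (b, b) = 0" "?T $$ (a, b) = 1" "?T $$ (b, a) = 1"
      using a b ab by (auto simp: Te) (simp_all add: a_def b_def)
    note expand = congruence_entry[OF T L ij] row[OF ij(2)] row[OF ij(1)]
    have abl: "a < b" by (simp add: a_def b_def)
    consider "b < i" "b < j" | "i = a \<or> i = b" "j = a \<or> j = b" | "i < a" | "j < a" "a \<le> i"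
      | "i = a \<or> i = b" "b < j" | "j = a \<or> j = b" "b < i"
      using abl unfolding a_def b_def by linarith
    then show "M $$ (i, j) = (L * ?T * L\<^sup>T) $$ (i, j)"
    proof cases
      case 1
      then have "ptn i \<noteq> a" "ptn i \<noteq> b" using le[of i] abl by auto
      then have "?T $$ (i, a) = 0" "?T $$ (i, b) = 0" "?T $$ (a, j) = 0" "?T $$ (b, j) = 0"
        using 1 ij a b abl by (auto simp: Te ab)
      then have "(L * ?T * L\<^sup>T) $$ (i, j) = 1 / s * (1 / s * (p * M $$ (i, j) + (M $$ (a,
        i) * M $$ (b, j) + M $$ (b, i) * M $$ (a, j)))) +
          M $$ (b, i) / p * M $$ (a, j) + M $$ (a, i) * (M $$ (b, j) / p)"
        unfolding expand using 1 abl Te[OF ij] by (simp add: c_def e_def f_def Tc sy)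
      also have "\<dots> = (p * M $$ (i, j) + (M $$ (a, i) * M $$ (b, j) + M $$ (b, i) * M $$ (a, j)) +
          (M $$ (a, i) * M $$ (b, j) + M $$ (b, i) * M $$ (a, j))) / p"
        using s0 p0 unfolding s[symmetric] by (simp add: field_simps)
      also have "\<dots> = M $$ (i, j)" using p0 by (simp add: add.assoc add_self)
      finally show ?thesis by simp
    next
      case 2
      then show ?thesis unfolding expand using abl
        by (elim disjE) (simp_all add: c_def e_def f_def Tc corner)
    next
      case 3
      then have "ptn i < a" using lt by simp
      then have T: "?T $$ (i, a) = 0" "?T $$ (i, b) = 0"
        "?T $$ (i, j) = (if j = ptn i then 1 else 0)"
        and cj: "j = ptn i \<Longrightarrow> c j = 1"
        using 3 ij a b abl by (auto simp: Te c_def)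
      have "c i = 1" "e i = 0" "f i = 0" using 3 abl by (auto simp: c_def e_def f_def)
      then show ?thesis unfolding expand using clean 3 cj by (simp add: T)
    next
      case 4
      then have "ptn j < a" using lt by simp
      then have ji: "j \<noteq> ptn i" using 4 ptn_eq_iff[of j i] by auto
      have T: "?T $$ (a, j) = 0" "?T $$ (b, j) = 0" "?T $$ (i, j) = 0"
        using 4 ij a b abl ji by (auto simp: Te ab)
      have "c j = 1" "e j = 0" "f j = 0" using 4 abl by (auto simp: c_def e_def f_def)
      then show ?thesis unfolding expand using clean 4 ji by (simp add: T)
    next
      case 5
      then have T: "?T $$ (a, j) = 0" "?T $$ (b, j) = 0" using ij a b abl by (auto simp: Te ab)
      show ?thesis
      proof (cases "i = a")
        case True
        then show ?thesis unfolding expand using 5 abl by (simp add: c_def e_def f_def T Tc)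
      next
        case False
        then show ?thesis unfolding expand using 5 abl p0 by (simp add: c_def e_def f_def T Tc)
      qed
    next
      case 6
      then have "ptn i \<noteq> a" "ptn i \<noteq> b" using le[of i] abl by auto
      then have T: "?T $$ (i, a) = 0" "?T $$ (i, b) = 0" using 6 ij a b abl by (auto simp: Te)
      show ?thesis
      proof (cases "j = a")
        case True
        then show ?thesis unfolding expand using 6 abl sy by (simp add: c_def e_def f_def T Tc)
      next
        case False
        then show ?thesis unfolding expand using 6 abl sy p0 by (simp add: c_def e_def f_def T Tc)
      qed
    qed
  qed (use M L in auto)
  moreover have "L $$ (i, j) = 0" if "i < m" "j < m" "i < j" for i j
    using that by (auto simp: L_def e_def f_def a_def b_def)
  moreover have "L $$ (i, i) \<noteq> 0" if "i < m" for i
    using that s0 p0 by (auto simp: L_def c_def e_def f_def a_def b_def)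
  ultimately show "tri_congruent m ?T M"
    unfolding tri_congruent_def using L T det_lower_nonzero[OF L]
    by (intro conjI bexI[of _ L]) auto
qed

lemma clean2_add_row:
  assumes M: "M \<in> carrier_mat m m" and cl: "clean2 m k M" and r: "2 * k \<le> r" "r < m"
    and s: "2 * k \<le> s" "s < m"
    and rs: "r \<noteq> s"
  obtains M' where "congruent_mat m M M'" "clean2 m k M'"
    "\<And>i. i < m \<Longrightarrow> i \<noteq> r \<Longrightarrow> M' $$ (i, r) = M $$ (i, r) + M $$ (i, s)"
    "\<And>j. j < m \<Longrightarrow> j \<noteq> r \<Longrightarrow> M' $$ (r, j) = M $$ (r, j) + M $$ (s, j)"
proof (rule that)
  let ?M = "mat m m (\<lambda>(i, l). M $$ (i, l) + (if i = r then M $$ (s, l) else 0) +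
    (if l = r then M $$ (i, s) else 0) + (if i = r \<and> l = r then M $$ (s, s) else 0))"
  show "congruent_mat m M ?M" by (rule congruent_add_row[OF M r(2) s(2) rs])
  have "s \<noteq> ptn i" if "i < 2 * k" for i using ptn_less[of i k] that s by auto
  moreover have "i \<noteq> ptn s" if "i < 2 * k" for i using ptn_less[of s k] that s by auto
  ultimately show "clean2 m k ?M" using cl r s by (auto simp: clean2_def)
qed (use r in auto)

text \<open>An alternating remainder has a nonzero entry off the diagonal, and two simultaneous
  additions of rows and columns bring it to the pivot position, first its row and then its
  column.\<close>

lemma stuck2:
  assumes M: "M \<in> carrier_mat m m" "M\<^sup>T = M" and alt: "\<And>i. i < m \<Longrightarrow> M $$ (i, i) = 0"
    and cl: "clean2 m k M" and ne: "M \<noteq> stdform2 m k"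
  shows "\<exists>M'. congruent_mat m M M' \<and> clean2 m k M' \<and> piv2 m k M' \<noteq> 0"
proof -
  define a b where "a = 2 * k" and "b = Suc (2 * k)"
  have "\<exists>p<m. \<exists>q<m. M $$ (p, q) \<noteq> stdform2 m k $$ (p, q)"
  proof (rule ccontr)
    assume no: "\<not> ?thesis"
    have "M = stdform2 m k"
      by (rule eq_matI) (use no M(1) in auto)
    then show False using ne by simp
  qed
  then obtain p q where pq: "p < m" "q < m" "M $$ (p, q) \<noteq> stdform2 m k $$ (p, q)" by blast
  have "\<not> p < a \<and> \<not> q < a"
  proof -
    have "stdform2 m k $$ (p, q) = (if q = ptn p then 1 else 0)" if "p < a \<or> q < a"
      using that pq ptn_less[of p k] by (auto simp: stdform2_def a_def)
    then show ?thesis using cl pq by (auto simp: clean2_def a_def)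
  qed
  then have ge: "a \<le> p" "a \<le> q" by auto
  then have nz: "M $$ (p, q) \<noteq> 0" using pq by (auto simp: stdform2_def a_def)
  then have "p \<noteq> q" using alt pq by auto
  \<comment> \<open>Ordering the indices ensures that \<open>q'\<close> differs from
    \<open>a\<close>, so adding row \<open>p'\<close> to row \<open>a\<close> brings
    \<open>M $$ (p', q')\<close> into column \<open>q'\<close> of row \<open>a\<close>.\<close>
  define p' q' where "p' = min p q" and "q' = max p q"
  have pq': "p' < m" "q' < m" "a \<le> p'" "p' < q'" "M $$ (p', q') \<noteq> 0"
    using pq ge nz \<open>p \<noteq> q\<close> sym_entry[OF M pq(1,2)] by (auto simp: p'_def q'_def min_def max_def)
  have am: "a < m" and bm: "b < m" and qb: "b \<le> q'" "a < q'" using pq' by (auto simp: a_def b_def)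
  obtain M1 where M1: "congruent_mat m M M1" "clean2 m k M1" "M1 $$ (a, q') \<noteq> 0"
  proof (cases "M $$ (a, q') = 0")
    case False
    then show ?thesis using that[of M] congruent_refl[OF M(1)] cl by blast
  next
    case True
    then have ap: "a \<noteq> p'" using pq'(5) by auto
    obtain M' where "congruent_mat m M M'" "clean2 m k M'"
      "\<And>j. j < m \<Longrightarrow> j \<noteq> a \<Longrightarrow> M' $$ (a, j) = M $$ (a, j) + M $$ (p', j)"
      using clean2_add_row[OF M(1) cl _ am _ pq'(1) ap] pq'(3) by (metis a_def order_refl)
    then show ?thesis using that[of M'] True pq' qb by auto
  qed
  have M1c: "M1 \<in> carrier_mat m m" using congruent_carrier[OF M1(1)] by blast
  show ?thesis
  proof (cases "M1 $$ (a, b) = 0")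
    case False
    then show ?thesis using M1 bm by (auto simp: piv2_def a_def b_def)
  next
    case True
    then have bq: "b \<noteq> q'" using M1(3) by auto
    obtain M' where M': "congruent_mat m M1 M'" "clean2 m k M'"
      "\<And>i. i < m \<Longrightarrow> i \<noteq> b \<Longrightarrow> M' $$ (i, b) = M1 $$ (i, b) + M1 $$ (i, q')"
      using clean2_add_row[OF M1c M1(2) _ bm _ pq'(2) bq] qb unfolding a_def b_def
      by (metis le_SucI less_imp_le order_refl)
    have "M' $$ (a, b) \<noteq> 0" using M'(3)[of a] am True M1(3) by (simp add: a_def b_def)
    then show ?thesis using M'(2) congruent_trans[OF M1(1) M'(1)] bm
      by (auto simp: piv2_def a_def b_def)
  qed
qed

lemma polymat_step1:
  assumes "polymat m m \<gamma>" shows "polymat m m (\<lambda>t. step1 m k (\<gamma> t))"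
proof (rule polymat_cong_entry[where f = "\<lambda>i j t. if i \<le> k \<or> j \<le> k then (if i = j then 1 else 0)
     else if k < m then \<gamma> t $$ (k, k) * \<gamma> t $$ (i, j) + \<gamma> t $$ (i, k) * \<gamma> t $$ (k, j) else 0"])
  fix i j assume "i < m" "j < m"
  then show "(\<lambda>t. if i \<le> k \<or> j \<le> k then (if i = j then 1 else 0)
     else if k < m then \<gamma> t $$ (k, k) * \<gamma> t $$ (i, j) + \<gamma> t $$ (i, k) * \<gamma> t $$ (k,
       j) else 0) \<in> polyf"
    by (intro polyf_if polyf_const polyf_add polyf_mult polymat_entry[OF assms])
qed (simp_all add: step1_def)

lemma polymat_step2:
  assumes "polymat m m \<gamma>" shows "polymat m m (\<lambda>t. step2 m k (\<gamma> t))"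
proof (rule polymat_cong_entry[where f =
  "\<lambda>i j t. if i < 2 * Suc k \<or> j < 2 * Suc k then (if j = ptn i then 1 else 0)
     else if Suc (2 * k) < m then \<gamma> t $$ (2 * k, Suc (2 * k)) * \<gamma> t $$ (i, j) +
       (\<gamma> t $$ (i, 2 * k) * \<gamma> t $$ (Suc (2 * k), j) + \<gamma> t $$ (i, Suc (2 * k)) * \<gamma> t $$ (2 * k,
         j)) else 0"])
  fix i j assume "i < m" "j < m"
  then show "(\<lambda>t. if i < 2 * Suc k \<or> j < 2 * Suc k then (if j = ptn i then 1 else 0)
     else if Suc (2 * k) < m then \<gamma> t $$ (2 * k, Suc (2 * k)) * \<gamma> t $$ (i, j) +
       (\<gamma> t $$ (i, 2 * k) * \<gamma> t $$ (Suc (2 * k), j) + \<gamma> t $$ (i, Suc (2 * k)) * \<gamma> t $$ (2 * k,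
         j)) else 0) \<in> polyf"
    by (intro polyf_if polyf_const polyf_add polyf_mult polymat_entry[OF assms]) simp_all
qed (simp_all add: step2_def)

text \<open>Two instances of the elimination, according to whether the diagonal vanishes. The normal
  forms are a partial identity and a sum of hyperbolic planes; in both cases
  \<open>E * E * E = E\<close>, so \<open>E\<close> is its own generalised inverse.\<close>

theorem symmetric_normal_form:
  assumes R: "R \<in> carrier_mat m m" "R\<^sup>T = R"
  obtains E \<Phi> where "E \<in> carrier_mat m m" "E\<^sup>T = E" "E * E * E = E" "congruent_mat m R E"
    "\<And>\<gamma>. polymat m m \<gamma> \<Longrightarrow> (\<lambda>t. \<Phi> (\<gamma> t)) \<in> polyf" "\<Phi> E \<noteq> (0 :: 'k)"
    "\<And>M. congruent_mat m E M \<Longrightarrow> \<Phi> M \<noteq> 0 \<Longrightarrow> tri_congruent m E M"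
proof (cases "\<exists>i<m. R $$ (i, i) \<noteq> 0")
  case True
  have "\<exists>k \<Phi>. congruent_mat m R (stdform1 m k) \<and> (\<forall>\<gamma>. polymat m m \<gamma> \<longrightarrow> (\<lambda>t. \<Phi> (\<gamma> t)) \<in> polyf) \<and>
    \<Phi> (stdform1 m k) \<noteq> 0 \<and> (\<forall>M. congruent_mat m (stdform1 m k) M \<longrightarrow> \<Phi> M \<noteq> 0 \<longrightarrow>
      tri_congruent m (stdform1 m k) M)"
  proof (rule elimination[where Adm = "\<lambda>M. M\<^sup>T = M \<and> (\<exists>i<m. M $$ (i, i) \<noteq> 0)" and clean = "clean1 m"
      and piv = "piv1 m" and step = "step1 m"])
    fix A B :: "'k mat" assume A: "A\<^sup>T = A \<and> (\<exists>i<m. A $$ (i, i) \<noteq> 0)" and AB: "congruent_mat m A B"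
    have "B\<^sup>T = B" using congruent_transpose[OF AB] A by blast
    then show "B\<^sup>T = B \<and> (\<exists>i<m. B $$ (i, i) \<noteq> 0)"
      using congruent_alternating[OF congruent_sym[OF AB]] A by blast
  next
    fix i k assume c: "clean1 m k (stdform1 m k)" and ik: "i < k"
    then have km: "k \<le> m" by (simp add: clean1_def)
    then show "step1 m i (stdform1 m k) = stdform1 m k \<and> piv1 m i (stdform1 m k) \<noteq> 0"
      using ik by (auto simp: mat_eq_iff step1_def stdform1_def piv1_def)
  next
    fix k and \<gamma> :: "'k \<Rightarrow> 'k mat" assume "polymat m m \<gamma>"
    then show "(\<lambda>t. piv1 m k (\<gamma> t)) \<in> polyf"
      unfolding piv1_def by (intro polyf_if polyf_const) (auto simp: polymat_def)
  qed (use R True step1_congruent stuck1 polymat_step1 in \<open>auto simp: clean1_def\<close>)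
  then obtain k \<Phi> where k: "congruent_mat m R (stdform1 m k)"
    and *: "\<forall>\<gamma>. polymat m m \<gamma> \<longrightarrow> (\<lambda>t. \<Phi> (\<gamma> t)) \<in> polyf"
    "\<Phi> (stdform1 m k) \<noteq> 0"
      "\<forall>M. congruent_mat m (stdform1 m k) M \<longrightarrow> \<Phi> M \<noteq> 0 \<longrightarrow> tri_congruent m (stdform1 m k) M"
    by blast
  have "stdform1 m k * stdform1 m k = stdform1 m k"
  proof (rule eq_matI)
    fix i j assume "i < dim_row (stdform1 m k)" "j < dim_col (stdform1 m k)"
    then have ij: "i < m" "j < m" by (auto simp: stdform1_def)
    have "(stdform1 m k * stdform1 m k) $$ (i, j) = (\<Sum>l<m. stdform1 m k $$ (i,
      l) * stdform1 m k $$ (l, j))"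
      using ij by (simp add: stdform1_def scalar_prod_def lessThan_atLeast0)
    also have "\<dots> = (\<Sum>l<m. if l = i then stdform1 m k $$ (i, j) else 0)"
      using ij by (intro sum.cong) (auto simp: stdform1_def)
    finally show "(stdform1 m k * stdform1 m k) $$ (i, j) = stdform1 m k $$ (i, j)" using ij by simp
  qed (auto simp: stdform1_def)
  then show thesis
    using that[OF _ congruent_transpose[OF k R(2)] _ k, of \<Phi>] * congruent_carrier[OF k] by simp
next
  case False
  have "\<exists>k \<Phi>. congruent_mat m R (stdform2 m k) \<and> (\<forall>\<gamma>. polymat m m \<gamma> \<longrightarrow> (\<lambda>t. \<Phi> (\<gamma> t)) \<in> polyf) \<and>
    \<Phi> (stdform2 m k) \<noteq> 0 \<and> (\<forall>M. congruent_mat m (stdform2 m k) M \<longrightarrow> \<Phi> M \<noteq> 0 \<longrightarrow>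
      tri_congruent m (stdform2 m k) M)"
  proof (rule elimination[where Adm = "\<lambda>M. M\<^sup>T = M \<and> (\<forall>i<m. M $$ (i, i) = 0)" and clean = "clean2 m"
      and piv = "piv2 m" and step = "step2 m"])
    fix A B :: "'k mat" assume A: "A\<^sup>T = A \<and> (\<forall>i<m. A $$ (i, i) = 0)" and AB: "congruent_mat m A B"
    show "B\<^sup>T = B \<and> (\<forall>i<m. B $$ (i, i) = 0)"
      using congruent_transpose[OF AB] congruent_alternating[OF AB] A by blast
  next
    fix i k assume c: "clean2 m k (stdform2 m k)" and ik: "i < k"
    then have km: "2 * k \<le> m" by (simp add: clean2_def)
    have pt: "ptn (2 * i) = Suc (2 * i)" "ptn (Suc (2 * i)) = 2 * i" by (auto simp: ptn_def)
    have big: "2 * Suc i \<le> ptn j" if "2 * Suc i \<le> j" for j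
      using ptn_less[of j "Suc i"] that by linarith
    have std: "stdform2 m k $$ (j, l) = (if j < 2 * k \<and> l = ptn j then 1 else 0)" if "j < m" "l < m"
      for j l
      using that by (simp add: stdform2_def)
    have lt: "2 * i < m" "Suc (2 * i) < m" "2 * i < 2 * k" using km ik by auto
    have piv: "stdform2 m k $$ (2 * i, Suc (2 * i)) = 1" using std[OF lt(1,2)] lt pt by simp
    have "step2 m i (stdform2 m k) = stdform2 m k"
    proof (rule eq_matI)
      fix j l assume "j < dim_row (stdform2 m k)" "l < dim_col (stdform2 m k)"
      then have jl: "j < m" "l < m" by (auto simp: stdform2_def)
      show "step2 m i (stdform2 m k) $$ (j, l) = stdform2 m k $$ (j, l)"
      proof (cases "j < 2 * Suc i \<or> l < 2 * Suc i")
        case True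
        have "j < 2 * k" if "l = ptn j" using True that ptn_less[of j "Suc i"] ik by auto
        then show ?thesis using True jl by (auto simp: step2_def stdform2_def)
      next
        case False
        then have "stdform2 m k $$ (j, 2 * i) = 0" "stdform2 m k $$ (j, Suc (2 * i)) = 0"
          using std[OF jl(1) lt(1)] std[OF jl(1) lt(2)] big[of j] by auto
        then show ?thesis using False jl lt piv by (simp add: step2_def)
      qed
    qed (auto simp: step2_def stdform2_def)
    then show "step2 m i (stdform2 m k) = stdform2 m k \<and> piv2 m i (stdform2 m k) \<noteq> 0"
      using piv lt by (simp add: piv2_def)
  next
    fix k and \<gamma> :: "'k \<Rightarrow> 'k mat" assume "polymat m m \<gamma>"
    then show "(\<lambda>t. piv2 m k (\<gamma> t)) \<in> polyf"
      unfolding piv2_def by (intro polyf_if polyf_const) (auto simp: polymat_def)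
  qed (use R False step2_congruent stuck2 polymat_step2 in \<open>auto simp: clean2_def\<close>)
  then obtain k \<Phi> where k: "congruent_mat m R (stdform2 m k)"
    and *: "\<forall>\<gamma>. polymat m m \<gamma> \<longrightarrow> (\<lambda>t. \<Phi> (\<gamma> t)) \<in> polyf"
    "\<Phi> (stdform2 m k) \<noteq> 0"
      "\<forall>M. congruent_mat m (stdform2 m k) M \<longrightarrow> \<Phi> M \<noteq> 0 \<longrightarrow> tri_congruent m (stdform2 m k) M"
    by blast
  let ?E = "stdform2 m k"
  have Es: "?E\<^sup>T = ?E" using congruent_transpose[OF k R(2)] .
  have Ec: "?E \<in> carrier_mat m m" by (simp add: stdform2_def)
  have EE: "(?E * ?E) $$ (i, j) = (if i = j \<and> i < 2 * k \<and> ptn i < m then 1 else 0)" if ij: "i < m"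
    "j < m" for i j
  proof -
    have "(?E * ?E) $$ (i, j) = (\<Sum>l<m. ?E $$ (i, l) * ?E $$ (l, j))"
      using ij Ec by (simp add: scalar_prod_def lessThan_atLeast0)
    also have "\<dots> = (\<Sum>l<m. if l = ptn i then (if i = j \<and> i < 2 * k then 1 else 0) else 0)"
      using ij ptn_less[of i k] by (intro sum.cong) (auto simp: stdform2_def)
    finally show ?thesis by auto
  qed
  have "?E * ?E * ?E = ?E"
  proof (rule eq_matI)
    fix i j assume "i < dim_row ?E" "j < dim_col ?E"
    then have ij: "i < m" "j < m" by (auto simp: stdform2_def)
    have "(?E * ?E * ?E) $$ (i, j) = (\<Sum>l<m. (?E * ?E) $$ (i, l) * ?E $$ (l, j))"
      by (rule mult_mat_entry[OF mult_square_carrier[OF Ec Ec] Ec ij])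
    also have "\<dots> = (\<Sum>l<m. if l = i then ?E $$ (i, j) else 0)"
      using ij EE by (intro sum.cong refl) (auto simp: stdform2_def)
    finally show "(?E * ?E * ?E) $$ (i, j) = ?E $$ (i, j)" using ij by simp
  qed (auto simp: stdform2_def)
  then show thesis using that[OF Ec Es _ k, of \<Phi>] * by blast
qed

end

section \<open>Kernels and rank-one matrices\<close>

lemma dot_in_span:
  fixes v p :: "'k::field vec"
  assumes v: "v \<in> carrier_vec m" and p: "p \<in> carrier_vec m"
    and *: "\<And>q. q \<in> carrier_vec m \<Longrightarrow> v \<bullet> q = 0 \<Longrightarrow> p \<bullet> q = 0"
  obtains c where "p = c \<cdot>\<^sub>v v"
proof (cases "v = 0\<^sub>v m")
  case True
  have "p $ i = 0" if "i < m" for i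
    using *[of "unit_vec m i"] p that unfolding True by simp
  then have "p = 0 \<cdot>\<^sub>v v" using p v by (intro eq_vecI) auto
  then show thesis by (rule that)
next
  case False
  then obtain i where i: "i < m" "v $ i \<noteq> 0" using v by (metis carrier_vecD eq_vecI index_zero_vec)
  have "p $ j = p $ i / v $ i * v $ j" if j: "j < m" for j
  proof -
    \<comment> \<open>A vector orthogonal to \<open>v\<close> on two coordinates; orthogonality of
      \<open>p\<close> to it makes the coordinates \<open>i\<close> and \<open>j\<close> of
      \<open>p\<close> and \<open>v\<close> proportional.\<close>
    define q where "q = v $ j \<cdot>\<^sub>v unit_vec m i + (- (v $ i)) \<cdot>\<^sub>v unit_vec m j"
    have q: "q \<in> carrier_vec m" by (simp add: q_def)
    have dot: "w \<bullet> q = v $ j * w $ i - v $ i * w $ j" if "w \<in> carrier_vec m" for w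
      unfolding q_def using that i j by (subst scalar_prod_add_distrib[of _ m]) auto
    have "p \<bullet> q = 0" using v by (intro *[OF q]) (simp add: dot)
    then have "v $ j * p $ i = v $ i * p $ j" using dot[OF p] by simp
    then show ?thesis using i(2) by (simp add: field_simps)
  qed
  then have "p = (p $ i / v $ i) \<cdot>\<^sub>v v" using p v by (intro eq_vecI) auto
  then show thesis by (rule that)
qed

lemma mat_eq_vecI:
  fixes A B :: "'k::comm_ring_1 mat"
  assumes A: "A \<in> carrier_mat l m" and B: "B \<in> carrier_mat l m"
    and *: "\<And>v. v \<in> carrier_vec m \<Longrightarrow> A *\<^sub>v v = B *\<^sub>v v"
  shows "A = B"
proof (rule eq_matI)
  fix i j assume "i < dim_row B" "j < dim_col B"
  then have ij: "i < l" "j < m" using B by auto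
  have "(A *\<^sub>v unit_vec m j) $ i = (B *\<^sub>v unit_vec m j) $ i" using *[of "unit_vec m j"] by simp
  then show "A $$ (i, j) = B $$ (i, j)" using A B ij by simp
qed (use A B in auto)

definition mat_ker :: "nat \<Rightarrow> 'k::field mat \<Rightarrow> 'k vec set" where
  "mat_ker m M = {v \<in> carrier_vec m. M *\<^sub>v v = 0\<^sub>v m}"

definition nullity :: "nat \<Rightarrow> 'k::field mat \<Rightarrow> nat" where
  "nullity m M = card (leads m (mat_ker m M))"

lemma nullity_less:
  assumes "A \<in> carrier_mat m m" "B \<in> carrier_mat m m" "mat_ker m A \<subseteq> mat_ker m B" "v \<in> mat_ker m B"
    "v \<notin> mat_ker m A"
  shows "nullity m A < nullity m B"
  unfolding nullity_def
  by (rule leads_psubset) (use assms subsp_vec_kernel in \<open>auto simp: mat_ker_def\<close>)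

definition outer :: "nat \<Rightarrow> 'k::comm_ring_1 vec \<Rightarrow> 'k mat" where
  "outer m q = mat m m (\<lambda>(i, j). q $ i * q $ j)"

lemma outer_carrier [simp]: "outer m q \<in> carrier_mat m m"
  by (simp add: outer_def)

lemma outer_transpose: "(outer m q)\<^sup>T = outer m q"
  by (auto simp: outer_def mat_eq_iff mult.commute)

lemma outer_apply:
  assumes "q \<in> carrier_vec m" "w \<in> carrier_vec m"
  shows "outer m q *\<^sub>v w = (q \<bullet> w) \<cdot>\<^sub>v q"
proof (rule eq_vecI)
  fix i assume "i < dim_vec ((q \<bullet> w) \<cdot>\<^sub>v q)"
  then have i: "i < m" using assms by simp
  then have "row (outer m q) i = q $ i \<cdot>\<^sub>v q" using assms by (intro eq_vecI) (auto simp: outer_def)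
  then have "(outer m q *\<^sub>v w) $ i = q $ i * (q \<bullet> w)"
    using i assms carrier_matD[OF outer_carrier[of m q]] by simp
  then show "(outer m q *\<^sub>v w) $ i = ((q \<bullet> w) \<cdot>\<^sub>v q) $ i" using i assms by simp
qed (use assms in \<open>auto simp: outer_def\<close>)

context symplectic_char2
begin

section \<open>Classes of involutions are spherical\<close>

abbreviation I\<^sub>n :: "'k mat" where "I\<^sub>n \<equiv> 1\<^sub>m n"
abbreviation O\<^sub>n :: "'k mat" where "O\<^sub>n \<equiv> 0\<^sub>m n n"
abbreviation M\<^sub>n :: "'k mat set" where "M\<^sub>n \<equiv> carrier_mat n n"

abbreviation low :: "'k mat \<Rightarrow> 'k mat" where "low S \<equiv> four_block_mat I\<^sub>n O\<^sub>n S I\<^sub>n"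
abbreviation up :: "'k mat \<Rightarrow> 'k mat" where "up S \<equiv> four_block_mat I\<^sub>n S O\<^sub>n I\<^sub>n"

lemma low_in_Sp: "S \<in> M\<^sub>n \<Longrightarrow> S\<^sup>T = S \<Longrightarrow> low S \<in> carrier G"
  by (subst Sp_four_block_iff) (auto simp: right_add_zero_mat[of _ n n])

lemma inv_low: "S \<in> M\<^sub>n \<Longrightarrow> S\<^sup>T = S \<Longrightarrow> inv\<^bsub>G\<^esub> (low S) = low S"
  using low_in_Sp[of S] by (simp add: Sp_four_block_inv)

lemma inv_up: "S \<in> M\<^sub>n \<Longrightarrow> S\<^sup>T = S \<Longrightarrow> inv\<^bsub>G\<^esub> (up S) = up S"
  using upper_unipotent_in_Sp[of S] by (simp add: Sp_four_block_inv)

lemma low_mult: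
  assumes "S \<in> M\<^sub>n" "a \<in> M\<^sub>n" "b \<in> M\<^sub>n" "c \<in> M\<^sub>n" "d \<in> M\<^sub>n"
  shows "low S * four_block_mat a b c d = four_block_mat a b (S * a + c) (S * b + d)"
    "four_block_mat a b c d * low S = four_block_mat (a + b * S) b (c + d * S) d"
  using assms by (subst block_mult; auto simp: left_add_zero_mat[of _ n n] right_add_zero_mat[of _ n
    n] mult_square_carrier)+

lemma up_mult:
  assumes "S \<in> M\<^sub>n" "a \<in> M\<^sub>n" "b \<in> M\<^sub>n" "c \<in> M\<^sub>n" "d \<in> M\<^sub>n"
  shows "up S * four_block_mat a b c d = four_block_mat (a + S * c) (b + S * d) c d"
    "four_block_mat a b c d * up S = four_block_mat a (a * S + b) c (c * S + d)"
  using assms by (subst block_mult; auto simp: left_add_zero_mat[of _ n n] right_add_zero_mat[of _ n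
    n] mult_square_carrier)+

text \<open>Congruence transports \<open>E * E * E = E\<close>: if
  \<open>R = K * E * K\<^sup>T\<close>, then the transform of \<open>E\<close> by the inverse
  transpose of \<open>K\<close> is a symmetric generalised inverse of \<open>R\<close>.\<close>

lemma symmetric_inverse:
  assumes R: "R \<in> M\<^sub>n" "R\<^sup>T = R"
  obtains S where "S \<in> M\<^sub>n" "S\<^sup>T = S" "R * S * R = R"
proof -
  obtain E where E: "E \<in> M\<^sub>n" "E\<^sup>T = E" "E * E * E = E" "congruent_mat n R E"
    using symmetric_normal_form[OF R] by metis
  obtain K where K: "K \<in> M\<^sub>n" "det K \<noteq> 0" "R = K * E * K\<^sup>T"
    using congruent_sym[OF E(4)] by (auto simp: congruent_mat_def)
  obtain K' where K': "K' \<in> M\<^sub>n" "K' * K = I\<^sub>n" using det_nonzero_inverse[OF K(1,2)] by blast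
  have KT: "K\<^sup>T * K'\<^sup>T = I\<^sub>n" using arg_cong[OF K'(2), of transpose_mat] K(1) K'(1)
    by (simp add: transpose_mult[of _ n n _ n])
  let ?S = "K'\<^sup>T * E * K'"
  have S: "?S \<in> M\<^sub>n" using K' E by (auto intro!: mult_square_carrier)
  have St: "?S\<^sup>T = ?S" using K' E by (simp add: transpose_mult[of _ n n _ n] block_simps)
  have "R * ?S * R = (K * E * K\<^sup>T) * (K'\<^sup>T * E * K') * (K * E * K\<^sup>T)" using K(3) by simp
  also have "\<dots> = K * (E * ((K\<^sup>T * K'\<^sup>T) * (E * ((K' * K) * (E * K\<^sup>T)))))"
    using K(1) K'(1) E(1) by (simp add: block_simps)
  also have "\<dots> = K * (E * E * E) * K\<^sup>T" unfolding KT K'(2)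
    using K(1) E(1) by (simp add: block_simps)
  also have "\<dots> = R" using E(3) K(3) by simp
  finally show thesis using that[OF S St] by blast
qed

text \<open>Comparing \<open>y\<close> with the block formula for its inverse makes \<open>b\<close>
  and \<open>c\<close> symmetric and the last block \<open>a\<^sup>T\<close>. The other relations
  are the blocks of \<open>y * y = 1\<close>.\<close>

lemma involution_block:
  assumes y: "y \<in> carrier G" "y * y = 1\<^sub>m (2 * n)"
  obtains a b c where "a \<in> M\<^sub>n" "b \<in> M\<^sub>n" "c \<in> M\<^sub>n" "y = four_block_mat a b c (a\<^sup>T)" "b\<^sup>T = b" "c\<^sup>T = c"
    "a * a + b * c = I\<^sub>n" "c * a = a\<^sup>T * c" "a * b = b * a\<^sup>T" "c * b + a\<^sup>T * a\<^sup>T = I\<^sub>n"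
proof -
  obtain a b c d where c: "a \<in> M\<^sub>n" "b \<in> M\<^sub>n" "c \<in> M\<^sub>n" "d \<in> M\<^sub>n" and yb: "y = four_block_mat a b c d"
    using four_block_cases[OF Sp_carrier[OF y(1)]] by blast
  have "inv\<^bsub>G\<^esub> y = y"
    using G.inv_equality[of y y] y by (simp add: Sp_mult Sp_one)
  then have "four_block_mat (d\<^sup>T) (b\<^sup>T) (c\<^sup>T) (a\<^sup>T) = four_block_mat a b c d"
    using Sp_four_block_inv[OF c] y(1) yb by simp
  then have t: "d\<^sup>T = a" "b\<^sup>T = b" "c\<^sup>T = c" "a\<^sup>T = d"
    using c by (subst (asm) four_block_mat_eq_iff, auto)+
  have "four_block_mat a b c d * four_block_mat a b c d = four_block_mat I\<^sub>n O\<^sub>n O\<^sub>n I\<^sub>n"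
    using y(2) unfolding yb by (simp add: mult_2)
  then have "four_block_mat (a * a + b * c) (a * b + b * d) (c * a + d * c) (c * b + d * d) =
      four_block_mat I\<^sub>n O\<^sub>n O\<^sub>n I\<^sub>n"
    unfolding block_mult[OF c c] .
  moreover have p: "a * a \<in> M\<^sub>n" "b * c \<in> M\<^sub>n" "a * b \<in> M\<^sub>n" "b * d \<in> M\<^sub>n" "c * a \<in> M\<^sub>n" "d * c \<in> M\<^sub>n"
    "c * b \<in> M\<^sub>n" "d * d \<in> M\<^sub>n" using c by (auto intro: mult_square_carrier)
  ultimately have m: "a * a + b * c = I\<^sub>n" "a * b + b * d = O\<^sub>n" "c * a + d * c = O\<^sub>n"
    "c * b + d * d = I\<^sub>n"
    using four_block_mat_eq_iff[of "a * a + b * c" n "a * b + b * d" "c * a + d * c" "c * b + d * d"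
      I\<^sub>n O\<^sub>n O\<^sub>n I\<^sub>n]
    by auto
  have "a * b = b * d" using m(2) mat_add_eq_0_iff[OF p(3,4)] by blast
  moreover have "c * a = d * c" using m(3) mat_add_eq_0_iff[OF p(5,6)] by blast
  ultimately show thesis using that[OF c(1-3) _ t(2,3) m(1)] m(4) yb unfolding t(4) by blast
qed

text \<open>Since \<open>d\<^sup>T * a = 1\<close>, the products \<open>h * low R\<close> and
  \<open>low (d * R * d\<^sup>T) * h\<close> have the same blocks. The block \<open>c\<close> drops
  out because lower unitriangular elements commute.\<close>

lemma conj_low:
  assumes c: "a \<in> M\<^sub>n" "c \<in> M\<^sub>n" "d \<in> M\<^sub>n" "R \<in> M\<^sub>n" "R\<^sup>T = R"
    and h: "four_block_mat a O\<^sub>n c d \<in> carrier G"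
  shows "four_block_mat a O\<^sub>n c d * low R * inv\<^bsub>G\<^esub> (four_block_mat a O\<^sub>n c d) = low (d * R * d\<^sup>T)"
proof -
  let ?h = "four_block_mat a O\<^sub>n c d"
  have ad: "a\<^sup>T * d = I\<^sub>n"
    using h c Sp_four_block_iff[of a O\<^sub>n c d] by (auto simp: right_add_zero_mat[of _ n n])
  have da: "d\<^sup>T * a = I\<^sub>n"
    using arg_cong[OF ad, of transpose_mat] c by (simp add: transpose_mult[of _ n n _ n])
  have D: "d * R * d\<^sup>T \<in> M\<^sub>n" using c by (auto intro!: mult_square_carrier)
  have Ds: "(d * R * d\<^sup>T)\<^sup>T = d * R * d\<^sup>T"
    using c by (simp add: transpose_mult[of _ n n _ n] block_simps)
  have "d * R * d\<^sup>T * a = d * R * (d\<^sup>T * a)" using c by (simp add: block_simps)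
  then have e: "d * R * d\<^sup>T * a + c = c + d * R" unfolding da using c
    by (simp add: comm_add_mat[of "d * R" n n c] mult_square_carrier)
  have "low (d * R * d\<^sup>T) * ?h = four_block_mat a O\<^sub>n (d * R * d\<^sup>T * a + c) d"
    using low_mult(1)[OF D c(1) _ c(2,3), of O\<^sub>n] D c by (simp add: left_add_zero_mat[of _ n n])
  moreover have "?h * low R = four_block_mat a O\<^sub>n (c + d * R) d"
    using low_mult(2)[OF c(4,1) _ c(2,3), of O\<^sub>n] c by (simp add: right_add_zero_mat[of _ n n])
  ultimately have hl: "?h * low R = low (d * R * d\<^sup>T) * ?h" using e by simp
  have "low (d * R * d\<^sup>T) \<otimes>\<^bsub>G\<^esub> ?h \<otimes>\<^bsub>G\<^esub> inv\<^bsub>G\<^esub> ?h = low (d * R * d\<^sup>T)"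
    using h low_in_Sp[OF D Ds] by (simp add: G.m_assoc)
  then show ?thesis unfolding hl by (simp add: Sp_mult)
qed

lemma conj_comp:
  assumes "g \<in> carrier G" "h \<in> carrier G" "x \<in> carrier G"
  shows "g * (h * x * inv\<^bsub>G\<^esub> h) * inv\<^bsub>G\<^esub> g = (g * h) * x * inv\<^bsub>G\<^esub> (g * h)"
proof -
  have "g \<otimes>\<^bsub>G\<^esub> (h \<otimes>\<^bsub>G\<^esub> x \<otimes>\<^bsub>G\<^esub> inv\<^bsub>G\<^esub> h) \<otimes>\<^bsub>G\<^esub> inv\<^bsub>G\<^esub> g = (g \<otimes>\<^bsub>G\<^esub> h) \<otimes>\<^bsub>G\<^esub> x \<otimes>\<^bsub>G\<^esub> inv\<^bsub>G\<^esub> (g \<otimes>\<^bsub>G\<^esub> h)"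
    using assms by (simp add: G.m_assoc G.inv_mult_group)
  then show ?thesis by (simp add: Sp_mult)
qed

lemma levi_in_Sp:
  assumes "d \<in> M\<^sub>n" "det d \<noteq> 0"
  obtains a where "a \<in> M\<^sub>n" "a\<^sup>T * d = I\<^sub>n" "four_block_mat a O\<^sub>n O\<^sub>n d \<in> carrier G"
proof -
  obtain K where K: "K \<in> M\<^sub>n" "K * d = I\<^sub>n" using det_nonzero_inverse[OF assms] by blast
  show thesis
    by (rule that[of "K\<^sup>T"]) (use K assms(1) in
      \<open>auto simp: Sp_four_block_iff right_add_zero_mat[of _ n n]\<close>)
qed

text \<open>Take \<open>y\<close> in the class with diagonal block \<open>a\<close> and lower left block \<open>c\<close> such that the kernel of \<open>c\<close>
  has minimal dimension. If \<open>a\<close> did not fix that kernel, then conjugation by \<open>low S\<close> with \<open>S\<close> of rank 1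
  would shrink it. Hence \<open>a + I\<^sub>n\<close> is a multiple of \<open>c\<close>, conjugation by some \<open>up Y\<close> turns \<open>a\<close> into \<open>I\<^sub>n\<close>,
  and minimality once more kills the upper right block.\<close>

lemma involution_class_contains_low:
  assumes C: "C \<noteq> {}" "C \<subseteq> carrier G" and inv: "\<And>y. y \<in> C \<Longrightarrow> y * y = 1\<^sub>m (2 * n)"
    and conj: "\<And>g y. g \<in> carrier G \<Longrightarrow> y \<in> C \<Longrightarrow> g * y * inv\<^bsub>G\<^esub> g \<in> C"
  obtains R where "R \<in> M\<^sub>n" "R\<^sup>T = R" "low R \<in> C"
proof -
  define ll where "ll y = mat n n (\<lambda>(i, j). y $$ (i + n, j))" for y :: "'k mat"
  have ll: "ll (four_block_mat a b c d) = c" if "a \<in> M\<^sub>n" "b \<in> M\<^sub>n" "c \<in> M\<^sub>n" "d \<in> M\<^sub>n" for a b c d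
    using that by (intro eq_matI) (auto simp: ll_def)
  obtain y where y: "y \<in> C" and ymin: "\<And>z. z \<in> C \<Longrightarrow> nullity n (ll y) \<le> nullity n (ll z)"
    using C(1) ex_has_least_nat[of "\<lambda>y. y \<in> C" _ "\<lambda>y. nullity n (ll y)"] by blast
  obtain a b c where abc: "a \<in> M\<^sub>n" "b \<in> M\<^sub>n" "c \<in> M\<^sub>n" "y = four_block_mat a b c (a\<^sup>T)" "b\<^sup>T = b"
    "c\<^sup>T = c"
    and rel: "a * a + b * c = I\<^sub>n" "c * a = a\<^sup>T * c" "a * b = b * a\<^sup>T" "c * b + a\<^sup>T * a\<^sup>T = I\<^sub>n"
    by (rule involution_block[OF subsetD[OF C(2) y] inv[OF y]])
  note car = abc(1-3) and at = transpose_carrier_mat[THEN iffD2, OF abc(1)]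
  have lly: "ll y = c" using ll[OF car at] abc(4) by simp
  \<comment> \<open>The terms linear in \<open>S\<close> detect where \<open>a\<close> moves the
    kernel of \<open>c\<close>; once \<open>a = 1\<close> they cancel, and the quadratic term
    detects the upper right block.\<close>
  have conj_low_block: "\<exists>z\<in>C. ll z = c' + S * a' + a'\<^sup>T * S + S * b' * S"
    if z: "four_block_mat a' b' c' (a'\<^sup>T) \<in> C" and c': "a' \<in> M\<^sub>n" "b' \<in> M\<^sub>n" "c' \<in> M\<^sub>n" and S: "S \<in> M\<^sub>n"
      "S\<^sup>T = S"
    for a' b' c' S
  proof -
    have at': "a'\<^sup>T \<in> M\<^sub>n" using c' by simp
    have p: "S * a' \<in> M\<^sub>n" "S * b' \<in> M\<^sub>n" "a'\<^sup>T * S \<in> M\<^sub>n" "S * b' * S \<in> M\<^sub>n"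
      using c' S at' by (auto intro!: mult_square_carrier)
    have "low S * four_block_mat a' b' c' (a'\<^sup>T) * inv\<^bsub>G\<^esub> (low S) =
      four_block_mat (a' + b' * S) b' ((S * a' + c') + (S * b' + a'\<^sup>T) * S) (S * b' + a'\<^sup>T)"
      unfolding inv_low[OF S] low_mult(1)[OF S(1) c' at']
      using c' S at' p by (subst low_mult(2)) auto
    moreover have "(S * a' + c') + (S * b' + a'\<^sup>T) * S = c' + S * a' + a'\<^sup>T * S + S * b' * S"
    proof -
      have e: "(S * b' + a'\<^sup>T) * S = S * b' * S + a'\<^sup>T * S"
        by (rule add_mult_distrib_mat[OF p(2) at' S(1)])
      show ?thesis unfolding e
        using p c' carrier_matD[OF p(1)] carrier_matD[OF p(3)] carrier_matD[OF p(4)]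
        by (intro eq_matI) (auto simp: ac_simps simp del: index_mult_mat(1))
    qed
    ultimately have "ll (low S * four_block_mat a' b' c' (a'\<^sup>T) * inv\<^bsub>G\<^esub> (low S)) = c' + S * a' +
      a'\<^sup>T * S + S * b' * S"
      using ll c' S at' p by (auto simp: mult_square_carrier)
    then show ?thesis using conj[OF low_in_Sp[OF S] z] by blast
  qed
  have sym_dot: "x \<bullet> (A *\<^sub>v w) = (A\<^sup>T *\<^sub>v x) \<bullet> w" if "A \<in> M\<^sub>n" "x \<in> carrier_vec n" "w \<in> carrier_vec n"
    for A x w
    using transpose_vec_mult_scalar[OF that(1,3,2)] by simp
  have vzero: "A *\<^sub>v 0\<^sub>v n = 0\<^sub>v n" if "A \<in> M\<^sub>n" for A using that by (intro eq_vecI) auto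
  have fixker: "a *\<^sub>v v = v" if v: "v \<in> carrier_vec n" "c *\<^sub>v v = 0\<^sub>v n" for v
  proof (rule ccontr)
    assume ne: "a *\<^sub>v v \<noteq> v"
    have av: "a *\<^sub>v v \<in> carrier_vec n" using car(1) v(1) by (rule mult_mat_vec_carrier)
    define p where "p = a *\<^sub>v v + v"
    have p: "p \<in> carrier_vec n" using av v by (simp add: p_def)
    have avp: "a *\<^sub>v v = p + v" using v carrier_vecD[OF av]
      by (intro eq_vecI) (auto simp: p_def add.assoc add_self simp del: index_mult_mat_vec
        dim_mult_mat_vec)
    have p0: "p \<noteq> 0\<^sub>v n" using ne avp v p by auto
    have aav: "a *\<^sub>v (a *\<^sub>v v) = v"
    proof -
      have "(a * a + b * c) *\<^sub>v v = a *\<^sub>v (a *\<^sub>v v) + b *\<^sub>v (c *\<^sub>v v)"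
        using car v by (simp add: add_mult_distrib_mat_vec[of _ n n] mult_square_carrier
          assoc_mult_mat_vec[of _ n n _ n])
      then show ?thesis unfolding rel(1) v(2) vzero[OF car(2)] using v car av by simp
    qed
    \<comment> \<open>Since \<open>a\<close> squares to the identity on \<open>v\<close>, its
      eigenvalue \<open>l + 1\<close> would satisfy \<open>(l + 1)\<^sup>2 = 1\<close>, that is
      \<open>l = 0\<close>.\<close>
    have np: "p \<noteq> l \<cdot>\<^sub>v v" for l
    proof
      assume pl: "p = l \<cdot>\<^sub>v v"
      then have avl: "a *\<^sub>v v = (l + 1) \<cdot>\<^sub>v v" using avp v by (simp add: add_smult_distrib_vec)
      have "v = ((l + 1) * (l + 1)) \<cdot>\<^sub>v v"
        using aav unfolding avl using avl v by (simp add: mult_mat_vec[OF car(1)] smult_smult_assoc)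
      then have "(v) $ i = ((l + 1) * (l + 1)) * v $ i" if "i < n" for i
        using v that by (metis carrier_vecD index_smult_vec(1))
      then have "l * l * v $ i = 0" if "i < n" for i using that
        by (simp add: algebra_simps add_left_self two_eq_0)
      then have "l * v $ i = 0" if "i < n" for i using that by fastforce
      then have "p = 0\<^sub>v n" using pl v by (intro eq_vecI) auto
      then show False using p0 by simp
    qed
    \<comment> \<open>A functional that vanishes on \<open>v\<close> but not on \<open>a v\<close>.
      The perturbation by \<open>outer n q\<close> then removes \<open>v\<close> from the kernel of
      the lower left block.\<close>
    obtain q0 where q0: "q0 \<in> carrier_vec n" "v \<bullet> q0 = 0" "p \<bullet> q0 \<noteq> 0"
      using dot_in_span[OF v(1) p] np by metis
    define q where "q = (1 / (p \<bullet> q0)) \<cdot>\<^sub>v q0"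
    have q: "q \<in> carrier_vec n" "v \<bullet> q = 0" "p \<bullet> q = 1" using q0 v p by (auto simp: q_def)
    let ?S = "outer n q"
    let ?c = "c + ?S * a + a\<^sup>T * ?S + ?S * b * ?S"
    have Sc: "?S \<in> M\<^sub>n" by simp
    have pc: "?S * a \<in> M\<^sub>n" "a\<^sup>T * ?S \<in> M\<^sub>n" "?S * b \<in> M\<^sub>n" "?S * b * ?S \<in> M\<^sub>n"
      using car at by (auto intro!: mult_square_carrier)
    have cc: "?c \<in> M\<^sub>n" using pc car by simp
    obtain z where z: "z \<in> C" "ll z = ?c"
      using conj_low_block[OF y[unfolded abc(4)] car Sc outer_transpose] by blast
    have key: "q \<bullet> w = 0 \<and> q \<bullet> (a *\<^sub>v w) = 0 \<and> c *\<^sub>v w = 0\<^sub>v n"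
      if w: "w \<in> carrier_vec n" "?c *\<^sub>v w = 0\<^sub>v n" for w
    proof -
      have aw: "a *\<^sub>v w \<in> carrier_vec n" and bq: "b *\<^sub>v q \<in> carrier_vec n"
        and cw: "c *\<^sub>v w \<in> carrier_vec n"
        and atq: "a\<^sup>T *\<^sub>v q \<in> carrier_vec n"
        using car at w q by (auto intro!: mult_mat_vec_carrier)
      define \<alpha> \<beta> \<gamma> where "\<alpha> = q \<bullet> (a *\<^sub>v w)" and "\<beta> = q \<bullet> w" and "\<gamma> = q \<bullet> (b *\<^sub>v q)"
      have "?c *\<^sub>v w = c *\<^sub>v w + (?S * a) *\<^sub>v w + (a\<^sup>T * ?S) *\<^sub>v w + (?S * b * ?S) *\<^sub>v w"
        using pc car w(1) by (simp only: add_mult_distrib_mat_vec[of _ n n] add_carrier_mat)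
      also have "(?S * a) *\<^sub>v w = \<alpha> \<cdot>\<^sub>v q"
        using assoc_mult_mat_vec[OF Sc car(1) w(1)] outer_apply[OF q(1) aw] by (simp add: \<alpha>_def)
      also have "(a\<^sup>T * ?S) *\<^sub>v w = \<beta> \<cdot>\<^sub>v (a\<^sup>T *\<^sub>v q)"
        using assoc_mult_mat_vec[OF at Sc w(1)] outer_apply[OF q(1) w(1)] mult_mat_vec[OF at q(1)]
          by (simp add: \<beta>_def)
      also have "(?S * b * ?S) *\<^sub>v w = (\<beta> * \<gamma>) \<cdot>\<^sub>v q"
        using assoc_mult_mat_vec[OF pc(3) Sc w(1)] outer_apply[OF q(1) w(1)] mult_mat_vec[OF pc(3)
          q(1)]
          assoc_mult_mat_vec[OF Sc car(2) q(1)] outer_apply[OF q(1) bq]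
            by (simp add: \<beta>_def \<gamma>_def smult_smult_assoc)
      finally have ex: "c *\<^sub>v w + \<alpha> \<cdot>\<^sub>v q + \<beta> \<cdot>\<^sub>v (a\<^sup>T *\<^sub>v q) + (\<beta> * \<gamma>) \<cdot>\<^sub>v q = 0\<^sub>v n" using w(2) by simp
      \<comment> \<open>Pairing with \<open>v\<close> and then with \<open>p\<close>, both in the
        kernel of the symmetric matrix \<open>c\<close>, isolates \<beta> and then \<alpha>. So the
        new kernel lies inside the old one.\<close>
      have dot: "x \<bullet> (c *\<^sub>v w) + \<alpha> * (x \<bullet> q) + \<beta> * (x \<bullet> (a\<^sup>T *\<^sub>v q)) + \<beta> * \<gamma> * (x \<bullet> q) = 0"
        if x: "x \<in> carrier_vec n" for x
      proof -
        have "x \<bullet> (c *\<^sub>v w + \<alpha> \<cdot>\<^sub>v q + \<beta> \<cdot>\<^sub>v (a\<^sup>T *\<^sub>v q) + (\<beta> * \<gamma>) \<cdot>\<^sub>v q) = 0" unfolding ex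
          using x by simp
        then show ?thesis using x cw q atq by (simp add: scalar_prod_add_distrib[of _ n] add.assoc)
      qed
      have "v \<bullet> (c *\<^sub>v w) = 0" using sym_dot[OF car(3) v(1) w(1)] abc(6) v(2) w by simp
      moreover have "v \<bullet> (a\<^sup>T *\<^sub>v q) = 1"
        using sym_dot[OF at v(1) q(1)] avp q p v by (simp add: add_scalar_prod_distrib[of _ n])
      ultimately have \<beta>: "\<beta> = 0" using dot[OF v(1)] q by simp
      have "c *\<^sub>v p = 0\<^sub>v n"
      proof -
        have "c *\<^sub>v p = c *\<^sub>v (a *\<^sub>v v) + c *\<^sub>v v" unfolding p_def
          using car(3) av v(1) by (rule mult_add_distrib_mat_vec)
        also have "c *\<^sub>v (a *\<^sub>v v) = (c * a) *\<^sub>v v"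
          using car v by (intro assoc_mult_mat_vec[symmetric])
        also have "\<dots> = a\<^sup>T *\<^sub>v (c *\<^sub>v v)" unfolding rel(2) using at car v by (intro assoc_mult_mat_vec)
        finally show ?thesis using v(2) vzero[OF at] by simp
      qed
      then have "p \<bullet> (c *\<^sub>v w) = 0" using sym_dot[OF car(3) p w(1)] abc(6) w by simp
      then have \<alpha>: "\<alpha> = 0" using dot[OF p] q \<beta> by simp
      have "c *\<^sub>v w = 0\<^sub>v n"
      proof (rule eq_vecI)
        fix i assume "i < dim_vec (0\<^sub>v n)"
        then have i: "i < n" by simp
        have "(c *\<^sub>v w + \<alpha> \<cdot>\<^sub>v q + \<beta> \<cdot>\<^sub>v (a\<^sup>T *\<^sub>v q) + (\<beta> * \<gamma>) \<cdot>\<^sub>v q) $ i = 0" unfolding ex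
          using i by simp
        then show "(c *\<^sub>v w) $ i = 0\<^sub>v n $ i" unfolding \<alpha> \<beta>
          using i q carrier_vecD[OF cw] carrier_vecD[OF atq]
            by (simp del: index_mult_mat_vec dim_mult_mat_vec)
      qed (use carrier_vecD[OF cw] in \<open>simp del: dim_mult_mat_vec\<close>)
      then show ?thesis using \<alpha> \<beta> by (simp add: \<alpha>_def \<beta>_def)
    qed
    have "nullity n ?c < nullity n c"
    proof (rule nullity_less[OF cc car(3)])
      show "mat_ker n ?c \<subseteq> mat_ker n c" using key by (auto simp: mat_ker_def)
      show "v \<in> mat_ker n c" using v by (simp add: mat_ker_def)
      show "v \<notin> mat_ker n ?c"
      proof
        assume "v \<in> mat_ker n ?c"
        then have "q \<bullet> (a *\<^sub>v v) = 0" using key by (simp add: mat_ker_def)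
        moreover have "q \<bullet> (a *\<^sub>v v) = 1"
          using comm_scalar_prod[OF q(1) av] q p v unfolding avp
            by (simp add: add_scalar_prod_distrib[of _ n])
        ultimately show False by simp
      qed
    qed
    then show False using ymin[OF z(1)] z(2) lly by simp
  qed
  have vec_add_self: "x + x = 0\<^sub>v n" if "x \<in> carrier_vec n" for x :: "'k vec"
    using that by (intro eq_vecI) (auto simp: add_self)
  obtain g where g: "g \<in> M\<^sub>n" "g\<^sup>T = g" "c * g * c = c"
    using symmetric_inverse[OF car(3) abc(6)] by blast
  define P where "P = a + I\<^sub>n"
  have P: "P \<in> M\<^sub>n" using car by (simp add: P_def)
  have Pt: "P\<^sup>T \<in> M\<^sub>n" using P by simp
  have aP: "a + P = I\<^sub>n" using car by (intro eq_matI) (auto simp: P_def add_left_self)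
  have PTc: "P\<^sup>T * c = c * P"
    using car rel(2) at
      by (simp add: P_def transpose_add[of _ n n] add_mult_distrib_mat[of _ n n _ _ n]
      mult_add_distrib_mat[of _ n n _ n])
  \<comment> \<open>For every \<open>w\<close> the vector \<open>g c w + w\<close> lies in the
    kernel of \<open>c\<close>, where \<open>P = a + 1\<close> vanishes by
    \<open>fixker\<close>.\<close>
  have Pgc: "P * g * c = P"
  proof (rule mat_eq_vecI[OF _ P])
    show "P * g * c \<in> M\<^sub>n" using P g car by (auto intro!: mult_square_carrier)
    fix w :: "'k vec" assume w: "w \<in> carrier_vec n"
    have gcw: "(g * c) *\<^sub>v w \<in> carrier_vec n"
      using mult_square_carrier[OF g(1) car(3)] w by (rule mult_mat_vec_carrier)
    let ?v = "(g * c) *\<^sub>v w + w"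
    have v: "?v \<in> carrier_vec n" using gcw w by simp
    have "c *\<^sub>v ?v = c *\<^sub>v ((g * c) *\<^sub>v w) + c *\<^sub>v w"
      by (rule mult_add_distrib_mat_vec[OF car(3) gcw w])
    also have "c *\<^sub>v ((g * c) *\<^sub>v w) = (c * (g * c)) *\<^sub>v w"
      by (rule assoc_mult_mat_vec[OF car(3) mult_square_carrier[OF g(1) car(3)] w, symmetric])
    also have "c * (g * c) = c" using assoc_mult_mat[OF car(3) g(1) car(3)] g(3) by simp
    also have "c *\<^sub>v w + c *\<^sub>v w = 0\<^sub>v n" using car w by (intro eq_vecI) (auto simp: add_self)
    finally have "a *\<^sub>v ?v = ?v" by (rule fixker[OF v])
    then have "P *\<^sub>v ?v = ?v + ?v" unfolding P_def
      using car v by (simp add: add_mult_distrib_mat_vec[of _ n n])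
    also have "\<dots> = 0\<^sub>v n" by (rule vec_add_self[OF v])
    finally have 0: "P *\<^sub>v ((g * c) *\<^sub>v w) + P *\<^sub>v w = 0\<^sub>v n"
      using mult_add_distrib_mat_vec[OF P gcw w] by simp
    have X: "P *\<^sub>v ((g * c) *\<^sub>v w) \<in> carrier_vec n" "P *\<^sub>v w \<in> carrier_vec n"
      using P gcw w by (auto intro!: mult_mat_vec_carrier)
    have "x = z" if "x \<in> carrier_vec n" "z \<in> carrier_vec n" "x + z = 0\<^sub>v n" for x z :: "'k vec"
    proof (rule eq_vecI)
      fix i assume "i < dim_vec z"
      then have "(x + z) $ i = 0" unfolding that(3) using that(2) by simp
      then have "x $ i + z $ i = 0" using \<open>i < dim_vec z\<close> that(1,2) by simp
      then show "x $ i = z $ i" by (simp add: add_eq_0_iff2 uminus_self)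
    qed (use that in auto)
    from this[OF X 0] show "(P * g * c) *\<^sub>v w = P *\<^sub>v w"
      using assoc_mult_mat[OF P g(1) car(3)] assoc_mult_mat_vec[OF P mult_square_carrier[OF g(1)
        car(3)] w] by simp
  qed
  \<comment> \<open>\<open>P * g\<close> solves \<open>Y * c = P\<close> but may fail to be
    symmetric. Adding its transpose and the symmetric third term repairs this: multiplied by
    \<open>c\<close>, both added terms become \<open>g * (c * P)\<close> and cancel.\<close>
  define Y where "Y = P * g + g * P\<^sup>T + g * (c * (P * g))"
  have pc: "P * g \<in> M\<^sub>n" "g * P\<^sup>T \<in> M\<^sub>n" "c * (P * g) \<in> M\<^sub>n" "g * (c * (P * g)) \<in> M\<^sub>n"
    using P Pt g car by (auto intro!: mult_square_carrier)
  have Y: "Y \<in> M\<^sub>n" using pc by (simp add: Y_def)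
  have cP: "(g * (c * (P * g)))\<^sup>T = g * (c * (P * g))"
  proof -
    have "(g * (c * (P * g)))\<^sup>T = g * (P\<^sup>T * c) * g"
      using P Pt g car abc(6) by (simp add: transpose_mult[of _ n n _ n] block_simps)
    then show ?thesis unfolding PTc using P g car by (simp add: block_simps)
  qed
  have Ys: "Y\<^sup>T = Y"
  proof -
    have "Y\<^sup>T = (g * P\<^sup>T + P * g) + g * (c * (P * g))"
      unfolding Y_def using pc cP g P
        by (simp add: transpose_add[of _ n n] transpose_mult[of _ n n _ n])
    then show ?thesis unfolding Y_def using comm_add_mat[OF pc(1,2)] by simp
  qed
  have "Y * c = P * g * c + g * (P\<^sup>T * c) + g * (c * (P * g * c))"
    unfolding Y_def using pc P Pt g car
    by (simp add: add_mult_distrib_mat[of _ n n _ _ n] block_simps)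
  also have "\<dots> = P + (g * (c * P) + g * (c * P))"
    unfolding PTc Pgc
      using P g car by (intro assoc_add_mat[of _ n n]) (auto intro!: mult_square_carrier)
  also have "\<dots> = P"
    using mat_add_self[of "g * (c * P)" n n] P g car by (simp add: mult_square_carrier)
  finally have Yc: "Y * c = P" .
  have uY: "up Y \<in> carrier G" by (rule upper_unipotent_in_Sp[OF Y Ys])
  obtain b1 d1 where y1: "four_block_mat I\<^sub>n b1 c d1 \<in> C" "b1 \<in> M\<^sub>n" "d1 \<in> M\<^sub>n"
  proof -
    have d: "b + Y * a\<^sup>T \<in> M\<^sub>n" using car Y at by (simp add: mult_square_carrier)
    have e: "up Y * y * inv\<^bsub>G\<^esub> (up Y) = four_block_mat I\<^sub>n (I\<^sub>n * Y + (b + Y * a\<^sup>T)) c (c * Y + a\<^sup>T)"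
      unfolding inv_up[OF Y Ys] abc(4) up_mult(1)[OF Y car at] Yc aP
      by (rule up_mult(2)[OF Y _ d car(3) at]) simp
    have "four_block_mat I\<^sub>n (I\<^sub>n * Y + (b + Y * a\<^sup>T)) c (c * Y + a\<^sup>T) \<in> C"
      using conj[OF uY y] unfolding e .
    then show thesis using that d Y car at by (auto simp: mult_square_carrier)
  qed
  \<comment> \<open>The conjugate is again an involution; hence its lower right block is 1 as well,
    and its off-diagonal blocks annihilate each other.\<close>
  obtain a2 b2 c2 where y2: "a2 \<in> M\<^sub>n" "b2 \<in> M\<^sub>n" "c2 \<in> M\<^sub>n"
    "four_block_mat I\<^sub>n b1 c d1 = four_block_mat a2 b2 c2 (a2\<^sup>T)"
    "b2\<^sup>T = b2" "c2\<^sup>T = c2" "a2 * a2 + b2 * c2 = I\<^sub>n" "c2 * a2 = a2\<^sup>T * c2" "a2 * b2 = b2 * a2\<^sup>T"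
    "c2 * b2 + a2\<^sup>T * a2\<^sup>T = I\<^sub>n"
    by (rule involution_block[OF subsetD[OF C(2) y1(1)] inv[OF y1(1)]])
  have "I\<^sub>n = a2 \<and> b1 = b2 \<and> c = c2 \<and> d1 = a2\<^sup>T"
    using y2(4) four_block_mat_eq_iff[OF _ y1(2) car(3) y1(3) y2(1-3), of I\<^sub>n "a2\<^sup>T"] y2(1) by simp
  then have eqs: "a2 = I\<^sub>n" "b1 = b2" "c2 = c" "d1 = I\<^sub>n" by auto
  have b1s: "b1\<^sup>T = b1" using y2(5) eqs by simp
  have z1: "four_block_mat I\<^sub>n b1 c (I\<^sub>n\<^sup>T) \<in> C" using y1(1) eqs by simp
  have cancel: "X = O\<^sub>n" if "X \<in> M\<^sub>n" "I\<^sub>n + X = I\<^sub>n" for X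
  proof (rule eq_matI)
    fix i j assume "i < dim_row O\<^sub>n" "j < dim_col O\<^sub>n"
    have "(I\<^sub>n + X) $$ (i, j) = I\<^sub>n $$ (i, j)" unfolding that(2) ..
    then show "X $$ (i, j) = O\<^sub>n $$ (i, j)" using that(1) \<open>i < _\<close> \<open>j < _\<close> by simp
  qed (use that in auto)
  have bc0: "b1 * c = O\<^sub>n"
    using cancel[of "b1 * c"] y2(7) eqs y1(2) car by (simp add: mult_square_carrier)
  have cb0: "c * b1 = O\<^sub>n"
    using cancel[of "c * b1"] y2(10) eqs y1(2) car comm_add_mat[of "c * b1" n n I\<^sub>n]
      by (simp add: mult_square_carrier)
  \<comment> \<open>With a generalised inverse \<open>S\<close> of \<open>b1\<close>, conjugation by
    \<open>low S\<close> replaces \<open>c\<close> by \<open>c + S * b1 * S\<close>. The kernel of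
    this lies in that of \<open>c\<close> but contains no nonzero vector \<open>b1 u\<close>,
    although \<open>c * b1 = 0\<close>.\<close>
  obtain S where S: "S \<in> M\<^sub>n" "S\<^sup>T = S" "b1 * S * b1 = b1"
    using symmetric_inverse[OF y1(2) b1s] by blast
  have "b1 = O\<^sub>n"
  proof (rule ccontr)
    assume "b1 \<noteq> O\<^sub>n"
    then obtain u where u: "u \<in> carrier_vec n" "b1 *\<^sub>v u \<noteq> O\<^sub>n *\<^sub>v u"
      using mat_eq_vecI[OF y1(2), of O\<^sub>n] by auto
    have "O\<^sub>n *\<^sub>v u = 0\<^sub>v n" using u(1) by (intro eq_vecI) (auto simp: scalar_prod_def)
    then have bu: "b1 *\<^sub>v u \<noteq> 0\<^sub>v n" using u(2) by simp
    have buc: "b1 *\<^sub>v u \<in> carrier_vec n" using y1(2) u(1) by (rule mult_mat_vec_carrier)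
    let ?c = "c + S * b1 * S"
    have SbS: "S * b1 * S \<in> M\<^sub>n" using S y1(2) by (auto intro!: mult_square_carrier)
    have cc: "?c \<in> M\<^sub>n" using SbS car by simp
    obtain z where z: "z \<in> C" "ll z = c + S * I\<^sub>n + I\<^sub>n\<^sup>T * S + S * b1 * S"
      using conj_low_block[OF z1 _ y1(2) car(3) S(1,2)] by auto
    have "c + S * I\<^sub>n + I\<^sub>n\<^sup>T * S + S * b1 * S = ?c"
      using S car SbS by (simp add: assoc_add_mat[of c n n S S] mat_add_self[of S n n])
    then have zc: "ll z = ?c" using z by simp
    have key: "b1 *\<^sub>v (S *\<^sub>v w) = 0\<^sub>v n \<and> c *\<^sub>v w = 0\<^sub>v n" if w: "w \<in> carrier_vec n" "?c *\<^sub>v w = 0\<^sub>v n"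
      for w
    proof -
      have Sw: "S *\<^sub>v w \<in> carrier_vec n" using S(1) w(1) by (rule mult_mat_vec_carrier)
      have bSw: "b1 *\<^sub>v (S *\<^sub>v w) \<in> carrier_vec n" using y1(2) Sw by (rule mult_mat_vec_carrier)
      have e: "?c *\<^sub>v w = c *\<^sub>v w + S *\<^sub>v (b1 *\<^sub>v (S *\<^sub>v w))"
        using car SbS S y1(2) w Sw by (simp add: add_mult_distrib_mat_vec[of _ n n] block_simps
          assoc_mult_mat_vec[of S n n "b1 * S" n] assoc_mult_mat_vec[of b1 n n S n])
      have "(b1 * c + b1 * S * b1 * S) *\<^sub>v w = b1 *\<^sub>v (?c *\<^sub>v w)"
      proof -
        have "b1 * (S * b1 * S) = b1 * S * b1 * S" using S(1) y1(2) by (simp add: block_simps)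
        then have "b1 * ?c = b1 * c + b1 * S * b1 * S"
          using mult_add_distrib_mat[OF y1(2) car(3) SbS] by simp
        then show ?thesis using assoc_mult_mat_vec[OF y1(2) cc w(1)] by simp
      qed
      then have "(b1 * S) *\<^sub>v w = 0\<^sub>v n"
        unfolding bc0 S(3) w(2) vzero[OF y1(2)]
          using S y1(2) by (simp add: left_add_zero_mat[of _ n n] mult_square_carrier)
      then have bs: "b1 *\<^sub>v (S *\<^sub>v w) = 0\<^sub>v n" using assoc_mult_mat_vec[OF y1(2) S(1) w(1)] by simp
      have "c *\<^sub>v w \<in> carrier_vec n" using car(3) w(1) by (rule mult_mat_vec_carrier)
      then show ?thesis using e bs w(2) vzero[OF S(1)] by simp
    qed
    have "nullity n ?c < nullity n c"
    proof (rule nullity_less[OF cc car(3)])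
      show "mat_ker n ?c \<subseteq> mat_ker n c" using key by (auto simp: mat_ker_def)
      have "c *\<^sub>v (b1 *\<^sub>v u) = O\<^sub>n *\<^sub>v u" using assoc_mult_mat_vec[OF car(3) y1(2) u(1)] cb0 by simp
      then show "b1 *\<^sub>v u \<in> mat_ker n c" using buc \<open>O\<^sub>n *\<^sub>v u = 0\<^sub>v n\<close> by (simp add: mat_ker_def)
      show "b1 *\<^sub>v u \<notin> mat_ker n ?c"
      proof
        assume "b1 *\<^sub>v u \<in> mat_ker n ?c"
        then have "b1 *\<^sub>v (S *\<^sub>v (b1 *\<^sub>v u)) = 0\<^sub>v n" using key by (simp add: mat_ker_def)
        moreover have "b1 *\<^sub>v (S *\<^sub>v (b1 *\<^sub>v u)) = (b1 * S * b1) *\<^sub>v u"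
          using y1(2) S(1) u(1) buc
            by (simp add: block_simps assoc_mult_mat_vec[of b1 n n "S * b1" n] assoc_mult_mat_vec[of
            S n n b1 n])
        ultimately show False using S(3) bu by simp
      qed
    qed
    then show False using ymin[OF z(1)] zc lly by simp
  qed
  then have "low c \<in> C" using z1 by simp
  then show thesis using that[OF car(3) abc(6)] by blast
qed

text \<open>Take \<open>S\<close> of minimal nullity and a nonzero \<open>z\<close> in the kernel of
  \<open>D = S b + d\<close>. The last symplectic relation shows that \<open>b z\<close> is nonzero,
  and symmetry of \<open>b\<^sup>T D\<close> that it is orthogonal to the image of \<open>D\<close>.
  A rank-one change of \<open>S\<close> by some \<open>q\<close> not orthogonal to
  \<open>b z\<close> then shrinks the kernel.\<close>

lemma exists_invertible_block:
  assumes h: "four_block_mat a b c d \<in> carrier G" and car: "a \<in> M\<^sub>n" "b \<in> M\<^sub>n" "c \<in> M\<^sub>n" "d \<in> M\<^sub>n"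
  obtains S where "S \<in> M\<^sub>n" "S\<^sup>T = S" "det (S * b + d) \<noteq> 0"
proof -
  obtain S where S: "S \<in> M\<^sub>n" "S\<^sup>T = S" and min: "\<And>S'. S' \<in> M\<^sub>n \<Longrightarrow> S'\<^sup>T = S' \<Longrightarrow>
      nullity n (S * b + d) \<le> nullity n (S' * b + d)"
    using ex_has_least_nat[of "\<lambda>S. S \<in> M\<^sub>n \<and> S\<^sup>T = S" "O\<^sub>n" "\<lambda>S. nullity n (S * b + d)"] by auto
  let ?D = "S * b + d" and ?c = "S * a + c"
  have D: "?D \<in> M\<^sub>n" and c': "?c \<in> M\<^sub>n" using S car by (auto simp: mult_square_carrier)
  have "low S \<otimes>\<^bsub>G\<^esub> four_block_mat a b c d \<in> carrier G" using low_in_Sp[OF S] h by (rule G.m_closed)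
  then have "four_block_mat a b ?c ?D \<in> carrier G"
    using low_mult(1)[OF S(1) car] by (simp add: Sp_mult)
  then have bD: "b\<^sup>T * ?D = ?D\<^sup>T * b" and one: "a\<^sup>T * ?D + ?c\<^sup>T * b = I\<^sub>n"
    using Sp_four_block_iff[OF car(1,2) c' D] by auto
  have vzero: "A *\<^sub>v 0\<^sub>v n = 0\<^sub>v n" if "A \<in> M\<^sub>n" for A using that by (intro eq_vecI) auto
  have "det ?D \<noteq> 0"
  proof
    assume "det ?D = 0"
    then obtain z where z: "z \<in> carrier_vec n" "z \<noteq> 0\<^sub>v n" "?D *\<^sub>v z = 0\<^sub>v n"
      using det_0_iff_vec_prod_zero_field[OF D] by blast
    define \<beta> where "\<beta> = b *\<^sub>v z"
    have \<beta>: "\<beta> \<in> carrier_vec n" unfolding \<beta>_def using car(2) z(1) by (rule mult_mat_vec_carrier)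
    have "\<beta> \<noteq> 0\<^sub>v n"
    proof
      assume "\<beta> = 0\<^sub>v n"
      have "z = (a\<^sup>T * ?D + ?c\<^sup>T * b) *\<^sub>v z" unfolding one using z by simp
      also have "\<dots> = a\<^sup>T *\<^sub>v (?D *\<^sub>v z) + ?c\<^sup>T *\<^sub>v (b *\<^sub>v z)"
        using car D c' z(1) by (simp add: add_mult_distrib_mat_vec[of _ n n] mult_square_carrier
          assoc_mult_mat_vec[of "a\<^sup>T" n n ?D n] assoc_mult_mat_vec[of "?c\<^sup>T" n n b n])
      finally show False
        using z \<open>\<beta> = 0\<^sub>v n\<close> vzero[of "a\<^sup>T"] vzero[of "?c\<^sup>T"] car c' by (simp add: \<beta>_def)
    qed
    then obtain i where i: "i < n" "\<beta> $ i \<noteq> 0"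
      using \<beta> by (metis carrier_vecD eq_vecI index_zero_vec)
    define q where "q = (1 / \<beta> $ i) \<cdot>\<^sub>v unit_vec n i"
    have q: "q \<in> carrier_vec n" by (simp add: q_def)
    have \<beta>q: "\<beta> \<bullet> q = 1" using i \<beta> by (simp add: q_def)
    let ?S = "S + outer n q"
    have S': "?S \<in> M\<^sub>n" "?S\<^sup>T = ?S" using S by (auto simp: transpose_add[of _ n n] outer_transpose)
    have D': "?S * b + d \<in> M\<^sub>n" using S' car by (simp add: mult_square_carrier)
    have app: "(?S * b + d) *\<^sub>v w = ?D *\<^sub>v w + (q \<bullet> (b *\<^sub>v w)) \<cdot>\<^sub>v q" if w: "w \<in> carrier_vec n" for w
    proof -
      have bw: "b *\<^sub>v w \<in> carrier_vec n" using car(2) w by (rule mult_mat_vec_carrier)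
      have Sb: "S * b \<in> M\<^sub>n" "outer n q * b \<in> M\<^sub>n" using S car by (auto intro!: mult_square_carrier)
      have "?S * b + d = ?D + outer n q * b"
        unfolding add_mult_distrib_mat[OF S(1) outer_carrier car(2)]
        using Sb car carrier_matD[OF Sb(1)] carrier_matD[OF Sb(2)]
        by (intro eq_matI) (auto simp: ac_simps simp del: index_mult_mat(1))
      then have "(?S * b + d) *\<^sub>v w = ?D *\<^sub>v w + (outer n q * b) *\<^sub>v w"
        using add_mult_distrib_mat_vec[OF D Sb(2) w] by simp
      then show ?thesis
        using assoc_mult_mat_vec[OF outer_carrier car(2) w] outer_apply[OF q bw] by simp
    qed
    have key: "q \<bullet> (b *\<^sub>v w) = 0 \<and> ?D *\<^sub>v w = 0\<^sub>v n" if w: "w \<in> carrier_vec n"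
      "(?S * b + d) *\<^sub>v w = 0\<^sub>v n" for w
    proof -
      have bw: "b *\<^sub>v w \<in> carrier_vec n" using car(2) w(1) by (rule mult_mat_vec_carrier)
      have Dw: "?D *\<^sub>v w \<in> carrier_vec n" using D w(1) by (rule mult_mat_vec_carrier)
      have "\<beta> \<bullet> (?D *\<^sub>v w) = z \<bullet> (b\<^sup>T *\<^sub>v (?D *\<^sub>v w))"
        using transpose_vec_mult_scalar[of "b\<^sup>T" n n "?D *\<^sub>v w" z] car(2) z(1) Dw by (simp add: \<beta>_def)
      also have "b\<^sup>T *\<^sub>v (?D *\<^sub>v w) = ?D\<^sup>T *\<^sub>v (b *\<^sub>v w)"
        using assoc_mult_mat_vec[of "b\<^sup>T" n n ?D n w] assoc_mult_mat_vec[of "?D\<^sup>T" n n b n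
          w] bD car(2) D w(1) by simp
      also have "z \<bullet> (?D\<^sup>T *\<^sub>v (b *\<^sub>v w)) = (?D *\<^sub>v z) \<bullet> (b *\<^sub>v w)"
        using transpose_vec_mult_scalar[of "?D\<^sup>T" n n "b *\<^sub>v w" z] D z(1) bw by simp
      also have "\<dots> = 0" using z(3) bw by simp
      finally have 0: "\<beta> \<bullet> (?D *\<^sub>v w) = 0" .
      have ex: "?D *\<^sub>v w + (q \<bullet> (b *\<^sub>v w)) \<cdot>\<^sub>v q = 0\<^sub>v n" using app[OF w(1)] w(2) by simp
      have "\<beta> \<bullet> (?D *\<^sub>v w + (q \<bullet> (b *\<^sub>v w)) \<cdot>\<^sub>v q) = 0" unfolding ex using \<beta> by simp
      then have q0: "q \<bullet> (b *\<^sub>v w) = 0"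
        using 0 \<beta> q Dw \<beta>q by (simp add: scalar_prod_add_distrib[of _ n])
      have "?D *\<^sub>v w = 0\<^sub>v n"
      proof (rule eq_vecI)
        fix j assume "j < dim_vec (0\<^sub>v n)"
        then have "(?D *\<^sub>v w + (q \<bullet> (b *\<^sub>v w)) \<cdot>\<^sub>v q) $ j = 0" unfolding ex by simp
        then show "(?D *\<^sub>v w) $ j = 0\<^sub>v n $ j" unfolding q0
          using \<open>j < _\<close> q carrier_vecD[OF Dw] by (simp del: index_mult_mat_vec)
      qed (use carrier_vecD[OF Dw] in \<open>simp del: dim_mult_mat_vec\<close>)
      then show ?thesis using q0 by blast
    qed
    have "nullity n (?S * b + d) < nullity n ?D"
    proof (rule nullity_less[OF D' D])
      show "mat_ker n (?S * b + d) \<subseteq> mat_ker n ?D" using key by (auto simp: mat_ker_def)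
      show "z \<in> mat_ker n ?D" using z by (simp add: mat_ker_def)
      show "z \<notin> mat_ker n (?S * b + d)"
        using key[of z] \<beta>q comm_scalar_prod[OF q \<beta>] by (auto simp: mat_ker_def \<beta>_def)
    qed
    then show False using min[OF S'] by simp
  qed
  then show thesis using that S by blast
qed

text \<open>The witness is \<open>b d^-1\<close>, which is symmetric because
  \<open>b\<^sup>T * d\<close> is; the block \<open>b + Y * d = b + b\<close> vanishes in
  characteristic 2.\<close>

lemma clear_upper_right_block:
  assumes h: "four_block_mat a b c d \<in> carrier G" and car: "a \<in> M\<^sub>n" "b \<in> M\<^sub>n" "c \<in> M\<^sub>n" "d \<in> M\<^sub>n"
    and det: "det d \<noteq> 0"
  obtains Y where "Y \<in> M\<^sub>n" "Y\<^sup>T = Y"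
    "up Y * four_block_mat a b c d = four_block_mat (a + Y * c) O\<^sub>n c d"
proof -
  obtain K where K: "K \<in> M\<^sub>n" "K * d = I\<^sub>n" "d * K = I\<^sub>n"
    using det_nonzero_inverse[OF car(4) det] by blast
  have bd: "b\<^sup>T * d = d\<^sup>T * b" using h Sp_four_block_iff[OF car] by simp
  have KT: "K\<^sup>T * d\<^sup>T = I\<^sub>n"
    using arg_cong[OF K(3), of transpose_mat] car K(1) by (simp add: transpose_mult[of _ n n _ n])
  define Y where "Y = b * K"
  have Y: "Y \<in> M\<^sub>n" using car K by (auto simp: Y_def intro!: mult_square_carrier)
  have "Y\<^sup>T = K\<^sup>T * (b\<^sup>T * (d * K))" unfolding Y_def K(3)
    using car K(1) by (simp add: transpose_mult[of _ n n _ n])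
  also have "\<dots> = K\<^sup>T * ((b\<^sup>T * d) * K)" using car K(1) by (simp add: block_simps)
  also have "\<dots> = (K\<^sup>T * d\<^sup>T) * (b * K)" unfolding bd using car K(1) by (simp add: block_simps)
  finally have "Y\<^sup>T = I\<^sub>n * Y" unfolding KT Y_def .
  then have Ys: "Y\<^sup>T = Y" unfolding left_mult_one_mat[OF Y] .
  have "Y * d = b" unfolding Y_def using car K by (simp add: block_simps)
  then have "up Y * four_block_mat a b c d = four_block_mat (a + Y * c) O\<^sub>n c d"
    unfolding up_mult(1)[OF Y car] using mat_add_self[OF car(2)] by simp
  then show thesis using that[OF Y Ys] by blast
qed

theorem involution_imp_spherical:
  assumes C: "C \<in> conjugacy_classes G" and inv: "\<And>y. y \<in> C \<Longrightarrow> y * y = 1\<^sub>m (2 * n)"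
  shows "spherical (2 * n) G C"
proof -
  let ?N = "2 * n"
  have ne: "C \<noteq> {}" using C G.one_closed by (auto simp: conjugacy_classes_def orbits_def orbit_def)
  note Cx = conjugacy_class_eq[OF C]
  have CG: "C \<subseteq> carrier G" using Cx(1) by blast
  have conjC: "g * y * inv\<^bsub>G\<^esub> g \<in> C" if "g \<in> carrier G" "y \<in> C" for g y
    using Cx(2)[OF that(2)] that(1) by blast
  obtain R where R: "R \<in> M\<^sub>n" "R\<^sup>T = R" "low R \<in> C"
    using involution_class_contains_low[OF ne CG inv conjC] by blast
  obtain E \<Phi> where E: "E \<in> M\<^sub>n" "E\<^sup>T = E" "congruent_mat n R E"
    and \<Phi>p: "\<And>\<gamma>. polymat n n \<gamma> \<Longrightarrow> (\<lambda>t. \<Phi> (\<gamma> t)) \<in> polyf" and \<Phi>E: "\<Phi> E \<noteq> 0"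
    and \<Phi>tri: "\<And>M. congruent_mat n E M \<Longrightarrow> \<Phi> M \<noteq> 0 \<Longrightarrow> tri_congruent n E M"
    using symmetric_normal_form[OF R(1,2)] by metis
  define x where "x = low E"
  have xG: "x \<in> carrier G" using low_in_Sp[OF E(1,2)] by (simp add: x_def)
  have xC: "x \<in> C"
  proof -
    obtain L where L: "L \<in> M\<^sub>n" "det L \<noteq> 0" "E = L * R * L\<^sup>T"
      using E(3) by (auto simp: congruent_mat_def)
    obtain a where a: "a \<in> M\<^sub>n" "four_block_mat a O\<^sub>n O\<^sub>n L \<in> carrier G"
      using levi_in_Sp[OF L(1,2)] by blast
    show ?thesis using conjC[OF a(2) R(3)] conj_low[OF a(1) _ L(1) R(1,2) a(2)] L(3)
      by (simp add: x_def)
  qed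
  \<comment> \<open>For invertible \<open>d\<close> an element \<open>up Y\<close> of the Borel
    subgroup clears the upper right block of \<open>h\<close>, and the conjugate becomes
    \<open>low (d * E * d\<^sup>T)\<close>. Under the open condition \<open>\<Phi>\<close>, the same
    matrix comes from a triangular \<open>L\<close> in place of \<open>d\<close>.\<close>
  have good: "\<exists>g\<in>std_borel. h * x * inv\<^bsub>G\<^esub> h = g * x * inv\<^bsub>G\<^esub> g"
    if hb: "h = four_block_mat a b c d" and h: "h \<in> carrier G" and car: "a \<in> M\<^sub>n" "b \<in> M\<^sub>n" "c \<in> M\<^sub>n"
      "d \<in> M\<^sub>n"
      and det: "det d \<noteq> 0" and \<Phi>: "\<Phi> (d * E * d\<^sup>T) \<noteq> 0" for h a b c d
  proof -
    obtain Y where Y: "Y \<in> M\<^sub>n" and Ys: "Y\<^sup>T = Y"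
      and u1: "up Y * h = four_block_mat (a + Y * c) O\<^sub>n c d"
      using clear_upper_right_block[OF h[unfolded hb] car det] unfolding hb by blast
    have uG: "up Y \<in> carrier G" by (rule upper_unipotent_in_Sp[OF Y Ys])
    have uB: "up Y \<in> std_borel" using std_borel_block_iff[OF _ Y _ _ uG] by auto
    have a': "a + Y * c \<in> M\<^sub>n" using car Y by (simp add: mult_square_carrier)
    have uh: "up Y * h \<in> carrier G" using G.m_closed[OF uG h] by (simp add: Sp_mult)
    have 1: "(up Y * h) * x * inv\<^bsub>G\<^esub> (up Y * h) = low (d * E * d\<^sup>T)"
      using conj_low[OF a' car(3,4) E(1,2)] uh unfolding u1 x_def by simp
    have "congruent_mat n E (d * E * d\<^sup>T)"
      unfolding congruent_mat_def using E(1) car(4) det by blast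
    from \<Phi>tri[OF this \<Phi>] obtain L where L: "L \<in> M\<^sub>n" "det L \<noteq> 0"
      "\<And>i j. i < n \<Longrightarrow> j < n \<Longrightarrow> i < j \<Longrightarrow> L $$ (i, j) = 0"
      "d * E * d\<^sup>T = L * E * L\<^sup>T" by (auto simp: tri_congruent_def)
    obtain e where e: "e \<in> M\<^sub>n" "e\<^sup>T * L = I\<^sub>n" "four_block_mat e O\<^sub>n O\<^sub>n L \<in> carrier G"
      using levi_in_Sp[OF L(1,2)] by blast
    let ?g = "four_block_mat e O\<^sub>n O\<^sub>n L"
    have 2: "?g * x * inv\<^bsub>G\<^esub> ?g = low (d * E * d\<^sup>T)"
      using conj_low[OF e(1) _ L(1) E(1,2) e(3)] L(4) by (simp add: x_def)
    have LeT: "L * e\<^sup>T = I\<^sub>n" using mat_mult_left_right_inverse[OF _ L(1) e(2)] e(1) by simp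
    have "e $$ (i, j) = 0" if "i < n" "j < i" for i j
    proof -
      have "(e\<^sup>T) $$ (j, i) = 0"
        by (rule lower_triangular_of_upper[of "L\<^sup>T" n "e\<^sup>T"]) (use L(1,3) e(1) LeT that in auto)
      then show ?thesis using e(1) that by simp
    qed
    then have gB: "?g \<in> std_borel" using std_borel_block_iff[OF e(1) _ _ L(1) e(3)] by simp
    have ugB: "up Y * ?g \<in> std_borel"
      using subgroup.m_closed[OF subgroup_std_borel uB gB] by (simp add: Sp_mult)
    have uu: "up Y * up Y = 1\<^sub>m ?N"
      using G.r_inv[OF uG] inv_up[OF Y Ys] by (simp add: Sp_mult Sp_one)
    have "up Y * (up Y * h) = h"
      using uu assoc_mult_square[OF Sp_carrier[OF uG] Sp_carrier[OF uG] Sp_carrier[OF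
        h]] Sp_carrier[OF h] by simp
    then have "h * x * inv\<^bsub>G\<^esub> h = up Y * ((up Y * h) * x * inv\<^bsub>G\<^esub> (up Y * h)) * inv\<^bsub>G\<^esub> (up Y)"
      using conj_comp[OF uG uh xG] by simp
    also have "\<dots> = (up Y * ?g) * x * inv\<^bsub>G\<^esub> (up Y * ?g)"
      unfolding 1 2[symmetric] by (rule conj_comp[OF uG e(3) xG])
    finally show ?thesis using ugB by blast
  qed
  have dense: "f y = 0" if f: "f \<in> poly_funs ?N" "\<And>g. g \<in> std_borel \<Longrightarrow> f (g * x * inv\<^bsub>G\<^esub> g) = 0"
    and y: "y \<in> C" for f y
  proof -
    obtain h where h: "h \<in> carrier G" "y = h * x * inv\<^bsub>G\<^esub> h" using Cx(2)[OF xC] y by blast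
    obtain a b c d where car: "a \<in> M\<^sub>n" "b \<in> M\<^sub>n" "c \<in> M\<^sub>n" "d \<in> M\<^sub>n"
      and hb: "h = four_block_mat a b c d"
      using four_block_cases[OF Sp_carrier[OF h(1)]] by blast
    \<comment> \<open>A singular \<open>d\<close> is first made invertible by \<open>low S\<close>,
      so that \<open>h\<close> becomes the product of \<open>low S\<close>, \<open>up Y\<close> and
      an element with zero upper right block.\<close>
    obtain S where S: "S \<in> M\<^sub>n" "S\<^sup>T = S" "det (S * b + d) \<noteq> 0"
      using exists_invertible_block[OF _ car] h(1) hb by blast
    define D where "D = S * b + d"
    have D: "D \<in> M\<^sub>n" "det D \<noteq> 0" using S car by (auto simp: D_def mult_square_carrier)
    have c': "S * a + c \<in> M\<^sub>n" using S car by (simp add: mult_square_carrier)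
    have lG: "low S \<in> carrier G" by (rule low_in_Sp[OF S(1,2)])
    define h1 where "h1 = low S * h"
    have h1G: "h1 \<in> carrier G" using G.m_closed[OF lG h(1)] by (simp add: Sp_mult h1_def)
    have h1b: "h1 = four_block_mat a b (S * a + c) D"
      unfolding h1_def hb low_mult(1)[OF S(1) car] D_def ..
    obtain Y where Y: "Y \<in> M\<^sub>n" and Ys: "Y\<^sup>T = Y"
      and u1: "up Y * h1 = four_block_mat (a + Y * (S * a + c)) O\<^sub>n (S * a + c) D"
      using clear_upper_right_block[OF h1G[unfolded h1b] car(1,2) c' D] unfolding h1b by blast
    have uG: "up Y \<in> carrier G" by (rule upper_unipotent_in_Sp[OF Y Ys])
    have uh1: "up Y * h1 \<in> carrier G" using G.m_closed[OF uG h1G] by (simp add: Sp_mult)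
    have a': "a + Y * (S * a + c) \<in> M\<^sub>n" using car Y c' by (simp add: mult_square_carrier)
    have base: "(up Y * h1) * x * inv\<^bsub>G\<^esub> (up Y * h1) = low (D * E * D\<^sup>T)"
      using conj_low[OF a' c' D(1) E(1,2)] uh1 unfolding u1 x_def by simp
    \<comment> \<open>\<open>S\<close> and \<open>D\<close> are deformed while \<open>Y\<close>
      stays fixed. At \<open>t = 0\<close> the block \<open>dt t\<close> is the identity, and
      \<open>\<Phi>\<close> does not vanish at \<open>E\<close>; at \<open>t = 1\<close> the curve
      reaches \<open>y\<close>.\<close>
    define Dt where "Dt t = I\<^sub>n + t \<cdot>\<^sub>m (D + I\<^sub>n)" for t
    \<comment> \<open>The lower right block of \<open>low (t S) * up Y\<close> times a
      block-diagonal element with lower right block \<open>Dt t\<close>.\<close>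
    define dt where "dt t = ((t \<cdot>\<^sub>m S) * Y + I\<^sub>n) * Dt t" for t
    \<comment> \<open>By \<open>conj_low\<close> the conjugate involves \<open>Dt t\<close> but not
      its inverse, and \<open>low\<close> and \<open>up\<close> give involutions; so the curve has
      polynomial entries and is defined for every \<open>t\<close>.\<close>
    define \<gamma> where "\<gamma> t = low (t \<cdot>\<^sub>m S) * (up Y * low (Dt t * E * (Dt t)\<^sup>T) * up Y) * low (t \<cdot>\<^sub>m S)"
      for t
    define \<psi> where "\<psi> t = det (dt t) * \<Phi> (dt t * E * (dt t)\<^sup>T)" for t
    have tSp: "polymat n n (\<lambda>t. t \<cdot>\<^sub>m S)" using S(1) by (intro polymat_smult polyf_id polymat_const)
    have Dtp: "polymat n n Dt" unfolding Dt_def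
      using D(1) by (intro polymat_add polymat_const polymat_smult polyf_id) auto
    have dtp: "polymat n n dt" unfolding dt_def
      by (intro polymat_mult[OF _ Dtp] polymat_add polymat_mult[OF tSp] polymat_const Y) simp
    have lowp: "polymat (n + n) (n + n) (\<lambda>t. low (A t))" if "polymat n n A" for A
      using that by (intro polymat_four_block polymat_const) auto
    have upp: "polymat (n + n) (n + n) (\<lambda>t. up Y)" using Y by (intro polymat_const) auto
    have "polymat (n + n) (n + n) \<gamma>" unfolding \<gamma>_def
      by (intro polymat_mult[of _ "n + n"] lowp tSp upp polymat_mult[of n n] Dtp polymat_transpose
        polymat_const E(1))
    then have \<gamma>p: "(\<lambda>t. \<gamma> t $$ (i, j)) \<in> polyf" if "i < ?N" "j < ?N" for i j
      using polymat_entry that by (metis mult_2)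
    have \<psi>p: "\<psi> \<in> polyf" unfolding \<psi>_def
      by (rule polyf_mult[OF polyf_det[OF dtp] \<Phi>p[OF polymat_mult[OF polymat_mult[OF dtp
        polymat_const[OF E(1)]] polymat_transpose[OF dtp]]]])
    have tS: "t \<cdot>\<^sub>m S \<in> M\<^sub>n" "(t \<cdot>\<^sub>m S)\<^sup>T = t \<cdot>\<^sub>m S" for t
      using S by (auto simp: mat_eq_iff)
    note Dtc = polymat_carrier[OF Dtp]
    have "Dt 0 = I\<^sub>n" using D(1) by (auto simp: Dt_def mat_eq_iff)
    moreover have "(0 \<cdot>\<^sub>m S) * Y + I\<^sub>n = I\<^sub>n"
    proof -
      have "0 \<cdot>\<^sub>m S = O\<^sub>n" using S(1) by (auto simp: mat_eq_iff)
      then show ?thesis using Y by simp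
    qed
    ultimately have "dt 0 = I\<^sub>n" by (simp add: dt_def)
    then have \<psi>0: "\<psi> 0 \<noteq> 0" using \<Phi>E E(1) by (simp add: \<psi>_def)
    have zero: "f (\<gamma> t) = 0" if t: "\<psi> t \<noteq> 0" for t
    proof -
      have A: "(t \<cdot>\<^sub>m S) * Y + I\<^sub>n \<in> M\<^sub>n" using tS Y by (simp add: mult_square_carrier)
      have dt: "det (dt t) \<noteq> 0" "\<Phi> (dt t * E * (dt t)\<^sup>T) \<noteq> 0" using t by (auto simp: \<psi>_def)
      have "det (Dt t) \<noteq> 0" using dt(1) det_mult[OF A Dtc] by (auto simp: dt_def)
      then obtain e where e: "e \<in> M\<^sub>n" "four_block_mat e O\<^sub>n O\<^sub>n (Dt t) \<in> carrier G"
        using levi_in_Sp[OF Dtc] by blast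
      let ?g = "four_block_mat e O\<^sub>n O\<^sub>n (Dt t)"
      have ltG: "low (t \<cdot>\<^sub>m S) \<in> carrier G" by (rule low_in_Sp[OF tS])
      have ug: "up Y * ?g = four_block_mat e (Y * Dt t) O\<^sub>n (Dt t)"
        using up_mult(1)[OF Y e(1) _ _ Dtc, of O\<^sub>n O\<^sub>n] e(1) Y Dtc[of t]
        by (simp add: right_add_zero_mat[of _ n n] left_add_zero_mat[of _ n n] mult_square_carrier)
      have YD: "Y * Dt t \<in> M\<^sub>n" using Y Dtc by (rule mult_square_carrier)
      have "(t \<cdot>\<^sub>m S) * (Y * Dt t) + Dt t = dt t"
        unfolding dt_def
          using add_mult_distrib_mat[OF mult_square_carrier[OF tS(1) Y] one_carrier_mat Dtc]
          tS(1) Y Dtc[of t] by (simp add: assoc_mult_square[of _ n])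
      then have lug: "low (t \<cdot>\<^sub>m S) * (up Y * ?g) = four_block_mat e (Y * Dt t) ((t \<cdot>\<^sub>m S) * e +
        O\<^sub>n) (dt t)"
        unfolding ug low_mult(1)[OF tS(1) e(1) YD zero_carrier_mat Dtc] by simp
      have ugG: "up Y * ?g \<in> carrier G" using G.m_closed[OF uG e(2)] by (simp add: Sp_mult)
      have lugG: "low (t \<cdot>\<^sub>m S) * (up Y * ?g) \<in> carrier G"
        using G.m_closed[OF ltG ugG] by (simp add: Sp_mult)
      have "low (t \<cdot>\<^sub>m S) * (up Y * ?g) * x * inv\<^bsub>G\<^esub> (low (t \<cdot>\<^sub>m S) * (up Y * ?g)) = \<gamma> t"
        unfolding conj_comp[OF ltG ugG xG, symmetric] conj_comp[OF uG e(2) xG,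
          symmetric] \<gamma>_def inv_low[OF tS] inv_up[OF Y Ys]
        using conj_low[OF e(1) _ Dtc E(1,2) e(2)] by (simp add: x_def)
      moreover obtain g where "g \<in> std_borel"
        "low (t \<cdot>\<^sub>m S) * (up Y * ?g) * x * inv\<^bsub>G\<^esub> (low (t \<cdot>\<^sub>m S) * (up Y * ?g)) = g * x * inv\<^bsub>G\<^esub> g"
        using good[OF lug lugG e(1) YD _ _ dt] tS(1) e(1) polymat_carrier[OF dtp]
        by (auto simp: mult_square_carrier)
      ultimately show ?thesis using f(2) by metis
    qed
    have "f (\<gamma> 1) = 0" using poly_funs_curve_eq_0[OF f(1) \<gamma>p \<psi>p \<psi>0 zero] .
    moreover have "\<gamma> 1 = y"
    proof -
      have D1: "Dt 1 = D"
        using D(1) by (auto simp: Dt_def mat_eq_iff add_left_self add.commute two_eq_0)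
      have S1: "1 \<cdot>\<^sub>m S = S" by (auto simp: mat_eq_iff)
      have inv2: "g * (g * k) = k" if "g \<in> carrier G" "inv\<^bsub>G\<^esub> g = g" "k \<in> carrier G" for g k
      proof -
        have "g \<otimes>\<^bsub>G\<^esub> (g \<otimes>\<^bsub>G\<^esub> k) = inv\<^bsub>G\<^esub> g \<otimes>\<^bsub>G\<^esub> (g \<otimes>\<^bsub>G\<^esub> k)" using that(2) by simp
        also have "\<dots> = k" using that(1,3) by (simp add: G.m_assoc[symmetric])
        finally show ?thesis by (simp add: Sp_mult)
      qed
      have "\<gamma> 1 = low S * (up Y * ((up Y * h1) * x * inv\<^bsub>G\<^esub> (up Y * h1)) * inv\<^bsub>G\<^esub> (up Y)) * inv\<^bsub>G\<^esub> (low S)"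
        unfolding \<gamma>_def base D1 S1 inv_low[OF S(1,2)] inv_up[OF Y Ys] ..
      also have "\<dots> = (low S * h1) * x * inv\<^bsub>G\<^esub> (low S * h1)"
        unfolding conj_comp[OF uG uh1 xG] inv2[OF uG inv_up[OF Y Ys] h1G]
          by (rule conj_comp[OF lG h1G xG])
      also have "low S * h1 = h" unfolding h1_def by (rule inv2[OF lG inv_low[OF S(1,2)] h(1)])
      finally show ?thesis using h(2) by simp
    qed
    ultimately show ?thesis by simp
  qed
  have CN: "C \<subseteq> carrier_mat ?N ?N" using CG Sp_carrier by blast
  have BG: "std_borel \<subseteq> carrier G" using subgroup_std_borel by (rule subgroup.subset)
  have sub: "(\<lambda>b. b * x * inv\<^bsub>G\<^esub> b) ` std_borel \<subseteq> C" using conjC[OF _ xC] BG by blast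
  have "(subtopology (zariski ?N) C) closure_of ((\<lambda>b. b * x * inv\<^bsub>G\<^esub> b) ` std_borel) = C"
    unfolding closure_of_eq_iff[OF sub CN] using dense by blast
  then show ?thesis unfolding spherical_def orbit_conjugation
    using borel_subgroup_std_borel xC by blast
qed

end

theorem proposition3p8:
  fixes n :: nat and C :: "'k::alg_closed_field mat set"
  assumes "CHAR('k) = 2" and "n \<ge> 2"
    and "C \<in> conjugacy_classes (Sp n)"
    and "\<forall>x\<in>C. unipotent (2 * n) x"
    and "C \<noteq> {\<one>\<^bsub>Sp n\<^esub>}"
  shows "spherical (2 * n) (Sp n) C \<longleftrightarrow> (\<forall>x\<in>C. group.ord (Sp n) x = 2)"
proof -
  interpret symplectic_char2 n "TYPE('k)" by unfold_locales (rule assms(1))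
  have ord: "G.ord x = 2 \<longleftrightarrow> x * x = 1\<^sub>m (2 * n)" if x: "x \<in> C" for x
  proof -
    note xG = conjugacy_class_eq[OF assms(3) x]
    \<comment> \<open>The class of the identity is the excluded trivial class.\<close>
    have "x \<noteq> \<one>\<^bsub>G\<^esub>"
    proof
      assume x1: "x = \<one>\<^bsub>G\<^esub>"
      have "C = (\<lambda>g. \<one>\<^bsub>G\<^esub>) ` carrier G"
        unfolding xG(2) by (intro image_cong) (auto simp: x1 Sp_mult[symmetric])
      then show False using assms(5) G.one_closed by auto
    qed
    then have n1: "G.ord x \<noteq> 1" using G.ord_eq_1[OF xG(1)] by auto
    have "x * x = 1\<^sub>m (2 * n) \<longleftrightarrow> x [^]\<^bsub>G\<^esub> (2 :: nat) = \<one>\<^bsub>G\<^esub>"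
    proof -
      have "x [^]\<^bsub>G\<^esub> (2 :: nat) = x \<otimes>\<^bsub>G\<^esub> x" using xG(1) by (simp add: numeral_2_eq_2)
      then show ?thesis by (simp only: Sp_mult Sp_one)
    qed
    also have "\<dots> \<longleftrightarrow> G.ord x dvd 2" by (rule G.pow_eq_id[OF xG(1)])
    also have "\<dots> \<longleftrightarrow> G.ord x = 2"
      using n1 prime_nat_iff[of 2] two_is_prime_nat by auto
    finally show ?thesis by simp
  qed
  show ?thesis
    using spherical_imp_involution[OF assms(2-4)] involution_imp_spherical[OF assms(3)] ord by blast
qed

end
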